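(* Let $k\in\{1,\dots,n\}$ and let a locally normal Heisenberg $(2n+1-k)$-current $\mathsf T=\vec{\mathsf T}\,\|\mathsf T\|$ and a locally $\mathbb H$-rectifiable set $R\subset\mathbb H^n$ of codimension $k$ be fixed. Decompose $\|\mathsf T\|=\|\mathsf T\|_a+\|\mathsf T\|_s$ as the sum of the absolutely continuous and singular parts of $\|\mathsf T\|$ with respect to $\mathscr S^{Q-k}\llcorner R$. Then $$\vec{\mathsf T}(p)\text{ is a multiple of }[t^{\mathbb H}_R(p)]_{\mathcal J}\qquad\text{for }\|\mathsf T\|_a\text{-a.e. }p .$$
   Context: $\mathbb H^n$ is $\mathbb R^{2n+1}=\mathbb R^n_x\times\mathbb R^n_y\times\mathbb R_t$ with group law $(x,y,t)(x',y',t')=(x+x',y+y',t+t'+\frac12\langle x,y'\rangle-\frac12\langle x',y\rangle)$ and dilations $\delta_\lambda(x,y,t)=(\lambda x,\lambda y,\lambda^2t)$. $d$ is a left-invariant, homogeneous, rotationally invariant distance inducing the Euclidean topology, with balls $B(p,r)$; $Q:=2n+2$; $\mathscr S^m(E):=\lim_{\delta\to0^+}\inf\{\sum_i(2r_i)^m:E\subset\bigcup_iB(p_i,r_i),r_i<\delta\}$. Left-invariant fields: $X_j=\partial_{x_j}-\frac{y_j}2\partial_t$, $Y_j=\partial_{y_j}+\frac{x_j}2\partial_t$, $T=\partial_t$; $\mathfrak h$ is their span, $\mathfrak h_1=\mathrm{span}\{X_j,Y_j\}$. The dual basis is $dx_j,dy_j,\theta$, $\theta=dt+\frac12\sum_j(y_jdx_j-x_jdy_j)$,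 $d\theta=-\sum_jdx_j\wedge dy_j$. $\bigwedge_m\mathfrak h,\bigwedge^m\mathfrak h$ (and $\bigwedge_m\mathfrak h_1,\bigwedge^m\mathfrak h_1$) are the exterior powers, identified with left-invariant multivector fields/forms, with the inner product for which the ordered $m$-fold wedge products of elements of the basis $X_1,\dots,X_n,Y_1,\dots,Y_n,T$ of $\mathfrak h$ (respectively, of the dual basis $dx_1,\dots,dx_n,dy_1,\dots,dy_n,\theta$) are orthonormal. Rumin forms: $\mathcal I^m=\{\lambda\wedge\theta+\mu\wedge d\theta:\lambda\in\bigwedge^{m-1}\mathfrak h,\mu\in\bigwedge^{m-2}\mathfrak h\}$, $\mathcal J^m=\{\lambda\in\bigwedge^m\mathfrak h:\lambda\wedge\theta=\lambda\wedge d\theta=0\}$; $\mathcal J_m:=(\mathcal J^m)^*$, and for $\tau\in\bigwedge_m\mathfrak h$, $[\tau]_{\mathcal J}\in\mathcal J_m$ is $\lambda\mapsto\langle\tau\mid\lambda\rangle$. $\mathcal D^m_{\mathbb H}$ is the space of smooth compactly supported functions on $\mathbb H^n$ with values in $\bigwedge^m\mathfrak h/\mathcal I^m$ if $0\le m\le n$, in $\mathcal J^m$ if $n+1\le m\le2n+1$ (usual test-form topology; fix any norms $|\cdot|$ on these finite-dimensional spaces). $d_C:\mathcal D^m_{\mathbb H}\to\mathcal D^{m+1}_{\mathbb H}$ is induced by the exterior derivative $d$ if $m\ne n$; if $m=n$, using $\bigwedge^n\mathfrak h/\mathcal I^n=\bigwedge^n\mathfrak h_1/\{\mu\wedge d\theta:\mu\in\bigwedge^{n-2}\mathfrak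 h_1\}$, it is given on a representative $\alpha$ (smooth section of $\bigwedge^n\mathfrak h_1$) by $D\alpha=d(\alpha-\theta\wedge L^{-1}((d\alpha)_{\mathfrak h_1}))$, where $(\cdot)_{\mathfrak h_1}$ is the component in $\bigwedge^{n+1}\mathfrak h_1$ and $L:\bigwedge^{n-1}\mathfrak h_1\to\bigwedge^{n+1}\mathfrak h_1$, $L(\lambda)=\lambda\wedge d\theta$, is bijective. A Heisenberg $m$-current is a continuous linear functional $\mathsf T$ on $\mathcal D^m_{\mathbb H}$; $\partial\mathsf T(\omega):=\mathsf T(d_C\omega)$. It has locally finite mass if for every compact $K$ there is $M$ with $|\mathsf T(\omega)|\le M\sup|\omega|$ for all $\omega$ supported in $K$; it is locally normal if $\mathsf T$ and $\partial\mathsf T$ both have locally finite mass. If $\mathsf T$ has locally finite mass and $m\ge n+1$, there are a Radon measure $\|\mathsf T\|$ and a $\|\mathsf T\|$-measurable $\vec{\mathsf T}:\mathbb H^n\to\mathcal J_m$ with $|\vec{\mathsf T}|=1$ $\|\mathsf T\|$-a.e. and $\mathsf T(\omega)=\int\langle\vec{\mathsf T}\mid\omega\rangle\,d\|\mathsf T\|$. $\mathbb H$-regular submanifold of codimension $k$: a set $S$ such that every $p\in S$ has an open neighbourhood $U$ and a continuous $f:U\to\mathbb R^k$ whose distributional horizontal gradient $\nabla_{\mathbb H}f=(X_1f,\dots,Y_nf)$ is continuous, with $S\cap U=\{f=0\}$ and $\nabla_{\mathbb H}f$ of rank $k$ on $U$. Its tangent $t^{\mathbb H}_S(p)\in\bigwedge_{2n+1-k}\mathfrak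 h$ is the unit simple vector (up to sign) $v_1\wedge\dots\wedge v_{2n-k}\wedge T$ with $v_1,\dots,v_{2n-k}$ an orthonormal basis of $\ker\nabla_{\mathbb H}f(p)\subset\mathbb R^{2n}\equiv\mathfrak h_1$. $R$ is locally $\mathbb H$-rectifiable of codimension $k$ if for every $r>0$, $\mathscr S^{Q-k}(R\cap B(0,r))<\infty$ and $R\cap B(0,r)$ is covered, up to an $\mathscr S^{Q-k}$-null set, by countably many $\mathbb H$-regular submanifolds $S_j$ of codimension $k$; $t^{\mathbb H}_R(p):=t^{\mathbb H}_{S_j}(p)$ if $p\in R\cap S_j$, which is well defined up to sign $\mathscr S^{Q-k}$-a.e. on $R$. *)

theory Defs
  imports "HOL-Analysis.Analysis"
begin

section \<open>The Heisenberg group\<close>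

text \<open>Throughout, \<open>n = CARD('n)\<close>; a point is a triple \<open>(x, y, t)\<close>.\<close>

type_synonym 'n heis = "(real^'n) \<times> (real^'n) \<times> real"

fun hmul :: "'n::finite heis \<Rightarrow> 'n heis \<Rightarrow> 'n heis" where
  "hmul (x, y, t) (x', y', t') = (x + x', y + y', t + t' + (x \<bullet> y') / 2 - (x' \<bullet> y) / 2)"

fun hdil :: "real \<Rightarrow> 'n::finite heis \<Rightarrow> 'n heis" where
  "hdil r (x, y, t) = (r *\<^sub>R x, r *\<^sub>R y, r\<^sup>2 * t)"

definition heis_distance :: "('n::finite heis \<Rightarrow> 'n heis \<Rightarrow> real) \<Rightarrow> bool" where
  "heis_distance d \<longleftrightarrow>
     Metric_space UNIV d \<and>
     Metric_space.mtopology UNIV d = euclidean \<and>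
     (\<forall>p q r. d (hmul p q) (hmul p r) = d q r) \<and>
     (\<forall>c>0. \<forall>p q. d (hdil c p) (hdil c q) = c * d p q) \<and>
     (\<forall>x y x' y' t. norm (x, y) = norm (x', y') \<longrightarrow> d 0 (x, y, t) = d 0 (x', y', t))"

abbreviation hball :: "('n::finite heis \<Rightarrow> 'n heis \<Rightarrow> real) \<Rightarrow> 'n heis \<Rightarrow> real \<Rightarrow> 'n heis set" where
  "hball d \<equiv> Metric_space.mball UNIV d"

definition spherical_pre ::
  "('n::finite heis \<Rightarrow> 'n heis \<Rightarrow> real) \<Rightarrow> nat \<Rightarrow> real \<Rightarrow> 'n heis set \<Rightarrow> ennreal" where
  "spherical_pre d m \<delta> E =
     Inf {(\<Sum>\<^sub>\<infinity>i\<in>I. ennreal ((2 * r i) ^ m)) | (I :: nat set) p r.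
            (\<forall>i\<in>I. 0 < r i \<and> r i < \<delta>) \<and> E \<subseteq> (\<Union>i\<in>I. hball d (p i) (r i))}"

definition spherical ::
  "('n::finite heis \<Rightarrow> 'n heis \<Rightarrow> real) \<Rightarrow> nat \<Rightarrow> 'n heis set \<Rightarrow> ennreal" where
  "spherical d m E = Lim (at_right 0) (\<lambda>\<delta>. spherical_pre d m \<delta> E)"

text \<open>The outer measure \<^term>\<open>spherical d m\<close> restricted to \<open>R\<close>, as a Borel measure. Its countable
  additivity (Caratheodory's criterion) needs no measurability of \<open>R\<close>.\<close>

definition spherical_restr ::
  "('n::finite heis \<Rightarrow> 'n heis \<Rightarrow> real) \<Rightarrow> nat \<Rightarrow> 'n heis set \<Rightarrow> 'n heis measure" where
  "spherical_restr d m R = measure_of UNIV (sets borel) (\<lambda>A. spherical d m (A \<inter> R))"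

abbreviation hom_dim :: "'n::finite itself \<Rightarrow> nat" where
  "hom_dim _ \<equiv> 2 * CARD('n) + 2"

section \<open>The exterior algebra\<close>

text \<open>\<open>IX j\<close>, \<open>IY j\<close>, \<open>IT\<close> index the basis \<open>X\<^sub>j\<close>, \<open>Y\<^sub>j\<close>, \<open>T\<close> and the dual basis \<open>dx\<^sub>j\<close>,
  \<open>dy\<^sub>j\<close>, \<open>\<theta>\<close>. The full exterior algebra (of the Lie algebra, and of its dual) is the type \<open>'n ext\<close>:
  the coordinate at \<open>I\<close> belongs to the wedge product of the basis elements with index in \<open>I\<close>,
  taken in increasing order. The Euclidean inner product of this type is thus the
  one for which these products are orthonormal; it is also the duality pairing between
  multivectors and covectors.\<close>

datatype 'n hidx = IX 'n | IY 'n | IT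

instance hidx :: (finite) finite
proof
  have "x \<in> range IX \<union> range IY \<union> {IT}" for x :: "'a::finite hidx"
    by (cases x) auto
  then have "(UNIV :: 'a::finite hidx set) = range IX \<union> range IY \<union> {IT}"
    by blast
  then show "finite (UNIV :: 'a::finite hidx set)"
    by (metis finite.simps finite_Un finite_imageI finite)
qed

type_synonym 'n ext = "real^('n hidx set)"

fun hidx_less :: "'n::linorder hidx \<Rightarrow> 'n hidx \<Rightarrow> bool" where
  "hidx_less (IX i) (IX j) = (i < j)"
| "hidx_less (IX i) (IY j) = True"
| "hidx_less (IX i) IT = True"
| "hidx_less (IY i) (IX j) = False"
| "hidx_less (IY i) (IY j) = (i < j)"
| "hidx_less (IY i) IT = True"
| "hidx_less IT j = False"

definition ext_basis :: "'n::finite hidx set \<Rightarrow> 'n ext" where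
  "ext_basis I = axis I 1"

text \<open>The sign of the permutation sorting the concatenation of \<open>I\<close> and \<open>J\<close>.\<close>

definition wedge_sign :: "'n::{finite,linorder} hidx set \<Rightarrow> 'n hidx set \<Rightarrow> real" where
  "wedge_sign I J = (- 1) ^ card {(i, j). i \<in> I \<and> j \<in> J \<and> hidx_less j i}"

definition wedge :: "'n::{finite,linorder} ext \<Rightarrow> 'n ext \<Rightarrow> 'n ext" (infixr "\<and>\<^sub>e" 65) where
  "a \<and>\<^sub>e b = (\<chi> K. \<Sum>I\<in>Pow K. wedge_sign I (K - I) * (a $ I) * (b $ (K - I)))"

text \<open>Degrees are integers so that powers of negative degree are zero.\<close>

definition ext_power :: "int \<Rightarrow> 'n::finite ext set" where
  "ext_power m = {a. \<forall>I. a $ I \<noteq> 0 \<longrightarrow> int (card I) = m}"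

definition ext_power_hor :: "int \<Rightarrow> 'n::finite ext set" where
  "ext_power_hor m = {a \<in> ext_power m. \<forall>I. IT \<in> I \<longrightarrow> a $ I = 0}"

definition hor_part :: "'n::finite ext \<Rightarrow> 'n ext" where
  "hor_part a = (\<chi> I. if IT \<in> I then 0 else a $ I)"

definition theta :: "'n::finite ext" where
  "theta = ext_basis {IT}"

definition dtheta :: "'n::{finite,linorder} ext" where
  "dtheta = - (\<Sum>j\<in>UNIV. ext_basis {IX j} \<and>\<^sub>e ext_basis {IY j})"

section \<open>Differential forms\<close>

fun Ck :: "nat \<Rightarrow> ('a::real_normed_vector \<Rightarrow> 'b::real_normed_vector) \<Rightarrow> bool" where
  "Ck 0 f \<longleftrightarrow> continuous_on UNIV f"
| "Ck (Suc k) f \<longleftrightarrow> (\<forall>x. f differentiable (at x)) \<and>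
     (\<forall>v. Ck k (\<lambda>x. frechet_derivative f (at x) v))"

definition smooth :: "('a::real_normed_vector \<Rightarrow> 'b::real_normed_vector) \<Rightarrow> bool" where
  "smooth f \<longleftrightarrow> (\<forall>k. Ck k f)"

fun dir_derivs :: "'a list \<Rightarrow> ('a::real_normed_vector \<Rightarrow> 'b::real_normed_vector) \<Rightarrow> 'a \<Rightarrow> 'b" where
  "dir_derivs [] f = f"
| "dir_derivs (v # vs) f = dir_derivs vs (\<lambda>x. frechet_derivative f (at x) v)"

fun frame :: "'n::finite hidx \<Rightarrow> 'n heis \<Rightarrow> 'n heis" where
  "frame (IX j) (x, y, t) = (axis j 1, 0, - (y $ j) / 2)"
| "frame (IY j) (x, y, t) = (0, axis j 1, x $ j / 2)"
| "frame IT (x, y, t) = (0, 0, 1)"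

text \<open>A form is a function with values in \<open>'n ext\<close>, its coefficients being taken in the
  left-invariant coframe. By the Leibniz rule, \<open>d (\<Sum>\<^sub>I \<alpha>\<^sub>I e\<^sub>I)\<close> is the sum of
  \<open>\<Sum>\<^sub>I d\<alpha>\<^sub>I \<and> e\<^sub>I\<close>, where the differential of a function \<open>u\<close> is \<open>\<Sum>\<^sub>i (W\<^sub>i u) e\<^sub>i\<close> for the frame
  \<open>W\<close>, and of \<open>\<Sum>\<^sub>I \<alpha>\<^sub>I de\<^sub>I\<close>, where \<open>de\<^sub>I = 0\<close> unless \<open>IT \<in> I\<close>; in that case
  \<open>e\<^sub>I = e\<^sub>J \<and> \<theta>\<close> and \<open>de\<^sub>I\<close> is \<open>(-1)^card J\<close> times \<open>e\<^sub>J \<and> d\<theta>\<close>, with \<open>J = I - {IT}\<close>.\<close>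

definition ext_deriv ::
  "('n::{finite,linorder} heis \<Rightarrow> 'n ext) \<Rightarrow> 'n heis \<Rightarrow> 'n ext" where
  "ext_deriv \<alpha> p =
     (\<Sum>i\<in>UNIV. ext_basis {i} \<and>\<^sub>e frechet_derivative \<alpha> (at p) (frame i p)) +
     (\<Sum>I | IT \<in> I. (\<alpha> p $ I) *\<^sub>R
        ((- 1) ^ card (I - {IT}) *\<^sub>R (ext_basis (I - {IT}) \<and>\<^sub>e dtheta)))"

section \<open>Rumin forms\<close>

definition rumin_I :: "nat \<Rightarrow> 'n::{finite,linorder} ext set" where
  "rumin_I m = {(l \<and>\<^sub>e theta) + (u \<and>\<^sub>e dtheta) | l u.
      l \<in> ext_power (int m - 1) \<and> u \<in> ext_power (int m - 2)}"

definition rumin_J :: "nat \<Rightarrow> 'n::{finite,linorder} ext set" where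
  "rumin_J m = {l \<in> ext_power (int m). l \<and>\<^sub>e theta = 0 \<and> l \<and>\<^sub>e dtheta = 0}"

text \<open>To treat all degrees uniformly, a value of a Rumin form is always a coset of
  \<open>rumin_den m\<close> in \<open>rumin_num m\<close>. For \<open>m > n\<close>, where the forms take their values
  in \<^term>\<open>rumin_J m\<close>, the cosets are singletons.\<close>

definition rumin_num :: "nat \<Rightarrow> 'n::{finite,linorder} ext set" where
  "rumin_num m = (if m \<le> CARD('n) then ext_power (int m) else rumin_J m)"

definition rumin_den :: "nat \<Rightarrow> 'n::{finite,linorder} ext set" where
  "rumin_den m = (if m \<le> CARD('n) then rumin_I m else {0})"

definition rumin_class :: "nat \<Rightarrow> 'n::{finite,linorder} ext \<Rightarrow> 'n ext set" where
  "rumin_class m a = (\<lambda>b. a + b) ` rumin_den m"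

text \<open>The quotient norm (for \<open>m > n\<close>, the norm of the unique element).\<close>

definition rumin_norm :: "'n::finite ext set \<Rightarrow> real" where
  "rumin_norm c = infdist 0 c"

definition test_lifts :: "nat \<Rightarrow> ('n::{finite,linorder} heis \<Rightarrow> 'n ext) set" where
  "test_lifts m = {\<alpha>. smooth \<alpha> \<and> compact (closure {p. \<alpha> p \<noteq> 0}) \<and> (\<forall>p. \<alpha> p \<in> rumin_num m)}"

text \<open>A map into a quotient of finite-dimensional spaces is smooth with compact support
  iff it has a smooth lift with compact support.\<close>

definition rumin_forms :: "nat \<Rightarrow> ('n::{finite,linorder} heis \<Rightarrow> 'n ext set) set" where
  "rumin_forms m = {\<lambda>p. rumin_class m (\<alpha> p) | \<alpha>. \<alpha> \<in> test_lifts m}"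

definition lefschetz :: "'n::{finite,linorder} ext \<Rightarrow> 'n ext" where
  "lefschetz l = l \<and>\<^sub>e dtheta"

definition lefschetz_inv :: "'n::{finite,linorder} ext \<Rightarrow> 'n ext" where
  "lefschetz_inv = inv_into (ext_power_hor (int CARD('n) - 1)) lefschetz"

definition rumin_D ::
  "('n::{finite,linorder} heis \<Rightarrow> 'n ext) \<Rightarrow> 'n heis \<Rightarrow> 'n ext" where
  "rumin_D \<alpha> =
     ext_deriv (\<lambda>p. \<alpha> p - (theta \<and>\<^sub>e lefschetz_inv (hor_part (ext_deriv \<alpha> p))))"

definition d_C :: "nat \<Rightarrow> ('n::{finite,linorder} heis \<Rightarrow> 'n ext set) \<Rightarrow> 'n heis \<Rightarrow> 'n ext set" where
  "d_C m \<omega> = (THE \<eta>. \<exists>\<alpha>\<in>test_lifts m.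
      \<omega> = (\<lambda>p. rumin_class m (\<alpha> p)) \<and>
      (if m = CARD('n)
       then (\<forall>p. \<alpha> p \<in> ext_power_hor (int m)) \<and>
            \<eta> = (\<lambda>p. rumin_class (Suc m) (rumin_D \<alpha> p))
       else \<eta> = (\<lambda>p. rumin_class (Suc m) (ext_deriv \<alpha> p))))"

section \<open>Heisenberg currents\<close>

text \<open>Continuity is expressed by the usual seminorm estimates on each compact set; the
  linear structure of the space of Rumin forms is that of the lifts.\<close>

definition heisenberg_current ::
  "nat \<Rightarrow> (('n::{finite,linorder} heis \<Rightarrow> 'n ext set) \<Rightarrow> real) \<Rightarrow> bool" where
  "heisenberg_current m T \<longleftrightarrow>
     (\<forall>\<alpha>\<in>test_lifts m. \<forall>\<beta>\<in>test_lifts m.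
        T (\<lambda>p. rumin_class m (\<alpha> p + \<beta> p)) =
        T (\<lambda>p. rumin_class m (\<alpha> p)) + T (\<lambda>p. rumin_class m (\<beta> p))) \<and>
     (\<forall>\<alpha>\<in>test_lifts m. \<forall>c.
        T (\<lambda>p. rumin_class m (c *\<^sub>R \<alpha> p)) = c * T (\<lambda>p. rumin_class m (\<alpha> p))) \<and>
     (\<forall>K. compact K \<longrightarrow> (\<exists>C N. \<forall>\<alpha>\<in>test_lifts m. (\<forall>p. p \<notin> K \<longrightarrow> \<alpha> p = 0) \<longrightarrow>
        (\<forall>b. (\<forall>vs p. set vs \<subseteq> Basis \<and> length vs \<le> N \<longrightarrow> norm (dir_derivs vs \<alpha> p) \<le> b) \<longrightarrow>
             \<bar>T (\<lambda>p. rumin_class m (\<alpha> p))\<bar> \<le> C * b)))"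

text \<open>The boundary of a current of degree \<open>m \<ge> 1\<close>.\<close>

definition boundary ::
  "nat \<Rightarrow> (('n::{finite,linorder} heis \<Rightarrow> 'n ext set) \<Rightarrow> real) \<Rightarrow>
   ('n heis \<Rightarrow> 'n ext set) \<Rightarrow> real" where
  "boundary m T \<omega> = T (d_C (m - 1) \<omega>)"

definition locally_finite_mass ::
  "nat \<Rightarrow> (('n::{finite,linorder} heis \<Rightarrow> 'n ext set) \<Rightarrow> real) \<Rightarrow> bool" where
  "locally_finite_mass m T \<longleftrightarrow>
     (\<forall>K. compact K \<longrightarrow> (\<exists>M. \<forall>\<omega>\<in>rumin_forms m.
        (\<forall>p. p \<notin> K \<longrightarrow> \<omega> p = rumin_class m 0) \<longrightarrow> \<bar>T \<omega>\<bar> \<le> M * (SUP p. rumin_norm (\<omega> p))))"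

definition locally_normal ::
  "nat \<Rightarrow> (('n::{finite,linorder} heis \<Rightarrow> 'n ext set) \<Rightarrow> real) \<Rightarrow> bool" where
  "locally_normal m T \<longleftrightarrow>
     heisenberg_current m T \<and> locally_finite_mass m T \<and>
     locally_finite_mass (m - 1) (boundary m T)"

text \<open>The dual of \<^term>\<open>rumin_J m\<close>; its elements are extended by zero, so that equality of
  functionals is equality of functions.\<close>

definition rumin_J_dual :: "nat \<Rightarrow> ('n::{finite,linorder} ext \<Rightarrow> real) set" where
  "rumin_J_dual m = {\<phi>.
     (\<forall>a\<in>rumin_J m. \<forall>b\<in>rumin_J m. \<phi> (a + b) = \<phi> a + \<phi> b) \<and>
     (\<forall>a\<in>rumin_J m. \<forall>c. \<phi> (c *\<^sub>R a) = c * \<phi> a) \<and>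
     (\<forall>a. a \<notin> rumin_J m \<longrightarrow> \<phi> a = 0)}"

definition J_class :: "nat \<Rightarrow> 'n::{finite,linorder} ext \<Rightarrow> 'n ext \<Rightarrow> real" where
  "J_class m \<tau> = (\<lambda>a. if a \<in> rumin_J m then \<tau> \<bullet> a else 0)"

definition norm_on_J_dual :: "nat \<Rightarrow> (('n::{finite,linorder} ext \<Rightarrow> real) \<Rightarrow> real) \<Rightarrow> bool" where
  "norm_on_J_dual m N \<longleftrightarrow>
     (\<forall>\<phi>\<in>rumin_J_dual m. 0 \<le> N \<phi> \<and> (N \<phi> = 0 \<longleftrightarrow> \<phi> = (\<lambda>a. 0)) \<and>
        (\<forall>c. N (\<lambda>a. c * \<phi> a) = \<bar>c\<bar> * N \<phi>) \<and>
        (\<forall>\<psi>\<in>rumin_J_dual m. N (\<lambda>a. \<phi> a + \<psi> a) \<le> N \<phi> + N \<psi>))"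

definition radon_measure :: "'a::topological_space measure \<Rightarrow> bool" where
  "radon_measure \<mu> \<longleftrightarrow> sets \<mu> = sets borel \<and> (\<forall>K. compact K \<longrightarrow> emeasure \<mu> K < \<infinity>)"

text \<open>\<open>T = Tvec \<mu>\<close>, where \<open>\<mu>\<close> is the mass measure of \<open>T\<close> with respect to the norm \<open>N\<close>.
  This is for degrees \<open>m > n\<close>.\<close>

definition mass_representation ::
  "nat \<Rightarrow> (('n::{finite,linorder} ext \<Rightarrow> real) \<Rightarrow> real) \<Rightarrow>
   (('n heis \<Rightarrow> 'n ext set) \<Rightarrow> real) \<Rightarrow> 'n heis measure \<Rightarrow>
   ('n heis \<Rightarrow> 'n ext \<Rightarrow> real) \<Rightarrow> bool" where
  "mass_representation m N T \<mu> Tvec \<longleftrightarrow>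
     radon_measure \<mu> \<and>
     (\<forall>p. Tvec p \<in> rumin_J_dual m) \<and>
     (\<forall>a\<in>rumin_J m. (\<lambda>p. Tvec p a) \<in> borel_measurable (completion \<mu>)) \<and>
     (AE p in \<mu>. N (Tvec p) = 1) \<and>
     (\<forall>\<alpha>\<in>test_lifts m.
        T (\<lambda>p. rumin_class m (\<alpha> p)) = (LINT p|completion \<mu>. Tvec p (\<alpha> p)))"

section \<open>Regular submanifolds and rectifiable sets\<close>

text \<open>\<open>G = (a, b)\<close> is the distributional horizontal gradient of \<open>u\<close> on \<open>U\<close>: the fields
  \<open>X\<^sub>j\<close> and \<open>Y\<^sub>j\<close> are divergence free.\<close>

definition distr_hgrad ::
  "'n::finite heis set \<Rightarrow> ('n heis \<Rightarrow> real) \<Rightarrow> ('n heis \<Rightarrow> (real^'n) \<times> (real^'n)) \<Rightarrow> bool" where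
  "distr_hgrad U u G \<longleftrightarrow>
     (\<forall>\<phi> :: 'n heis \<Rightarrow> real.
        smooth \<phi> \<and> compact (closure {p. \<phi> p \<noteq> 0}) \<and> closure {p. \<phi> p \<noteq> 0} \<subseteq> U \<longrightarrow>
        (\<forall>j. (LINT p|lborel. u p * frechet_derivative \<phi> (at p) (frame (IX j) p)) =
              - (LINT p|lborel. fst (G p) $ j * \<phi> p) \<and>
             (LINT p|lborel. u p * frechet_derivative \<phi> (at p) (frame (IY j) p)) =
              - (LINT p|lborel. snd (G p) $ j * \<phi> p)))"

text \<open>\<open>f i\<close> and \<open>G i\<close>, for \<open>i < k\<close>, are the components of the defining map and the rows
  of its horizontal gradient.\<close>

definition local_defining ::
  "nat \<Rightarrow> 'n::finite heis set \<Rightarrow> 'n heis set \<Rightarrow> (nat \<Rightarrow> 'n heis \<Rightarrow> real) \<Rightarrow>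
   (nat \<Rightarrow> 'n heis \<Rightarrow> (real^'n) \<times> (real^'n)) \<Rightarrow> bool" where
  "local_defining k S U f G \<longleftrightarrow>
     open U \<and>
     (\<forall>i<k. continuous_on U (f i) \<and> continuous_on U (G i) \<and> distr_hgrad U (f i) (G i)) \<and>
     S \<inter> U = {p \<in> U. \<forall>i<k. f i p = 0} \<and>
     (\<forall>p\<in>U. dim ((\<lambda>i. G i p) ` {..<k}) = k)"

definition H_regular :: "nat \<Rightarrow> 'n::finite heis set \<Rightarrow> bool" where
  "H_regular k S \<longleftrightarrow> (\<forall>p\<in>S. \<exists>U f G. p \<in> U \<and> local_defining k S U f G)"

definition hor_vec :: "(real^'n) \<times> (real^'n) \<Rightarrow> 'n::finite ext" where
  "hor_vec v = (\<Sum>j\<in>UNIV. (fst v $ j) *\<^sub>R ext_basis {IX j} + (snd v $ j) *\<^sub>R ext_basis {IY j})"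

text \<open>\<open>\<tau>\<close> is one of the two unit tangent multivectors of \<open>S\<close> at \<open>p\<close>.\<close>

definition H_tangent :: "nat \<Rightarrow> 'n::{finite,linorder} heis set \<Rightarrow> 'n heis \<Rightarrow> 'n ext \<Rightarrow> bool" where
  "H_tangent k S p \<tau> \<longleftrightarrow>
     p \<in> S \<and>
     (\<exists>U f G vs. p \<in> U \<and> local_defining k S U f G \<and>
        length vs = 2 * CARD('n) - k \<and>
        (\<forall>i<length vs. \<forall>j<length vs. vs ! i \<bullet> vs ! j = (if i = j then 1 else 0)) \<and>
        span (set vs) = {v. \<forall>i<k. G i p \<bullet> v = 0} \<and>
        \<tau> = foldr (\<lambda>v a. hor_vec v \<and>\<^sub>e a) vs (ext_basis {IT}))"

definition locally_H_rectifiable ::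
  "('n::finite heis \<Rightarrow> 'n heis \<Rightarrow> real) \<Rightarrow> nat \<Rightarrow> 'n heis set \<Rightarrow> bool" where
  "locally_H_rectifiable d k R \<longleftrightarrow>
     (\<forall>r>0. spherical d (hom_dim TYPE('n) - k) (R \<inter> hball d 0 r) < \<infinity> \<and>
        (\<exists>S :: nat \<Rightarrow> 'n heis set. (\<forall>j. H_regular k (S j)) \<and>
           spherical d (hom_dim TYPE('n) - k) (R \<inter> hball d 0 r - (\<Union>j. S j)) = 0))"

text \<open>\<open>tR\<close> is a choice of the tangent of \<open>R\<close>: almost everywhere on \<open>R\<close> it is a tangent
  of one of countably many submanifolds covering \<open>R\<close>. Neither the covering, nor the
  submanifold chosen at a point of several of them, nor the orientation is prescribed.
  As \<open>R\<close> need not be measurable, ``almost everywhere'' refers to the restricted Borel measure.\<close>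

definition H_tangent_field ::
  "('n::{finite,linorder} heis \<Rightarrow> 'n heis \<Rightarrow> real) \<Rightarrow> nat \<Rightarrow> 'n heis set \<Rightarrow>
   ('n heis \<Rightarrow> 'n ext) \<Rightarrow> bool" where
  "H_tangent_field d k R tR \<longleftrightarrow>
     (\<exists>S :: nat \<Rightarrow> 'n heis set. (\<forall>j. H_regular k (S j)) \<and>
        (AE p in spherical_restr d (hom_dim TYPE('n) - k) R. \<exists>j. H_tangent k (S j) p (tR p)))"

definition lebesgue_decomposition ::
  "'a measure \<Rightarrow> 'a measure \<Rightarrow> 'a measure \<Rightarrow> 'a measure \<Rightarrow> bool" where
  "lebesgue_decomposition \<nu> \<mu> \<mu>a \<mu>s \<longleftrightarrow>
     sets \<mu>a = sets \<mu> \<and> sets \<mu>s = sets \<mu> \<and>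
     (\<forall>A\<in>sets \<mu>. emeasure \<mu> A = emeasure \<mu>a A + emeasure \<mu>s A) \<and>
     absolutely_continuous \<nu> \<mu>a \<and>
     (\<exists>A\<in>sets \<nu>. emeasure \<nu> A = 0 \<and> emeasure \<mu>s (space \<mu>s - A) = 0)"

end

theory Submission imports Defs
begin

text \<open>No blow-up is needed: the boundary alone forces the orientation. Let \<open>S = {f = 0}\<close> be
  \<open>\<bbbH>\<close>-regular, and let \<open>f\<^sub>\<delta>\<close> be a mollification of a component of \<open>f\<close>. The functions
  \<open>g = \<delta>\<^sup>2 \<Psi> (f\<^sub>\<delta> / \<delta>) \<zeta>\<close> with \<open>\<Psi> s = ln (1 + s\<^sup>2) / 2\<close> tend to \<open>0\<close> uniformly together
  with their first horizontal derivatives, while \<open>W\<^sub>j W\<^sub>i g\<close> stays bounded and tends to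
  \<open>\<zeta> (W\<^sub>j f) (W\<^sub>i f)\<close> on \<open>{f = 0}\<close> and to \<open>0\<close> elsewhere. Testing the boundary, which has
  locally finite mass, on \<open>W\<^sub>j g \<lambda>\<close> for \<open>k < n\<close>, where \<open>d\<^sub>C\<close> has order one, and on
  \<open>g \<lambda>\<close> for \<open>k = n\<close>, where it has order two, with \<open>\<lambda>\<close> left-invariant, shows that almost
  everywhere on \<open>S\<close> the vector \<open>\<tau>\<close> of the current kills the symbol of \<open>d\<^sub>C\<close> at every
  conormal \<open>w \<in> span {\<nabla>f\<^sub>1, \<dots>, \<nabla>f\<^sub>k}\<close>.

  In terms of the Lefschetz operator and its adjoint \<open>\<Lambda>\<close>, this says that \<open>\<tau> = \<theta> \<and> b\<close> with
  \<open>\<iota>\<^sub>w b\<close> in \<open>\<Lambda> \<iota>\<^sub>w\<close> of the forms of degree two higher, for every such \<open>w\<close>. Koszul exactness and the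
  injectivity of \<open>\<Lambda>\<close> above the middle degree give \<open>b \<in> \<real> v\<^sub>1 \<and> \<dots> \<and> v\<^sub>2\<^sub>n\<^sub>-\<^sub>k + range \<Lambda>\<close>, and
  \<open>range \<Lambda>\<close> is invisible to Rumin forms. That the conormals do not depend on the defining
  function follows from strict differentiability along horizontal directions and Brouwer's theorem.\<close>

section \<open>Creation and annihilation operators\<close>

text \<open>The mass bound on the boundary sees only the size of a test form, whereas the current
  itself is tested against derivatives of that form. Functions that are small together with their
  first derivatives but keep second derivatives of order one on \<open>{f = 0}\<close> exploit this
  gap. The obstacle is that \<open>f\<close> has only a continuous horizontal gradient. A
  mollification at scale \<delta> differs from \<open>f\<close> by o(\<delta>) and has second
  derivatives of order o(1 / \<delta>), which is just what the rescaling by \<delta> tolerates. The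
  convolution is taken in the group, on the side on which left-invariant derivatives pass to the
  kernel.

  The case \<open>k = n\<close> differs from the others in that the condition obtained is quadratic
  in the conormal instead of linear, so it is polarised by means of the sums
  \<open>f\<^sub>i + f\<^sub>j\<close>. Absolute continuity serves to transfer the choice of
  tangent, made almost everywhere on \<open>R\<close>, to \<open>\<mu>a\<close>.\<close>

abbreviation isgn :: "'n::{finite,linorder} hidx \<Rightarrow> 'n hidx set \<Rightarrow> real" where
  "isgn i K \<equiv> wedge_sign {i} K"

lemma hidx_less_total: "i \<noteq> j \<Longrightarrow> hidx_less i j \<longleftrightarrow> \<not> hidx_less j i"
  by (cases i; cases j) auto

lemma hidx_less_irrefl [simp]: "\<not> hidx_less i i"
  by (cases i) auto

text \<open>Only the members of \<open>K\<close> below \<open>i\<close> are passed when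
  \<open>i\<close> is moved to its place.\<close>

lemma isgn_eq: "isgn i K = (- 1) ^ card {j\<in>K. hidx_less j i}"
proof -
  have "{(i', j). i' \<in> {i} \<and> j \<in> K \<and> hidx_less j i'} = Pair i ` {j\<in>K. hidx_less j i}"
    by auto
  then show ?thesis
    by (simp add: wedge_sign_def card_image inj_on_def)
qed

lemma isgn_square [simp]: "isgn i K * isgn i K = 1"
  by (simp add: isgn_eq flip: power_mult_distrib)

lemma isgn_square_left [simp]: "isgn i K * (isgn i K * x) = x"
  by (simp flip: mult.assoc)

lemma isgn_insert:
  assumes "j \<notin> K"
  shows "isgn i (insert j K) = (if hidx_less j i then - isgn i K else isgn i K)"
proof -
  have "{l \<in> insert j K. hidx_less l i} =
      (if hidx_less j i then insert j {l\<in>K. hidx_less l i} else {l\<in>K. hidx_less l i})"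
    by auto
  with assms show ?thesis
    by (simp add: isgn_eq)
qed

lemma isgn_Diff_self [simp]: "isgn i (K - {i}) = isgn i K"
proof -
  have "{l \<in> K - {i}. hidx_less l i} = {l\<in>K. hidx_less l i}"
    by auto
  then show ?thesis
    by (simp add: isgn_eq)
qed

definition cre :: "'n::{finite,linorder} hidx \<Rightarrow> 'n ext \<Rightarrow> 'n ext" where
  "cre i a = ext_basis {i} \<and>\<^sub>e a"

text \<open>Interior multiplication by a basis vector. The coordinates are those that make it the
  adjoint of \<open>cre i\<close>, so that its relations follow from those of \<open>cre\<close> by
  duality.\<close>

definition ann :: "'n::{finite,linorder} hidx \<Rightarrow> 'n ext \<Rightarrow> 'n ext" where
  "ann i a = (\<chi> K. if i \<in> K then 0 else isgn i K * a $ insert i K)"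

lemma cre_nth: "cre i a $ K = (if i \<in> K then isgn i K * a $ (K - {i}) else 0)"
proof -
  have "cre i a $ K = (\<Sum>I\<in>Pow K. if I = {i} then isgn i K * a $ (K - {i}) else 0)"
    unfolding cre_def wedge_def vec_lambda_beta
    by (intro sum.cong) (auto simp: ext_basis_def axis_def)
  then show ?thesis
    by (simp add: sum.delta)
qed

lemma ann_nth: "ann i a $ K = (if i \<in> K then 0 else isgn i K * a $ insert i K)"
  by (simp add: ann_def)

lemma linear_cre: "linear (cre i)"
  by (rule linearI) (auto simp: vec_eq_iff cre_nth algebra_simps)

lemma linear_ann: "linear (ann i)"
  by (rule linearI) (auto simp: vec_eq_iff ann_nth algebra_simps)

lemmas cre_simps = linear_0[OF linear_cre] linear_add[OF linear_cre] linear_diff[OF linear_cre]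
  linear_neg[OF linear_cre] linear_cmul[OF linear_cre] linear_sum[OF linear_cre]

lemmas ann_simps = linear_0[OF linear_ann] linear_add[OF linear_ann] linear_diff[OF linear_ann]
  linear_neg[OF linear_ann] linear_cmul[OF linear_ann] linear_sum[OF linear_ann]

lemma ann_adjoint: "ann i a \<bullet> b = a \<bullet> cre i b"
proof -
  have "ann i a \<bullet> b = (\<Sum>K | i \<notin> K. isgn i K * a $ insert i K * b $ K)"
    by (simp add: inner_vec_def ann_nth sum.inter_filter [symmetric] if_distrib if_distribR cong: if_cong)
       (intro sum.mono_neutral_cong_right, auto)
  also have "\<dots> = (\<Sum>K | i \<in> K. a $ K * (isgn i K * b $ (K - {i})))"
    by (rule sum.reindex_bij_witness[where i = "\<lambda>K. K - {i}" and j = "insert i"])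
       (auto simp: insert_absorb isgn_insert algebra_simps)
  also have "\<dots> = a \<bullet> cre i b"
    by (simp add: inner_vec_def cre_nth) (intro sum.mono_neutral_cong_left, auto)
  finally show ?thesis .
qed

lemma cre_adjoint: "cre i a \<bullet> b = a \<bullet> ann i b"
  by (metis ann_adjoint inner_commute)

text \<open>Only index sets containing both \<open>i\<close> and \<open>j\<close> contribute.
  Exactly one of the two precedes the other, so exactly one order of insertion picks up an extra
  sign.\<close>

lemma cre_anticommute: "cre i (cre j a) = - cre j (cre i a)"
proof (cases "i = j")
  case True
  then show ?thesis by (simp add: vec_eq_iff cre_nth)
next
  case False
  have "cre i (cre j a) $ K = - cre j (cre i a) $ K" for K
  proof (cases "i \<in> K \<and> j \<in> K")
    case True
    define M where "M = K - {i, j}"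
    have K: "K = insert i (insert j M)" "i \<notin> M" "j \<notin> M" "K - {i} = insert j M"
      "K - {j} = insert i M" "K - {i} - {j} = M" "K - {j} - {i} = M"
      using True False by (auto simp: M_def)
    have "isgn i K = isgn i (insert j M)" "isgn j K = isgn j (insert i M)"
      using K isgn_Diff_self by metis+
    with False K show ?thesis
      using hidx_less_total[OF False] by (simp add: cre_nth isgn_insert)
  qed (use False in \<open>auto simp: cre_nth\<close>)
  then show ?thesis
    by (simp add: vec_eq_iff)
qed

lemma cre_cre [simp]: "cre i (cre i a) = 0"
  by (simp add: vec_eq_iff cre_nth)

lemma ann_anticommute: "ann i (ann j a) = - ann j (ann i a)"
proof (rule vector_eq_rdot[THEN iffD1], rule allI)
  fix b
  show "ann i (ann j a) \<bullet> b = - ann j (ann i a) \<bullet> b"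
    using cre_anticommute[of j i b] by (simp add: ann_adjoint)
qed

text \<open>The canonical anticommutation relation. The commutator of the Lefschetz operators and
  the relation between exterior and interior multiplication by vectors both come from it.\<close>

lemma ann_cre: "ann i (cre j a) = (if i = j then a else 0) - cre j (ann i a)"
proof (cases "i = j")
  case True
  have "ann i (cre i a) $ K = (a - cre i (ann i a)) $ K" for K
    by (auto simp: ann_nth cre_nth isgn_insert insert_absorb)
  with True show ?thesis
    by (simp add: vec_eq_iff)
next
  case False
  have "ann i (cre j a) $ K = - cre j (ann i a) $ K" for K
  proof (cases "i \<notin> K \<and> j \<in> K")
    case True
    define M where "M = K - {j}"
    have K: "K = insert j M" "i \<notin> M" "j \<notin> M" "insert i K - {j} = insert i M"
      using True False by (auto simp: M_def)
    have "isgn j (insert i K) = isgn j (insert i M)" "isgn j K = isgn j M"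
      using K isgn_Diff_self[of j "insert i K"] by (auto simp: isgn_insert)
    with False K show ?thesis
      using hidx_less_total[OF False] by (simp add: cre_nth ann_nth isgn_insert)
  qed (use False in \<open>auto simp: cre_nth ann_nth\<close>)
  with False show ?thesis
    by (simp add: vec_eq_iff)
qed

section \<open>The Lefschetz operator\<close>

lemma card_pairs_two:
  fixes M :: "'a::finite set"
  assumes "x \<noteq> y"
  shows "card {(i, j). i \<in> M \<and> j \<in> {x, y} \<and> P j i} = card {i\<in>M. P x i} + card {i\<in>M. P y i}"
proof -
  have "{(i, j). i \<in> M \<and> j \<in> {x, y} \<and> P j i} =
      (\<lambda>i. (i, x)) ` {i\<in>M. P x i} \<union> (\<lambda>i. (i, y)) ` {i\<in>M. P y i}"
    by auto
  with assms show ?thesis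
    by (simp, subst card_Un_disjoint) (auto simp: card_image inj_on_def)
qed

text \<open>A two-form can be multiplied from either side. For the sign, \<open>wedge_sign\<close>
  counts the members of \<open>M\<close> above each of the two indices and \<open>isgn\<close> those
  below; together they count \<open>M\<close> twice, an even number.\<close>

lemma wedge_pair_eq: "a \<and>\<^sub>e (ext_basis {IX j} \<and>\<^sub>e ext_basis {IY j}) = cre (IX j) (cre (IY j) a)"
proof -
  let ?P = "{IX j, IY j}"
  have *: "ext_basis {IX j} \<and>\<^sub>e ext_basis {IY j} = ext_basis ?P"
  proof -
    have "cre (IX j) (ext_basis {IY j}) $ K = ext_basis ?P $ K" for K
    proof (cases "K = ?P")
      case True
      have "{l \<in> ?P. hidx_less l (IX j)} = {}" by auto
      then have "isgn (IX j) ?P = 1" by (simp only: isgn_eq card.empty power_0)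
      moreover have "?P - {IX j} = {IY j}" by auto
      ultimately show ?thesis
        by (simp add: True cre_nth ext_basis_def axis_def)
    next
      case False
      then have "IX j \<in> K \<Longrightarrow> K - {IX j} \<noteq> {IY j}" by auto
      with False show ?thesis
        by (auto simp: cre_nth ext_basis_def axis_def)
    qed
    then show ?thesis
      unfolding cre_def by (simp add: vec_eq_iff)
  qed
  have "(a \<and>\<^sub>e ext_basis ?P) $ K = cre (IX j) (cre (IY j) a) $ K" for K
  proof (cases "?P \<subseteq> K")
    case True
    define M where "M = K - ?P"
    have K: "K = insert (IX j) (insert (IY j) M)" "IX j \<notin> M" "IY j \<notin> M" "K - {IX j} = insert (IY j) M"
      "K - {IX j} - {IY j} = M" "M \<subseteq> K" "K - M = ?P" "insert (IY j) M - {IY j} = M"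
      using True by (auto simp: M_def)
    have "(a \<and>\<^sub>e ext_basis ?P) $ K = (\<Sum>I\<in>Pow K. if I = M then wedge_sign M ?P * a $ M else 0)"
      unfolding wedge_def vec_lambda_beta
    proof (rule sum.cong)
      fix I assume "I \<in> Pow K"
      then have "?P = K - I \<longleftrightarrow> I = M"
        using True by (auto simp: M_def)
      moreover have "?P = K - M" using K by simp
      ultimately show "wedge_sign I (K - I) * a $ I * ext_basis ?P $ (K - I) =
          (if I = M then wedge_sign M ?P * a $ M else 0)"
        by (auto simp: ext_basis_def axis_def)
    qed simp
    also have "\<dots> = wedge_sign M ?P * a $ M"
      using K by (simp add: sum.delta)
    finally have 1: "(a \<and>\<^sub>e ext_basis ?P) $ K = wedge_sign M ?P * a $ M" .
    have 2: "cre (IX j) (cre (IY j) a) $ K = isgn (IX j) M * isgn (IY j) M * a $ M"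
    proof -
      have "isgn (IX j) K = isgn (IX j) M" "isgn (IY j) (insert (IY j) M) = isgn (IY j) M"
        using K by (simp_all add: isgn_insert)
      with K show ?thesis by (simp add: cre_nth)
    qed
    have c: "card {i\<in>M. hidx_less x i} + card {i\<in>M. hidx_less i x} = card M" if "x \<notin> M" for x
    proof -
      have "hidx_less x i \<longleftrightarrow> \<not> hidx_less i x" if "i \<in> M" for i
        using that \<open>x \<notin> M\<close> hidx_less_total[of x i] by blast
      then show ?thesis
        by (subst card_Un_disjoint[symmetric]) (auto intro!: arg_cong[where f = card])
    qed
    have "card {(i, l). i \<in> M \<and> l \<in> ?P \<and> hidx_less l i} =
        card {i\<in>M. hidx_less (IX j) i} + card {i\<in>M. hidx_less (IY j) i}"
      by (rule card_pairs_two) simp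
    then have "wedge_sign M ?P * (isgn (IX j) M * isgn (IY j) M) =
        (- 1) ^ ((card {i\<in>M. hidx_less (IX j) i} + card {i\<in>M. hidx_less i (IX j)}) +
          (card {i\<in>M. hidx_less (IY j) i} + card {i\<in>M. hidx_less i (IY j)}))"
      unfolding isgn_eq wedge_sign_def[of M ?P] by (simp add: power_add)
    also have "\<dots> = 1"
      unfolding c[OF K(2)] c[OF K(3)] by (simp flip: mult_2)
    finally have "wedge_sign M ?P * (isgn (IX j) M * isgn (IY j) M) *
        (isgn (IX j) M * isgn (IY j) M) = isgn (IX j) M * isgn (IY j) M"
      by simp
    then have "wedge_sign M ?P = isgn (IX j) M * isgn (IY j) M"
      by (simp add: mult.assoc mult.left_commute)
    with 1 2 show ?thesis by simp
  next
    case False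
    then have "wedge_sign I (K - I) * a $ I * ext_basis ?P $ (K - I) = 0" if "I \<in> Pow K" for I
      using that by (auto simp: ext_basis_def axis_def)
    with False show ?thesis
      by (auto simp: wedge_def cre_nth intro!: sum.neutral)
  qed
  then show ?thesis
    unfolding * by (simp add: vec_eq_iff)
qed

lemma linear_wedge_right: "linear (\<lambda>b. a \<and>\<^sub>e b)"
  by (rule linearI) (simp_all add: vec_eq_iff wedge_def algebra_simps sum.distrib sum_distrib_left)

lemma linear_wedge_left: "linear (\<lambda>a. a \<and>\<^sub>e b)"
  by (rule linearI) (simp_all add: vec_eq_iff wedge_def algebra_simps sum.distrib sum_distrib_left)

lemma lefschetz_eq: "lefschetz a = - (\<Sum>j\<in>UNIV. cre (IX j) (cre (IY j) a))"
  unfolding lefschetz_def dtheta_def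
  by (simp add: linear_neg[OF linear_wedge_right] linear_sum[OF linear_wedge_right] wedge_pair_eq)

text \<open>The operator \<Lambda>, contraction with \<open>d\<theta>\<close>. The two contractions
  come in reverse order, as befits the adjoint of a product.\<close>

definition lefs_adj :: "'n::{finite,linorder} ext \<Rightarrow> 'n ext" where
  "lefs_adj a = - (\<Sum>j\<in>UNIV. ann (IY j) (ann (IX j) a))"

lemma lefs_adjoint: "lefs_adj a \<bullet> b = a \<bullet> lefschetz b"
  by (simp add: lefs_adj_def lefschetz_eq inner_sum_left inner_sum_right ann_adjoint)

lemma linear_lefschetz: "linear lefschetz"
  unfolding lefschetz_def[abs_def] by (rule linear_wedge_left)

lemma linear_lefs_adj: "linear lefs_adj"
  by (rule linearI) (simp_all add: lefs_adj_def ann_simps sum.distrib scaleR_sum_right)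

lemmas lefschetz_simps = linear_0[OF linear_lefschetz] linear_add[OF linear_lefschetz]
  linear_diff[OF linear_lefschetz] linear_neg[OF linear_lefschetz]
  linear_cmul[OF linear_lefschetz] linear_sum[OF linear_lefschetz]

lemmas lefs_adj_simps = linear_0[OF linear_lefs_adj] linear_add[OF linear_lefs_adj]
  linear_diff[OF linear_lefs_adj] linear_neg[OF linear_lefs_adj]
  linear_cmul[OF linear_lefs_adj] linear_sum[OF linear_lefs_adj]

lemma cre_lefschetz: "cre i (lefschetz a) = lefschetz (cre i a)"
proof -
  have "cre i (cre (IX j) (cre (IY j) a)) = cre (IX j) (cre (IY j) (cre i a))" for j
    by (metis (no_types) cre_anticommute cre_simps(4) minus_minus)
  then show ?thesis
    by (simp add: lefschetz_eq cre_simps)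
qed

lemma ann_lefs_adj: "ann i (lefs_adj a) = lefs_adj (ann i a)"
proof -
  have "ann i (ann (IY j) (ann (IX j) a)) = ann (IY j) (ann (IX j) (ann i a))" for j
    by (metis (no_types) ann_anticommute ann_simps(4) minus_minus)
  then show ?thesis
    by (simp add: lefs_adj_def ann_simps)
qed

text \<open>\<open>d\<theta>\<close> is even and has no \<theta> component, so contraction with
  \<open>T\<close> commutes with multiplication by it.\<close>

lemma ann_IT_lefschetz: "ann IT (lefschetz a) = lefschetz (ann IT a)"
  by (simp add: lefschetz_eq ann_simps ann_cre cre_simps)

text \<open>\<open>IT\<close> is the largest index, hence multiplication by \<theta> from the right
  carries no sign.\<close>

lemma wedge_theta: "(a \<and>\<^sub>e theta) $ K = (if IT \<in> K then a $ (K - {IT}) else 0)"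
proof -
  have no: "\<not> hidx_less IT i" for i by simp
  have ws: "wedge_sign M {IT} = 1" for M :: "'a hidx set"
  proof -
    have "{(i, j). i \<in> M \<and> j \<in> {IT} \<and> hidx_less j i} = {}" by auto
    then show ?thesis by (simp only: wedge_sign_def card.empty power_0)
  qed
  have "(a \<and>\<^sub>e theta) $ K = (\<Sum>I\<in>Pow K. if I = K - {IT} \<and> IT \<in> K then a $ (K - {IT}) else 0)"
    unfolding wedge_def vec_lambda_beta
  proof (rule sum.cong)
    fix I assume "I \<in> Pow K"
    then have "{IT} = K - I \<longleftrightarrow> I = K - {IT} \<and> IT \<in> K" by auto
    moreover have "IT \<in> K \<Longrightarrow> K - (K - {IT}) = {IT}" by auto
    ultimately show "wedge_sign I (K - I) * a $ I * theta $ (K - I) =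
        (if I = K - {IT} \<and> IT \<in> K then a $ (K - {IT}) else 0)"
      by (auto simp: theta_def ext_basis_def axis_def ws)
  qed simp
  then show ?thesis
    by (simp add: sum.delta)
qed

lemma isgn_nonzero [simp]: "isgn i K \<noteq> 0"
  by (simp add: isgn_eq)

lemma wedge_theta_eq_0_iff: "a \<and>\<^sub>e theta = 0 \<longleftrightarrow> cre IT a = 0"
  by (auto simp: vec_eq_iff wedge_theta cre_nth)

lemma ext_power_hor_iff: "a \<in> ext_power_hor j \<longleftrightarrow> (\<forall>K. a $ K \<noteq> 0 \<longrightarrow> IT \<notin> K \<and> int (card K) = j)"
  by (auto simp: ext_power_hor_def ext_power_def)

lemma subspace_ext_power: "subspace (ext_power j)"
  unfolding subspace_def ext_power_def by simp (metis add.left_neutral)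

lemma subspace_ext_power_hor: "subspace (ext_power_hor j)"
  using subspace_ext_power[of j] by (auto simp: subspace_def ext_power_hor_def)

lemma ext_power_hor_subset: "ext_power_hor j \<subseteq> ext_power j"
  by (auto simp: ext_power_hor_def)

lemma cre_ext_power: "a \<in> ext_power j \<Longrightarrow> cre i a \<in> ext_power (j + 1)"
  unfolding ext_power_def
proof clarsimp
  fix K assume a: "\<forall>I. a $ I \<noteq> 0 \<longrightarrow> int (card I) = j" and "cre i a $ K \<noteq> 0"
  then have "i \<in> K" "a $ (K - {i}) \<noteq> 0"
    by (metis cre_nth, metis cre_nth mult_zero_right)
  with a have "int (card (K - {i})) = j"
    by blast
  moreover from \<open>i \<in> K\<close> have "card K = Suc (card (K - {i}))"
    using card_Suc_Diff1[of K i] by simp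
  ultimately show "int (card K) = j + 1"
    by simp
qed

lemma ann_ext_power: "a \<in> ext_power j \<Longrightarrow> ann i a \<in> ext_power (j - 1)"
  unfolding ext_power_def
proof clarsimp
  fix K assume a: "\<forall>I. a $ I \<noteq> 0 \<longrightarrow> int (card I) = j" and "ann i a $ K \<noteq> 0"
  then have "i \<notin> K" "a $ insert i K \<noteq> 0"
    by (metis ann_nth, metis ann_nth mult_zero_right)
  with a have "int (card (insert i K)) = j"
    by blast
  with \<open>i \<notin> K\<close> show "int (card K) = j - 1"
    by simp
qed

lemma cre_ext_power_hor: "a \<in> ext_power_hor j \<Longrightarrow> i \<noteq> IT \<Longrightarrow> cre i a \<in> ext_power_hor (j + 1)"
  using cre_ext_power[of a j i] by (auto simp: ext_power_hor_def cre_nth)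

lemma ann_ext_power_hor: "a \<in> ext_power_hor j \<Longrightarrow> ann i a \<in> ext_power_hor (j - 1)"
  using ann_ext_power[of a j i] by (auto simp: ext_power_hor_def ann_nth)

lemma ann_IT_hor: "a \<in> ext_power j \<Longrightarrow> ann IT a \<in> ext_power_hor (j - 1)"
  using ann_ext_power[of a j IT] by (auto simp: ext_power_hor_def ann_nth)

lemma ann_IT_eq_0: "a \<in> ext_power_hor j \<Longrightarrow> ann IT a = 0"
  by (auto simp: vec_eq_iff ann_nth ext_power_hor_def)

lemma lefschetz_ext_power_hor:
  assumes "a \<in> ext_power_hor j" shows "lefschetz a \<in> ext_power_hor (j + 2)"
proof -
  have "cre (IX l) (cre (IY l) a) \<in> ext_power_hor (j + 1 + 1)" for l
    by (intro cre_ext_power_hor assms) auto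
  then show ?thesis
    unfolding lefschetz_eq by (intro subspace_neg subspace_sum subspace_ext_power_hor) (simp add: add.assoc)
qed

lemma lefs_adj_ext_power_hor:
  assumes "a \<in> ext_power_hor j" shows "lefs_adj a \<in> ext_power_hor (j - 2)"
proof -
  have "ann (IY l) (ann (IX l) a) \<in> ext_power_hor (j - 1 - 1)" for l
    by (intro ann_ext_power_hor assms)
  then show ?thesis
    unfolding lefs_adj_def by (intro subspace_neg subspace_sum subspace_ext_power_hor) simp
qed

lemma UNIV_hidx: "(UNIV :: 'n hidx set) = range IX \<union> range IY \<union> {IT}"
proof -
  have "x \<in> range IX \<union> range IY \<union> {IT}" for x :: "'n hidx"
    by (cases x) auto
  then show ?thesis by blast
qed

lemma sum_hidx:
  fixes f :: "'n::finite hidx \<Rightarrow> 'a::comm_monoid_add"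
  shows "(\<Sum>i\<in>UNIV. f i) = (\<Sum>j\<in>UNIV. f (IX j)) + (\<Sum>j\<in>UNIV. f (IY j)) + f IT"
proof -
  have "range IX \<inter> range IY = ({} :: 'n hidx set)" "IT \<notin> range IX \<union> range (IY :: 'n \<Rightarrow> 'n hidx)"
    by auto
  moreover have "inj (IX :: 'n \<Rightarrow> 'n hidx)" "inj (IY :: 'n \<Rightarrow> 'n hidx)"
    by (auto intro: injI)
  ultimately show ?thesis
    unfolding UNIV_hidx by (simp add: sum.union_disjoint sum.reindex add.commute)
qed

section \<open>Kernel and range of the Lefschetz operator\<close>

lemma number_operator:
  assumes "a \<in> ext_power_hor j"
  shows "(\<Sum>i\<in>UNIV. cre i (ann i a)) = of_int j *\<^sub>R a"
proof -
  have "(\<Sum>i\<in>UNIV. cre i (ann i a)) $ K = of_int j * a $ K" for K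
  proof -
    have "(\<Sum>i\<in>UNIV. cre i (ann i a)) $ K = (\<Sum>i\<in>UNIV. if i \<in> K then a $ K else 0)"
      unfolding sum_component by (intro sum.cong) (auto simp: cre_nth ann_nth insert_absorb)
    also have "\<dots> = real (card K) * a $ K"
      by (simp add: sum.inter_restrict[symmetric])
    also have "\<dots> = of_int j * a $ K"
      using assms by (auto simp: ext_power_hor_iff)
    finally show ?thesis .
  qed
  then show ?thesis
    by (simp add: vec_eq_iff)
qed

text \<open>One of the relations of the \<open>sl\<^sub>2\<close>-triple spanned by the Lefschetz operator and its adjoint.\<close>

lemma lefschetz_commutator:
  fixes a :: "'n::{finite,linorder} ext"
  assumes "a \<in> ext_power_hor j"
  shows "lefs_adj (lefschetz a) - lefschetz (lefs_adj a) = of_int (int CARD('n) - j) *\<^sub>R a"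
proof -
  let ?D = "\<lambda>l. a - cre (IX l) (ann (IX l) a) - cre (IY l) (ann (IY l) a)"
  \<comment> \<open>Moving the contractions to the right past the creations leaves extra terms only
    when the two pairs have the same index.\<close>
  have 1: "ann (IY j) (ann (IX j) (cre (IX l) (cre (IY l) a))) =
      cre (IX l) (cre (IY l) (ann (IY j) (ann (IX j) a))) + (if j = l then ?D l else 0)" for j l
    by (auto simp: ann_cre cre_simps ann_simps)
  have "lefs_adj (lefschetz a) =
      (\<Sum>j\<in>UNIV. \<Sum>l\<in>UNIV. ann (IY j) (ann (IX j) (cre (IX l) (cre (IY l) a))))"
    by (simp add: lefs_adj_def lefschetz_eq ann_simps sum_negf)
  also have "\<dots> = (\<Sum>j\<in>UNIV. \<Sum>l\<in>UNIV. cre (IX l) (cre (IY l) (ann (IY j) (ann (IX j) a)))) +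
      (\<Sum>l\<in>UNIV. ?D l)"
    unfolding 1 by (simp add: sum.distrib)
  also have "(\<Sum>j\<in>UNIV. \<Sum>l\<in>UNIV. cre (IX l) (cre (IY l) (ann (IY j) (ann (IX j) a)))) =
      lefschetz (lefs_adj a)"
    by (subst sum.swap) (simp add: lefs_adj_def lefschetz_eq cre_simps sum_negf)
  also have "(\<Sum>l\<in>UNIV. ?D l) = of_int (int CARD('n) - j) *\<^sub>R a"
  proof -
    \<comment> \<open>Horizontal forms have no \<open>T\<close> part, so the number operator reduces
      to these two sums.\<close>
    have N: "(\<Sum>l\<in>UNIV. cre (IX l) (ann (IX l) a)) + (\<Sum>l\<in>UNIV. cre (IY l) (ann (IY l) a)) = of_int j *\<^sub>R a"
      using number_operator[OF assms] ann_IT_eq_0[OF assms] by (simp add: sum_hidx cre_simps)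
    have "(\<Sum>l\<in>(UNIV::'n set). ?D l) = real CARD('n) *\<^sub>R a -
        ((\<Sum>l\<in>UNIV. cre (IX l) (ann (IX l) a)) + (\<Sum>l\<in>UNIV. cre (IY l) (ann (IY l) a)))"
      by (simp only: sum_subtractf sum_constant_scaleR) (rule diff_diff_eq)
    then show ?thesis
      unfolding N by (simp add: scaleR_left_diff_distrib)
  qed
  finally show ?thesis
    by simp
qed

text \<open>The commutator relation paired with \<open>a\<close>. The sign of \<open>n - j\<close>
  decides which of the two operators is injective: \<open>lefschetz\<close> below the middle degree,
  its adjoint above it.\<close>

lemma lefschetz_norm:
  fixes a :: "'n::{finite,linorder} ext"
  assumes "a \<in> ext_power_hor j"
  shows "lefschetz a \<bullet> lefschetz a = lefs_adj a \<bullet> lefs_adj a + of_int (int CARD('n) - j) * (a \<bullet> a)"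
proof -
  have "lefschetz a \<bullet> lefschetz a = lefs_adj (lefschetz a) \<bullet> a"
    by (simp add: lefs_adjoint)
  also have "lefs_adj (lefschetz a) = lefschetz (lefs_adj a) + of_int (int CARD('n) - j) *\<^sub>R a"
    using lefschetz_commutator[OF assms] by (metis add.commute diff_add_cancel)
  also have "\<dots> \<bullet> a = lefs_adj a \<bullet> lefs_adj a + of_int (int CARD('n) - j) * (a \<bullet> a)"
    by (simp add: inner_add_left lefs_adjoint inner_commute[of "lefschetz (lefs_adj a)"])
  finally show ?thesis .
qed

lemma lefschetz_eq_0D:
  fixes a :: "'n::{finite,linorder} ext"
  assumes "a \<in> ext_power_hor j" "j < int CARD('n)" "lefschetz a = 0"
  shows "a = 0"
proof -
  have "lefs_adj a \<bullet> lefs_adj a + of_int (int CARD('n) - j) * (a \<bullet> a) = 0"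
    using lefschetz_norm[OF assms(1)] assms(3) by simp
  moreover have "of_int (int CARD('n) - j) * (a \<bullet> a) \<ge> 0"
    using assms(2) by simp
  ultimately have "of_int (int CARD('n) - j) * (a \<bullet> a) = 0"
    using inner_ge_zero[of "lefs_adj a"] by linarith
  with assms(2) show ?thesis
    by simp
qed

lemma lefs_adj_eq_0D:
  fixes a :: "'n::{finite,linorder} ext"
  assumes "a \<in> ext_power_hor j" "int CARD('n) < j" "lefs_adj a = 0"
  shows "a = 0"
proof -
  have "lefschetz a \<bullet> lefschetz a + of_int (j - int CARD('n)) * (a \<bullet> a) = 0"
    using lefschetz_norm[OF assms(1)] assms(3) by (simp add: left_diff_distrib)
  moreover have "of_int (j - int CARD('n)) * (a \<bullet> a) \<ge> 0"
    using assms(2) by simp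
  ultimately have "of_int (j - int CARD('n)) * (a \<bullet> a) = 0"
    using inner_ge_zero[of "lefschetz a"] by linarith
  with assms(2) show ?thesis
    by simp
qed

text \<open>The kernel of \<open>lefschetz\<close> is the orthogonal complement of the range of its
  adjoint. Testing orthogonality against \<open>lefs_adj (lefschetz z)\<close> gives the vanishing
  of \<open>lefschetz z\<close> without leaving the degree.\<close>

lemma primitive_decomposition:
  assumes a: "a \<in> ext_power_hor j"
  obtains z r where "a = z + lefs_adj r" "z \<in> ext_power_hor j" "r \<in> ext_power_hor (j + 2)" "lefschetz z = 0"
proof -
  let ?R = "lefs_adj ` ext_power_hor (j + 2)"
  have R: "subspace ?R"
    by (rule linear_subspace_image[OF linear_lefs_adj subspace_ext_power_hor])
  obtain y z where y: "y \<in> span ?R" and z: "\<And>w. w \<in> span ?R \<Longrightarrow> orthogonal z w" and a': "a = y + z"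
    using orthogonal_subspace_decomp_exists[of ?R a] by metis
  have span: "span ?R = ?R"
    using R by (simp add: span_eq_iff)
  then obtain r where r: "r \<in> ext_power_hor (j + 2)" "y = lefs_adj r"
    using y unfolding span by (auto elim!: imageE)
  have "y \<in> ext_power_hor j"
    using lefs_adj_ext_power_hor[OF r(1)] r(2) by simp
  then have zh: "z \<in> ext_power_hor j"
    using a a' subspace_diff[OF subspace_ext_power_hor, of a j y] by simp
  have "lefs_adj (lefschetz z) \<in> ?R"
    using lefschetz_ext_power_hor[OF zh] by blast
  then have "z \<bullet> lefs_adj (lefschetz z) = 0"
    using z[unfolded span] by (simp add: orthogonal_def)
  then have "lefs_adj (lefschetz z) \<bullet> z = 0"
    by (simp only: inner_commute)
  then have "lefschetz z = 0"
    by (simp add: lefs_adjoint)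
  with r zh a' that show ?thesis
    by (metis add.commute)
qed

text \<open>What is orthogonal to the range is annihilated by the adjoint, which is injective just
  above the middle degree.\<close>

lemma lefschetz_surj:
  fixes a :: "'n::{finite,linorder} ext"
  assumes a: "a \<in> ext_power_hor (int CARD('n) + 1)"
  obtains r where "r \<in> ext_power_hor (int CARD('n) - 1)" "lefschetz r = a"
proof -
  let ?S = "ext_power_hor (int CARD('n) - 1) :: 'n ext set"
  let ?R = "lefschetz ` ?S"
  have R: "subspace ?R"
    by (rule linear_subspace_image[OF linear_lefschetz subspace_ext_power_hor])
  obtain y z where y: "y \<in> span ?R" and z: "\<And>w. w \<in> span ?R \<Longrightarrow> orthogonal z w" and a': "a = y + z"
    using orthogonal_subspace_decomp_exists[of ?R a] by metis
  have span: "span ?R = ?R"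
    using R by (simp add: span_eq_iff)
  then obtain r where r: "r \<in> ?S" "y = lefschetz r"
    using y unfolding span by (auto elim!: imageE)
  have "y \<in> ext_power_hor (int CARD('n) + 1)"
    using lefschetz_ext_power_hor[OF r(1)] r(2) by (simp add: add.commute)
  then have zh: "z \<in> ext_power_hor (int CARD('n) + 1)"
    using a a' subspace_diff[OF subspace_ext_power_hor, of a _ y] by simp
  have "lefs_adj z \<in> ?S"
    using lefs_adj_ext_power_hor[OF zh] by simp
  then have "lefs_adj z \<bullet> lefs_adj z = 0"
    using z[unfolded span] by (simp add: orthogonal_def lefs_adjoint)
  then have "z = 0"
    using lefs_adj_eq_0D[OF zh] by simp
  with r a' that show ?thesis
    by simp
qed

lemma lefschetz_inj_on: "inj_on lefschetz (ext_power_hor (int CARD('n) - 1) :: 'n::{finite,linorder} ext set)"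
proof (rule inj_onI)
  fix a b :: "'n ext"
  assume a: "a \<in> ext_power_hor (int CARD('n) - 1)" and b: "b \<in> ext_power_hor (int CARD('n) - 1)"
    and eq: "lefschetz a = lefschetz b"
  have "a - b \<in> ext_power_hor (int CARD('n) - 1)"
    using a b by (rule subspace_diff[OF subspace_ext_power_hor])
  moreover have "lefschetz (a - b) = 0"
    by (simp add: lefschetz_simps(3) eq)
  ultimately have "a - b = 0"
    using lefschetz_eq_0D[of "a - b" "int CARD('n) - 1"] by simp
  then show "a = b" by simp
qed

lemma lefschetz_inv:
  fixes a :: "'n::{finite,linorder} ext"
  assumes "a \<in> ext_power_hor (int CARD('n) + 1)"
  shows "lefschetz_inv a \<in> ext_power_hor (int CARD('n) - 1)" and "lefschetz (lefschetz_inv a) = a"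
proof -
  have a: "a \<in> lefschetz ` ext_power_hor (int CARD('n) - 1)"
  proof -
    obtain r where "r \<in> ext_power_hor (int CARD('n) - 1)" "lefschetz r = a"
      using lefschetz_surj[OF assms] by blast
    then show ?thesis by blast
  qed
  show "lefschetz_inv a \<in> ext_power_hor (int CARD('n) - 1)" "lefschetz (lefschetz_inv a) = a"
    unfolding lefschetz_inv_def using inv_into_into[OF a] f_inv_into_f[OF a] by auto
qed

lemma lefschetz_inv_eq:
  fixes b :: "'n::{finite,linorder} ext"
  assumes "b \<in> ext_power_hor (int CARD('n) - 1)"
  shows "lefschetz_inv (lefschetz b) = b"
  unfolding lefschetz_inv_def using lefschetz_inj_on assms by (rule inv_into_f_f)

text \<open>A total linear extension of \<open>lefschetz_inv\<close>, obtained by first projecting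
  to the horizontal forms of degree \<open>n + 1\<close>. The inverse itself has arbitrary values
  outside the range of \<open>lefschetz\<close>, whereas linearity is wanted for smoothness and for
  moving derivatives through.\<close>

definition lefs_pinv :: "'n::{finite,linorder} ext \<Rightarrow> 'n ext" where
  "lefs_pinv a = lefschetz_inv (\<chi> K. if IT \<notin> K \<and> card K = CARD('n) + 1 then a $ K else 0)"

lemma lefs_pinv_eq:
  fixes a :: "'n::{finite,linorder} ext"
  assumes "a \<in> ext_power_hor (int CARD('n) + 1)"
  shows "lefs_pinv a = lefschetz_inv a"
proof -
  have "(\<chi> K. if IT \<notin> K \<and> card K = CARD('n) + 1 then a $ K else 0) = a"
  proof (rule vec_eq_iff[THEN iffD2], rule allI)
    fix K
    have "a $ K = 0 \<or> IT \<notin> K \<and> int (card K) = int CARD('n) + 1"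
      using assms unfolding ext_power_hor_iff by blast
    then show "(\<chi> K. if IT \<notin> K \<and> card K = CARD('n) + 1 then a $ K else 0) $ K = a $ K"
      by (elim disjE) simp_all
  qed
  then show ?thesis
    by (simp add: lefs_pinv_def)
qed

lemma linear_lefs_pinv: "linear (lefs_pinv :: 'n::{finite,linorder} ext \<Rightarrow> 'n ext)"
proof -
  define pr :: "'n ext \<Rightarrow> 'n ext" where "pr a = (\<chi> K. if IT \<notin> K \<and> card K = CARD('n) + 1 then a $ K else 0)" for a
  have pr: "pr a \<in> ext_power_hor (int CARD('n) + 1)" for a
    unfolding pr_def ext_power_hor_iff vec_lambda_beta by (intro allI impI) (simp split: if_splits)
  have pr_add: "pr (a + b) = pr a + pr b" for a b
    by (rule vec_eq_iff[THEN iffD2]) (simp add: pr_def)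
  have pr_scale: "pr (c *\<^sub>R a) = c *\<^sub>R pr a" for a c
    by (rule vec_eq_iff[THEN iffD2]) (simp add: pr_def)
  have eq: "lefs_pinv a = lefschetz_inv (pr a)" for a
    by (simp add: lefs_pinv_def pr_def)
  have mem: "lefs_pinv a \<in> ext_power_hor (int CARD('n) - 1)" and inv: "lefschetz (lefs_pinv a) = pr a" for a
    using lefschetz_inv[OF pr] by (simp_all add: eq)
  show ?thesis
  proof (rule linearI)
    fix a b :: "'n ext" and c :: real
    have "lefs_pinv a + lefs_pinv b \<in> ext_power_hor (int CARD('n) - 1)"
      using mem by (intro subspace_add[OF subspace_ext_power_hor]) auto
    then show "lefs_pinv (a + b) = lefs_pinv a + lefs_pinv b"
      using lefschetz_inv_eq[of "lefs_pinv a + lefs_pinv b"]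
      by (simp add: lefschetz_simps inv eq[of "a + b"] pr_add)
    have "c *\<^sub>R lefs_pinv a \<in> ext_power_hor (int CARD('n) - 1)"
      using mem by (intro subspace_scale[OF subspace_ext_power_hor]) auto
    then show "lefs_pinv (c *\<^sub>R a) = c *\<^sub>R lefs_pinv a"
      using lefschetz_inv_eq[of "c *\<^sub>R lefs_pinv a"]
      by (simp add: lefschetz_simps inv eq[of "c *\<^sub>R a"] pr_scale)
  qed
qed

section \<open>Exterior and interior multiplication by horizontal vectors\<close>

type_synonym 'n hvec = "(real^'n) \<times> (real^'n)"

fun hcoef :: "'n::finite hvec \<Rightarrow> 'n hidx \<Rightarrow> real" where
  "hcoef v (IX j) = fst v $ j"
| "hcoef v (IY j) = snd v $ j"
| "hcoef v IT = 0"

definition hcre :: "'n::{finite,linorder} hvec \<Rightarrow> 'n ext \<Rightarrow> 'n ext" where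
  "hcre v a = (\<Sum>i\<in>UNIV. hcoef v i *\<^sub>R cre i a)"

text \<open>Interior multiplication by \<open>v\<close>, with vectors and covectors identified
  through the inner product; it is the adjoint of exterior multiplication by
  \<open>v\<close>.\<close>

definition hann :: "'n::{finite,linorder} hvec \<Rightarrow> 'n ext \<Rightarrow> 'n ext" where
  "hann v a = (\<Sum>i\<in>UNIV. hcoef v i *\<^sub>R ann i a)"

lemma hcoef_add: "hcoef (v + w) i = hcoef v i + hcoef w i"
  by (cases i) auto

lemma hcoef_scale: "hcoef (c *\<^sub>R v) i = c * hcoef v i"
  by (cases i) auto

lemma hcoef_inner: "(\<Sum>i\<in>UNIV. hcoef v i * hcoef w i) = v \<bullet> w"
  by (simp add: sum_hidx inner_prod_def inner_vec_def)

lemma hor_vec_wedge: "hor_vec v \<and>\<^sub>e a = hcre v a"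
  by (simp add: hor_vec_def hcre_def sum_hidx sum.distrib linear_sum[OF linear_wedge_left]
      linear_add[OF linear_wedge_left] linear_cmul[OF linear_wedge_left] cre_def)

lemma linear_hcre: "linear (hcre v)"
  by (rule linearI)
     (simp_all add: hcre_def cre_simps scaleR_add_right sum.distrib scaleR_sum_right mult.commute)

lemma linear_hann: "linear (hann v)"
  by (rule linearI)
     (simp_all add: hann_def ann_simps scaleR_add_right sum.distrib scaleR_sum_right mult.commute)

lemmas hcre_simps = linear_0[OF linear_hcre] linear_add[OF linear_hcre] linear_diff[OF linear_hcre]
  linear_neg[OF linear_hcre] linear_cmul[OF linear_hcre] linear_sum[OF linear_hcre]

lemmas hann_simps = linear_0[OF linear_hann] linear_add[OF linear_hann] linear_diff[OF linear_hann]
  linear_neg[OF linear_hann] linear_cmul[OF linear_hann] linear_sum[OF linear_hann]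

lemma hann_add_vec: "hann (v + w) a = hann v a + hann w a"
  by (simp add: hann_def hcoef_add scaleR_add_left sum.distrib)

lemma hann_adjoint: "hann v a \<bullet> b = a \<bullet> hcre v b"
  by (simp add: hann_def hcre_def inner_sum_left inner_sum_right ann_adjoint)

lemma cre_hcre: "cre i (hcre v a) = - hcre v (cre i a)"
proof -
  have "cre i (hcre v a) = (\<Sum>j\<in>UNIV. hcoef v j *\<^sub>R - cre j (cre i a))"
    unfolding hcre_def cre_simps by (intro sum.cong refl arg_cong[where f = "scaleR _"] cre_anticommute)
  then show ?thesis
    by (simp add: hcre_def sum_negf)
qed

lemma hcre_anticommute: "hcre v (hcre w a) = - hcre w (hcre v a)"
proof -
  have "hcre v (hcre w a) = (\<Sum>i\<in>UNIV. hcoef v i *\<^sub>R - hcre w (cre i a))"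
    unfolding hcre_def[of v] cre_hcre ..
  also have "\<dots> = - hcre w (hcre v a)"
    by (simp add: hcre_def[of v] hcre_simps sum_negf)
  finally show ?thesis .
qed

lemma ann_hcre: "ann i (hcre v a) = hcoef v i *\<^sub>R a - hcre v (ann i a)"
proof -
  have "ann i (hcre v a) = (\<Sum>j\<in>UNIV. (if i = j then hcoef v j *\<^sub>R a else 0) - hcoef v j *\<^sub>R cre j (ann i a))"
    unfolding hcre_def ann_simps ann_cre by (intro sum.cong) (auto simp: scaleR_diff_right)
  then show ?thesis
    by (simp add: hcre_def sum_subtractf)
qed

text \<open>The basis relations summed up. For \<open>v = w\<close> of length one this is the
  homotopy that makes the Koszul complexes exact.\<close>

lemma hann_hcre: "hann v (hcre w a) = (v \<bullet> w) *\<^sub>R a - hcre w (hann v a)"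
proof -
  have "hann v (hcre w a) = (\<Sum>i\<in>UNIV. (hcoef v i * hcoef w i) *\<^sub>R a - hcoef v i *\<^sub>R hcre w (ann i a))"
    unfolding hann_def ann_hcre by (simp add: scaleR_diff_right)
  also have "\<dots> = (\<Sum>i\<in>UNIV. hcoef v i * hcoef w i) *\<^sub>R a - hcre w (hann v a)"
    by (simp only: sum_subtractf scaleR_left.sum hann_def hcre_simps)
  finally show ?thesis
    by (simp add: hcoef_inner)
qed

lemma hann_anticommute: "hann v (hann w a) = - hann w (hann v a)"
proof (rule vector_eq_rdot[THEN iffD1], rule allI)
  fix b
  show "hann v (hann w a) \<bullet> b = - hann w (hann v a) \<bullet> b"
    using hcre_anticommute[of w v b] by (simp add: hann_adjoint)
qed

lemma hann_hann [simp]: "hann v (hann v a) = 0"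
  using hann_anticommute[of v v a] by (simp add: eq_neg_iff_add_eq_0 flip: scaleR_2)

lemma hcre_ext_power_hor:
  assumes "a \<in> ext_power_hor j" shows "hcre v a \<in> ext_power_hor (j + 1)"
proof -
  have "hcoef v i *\<^sub>R cre i a \<in> ext_power_hor (j + 1)" for i
  proof (cases "i = IT")
    case True
    then show ?thesis using subspace_0[OF subspace_ext_power_hor] by simp
  next
    case False
    with assms show ?thesis
      by (intro subspace_scale subspace_ext_power_hor cre_ext_power_hor)
  qed
  then show ?thesis
    unfolding hcre_def by (intro subspace_sum subspace_ext_power_hor)
qed

lemma hann_ext_power_hor: "a \<in> ext_power_hor j \<Longrightarrow> hann v a \<in> ext_power_hor (j - 1)"
  unfolding hann_def by (intro subspace_sum subspace_scale subspace_ext_power_hor ann_ext_power_hor)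

lemma hann_lefs_adj: "hann v (lefs_adj a) = lefs_adj (hann v a)"
  by (simp add: hann_def ann_lefs_adj lefs_adj_simps)

section \<open>Iterated multiplications and Koszul exactness\<close>

abbreviation hcres :: "'n::{finite,linorder} hvec list \<Rightarrow> 'n ext \<Rightarrow> 'n ext" where
  "hcres vs a \<equiv> foldr hcre vs a"

abbreviation hanns :: "'n::{finite,linorder} hvec list \<Rightarrow> 'n ext \<Rightarrow> 'n ext" where
  "hanns vs a \<equiv> foldr hann vs a"

definition orthonormal_list :: "'a::real_inner list \<Rightarrow> bool" where
  "orthonormal_list vs \<longleftrightarrow> distinct vs \<and> pairwise orthogonal (set vs) \<and> (\<forall>v\<in>set vs. v \<bullet> v = 1)"

lemma orthonormal_list_Cons:
  "orthonormal_list (v # vs) \<longleftrightarrow> v \<bullet> v = 1 \<and> (\<forall>w\<in>set vs. v \<bullet> w = 0) \<and> orthonormal_list vs"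
proof
  assume "orthonormal_list (v # vs)"
  then show "v \<bullet> v = 1 \<and> (\<forall>w\<in>set vs. v \<bullet> w = 0) \<and> orthonormal_list vs"
    unfolding orthonormal_list_def pairwise_def orthogonal_def by fastforce
next
  assume *: "v \<bullet> v = 1 \<and> (\<forall>w\<in>set vs. v \<bullet> w = 0) \<and> orthonormal_list vs"
  then have "v \<notin> set vs"
    by (metis zero_neq_one)
  with * show "orthonormal_list (v # vs)"
    unfolding orthonormal_list_def pairwise_def orthogonal_def by (auto simp: inner_commute)
qed

lemma linear_hcres: "linear (hcres vs)"
proof (induction vs)
  case Nil
  show ?case by (simp add: linear_iff)
next
  case (Cons v vs)
  then show ?case
    using linear_compose[OF Cons linear_hcre[of v]] by (simp add: o_def)
qed

lemma linear_hanns: "linear (hanns vs)"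
proof (induction vs)
  case Nil
  show ?case by (simp add: linear_iff)
next
  case (Cons v vs)
  then show ?case
    using linear_compose[OF Cons linear_hann[of v]] by (simp add: o_def)
qed

lemma hanns_ext_power_hor: "a \<in> ext_power_hor j \<Longrightarrow> hanns vs a \<in> ext_power_hor (j - int (length vs))"
proof (induction vs)
  case (Cons v vs)
  then have "hann v (hanns vs a) \<in> ext_power_hor (j - int (length vs) - 1)"
    by (intro hann_ext_power_hor) auto
  then show ?case
    by (simp add: diff_diff_eq add.commute)
qed simp

lemma hann_hanns_eq_0: "v \<in> set vs \<Longrightarrow> hann v (hanns vs a) = 0"
  by (induction vs) (auto simp: hann_anticommute[of v] hann_simps)

text \<open>Exterior multiplication by \<open>v\<close> anticommutes with contraction along vectors
  orthogonal to \<open>v\<close>, so it passes through the whole product.\<close>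

lemma hcre_hanns_orthogonal:
  "(\<And>w. w \<in> set vs \<Longrightarrow> v \<bullet> w = 0) \<Longrightarrow> hcre v a = 0 \<Longrightarrow> hcre v (hanns vs a) = 0"
proof (induction vs)
  case (Cons w vs)
  have "hcre v (hanns vs a) = 0"
    using Cons by simp
  moreover have "w \<bullet> v = 0"
    using Cons.prems(1)[of w] by (simp add: inner_commute)
  ultimately show ?case
    using hann_hcre[of w v "hanns vs a"] by (simp add: hann_simps)
qed simp

text \<open>Exactness of the Koszul complexes: a common zero of the interior (exterior)
  multiplications is divisible by their product.\<close>

lemma hanns_divisible:
  "orthonormal_list vs \<Longrightarrow> (\<And>v. v \<in> set vs \<Longrightarrow> hann v a = 0) \<Longrightarrow> a \<in> ext_power_hor j \<Longrightarrow>
    \<exists>b\<in>ext_power_hor (j + int (length vs)). a = hanns vs b"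
proof (induction vs arbitrary: a j)
  case (Cons v vs)
  have *: "v \<bullet> v = 1" "\<And>w. w \<in> set vs \<Longrightarrow> v \<bullet> w = 0" "orthonormal_list vs"
    using Cons.prems(1) by (auto simp: orthonormal_list_Cons)
  \<comment> \<open>A unit vector whose contraction annihilates \<open>a\<close> can be split off.
    By orthogonality the remaining contractions annihilate \<open>hcre v a\<close> as well, so the
    induction applies to it.\<close>
  have a: "hann v (hcre v a) = a"
    using hann_hcre[of v v a] Cons.prems(2)[of v] *(1) by (simp add: hcre_simps)
  have "hann w (hcre v a) = 0" if "w \<in> set vs" for w
    using hann_hcre[of w v a] Cons.prems(2)[of w] *(2)[OF that] that by (simp add: hcre_simps inner_commute)
  then obtain b where "b \<in> ext_power_hor (j + 1 + int (length vs))" "hcre v a = hanns vs b"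
    using Cons.IH[OF *(3) _ hcre_ext_power_hor[OF Cons.prems(3), of v]] by blast
  with a show ?case
    by (intro bexI[of _ b]) (auto simp: ac_simps)
qed auto

lemma hcres_divisible:
  "orthonormal_list vs \<Longrightarrow> (\<And>v. v \<in> set vs \<Longrightarrow> hcre v a = 0) \<Longrightarrow> a \<in> ext_power_hor j \<Longrightarrow>
    \<exists>b\<in>ext_power_hor (j - int (length vs)). a = hcres vs b"
proof (induction vs arbitrary: a j)
  case (Cons v vs)
  have *: "v \<bullet> v = 1" "\<And>w. w \<in> set vs \<Longrightarrow> v \<bullet> w = 0" "orthonormal_list vs"
    using Cons.prems(1) by (auto simp: orthonormal_list_Cons)
  have a: "hcre v (hann v a) = a"
    using hann_hcre[of v v a] Cons.prems(2)[of v] *(1) by (simp add: hann_simps)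
  have "hcre w (hann v a) = 0" if "w \<in> set vs" for w
    using hann_hcre[of v w a] Cons.prems(2)[of w] *(2)[OF that] that by (simp add: hann_simps)
  then obtain b where "b \<in> ext_power_hor (j - 1 - int (length vs))" "hann v a = hcres vs b"
    using Cons.IH[OF *(3) _ hann_ext_power_hor[OF Cons.prems(3), of v]] by blast
  with a show ?case
    by (intro bexI[of _ b]) (auto simp: diff_diff_eq)
qed auto

lemma ext_power_hor_0: "a \<in> ext_power_hor 0 \<Longrightarrow> a = (a $ {}) *\<^sub>R ext_basis {}"
  by (auto simp: vec_eq_iff ext_basis_def axis_def ext_power_hor_iff)

lemma card_Compl_IT: "card (- {IT :: 'n::finite hidx}) = 2 * CARD('n)"
proof -
  have "card (- {IT :: 'n hidx}) = (\<Sum>i\<in>(UNIV :: 'n hidx set). if i = IT then 0 else 1)"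
    unfolding card_eq_sum by (intro sum.mono_neutral_cong_left) auto
  also have "\<dots> = 2 * CARD('n)"
    by (simp add: sum_hidx)
  finally show ?thesis .
qed

lemma ext_power_hor_top:
  fixes a :: "'n::{finite,linorder} ext"
  assumes "a \<in> ext_power_hor (2 * int CARD('n))"
  shows "a = (a $ (- {IT})) *\<^sub>R ext_basis (- {IT})"
proof -
  have "K = - {IT}" if "a $ K \<noteq> 0" for K
  proof -
    have "K \<subseteq> - {IT}" "card K = card (- {IT :: 'n hidx})"
      using that assms unfolding ext_power_hor_iff card_Compl_IT by (auto simp flip: of_nat_eq_iff)
    then show ?thesis
      by (intro card_subset_eq) auto
  qed
  then show ?thesis
    by (auto simp: vec_eq_iff ext_basis_def axis_def)
qed

lemma hcre_top: "hcre v (ext_basis (- {IT})) = 0"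
proof -
  have "cre i (ext_basis (- {IT})) = 0" if "i \<noteq> IT" for i
    using that by (auto simp: vec_eq_iff cre_nth ext_basis_def axis_def)
  then have "hcoef v i *\<^sub>R cre i (ext_basis (- {IT})) = 0" for i
    by (cases "i = IT") auto
  then show ?thesis
    unfolding hcre_def by (intro sum.neutral ballI)
qed

text \<open>The step \<open>\<kappa>\<close> below lies in the range of \<open>hann \<xi>\<close> for every \<open>\<xi> = v + w\<close>, as the Lefschetz adjoint
  is injective above the middle degree; this makes \<open>\<kappa>\<close> a common zero of all interior multiplications.\<close>

lemma Koszul_lefschetz_step:
  fixes b :: "'n::{finite,linorder} ext"
  assumes j: "int CARD('n) \<le> j"
    and ws: "orthonormal_list (v # ws)"
    and b: "b \<in> ext_power_hor j" "\<And>w. w \<in> set ws \<Longrightarrow> hann w b = 0"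
    and ex: "\<And>w. w \<in> insert 0 (set ws) \<Longrightarrow> \<exists>\<sigma>\<in>ext_power_hor (j + 2). hann (v + w) b = lefs_adj (hann (v + w) \<sigma>)"
  shows "\<exists>\<sigma>\<in>ext_power_hor (j + 2). \<exists>c\<in>ext_power_hor (j + 1 + int (length ws)).
    b = lefs_adj \<sigma> + hanns (v # ws) c"
proof -
  obtain \<sigma> where \<sigma>: "\<sigma> \<in> ext_power_hor (j + 2)" "hann v b = lefs_adj (hann v \<sigma>)"
    using ex[of 0] by auto
  define \<kappa> where "\<kappa> = hann v \<sigma>"
  have \<kappa>h: "\<kappa> \<in> ext_power_hor (j + 1)"
    using hann_ext_power_hor[OF \<sigma>(1), of v] by (simp add: \<kappa>_def add.commute)
  have \<kappa>v: "hann v \<kappa> = 0"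
    by (simp add: \<kappa>_def)
  have \<kappa>w: "hann w \<kappa> = 0" if w: "w \<in> set ws" for w
  proof -
    obtain \<rho> where \<rho>: "\<rho> \<in> ext_power_hor (j + 2)" "hann (v + w) b = lefs_adj (hann (v + w) \<rho>)"
      using ex[of w] w by auto
    have \<rho>h: "hann (v + w) \<rho> \<in> ext_power_hor (j + 1)"
      using hann_ext_power_hor[OF \<rho>(1), of "v + w"] by (simp add: add.commute)
    have "lefs_adj (hann (v + w) \<rho> - \<kappa>) = 0"
      using \<sigma>(2) \<rho>(2) b(2)[OF w] by (simp add: \<kappa>_def lefs_adj_simps hann_add_vec)
    moreover have "hann (v + w) \<rho> - \<kappa> \<in> ext_power_hor (j + 1)"
      using \<rho>h \<kappa>h by (rule subspace_diff[OF subspace_ext_power_hor])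
    ultimately have "hann (v + w) \<rho> - \<kappa> = 0"
      using j lefs_adj_eq_0D[of "hann (v + w) \<rho> - \<kappa>" "j + 1"] by simp
    then have "hann (v + w) \<kappa> = 0"
      using hann_hann[of "v + w" \<rho>] by simp
    with \<kappa>v show ?thesis
      by (simp add: hann_add_vec)
  qed
  obtain e where e: "e \<in> ext_power_hor (j + 1 + int (length (v # ws)))" "\<kappa> = hanns (v # ws) e"
    using hanns_divisible[OF ws _ \<kappa>h] \<kappa>v \<kappa>w by auto
  \<comment> \<open>With this choice \<open>hann v \<tau> = \<kappa>\<close>, so subtracting
    \<open>lefs_adj \<tau>\<close> removes \<open>hann v b\<close>, while the contractions along
    \<open>ws\<close> still vanish.\<close>
  define \<tau> where "\<tau> = hanns ws e"
  have \<tau>: "\<tau> \<in> ext_power_hor (j + 2)"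
    using hanns_ext_power_hor[OF e(1), of ws] by (simp add: \<tau>_def add.commute)
  have "b - lefs_adj \<tau> \<in> ext_power_hor j"
    using b(1) lefs_adj_ext_power_hor[OF \<tau>] by (intro subspace_diff[OF subspace_ext_power_hor]) auto
  moreover have "hann v (b - lefs_adj \<tau>) = 0"
    using \<sigma>(2) e(2) by (simp add: hann_simps hann_lefs_adj \<kappa>_def \<tau>_def)
  moreover have "hann w (b - lefs_adj \<tau>) = 0" if "w \<in> set ws" for w
    using b(2)[OF that] hann_hanns_eq_0[OF that, of e] by (simp add: hann_simps hann_lefs_adj \<tau>_def lefs_adj_simps)
  ultimately obtain c where c: "c \<in> ext_power_hor (j + int (length (v # ws)))" "b - lefs_adj \<tau> = hanns (v # ws) c"
    using hanns_divisible[OF ws, of "b - lefs_adj \<tau>" j] by auto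
  then have "c \<in> ext_power_hor (j + 1 + int (length ws))"
    by (simp add: ac_simps)
  moreover have "b = lefs_adj \<tau> + hanns (v # ws) c"
    using c(2) by (metis add.commute diff_add_cancel)
  ultimately show ?thesis
    using \<tau> by blast
qed

text \<open>The vectors are treated one at a time. What has been found is subtracted as
  \<open>lefs_adj \<sigma>\<close>, which preserves the hypothesis because contractions commute with
  \<open>lefs_adj\<close>. The hypothesis covers a whole subspace since the single step uses it at
  the sums \<open>v + w\<close>.\<close>

lemma Koszul_lefschetz:
  fixes b :: "'n::{finite,linorder} ext"
  assumes j: "int CARD('n) \<le> j" and A: "subspace A"
    and b: "b \<in> ext_power_hor j"
    and ex: "\<And>w. w \<in> A \<Longrightarrow> \<exists>\<sigma>\<in>ext_power_hor (j + 2). hann w b = lefs_adj (hann w \<sigma>)"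
    and "orthonormal_list vs" "set vs \<subseteq> A"
  shows "\<exists>\<sigma>\<in>ext_power_hor (j + 2). \<exists>c\<in>ext_power_hor (j + int (length vs)). b = lefs_adj \<sigma> + hanns vs c"
  using assms(5,6)
proof (induction vs)
  case Nil
  then show ?case
    using b by (intro bexI[of _ 0] bexI[of _ b]) (auto simp: lefs_adj_simps subspace_0[OF subspace_ext_power_hor])
next
  case (Cons v vs)
  then obtain \<sigma> c where \<sigma>: "\<sigma> \<in> ext_power_hor (j + 2)" and c: "b = lefs_adj \<sigma> + hanns vs c"
    by (auto simp: orthonormal_list_Cons)
  define b' where "b' = b - lefs_adj \<sigma>"
  have b': "b' \<in> ext_power_hor j"
    unfolding b'_def using b lefs_adj_ext_power_hor[OF \<sigma>] by (intro subspace_diff[OF subspace_ext_power_hor]) auto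
  have "hann w b' = 0" if "w \<in> set vs" for w
    using hann_hanns_eq_0[OF that, of c] c by (simp add: b'_def)
  moreover have "\<exists>\<rho>\<in>ext_power_hor (j + 2). hann (v + w) b' = lefs_adj (hann (v + w) \<rho>)"
    if "w \<in> insert 0 (set vs)" for w
  proof -
    have "v + w \<in> A"
      using that Cons.prems(2) A by (auto intro: subspace_add)
    then obtain \<rho> where \<rho>: "\<rho> \<in> ext_power_hor (j + 2)" "hann (v + w) b = lefs_adj (hann (v + w) \<rho>)"
      using ex by blast
    have "\<rho> - \<sigma> \<in> ext_power_hor (j + 2)"
      using \<rho>(1) \<sigma> by (rule subspace_diff[OF subspace_ext_power_hor])
    moreover have "hann (v + w) b' = lefs_adj (hann (v + w) (\<rho> - \<sigma>))"
      using \<rho>(2) by (simp add: b'_def hann_simps lefs_adj_simps hann_lefs_adj)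
    ultimately show ?thesis by blast
  qed
  ultimately obtain \<rho> e where \<rho>: "\<rho> \<in> ext_power_hor (j + 2)" and
    e: "e \<in> ext_power_hor (j + 1 + int (length vs))" "b' = lefs_adj \<rho> + hanns (v # vs) e"
    using Koszul_lefschetz_step[OF j Cons.prems(1) b'] by blast
  have "b = lefs_adj (\<sigma> + \<rho>) + hanns (v # vs) e"
    using e(2) by (simp add: b'_def lefs_adj_simps algebra_simps)
  moreover have "\<sigma> + \<rho> \<in> ext_power_hor (j + 2)"
    using \<sigma> \<rho> by (rule subspace_add[OF subspace_ext_power_hor])
  moreover have "e \<in> ext_power_hor (j + int (length (v # vs)))"
    using e(1) by (simp add: ac_simps)
  ultimately show ?case by blast
qed

text \<open>With a full orthonormal basis of \<open>A\<close>, the remainder is a multiple of the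
  volume form contracted along \<open>A\<close>, which is up to a factor the product of an
  orthonormal basis of the complement. The term in the range of \<open>lefs_adj\<close> pairs to
  zero with the kernel of \<open>lefschetz\<close>.\<close>

lemma primitive_pairing_multiple:
  fixes b :: "'n::{finite,linorder} ext"
  assumes k: "k \<le> CARD('n)" and A: "subspace A" "dim A = k"
    and b: "b \<in> ext_power_hor (2 * int CARD('n) - int k)"
    and ex: "\<And>w. w \<in> A \<Longrightarrow> \<exists>\<sigma>\<in>ext_power_hor (2 * int CARD('n) - int k + 2). hann w b = lefs_adj (hann w \<sigma>)"
    and vs: "orthonormal_list vs" "length vs = 2 * CARD('n) - k" "\<And>v w. v \<in> set vs \<Longrightarrow> w \<in> A \<Longrightarrow> v \<bullet> w = 0"
  obtains c where "\<And>\<mu>. lefschetz \<mu> = 0 \<Longrightarrow> b \<bullet> \<mu> = c * (hcres vs (ext_basis {}) \<bullet> \<mu>)"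
proof -
  obtain B where B: "B \<subseteq> A" "pairwise orthogonal B" "\<And>x. x \<in> B \<Longrightarrow> norm x = 1"
    "independent B" "card B = dim A" "span B = A"
    using orthonormal_basis_subspace[OF A(1)] by blast
  have "finite B"
    using B(4) independent_bound by blast
  then obtain ws where ws: "set ws = B" "distinct ws"
    using finite_distinct_list by blast
  then have len: "length ws = k"
    using B(5) A(2) distinct_card by metis
  have on: "orthonormal_list ws"
    using B(2,3) ws by (auto simp: orthonormal_list_def dot_square_norm)
  have "int CARD('n) \<le> 2 * int CARD('n) - int k"
    using k by simp
  then obtain \<sigma> c where \<sigma>: "b = lefs_adj \<sigma> + hanns ws c"
    "c \<in> ext_power_hor (2 * int CARD('n) - int k + int (length ws))"
    using Koszul_lefschetz[OF _ A(1) b ex on] ws(1) B(1) by blast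
  define top :: "'n ext" where "top = ext_basis (- {IT})"
  have c: "c = c $ (- {IT}) *\<^sub>R top"
    using ext_power_hor_top[of c] \<sigma>(2) len by (simp add: top_def)
  have toph: "top \<in> ext_power_hor (2 * int CARD('n))"
    using card_Compl_IT[where 'n = 'n] by (auto simp: top_def ext_power_hor_iff ext_basis_def axis_def split: if_splits)
  have z: "hanns ws top \<in> ext_power_hor (2 * int CARD('n) - int k)"
    using hanns_ext_power_hor[OF toph, of ws] len by simp
  \<comment> \<open>Exterior multiplication by the complementary vectors annihilates the contracted
    volume form, so this form is divisible by their product; counting degrees leaves a scalar
    \<open>e\<close>.\<close>
  have "hcre v (hanns ws top) = 0" if "v \<in> set vs" for v
    using vs(3)[OF that] ws(1) B(1) hcre_top[of v] by (intro hcre_hanns_orthogonal) (auto simp: top_def)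
  then obtain e where "e \<in> ext_power_hor (2 * int CARD('n) - int k - int (length vs))" "hanns ws top = hcres vs e"
    using hcres_divisible[OF vs(1) _ z] by blast
  moreover from this(1) have "e \<in> ext_power_hor 0"
    using vs(2) k by (simp add: of_nat_diff)
  ultimately have e: "hanns ws top = (e $ {}) *\<^sub>R hcres vs (ext_basis {})"
    using ext_power_hor_0[of e] linear_cmul[OF linear_hcres[of vs], of "e $ {}" "ext_basis {}"] by simp
  have "b \<bullet> \<mu> = (c $ (- {IT}) * e $ {}) * (hcres vs (ext_basis {}) \<bullet> \<mu>)" if "lefschetz \<mu> = 0" for \<mu>
  proof -
    have "hanns ws c = (c $ (- {IT}) * e $ {}) *\<^sub>R hcres vs (ext_basis {})"
      using linear_cmul[OF linear_hanns[of ws], of "c $ (- {IT})" top] c e by simp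
    moreover have "lefs_adj \<sigma> \<bullet> \<mu> = 0"
      by (simp add: lefs_adjoint that)
    ultimately show ?thesis
      by (simp add: \<sigma>(1) inner_add_left)
  qed
  then show ?thesis
    by (rule that)
qed

section \<open>Smooth functions\<close>

lemma Ck_SucD: "Ck (Suc k) f \<Longrightarrow> (f has_derivative frechet_derivative f (at x)) (at x)"
  by (simp add: frechet_derivative_works)

lemma Ck_SucI:
  assumes "\<And>x. (f has_derivative f' x) (at x)" "\<And>v. Ck k (\<lambda>x. f' x v)"
  shows "Ck (Suc k) f"
proof -
  have "frechet_derivative f (at x) = f' x" for x
    using frechet_derivative_at[OF assms(1)] by simp
  with assms show ?thesis
    by (auto simp: differentiable_def)
qed

lemma Ck_Suc_imp: "Ck (Suc k) f \<Longrightarrow> Ck k f"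
proof (induction k arbitrary: f)
  case 0
  then show ?case
    by (auto intro!: differentiable_imp_continuous_on simp: differentiable_on_def)
next
  case (Suc k)
  from Suc.prems have "\<forall>x. f differentiable (at x)"
    "\<forall>v. Ck (Suc k) (\<lambda>x. frechet_derivative f (at x) v)"
    unfolding Ck.simps(2)[of "Suc k"] by auto
  with Suc.IH show ?case
    unfolding Ck.simps(2)[of k f] by blast
qed

lemma Ck_continuous_on: "Ck k f \<Longrightarrow> continuous_on A f"
proof (induction k)
  case 0
  then show ?case by (auto intro: continuous_on_subset)
qed (use Ck_Suc_imp in blast)

lemma Ck_bounded_linear_compose:
  assumes l: "bounded_linear l"
  shows "Ck k f \<Longrightarrow> Ck k (\<lambda>x. l (f x))"
proof (induction k arbitrary: f)
  case 0
  then show ?case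
    using bounded_linear.continuous_on[OF l] by auto
next
  case (Suc k)
  show ?case
  proof (rule Ck_SucI)
    show "((\<lambda>x. l (f x)) has_derivative (\<lambda>v. l (frechet_derivative f (at x) v))) (at x)" for x
      by (rule bounded_linear.has_derivative[OF l Ck_SucD[OF Suc.prems]])
    show "Ck k (\<lambda>x. l (frechet_derivative f (at x) v))" for v
      using Suc.prems by (intro Suc.IH) simp
  qed
qed

lemma Ck_const: "Ck k (\<lambda>x. c)"
proof (induction k arbitrary: c)
  case (Suc k)
  then show ?case
    by (intro Ck_SucI[where f' = "\<lambda>x v. 0"]) auto
qed simp

lemma Ck_bounded_linear: "bounded_linear l \<Longrightarrow> Ck k l"
proof (cases k)
  case (Suc j)
  assume "bounded_linear l"
  then show ?thesis
    unfolding Suc by (intro Ck_SucI[where f' = "\<lambda>x. l"] Ck_const) (rule bounded_linear_imp_has_derivative)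
qed (simp add: linear_continuous_on)

lemma Ck_add: "Ck k f \<Longrightarrow> Ck k g \<Longrightarrow> Ck k (\<lambda>x. f x + g x)"
proof (induction k arbitrary: f g)
  case (Suc k)
  show ?case
  proof (rule Ck_SucI)
    show "((\<lambda>x. f x + g x) has_derivative (\<lambda>v. frechet_derivative f (at x) v + frechet_derivative g (at x) v)) (at x)" for x
      by (intro has_derivative_add Ck_SucD[OF Suc.prems(1)] Ck_SucD[OF Suc.prems(2)])
    show "Ck k (\<lambda>x. frechet_derivative f (at x) v + frechet_derivative g (at x) v)" for v
      using Suc.prems by (intro Suc.IH) simp_all
  qed
qed (auto intro: continuous_on_add)

lemma Ck_sum:
  assumes "\<And>i. i \<in> I \<Longrightarrow> Ck k (f i)"
  shows "Ck k (\<lambda>x. \<Sum>i\<in>I. f i x)"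
  using assms
proof (induction I rule: infinite_finite_induct)
  case (insert i I)
  then have "Ck k (\<lambda>x. f i x + (\<Sum>j\<in>I. f j x))"
    by (intro Ck_add) auto
  with insert show ?case by simp
qed (simp_all add: Ck_const)

lemma Ck_bilinear:
  assumes b: "bounded_bilinear b"
  shows "Ck k f \<Longrightarrow> Ck k g \<Longrightarrow> Ck k (\<lambda>x. b (f x) (g x))"
proof (induction k arbitrary: f g)
  case 0
  then show ?case
    using bounded_bilinear.continuous_on[OF b] by auto
next
  case (Suc k)
  show ?case
  proof (rule Ck_SucI)
    show "((\<lambda>x. b (f x) (g x)) has_derivative
        (\<lambda>v. b (f x) (frechet_derivative g (at x) v) + b (frechet_derivative f (at x) v) (g x))) (at x)" for x
      by (rule bounded_bilinear.FDERIV[OF b Ck_SucD[OF Suc.prems(1)] Ck_SucD[OF Suc.prems(2)]])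
    show "Ck k (\<lambda>x. b (f x) (frechet_derivative g (at x) v) + b (frechet_derivative f (at x) v) (g x))" for v
      using Suc.prems Ck_Suc_imp[OF Suc.prems(1)] Ck_Suc_imp[OF Suc.prems(2)]
      by (intro Ck_add Suc.IH) simp_all
  qed
qed

lemma Ck_compose:
  fixes f :: "'b::euclidean_space \<Rightarrow> 'c::real_normed_vector"
  shows "Ck k f \<Longrightarrow> Ck k g \<Longrightarrow> Ck k (\<lambda>x. f (g x))"
proof (induction k arbitrary: f g)
  case 0
  then show ?case
    by (auto intro: continuous_on_compose2)
next
  case (Suc k)
  show ?case
  proof (rule Ck_SucI)
    fix x
    have d: "(f has_derivative frechet_derivative f (at (g x))) (at (g x))"
      by (rule Ck_SucD[OF Suc.prems(1)])
    have l: "linear (frechet_derivative f (at (g x)))"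
      using has_derivative_linear[OF d] .
    \<comment> \<open>The basis expansion separates the point of differentiation from the direction:
      each summand is a product of functions to which the induction hypothesis applies.\<close>
    have eq: "frechet_derivative f (at (g x)) w = (\<Sum>b\<in>Basis. (w \<bullet> b) *\<^sub>R frechet_derivative f (at (g x)) b)" for w
      by (subst euclidean_representation[of w, symmetric]) (simp only: linear_sum[OF l] linear_cmul[OF l])
    show "((\<lambda>x. f (g x)) has_derivative
        (\<lambda>v. \<Sum>b\<in>Basis. (frechet_derivative g (at x) v \<bullet> b) *\<^sub>R frechet_derivative f (at (g x)) b)) (at x)"
      unfolding eq[symmetric] by (rule has_derivative_compose[OF Ck_SucD[OF Suc.prems(2), of x] d])
  next
    fix v
    have "Ck k (\<lambda>x. frechet_derivative g (at x) v)" "\<And>b. Ck k (\<lambda>x. frechet_derivative f (at x) b)" "Ck k g"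
      using Suc.prems(1) Suc.prems(2) Ck_Suc_imp[OF Suc.prems(2)] by simp_all
    then show "Ck k (\<lambda>x. \<Sum>b\<in>Basis. (frechet_derivative g (at x) v \<bullet> b) *\<^sub>R frechet_derivative f (at (g x)) b)"
      by (intro Ck_sum Ck_bilinear[OF bounded_bilinear_scaleR] Suc.IH
          Ck_bounded_linear_compose[OF bounded_linear_inner_left])
  qed
qed

lemma Ck_SucI_real:
  fixes f :: "real \<Rightarrow> real"
  assumes "\<And>x. (f has_real_derivative f' x) (at x)" "Ck k f'"
  shows "Ck (Suc k) f"
  using assms
  by (intro Ck_SucI[where f' = "\<lambda>x v. f' x * v"] Ck_bounded_linear_compose[OF bounded_linear_mult_left])
     (auto simp: has_field_derivative_def)

lemma Ck_inverse:
  fixes f :: "'a::real_normed_vector \<Rightarrow> real"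
  shows "Ck k f \<Longrightarrow> (\<And>x. f x \<noteq> 0) \<Longrightarrow> Ck k (\<lambda>x. inverse (f x))"
proof (induction k arbitrary: f)
  case 0
  then show ?case by (auto intro: continuous_on_inverse)
next
  case (Suc k)
  show ?case
  proof (rule Ck_SucI)
    show "((\<lambda>x. inverse (f x)) has_derivative
        (\<lambda>v. - (inverse (f x) * frechet_derivative f (at x) v * inverse (f x)))) (at x)" for x
      by (rule Deriv.has_derivative_inverse[OF Suc.prems(2) Ck_SucD[OF Suc.prems(1)]])
    fix v
    have "Ck k (\<lambda>x. frechet_derivative f (at x) v)" "Ck k (\<lambda>x. inverse (f x))"
      using Suc.prems Ck_Suc_imp by (auto intro: Suc.IH)
    then show "Ck k (\<lambda>x. - (inverse (f x) * frechet_derivative f (at x) v * inverse (f x)))"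
      by (intro Ck_bounded_linear_compose[OF bounded_linear_minus[OF bounded_linear_ident]]
          Ck_bilinear[OF bounded_bilinear_mult])
  qed
qed

lemma smooth_const: "smooth (\<lambda>x. c)"
  by (simp add: smooth_def Ck_const)

lemma smooth_bounded_linear: "bounded_linear l \<Longrightarrow> smooth l"
  by (simp add: smooth_def Ck_bounded_linear)

lemma smooth_bounded_linear_compose: "bounded_linear l \<Longrightarrow> smooth f \<Longrightarrow> smooth (\<lambda>x. l (f x))"
  by (simp add: smooth_def Ck_bounded_linear_compose)

lemma smooth_add: "smooth f \<Longrightarrow> smooth g \<Longrightarrow> smooth (\<lambda>x. f x + g x)"
  by (simp add: smooth_def Ck_add)

lemma smooth_sum: "(\<And>i. i \<in> I \<Longrightarrow> smooth (f i)) \<Longrightarrow> smooth (\<lambda>x. \<Sum>i\<in>I. f i x)"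
  by (simp add: smooth_def Ck_sum)

lemma smooth_minus: "smooth f \<Longrightarrow> smooth (\<lambda>x. - f x)"
  by (rule smooth_bounded_linear_compose[OF bounded_linear_minus[OF bounded_linear_ident]])

lemma smooth_diff: "smooth f \<Longrightarrow> smooth g \<Longrightarrow> smooth (\<lambda>x. f x - g x)"
  using smooth_add[of f "\<lambda>x. - g x"] smooth_minus[of g] by simp

lemma smooth_scaleR: "smooth f \<Longrightarrow> smooth g \<Longrightarrow> smooth (\<lambda>x. f x *\<^sub>R g x)"
  by (simp add: smooth_def Ck_bilinear[OF bounded_bilinear_scaleR])

lemma smooth_mult: "smooth f \<Longrightarrow> smooth g \<Longrightarrow> smooth (\<lambda>x. f x * g x :: 'a::real_normed_algebra)"
  by (simp add: smooth_def Ck_bilinear[OF bounded_bilinear_mult])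

lemma smooth_cmult: "smooth f \<Longrightarrow> smooth (\<lambda>x. c * f x :: 'a::real_normed_algebra)"
  by (rule smooth_mult[OF smooth_const])

lemma smooth_prod:
  fixes f :: "'i \<Rightarrow> 'a::real_normed_vector \<Rightarrow> real"
  assumes "\<And>i. i \<in> I \<Longrightarrow> smooth (f i)"
  shows "smooth (\<lambda>x. \<Prod>i\<in>I. f i x)"
  using assms
proof (induction I rule: infinite_finite_induct)
  case (insert i I)
  then have "smooth (\<lambda>x. f i x * (\<Prod>j\<in>I. f j x))"
    by (intro smooth_mult) auto
  with insert show ?case by simp
qed (simp_all add: smooth_const)

lemma smooth_compose:
  fixes f :: "'b::euclidean_space \<Rightarrow> 'c::real_normed_vector"
  shows "smooth f \<Longrightarrow> smooth g \<Longrightarrow> smooth (\<lambda>x. f (g x))"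
  by (simp add: smooth_def Ck_compose)

lemma smooth_inverse:
  fixes f :: "'a::real_normed_vector \<Rightarrow> real"
  shows "smooth f \<Longrightarrow> (\<And>x. f x \<noteq> 0) \<Longrightarrow> smooth (\<lambda>x. inverse (f x))"
  by (simp add: smooth_def Ck_inverse)

lemma smooth_has_derivative: "smooth f \<Longrightarrow> (f has_derivative frechet_derivative f (at x)) (at x)"
  unfolding smooth_def using Ck_SucD by blast

lemma smooth_differentiable: "smooth f \<Longrightarrow> f differentiable at x"
  using smooth_has_derivative by (auto simp: differentiable_def)

lemma smooth_continuous_on: "smooth f \<Longrightarrow> continuous_on A f"
  unfolding smooth_def using Ck_continuous_on by blast

lemma smooth_frechet_derivative: "smooth f \<Longrightarrow> smooth (\<lambda>x. frechet_derivative f (at x) v)"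
  unfolding smooth_def by (metis Ck.simps(2))

lemma smooth_compose_real_antiderivative:
  fixes f :: "real \<Rightarrow> real"
  assumes "\<And>x. (f has_real_derivative f' x) (at x)" "smooth f'"
  shows "smooth f"
proof -
  have "Ck (Suc k) f" for k
    using assms by (intro Ck_SucI_real) (auto simp: smooth_def)
  then show ?thesis
    unfolding smooth_def using Ck_Suc_imp by blast
qed

text \<open>One mean value theorem in each direction turns the second difference into a mixed
  derivative at a nearby point. The difference is symmetric in \<open>v\<close> and
  \<open>w\<close>, which yields the symmetry of second derivatives.\<close>

lemma mixed_difference_mean_value:
  fixes f :: "'a::real_normed_vector \<Rightarrow> real"
  assumes f: "Ck 2 f" and h: "0 < h"
  shows "\<exists>s t. 0 < s \<and> s < h \<and> 0 < t \<and> t < h \<and>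
    f (x + h *\<^sub>R v + h *\<^sub>R w) - f (x + h *\<^sub>R v) - f (x + h *\<^sub>R w) + f x =
    h * h * frechet_derivative (\<lambda>y. frechet_derivative f (at y) v) (at (x + s *\<^sub>R v + t *\<^sub>R w)) w"
proof -
  have C: "Ck (Suc 1) f" "Ck (Suc 0) (\<lambda>y. frechet_derivative f (at y) v)"
    using f by (simp_all add: numeral_2_eq_2)
  define D where "D y = frechet_derivative f (at y) v" for y
  have *: "((\<lambda>s. f (y + s *\<^sub>R v)) has_real_derivative D (y + s *\<^sub>R v)) (at s)" for y s
  proof -
    have "((\<lambda>s. f (y + s *\<^sub>R v)) has_derivative (\<lambda>h. frechet_derivative f (at (y + s *\<^sub>R v)) (h *\<^sub>R v))) (at s)"
      by (rule has_derivative_compose[OF _ Ck_SucD[OF C(1)]]) (auto intro!: derivative_eq_intros)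
    moreover have "frechet_derivative f (at (y + s *\<^sub>R v)) (h *\<^sub>R v) = D (y + s *\<^sub>R v) * h" for h
      using linear_cmul[OF has_derivative_linear[OF Ck_SucD[OF C(1)]]] by (simp add: D_def)
    ultimately show ?thesis
      by (simp add: has_field_derivative_def)
  qed
  have **: "((\<lambda>t. D (y + t *\<^sub>R w)) has_real_derivative frechet_derivative D (at (y + t *\<^sub>R w)) w) (at t)" for y t
  proof -
    have D: "(D has_derivative frechet_derivative D (at y)) (at y)" for y
      using Ck_SucD[OF C(2)] by (simp add: D_def[abs_def])
    have "((\<lambda>t. D (y + t *\<^sub>R w)) has_derivative (\<lambda>h. frechet_derivative D (at (y + t *\<^sub>R w)) (h *\<^sub>R w))) (at t)"
      by (rule has_derivative_compose[OF _ D]) (auto intro!: derivative_eq_intros)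
    moreover have "frechet_derivative D (at (y + t *\<^sub>R w)) (h *\<^sub>R w) = frechet_derivative D (at (y + t *\<^sub>R w)) w * h" for h
      using linear_cmul[OF has_derivative_linear[OF D]] by simp
    ultimately show ?thesis
      by (simp add: has_field_derivative_def)
  qed
  have "((\<lambda>s. f (x + h *\<^sub>R w + s *\<^sub>R v) - f (x + s *\<^sub>R v)) has_real_derivative
      D (x + h *\<^sub>R w + s *\<^sub>R v) - D (x + s *\<^sub>R v)) (at s)" for s
    by (intro DERIV_diff *)
  then obtain s where s: "0 < s" "s < h"
    "f (x + h *\<^sub>R w + h *\<^sub>R v) - f (x + h *\<^sub>R v) - (f (x + h *\<^sub>R w + 0 *\<^sub>R v) - f (x + 0 *\<^sub>R v)) =
      (h - 0) * (D (x + h *\<^sub>R w + s *\<^sub>R v) - D (x + s *\<^sub>R v))"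
    using MVT2[OF h, of "\<lambda>s. f (x + h *\<^sub>R w + s *\<^sub>R v) - f (x + s *\<^sub>R v)"
      "\<lambda>s. D (x + h *\<^sub>R w + s *\<^sub>R v) - D (x + s *\<^sub>R v)"] by blast
  obtain t where t: "0 < t" "t < h"
    "D (x + s *\<^sub>R v + h *\<^sub>R w) - D (x + s *\<^sub>R v + 0 *\<^sub>R w) = (h - 0) * frechet_derivative D (at (x + s *\<^sub>R v + t *\<^sub>R w)) w"
    using MVT2[OF h **[of "x + s *\<^sub>R v"]] by blast
  have "f (x + h *\<^sub>R v + h *\<^sub>R w) - f (x + h *\<^sub>R v) - f (x + h *\<^sub>R w) + f x =
      h * (D (x + s *\<^sub>R v + h *\<^sub>R w) - D (x + s *\<^sub>R v))"
    using s(3) by (simp add: algebra_simps)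
  also have "\<dots> = h * h * frechet_derivative D (at (x + s *\<^sub>R v + t *\<^sub>R w)) w"
    using t(3) by simp
  finally show ?thesis
    using s t unfolding D_def by blast
qed

lemma frechet_derivative_commute_real:
  fixes f :: "'a::real_normed_vector \<Rightarrow> real"
  assumes f: "Ck 2 f"
  shows "frechet_derivative (\<lambda>y. frechet_derivative f (at y) v) (at x) w =
    frechet_derivative (\<lambda>y. frechet_derivative f (at y) w) (at x) v"
proof -
  define A where "A y = frechet_derivative (\<lambda>y. frechet_derivative f (at y) v) (at y) w" for y
  define B where "B y = frechet_derivative (\<lambda>y. frechet_derivative f (at y) w) (at y) v" for y
  have "continuous_on UNIV A" "continuous_on UNIV B"
    using f by (simp_all add: A_def[abs_def] B_def[abs_def] numeral_2_eq_2)
  then have cont: "isCont A x" "isCont B x"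
    by (simp_all add: continuous_on_eq_continuous_at)
  show ?thesis
  proof (rule ccontr)
    assume "\<not> ?thesis"
    then have e: "0 < \<bar>A x - B x\<bar> / 2"
      by (simp add: A_def B_def)
    obtain r1 where r1: "0 < r1" "\<And>y. dist y x < r1 \<Longrightarrow> dist (A y) (A x) < \<bar>A x - B x\<bar> / 2"
      using cont(1) e unfolding continuous_at_eps_delta by blast
    obtain r2 where r2: "0 < r2" "\<And>y. dist y x < r2 \<Longrightarrow> dist (B y) (B x) < \<bar>A x - B x\<bar> / 2"
      using cont(2) e unfolding continuous_at_eps_delta by blast
    \<comment> \<open>The extra 1 keeps the denominator positive. With this \<open>h\<close> all
      intermediate points lie in both neighbourhoods, where the two mixed derivatives cannot
      coincide.\<close>
    define h where "h = min r1 r2 / (norm v + norm w + 1)"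
    have h: "0 < h"
      using r1(1) r2(1) by (auto simp: h_def intro!: divide_pos_pos add_nonneg_pos)
    have near: "dist (x + s *\<^sub>R a + t *\<^sub>R b) x < min r1 r2"
      if "0 < s" "s < h" "0 < t" "t < h" "norm a + norm b = norm v + norm w" for s t a b
    proof -
      have "dist (x + s *\<^sub>R a + t *\<^sub>R b) x \<le> s * norm a + t * norm b"
        using norm_triangle_ineq[of "s *\<^sub>R a" "t *\<^sub>R b"] that by (simp add: dist_norm add.assoc)
      also have "\<dots> \<le> h * norm a + h * norm b"
        using that by (intro add_mono mult_right_mono) auto
      also have "\<dots> = h * (norm v + norm w)"
        using that by (simp flip: distrib_left)
      also have "\<dots> < h * (norm v + norm w + 1)"
        using h by simp
      also have "\<dots> = min r1 r2"
      proof -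
        have "norm v + norm w + 1 > 0"
          by (intro add_nonneg_pos) auto
        then show ?thesis by (simp add: h_def)
      qed
      finally show ?thesis .
    qed
    obtain s t where st: "0 < s" "s < h" "0 < t" "t < h"
      "f (x + h *\<^sub>R v + h *\<^sub>R w) - f (x + h *\<^sub>R v) - f (x + h *\<^sub>R w) + f x = h * h * A (x + s *\<^sub>R v + t *\<^sub>R w)"
      using mixed_difference_mean_value[OF f h, of x v w] unfolding A_def by blast
    obtain s' t' where st': "0 < s'" "s' < h" "0 < t'" "t' < h"
      "f (x + h *\<^sub>R w + h *\<^sub>R v) - f (x + h *\<^sub>R w) - f (x + h *\<^sub>R v) + f x = h * h * B (x + s' *\<^sub>R w + t' *\<^sub>R v)"
      using mixed_difference_mean_value[OF f h, of x w v] unfolding B_def by blast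
    have "h * h * A (x + s *\<^sub>R v + t *\<^sub>R w) = h * h * B (x + s' *\<^sub>R w + t' *\<^sub>R v)"
      using st(5) st'(5) by (simp add: algebra_simps)
    then have "A (x + s *\<^sub>R v + t *\<^sub>R w) = B (x + s' *\<^sub>R w + t' *\<^sub>R v)"
      using h by simp
    moreover have "dist (A (x + s *\<^sub>R v + t *\<^sub>R w)) (A x) < \<bar>A x - B x\<bar> / 2"
      using near[OF st(1-4), of v w] by (intro r1) auto
    moreover have "dist (B (x + s' *\<^sub>R w + t' *\<^sub>R v)) (B x) < \<bar>A x - B x\<bar> / 2"
      using near[OF st'(1-4), of w v] by (intro r2) auto
    ultimately show False
      unfolding dist_real_def by argo
  qed
qed

lemma frechet_derivative_bounded_linear_compose:
  assumes "bounded_linear l" "f differentiable (at x)"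
  shows "frechet_derivative (\<lambda>x. l (f x)) (at x) v = l (frechet_derivative f (at x) v)"
proof -
  have "((\<lambda>x. l (f x)) has_derivative (\<lambda>v. l (frechet_derivative f (at x) v))) (at x)"
    using assms by (intro bounded_linear.has_derivative[OF assms(1)]) (simp add: frechet_derivative_works)
  from frechet_derivative_at[OF this] show ?thesis
    by metis
qed

lemma frechet_derivative_commute:
  fixes f :: "'a::real_normed_vector \<Rightarrow> 'b::euclidean_space"
  assumes f: "smooth f"
  shows "frechet_derivative (\<lambda>y. frechet_derivative f (at y) v) (at x) w =
    frechet_derivative (\<lambda>y. frechet_derivative f (at y) w) (at x) v"
proof (rule euclidean_eqI)
  fix b :: 'b
  have 1: "frechet_derivative (\<lambda>y. f y \<bullet> b) (at x) v = frechet_derivative f (at x) v \<bullet> b" for x v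
    by (rule frechet_derivative_bounded_linear_compose[OF bounded_linear_inner_left smooth_differentiable[OF f]])
  have 2: "frechet_derivative (\<lambda>y. frechet_derivative f (at y) v \<bullet> b) (at x) w =
      frechet_derivative (\<lambda>y. frechet_derivative f (at y) v) (at x) w \<bullet> b" for v w
    by (rule frechet_derivative_bounded_linear_compose[OF bounded_linear_inner_left
          smooth_differentiable[OF smooth_frechet_derivative[OF f]]])
  have "smooth (\<lambda>y. f y \<bullet> b)"
    using f by (rule smooth_bounded_linear_compose[OF bounded_linear_inner_left])
  then have "Ck 2 (\<lambda>y. f y \<bullet> b)"
    by (simp add: smooth_def)
  from frechet_derivative_commute_real[OF this, of v x w]
  show "frechet_derivative (\<lambda>y. frechet_derivative f (at y) v) (at x) w \<bullet> b =
      frechet_derivative (\<lambda>y. frechet_derivative f (at y) w) (at x) v \<bullet> b"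
    by (simp add: 1 2)
qed

section \<open>Bump functions and smooth approximations of boxes\<close>

definition flat_exp :: "nat \<Rightarrow> real \<Rightarrow> real" where
  "flat_exp m x = (if 0 < x then inverse x ^ m * exp (- inverse x) else 0)"

lemma flat_exp_tendsto_0: "(flat_exp m \<longlongrightarrow> 0) (at 0)"
proof -
  have "(flat_exp m \<longlongrightarrow> 0) (at_left 0)"
    by (rule tendsto_eventually) (auto simp: flat_exp_def eventually_at intro!: exI[of _ 1])
  moreover have "((\<lambda>x. inverse x ^ m / exp (inverse x)) \<longlongrightarrow> 0) (at_right (0::real))"
    by (rule filterlim_compose[OF tendsto_power_div_exp_0 filterlim_inverse_at_top_right])
  then have "(flat_exp m \<longlongrightarrow> 0) (at_right 0)"
    by (rule Lim_transform_eventually)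
       (auto simp: flat_exp_def eventually_at exp_minus field_simps intro!: exI[of _ 1])
  ultimately show ?thesis
    by (simp add: filterlim_split_at)
qed

text \<open>Powers of \<open>inverse x\<close> belong to the family so that it is closed under
  differentiation; smoothness is then an induction. At the origin the difference quotient is
  \<open>flat_exp (m + 1)\<close>, which tends to 0.\<close>

lemma DERIV_flat_exp: "(flat_exp m has_real_derivative flat_exp (m + 2) x - real m * flat_exp (m + 1) x) (at x)"
proof -
  consider "x < 0" | "x = 0" | "0 < x" by linarith
  then show ?thesis
  proof cases
    case 1
    have "((\<lambda>x. 0) has_real_derivative flat_exp (m + 2) x - real m * flat_exp (m + 1) x) (at x)"
      using 1 by (simp add: flat_exp_def)
    then show ?thesis
      by (rule has_field_derivative_transform_within_open[where S = "{..<0}"]) (use 1 in \<open>auto simp: flat_exp_def\<close>)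
  next
    case 2
    have "(\<lambda>h. (flat_exp m (0 + h) - flat_exp m 0) / h) = flat_exp (m + 1)"
      by (auto simp: flat_exp_def divide_inverse fun_eq_iff)
    then have "(flat_exp m has_real_derivative 0) (at 0)"
      unfolding DERIV_def using flat_exp_tendsto_0[of "m + 1"] by simp
    with 2 show ?thesis
      by (simp add: flat_exp_def)
  next
    case 3
    have "((\<lambda>x. inverse x ^ m * exp (- inverse x)) has_real_derivative
        real m * inverse x ^ (m - 1) * (- (inverse x ^ 2)) * exp (- inverse x) +
        inverse x ^ m * (inverse x ^ 2 * exp (- inverse x))) (at x)"
      using 3 by (auto intro!: derivative_eq_intros simp: power2_eq_square)
    also have "real m * inverse x ^ (m - 1) * (- (inverse x ^ 2)) * exp (- inverse x) +
        inverse x ^ m * (inverse x ^ 2 * exp (- inverse x)) = flat_exp (m + 2) x - real m * flat_exp (m + 1) x"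
      using 3 by (cases m) (auto simp: flat_exp_def power2_eq_square power_add algebra_simps)
    finally show ?thesis
      by (rule has_field_derivative_transform_within_open[where S = "{0<..}"]) (use 3 in \<open>auto simp: flat_exp_def\<close>)
  qed
qed

lemma Ck_flat_exp: "Ck k (flat_exp m)"
proof (induction k arbitrary: m)
  case 0
  have "isCont (flat_exp m) x" for x
    by (rule DERIV_isCont[OF DERIV_flat_exp])
  then show ?case
    by (simp add: continuous_at_imp_continuous_on)
next
  case (Suc k)
  have "Ck k (\<lambda>x. flat_exp (m + 2) x - real m * flat_exp (m + 1) x)"
    using Ck_add[OF Suc Ck_bounded_linear_compose[OF bounded_linear_mult_right Suc]]
    by (metis (no_types, lifting) ext minus_mult_left diff_conv_add_uminus)
  then show ?case
    by (rule Ck_SucI_real[OF DERIV_flat_exp])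
qed

lemma smooth_flat_exp: "smooth (flat_exp m)"
  by (simp add: smooth_def Ck_flat_exp)

text \<open>Positive exactly on the open box. Boxes are preferred to balls because they are stable
  under intersection and generate the Borel sets.\<close>

definition bump :: "'a::euclidean_space \<Rightarrow> 'a \<Rightarrow> 'a \<Rightarrow> real" where
  "bump a b p = (\<Prod>i\<in>Basis. flat_exp 0 (p \<bullet> i - a \<bullet> i) * flat_exp 0 (b \<bullet> i - p \<bullet> i))"

lemma flat_exp_nonneg: "0 \<le> flat_exp m x"
  by (simp add: flat_exp_def)

lemma flat_exp_pos_iff: "0 < flat_exp 0 x \<longleftrightarrow> 0 < x"
  by (simp add: flat_exp_def)

lemma bump_nonneg: "0 \<le> bump a b p"
  by (simp add: bump_def prod_nonneg flat_exp_nonneg)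

lemma bump_pos_iff: "0 < bump a b p \<longleftrightarrow> p \<in> box a b"
proof
  assume *: "p \<in> box a b"
  then show "0 < bump a b p"
    unfolding bump_def by (intro prod_pos) (auto simp: flat_exp_pos_iff mem_box)
next
  assume *: "0 < bump a b p"
  show "p \<in> box a b"
    unfolding mem_box
  proof
    fix i :: 'a assume i: "i \<in> Basis"
    have "flat_exp 0 (p \<bullet> i - a \<bullet> i) * flat_exp 0 (b \<bullet> i - p \<bullet> i) \<noteq> 0"
    proof
      assume "flat_exp 0 (p \<bullet> i - a \<bullet> i) * flat_exp 0 (b \<bullet> i - p \<bullet> i) = 0"
      with i have "bump a b p = 0"
        unfolding bump_def by (intro prod_zero) auto
      with * show False by simp
    qed
    then show "a \<bullet> i < p \<bullet> i \<and> p \<bullet> i < b \<bullet> i"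
      by (auto simp: flat_exp_def split: if_splits)
  qed
qed

lemma bump_eq_0: "p \<notin> box a b \<Longrightarrow> bump a b p = 0"
  using bump_nonneg[of a b p] bump_pos_iff[of a b p] by linarith

lemma smooth_bump: "smooth (bump a b)"
proof -
  have "smooth (\<lambda>p. p \<bullet> i)" for i :: 'a
    by (intro smooth_bounded_linear bounded_linear_inner_left)
  then show ?thesis
    unfolding bump_def[abs_def]
    by (intro smooth_prod smooth_mult smooth_compose[OF smooth_flat_exp] smooth_diff smooth_const)
qed

text \<open>Smooth approximations of the indicator of the open box: the inverse tends to 0 where
  \<open>bump\<close> is positive and equals 1 elsewhere.\<close>

definition bump_step :: "'a::euclidean_space \<Rightarrow> 'a \<Rightarrow> nat \<Rightarrow> 'a \<Rightarrow> real" where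
  "bump_step a b \<nu> p = 1 - inverse (1 + real \<nu> * bump a b p)"

lemma bump_denominator: "0 < 1 + real \<nu> * bump a b p"
  using bump_nonneg[of a b p] by (intro add_pos_nonneg) auto

lemma smooth_bump_step: "smooth (bump_step a b \<nu>)"
  unfolding bump_step_def[abs_def]
  by (intro smooth_diff smooth_const smooth_inverse smooth_add smooth_cmult smooth_bump)
     (metis bump_denominator less_irrefl)

lemma bump_step_bounds: "0 \<le> bump_step a b \<nu> p" "bump_step a b \<nu> p \<le> 1"
proof -
  have "1 \<le> 1 + real \<nu> * bump a b p"
    using bump_nonneg[of a b p] by simp
  then have "inverse (1 + real \<nu> * bump a b p) \<le> 1" "0 \<le> inverse (1 + real \<nu> * bump a b p)"
    by (auto simp: inverse_le_1_iff)
  then show "0 \<le> bump_step a b \<nu> p" "bump_step a b \<nu> p \<le> 1"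
    by (simp_all add: bump_step_def)
qed

lemma bump_step_eq_0: "p \<notin> box a b \<Longrightarrow> bump_step a b \<nu> p = 0"
  by (simp add: bump_step_def bump_eq_0)

lemma bump_step_tendsto: "(\<lambda>\<nu>. bump_step a b \<nu> p) \<longlonglongrightarrow> indicator (box a b) p"
proof (cases "p \<in> box a b")
  case True
  then have pos: "0 < bump a b p"
    by (simp add: bump_pos_iff)
  have "filterlim (\<lambda>\<nu>. 1 + real \<nu> * bump a b p) at_top sequentially"
    by (intro filterlim_tendsto_add_at_top[OF tendsto_const]
        filterlim_at_top_mult_tendsto_pos[OF tendsto_const pos] filterlim_real_sequentially)
  then have "(\<lambda>\<nu>. inverse (1 + real \<nu> * bump a b p)) \<longlonglongrightarrow> 0"
    by (rule tendsto_inverse_0_at_top)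
  then have "(\<lambda>\<nu>. 1 - inverse (1 + real \<nu> * bump a b p)) \<longlonglongrightarrow> 1 - 0"
    by (intro tendsto_diff tendsto_const)
  with True show ?thesis
    by (simp add: bump_step_def[abs_def])
next
  case False
  then show ?thesis
    by (simp add: bump_step_eq_0)
qed

text \<open>Only three properties of \<open>\<Psi>\<close> matter: linear growth, bounded first derivative, and a bounded
  second derivative that is \<open>1\<close> at the origin and vanishes at infinity.\<close>

definition Psi :: "real \<Rightarrow> real" where "Psi s = ln (1 + s\<^sup>2) / 2"
definition Psi1 :: "real \<Rightarrow> real" where "Psi1 s = s * inverse (1 + s\<^sup>2)"
definition Psi2 :: "real \<Rightarrow> real" where "Psi2 s = (1 - s\<^sup>2) * inverse (1 + s\<^sup>2) * inverse (1 + s\<^sup>2)"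

lemma one_plus_square_pos: "0 < 1 + (s::real)\<^sup>2"
  by (simp add: add_pos_nonneg)

lemma DERIV_Psi: "(Psi has_real_derivative Psi1 s) (at s)"
  unfolding Psi_def[abs_def] Psi1_def using one_plus_square_pos[of s]
  by (auto intro!: derivative_eq_intros simp: field_simps)

lemma DERIV_Psi1: "(Psi1 has_real_derivative Psi2 s) (at s)"
proof -
  have *: "1 + s\<^sup>2 \<noteq> 0" using one_plus_square_pos[of s] by linarith
  have "((\<lambda>s. s * inverse (1 + s\<^sup>2)) has_real_derivative
      inverse (1 + s\<^sup>2) + s * (- (inverse (1 + s\<^sup>2) * (2 * s) * inverse (1 + s\<^sup>2)))) (at s)"
    using * by (auto intro!: derivative_eq_intros simp: power2_eq_square)
  also have "inverse (1 + s\<^sup>2) + s * (- (inverse (1 + s\<^sup>2) * (2 * s) * inverse (1 + s\<^sup>2))) =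
      ((1 + s\<^sup>2) - 2 * s\<^sup>2) * inverse (1 + s\<^sup>2) * inverse (1 + s\<^sup>2)"
  proof -
    define I where "I = inverse (1 + s\<^sup>2)"
    have "(1 + s\<^sup>2) * I = 1"
      using * by (simp add: I_def)
    then show ?thesis
      unfolding I_def[symmetric] by algebra
  qed
  also have "\<dots> = Psi2 s"
    by (simp add: Psi2_def)
  finally show ?thesis
    by (simp add: Psi1_def[abs_def])
qed

lemma smooth_Psi2: "smooth Psi2"
proof -
  have id: "smooth (\<lambda>s::real. s)"
    by (rule smooth_bounded_linear[OF bounded_linear_ident])
  then have sq: "smooth (\<lambda>s::real. s\<^sup>2)"
    unfolding power2_eq_square by (intro smooth_mult)
  have inv: "smooth (\<lambda>s::real. inverse (1 + s\<^sup>2))"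
    by (intro smooth_inverse smooth_add smooth_const sq) (metis one_plus_square_pos less_irrefl)
  show ?thesis
    unfolding Psi2_def[abs_def] by (intro smooth_mult smooth_diff smooth_const sq inv)
qed

lemma smooth_Psi1: "smooth Psi1"
  by (rule smooth_compose_real_antiderivative[OF DERIV_Psi1 smooth_Psi2])

lemma smooth_Psi: "smooth Psi"
  by (rule smooth_compose_real_antiderivative[OF DERIV_Psi smooth_Psi1])

lemma Psi_bound: "\<bar>Psi s\<bar> \<le> \<bar>s\<bar>"
proof -
  have "ln (1 + s\<^sup>2) \<le> ln ((1 + \<bar>s\<bar>)\<^sup>2)"
    using one_plus_square_pos[of s] by (intro ln_mono) (auto simp: power2_sum)
  also have "\<dots> = 2 * ln (1 + \<bar>s\<bar>)"
    by (subst ln_realpow) auto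
  also have "\<dots> \<le> 2 * \<bar>s\<bar>"
    using ln_add_one_self_le_self[of "\<bar>s\<bar>"] by simp
  finally have "Psi s \<le> \<bar>s\<bar>"
    by (simp add: Psi_def)
  moreover have "0 \<le> Psi s"
    by (simp add: Psi_def)
  ultimately show ?thesis by simp
qed

lemma Psi1_bound: "\<bar>Psi1 s\<bar> \<le> 1"
proof -
  have "2 * \<bar>s\<bar> \<le> 1 + s\<^sup>2"
    using zero_le_power2[of "\<bar>s\<bar> - 1"] by (simp add: power2_diff)
  then have "\<bar>s\<bar> \<le> 1 + s\<^sup>2" by simp
  then show ?thesis
    using one_plus_square_pos[of s] by (simp add: Psi1_def abs_mult divide_inverse[symmetric] field_simps)
qed

text \<open>The decay at infinity makes the second derivatives of the test functions disappear off
  the level set.\<close>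

lemma Psi2_bound: "\<bar>Psi2 s\<bar> \<le> inverse (1 + s\<^sup>2)"
proof -
  have pos: "0 < 1 + s\<^sup>2" by (rule one_plus_square_pos)
  have "\<bar>1 - s\<^sup>2\<bar> \<le> 1 + s\<^sup>2" by (simp add: abs_le_iff)
  then have "\<bar>1 - s\<^sup>2\<bar> * inverse (1 + s\<^sup>2) \<le> 1"
    using pos by (simp add: divide_inverse[symmetric])
  then have "\<bar>1 - s\<^sup>2\<bar> * inverse (1 + s\<^sup>2) * inverse (1 + s\<^sup>2) \<le> 1 * inverse (1 + s\<^sup>2)"
    using pos by (intro mult_right_mono) auto
  then show ?thesis
    using pos by (simp add: Psi2_def abs_mult)
qed

lemma Psi2_bound_1: "\<bar>Psi2 s\<bar> \<le> 1"
proof -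
  have "inverse (1 + s\<^sup>2) \<le> 1"
    by (simp add: inverse_le_1_iff)
  with Psi2_bound[of s] show ?thesis by linarith
qed

lemma Psi2_0: "Psi2 0 = 1"
  by (simp add: Psi2_def)

section \<open>Calculus on the Heisenberg group\<close>

lemma hmul_eq: "hmul p q = (fst p + fst q, fst (snd p) + fst (snd q),
    snd (snd p) + snd (snd q) + (fst p \<bullet> fst (snd q)) / 2 - (fst q \<bullet> fst (snd p)) / 2)"
  by (cases p; cases q) simp

lemma hmul_assoc: "hmul (hmul p q) r = hmul p (hmul q r)"
  by (simp add: hmul_eq inner_add_left inner_add_right field_simps)

lemma hmul_0 [simp]: "hmul p 0 = p" "hmul 0 p = p"
  by (simp_all add: hmul_eq)

lemma hmul_uminus [simp]: "hmul p (- p) = 0" "hmul (- p) p = 0"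
  by (simp_all add: hmul_eq inner_commute zero_prod_def)

lemma hmul_uminus_cancel [simp]: "hmul p (hmul (- p) q) = q" "hmul (- p) (hmul p q) = q"
  by (simp_all flip: hmul_assoc)

lemma uminus_hmul: "- hmul p q = hmul (- q) (- p)"
  by (simp add: hmul_eq inner_commute)

lemma continuous_on_hmul [continuous_intros]:
  "continuous_on A f \<Longrightarrow> continuous_on A g \<Longrightarrow> continuous_on A (\<lambda>x. hmul (f x) (g x))"
  unfolding hmul_eq by (intro continuous_intros) auto

text \<open>A frame field differs from its value at the origin only in the vertical component, and
  there linearly in the point; this is that component.\<close>

fun frame_slope :: "'n::finite hidx \<Rightarrow> 'n heis \<Rightarrow> real" where
  "frame_slope (IX j) p = - (fst (snd p) $ j) / 2"
| "frame_slope (IY j) p = fst p $ j / 2"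
| "frame_slope IT p = 0"

lemma frame_eq: "frame i p = frame i 0 + frame_slope i p *\<^sub>R (0, 0, 1)"
  by (cases p; cases i) (auto simp: zero_prod_def)

lemma bounded_linear_frame_slope: "bounded_linear (frame_slope i)"
proof -
  have "linear (frame_slope i)"
    by (rule linearI; cases i) (auto simp: add_divide_distrib)
  then show ?thesis
    by (rule linear_conv_bounded_linear[THEN iffD1])
qed

definition fder :: "'n::finite hidx \<Rightarrow> ('n heis \<Rightarrow> 'b::real_normed_vector) \<Rightarrow> 'n heis \<Rightarrow> 'b" where
  "fder i g p = frechet_derivative g (at p) (frame i p)"

lemma fder_at: "(g has_derivative g') (at p) \<Longrightarrow> fder i g p = g' (frame i p)"
  unfolding fder_def using frechet_derivative_at by metis

lemma fder_eq:
  assumes "smooth g"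
  shows "fder i g p = frechet_derivative g (at p) (frame i 0) +
    frame_slope i p *\<^sub>R frechet_derivative g (at p) (0, 0, 1)"
proof -
  have l: "linear (frechet_derivative g (at p))"
    using smooth_has_derivative[OF assms] has_derivative_linear by blast
  show ?thesis
    unfolding fder_def by (subst frame_eq) (simp only: linear_add[OF l] linear_cmul[OF l])
qed

lemma smooth_frame_slope: "smooth (frame_slope i)"
  by (intro smooth_bounded_linear bounded_linear_frame_slope)

lemma smooth_fder:
  assumes "smooth g" shows "smooth (fder i g)"
proof -
  have "fder i g = (\<lambda>p. frechet_derivative g (at p) (frame i 0) +
      frame_slope i p *\<^sub>R frechet_derivative g (at p) (0, 0, 1))"
    using fder_eq[OF assms] by (intro ext)
  then show ?thesis
    using assms by (simp only:) (intro smooth_add smooth_scaleR smooth_frame_slope smooth_frechet_derivative)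
qed

lemma fder_add: "smooth f \<Longrightarrow> smooth g \<Longrightarrow> fder i (\<lambda>p. f p + g p) p = fder i f p + fder i g p"
  by (subst fder_at[OF has_derivative_add[OF smooth_has_derivative smooth_has_derivative]]) (auto simp: fder_def)

lemma fder_diff: "smooth f \<Longrightarrow> smooth g \<Longrightarrow> fder i (\<lambda>p. f p - g p) p = fder i f p - fder i g p"
  by (subst fder_at[OF has_derivative_diff[OF smooth_has_derivative smooth_has_derivative]]) (auto simp: fder_def)

lemma fder_bounded_linear: "bounded_linear l \<Longrightarrow> smooth f \<Longrightarrow> fder i (\<lambda>p. l (f p)) p = l (fder i f p)"
  by (subst fder_at[OF bounded_linear.has_derivative[OF _ smooth_has_derivative]]) (auto simp: fder_def)

lemma fder_mult:
  fixes f g :: "'n::finite heis \<Rightarrow> real"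
  shows "smooth f \<Longrightarrow> smooth g \<Longrightarrow> fder i (\<lambda>p. f p * g p) p = f p * fder i g p + fder i f p * g p"
  by (subst fder_at[OF has_derivative_mult[OF smooth_has_derivative smooth_has_derivative]]) (auto simp: fder_def)

lemma fder_compose:
  fixes f :: "'n::finite heis \<Rightarrow> real"
  assumes "smooth f" "(h has_real_derivative h') (at (f p))"
  shows "fder i (\<lambda>p. h (f p)) p = h' * fder i f p"
  by (subst fder_at[OF has_derivative_compose[OF smooth_has_derivative[OF assms(1)]
          has_field_derivative_imp_has_derivative[OF assms(2)]]]) (simp add: fder_def)

lemma frame_slope_frame: "frame_slope i (frame j p) = frame_slope i (frame j 0)"
  by (cases p; cases i; cases j) (auto simp: zero_prod_def)

text \<open>Second derivatives in fixed directions commute, so only the derivatives of the frame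
  coefficients survive, and these multiply \<open>T\<close>.\<close>

lemma fder_commutator:
  fixes g :: "'n::finite heis \<Rightarrow> 'b::euclidean_space"
  assumes g: "smooth g"
  shows "fder j (fder i g) p - fder i (fder j g) p =
    (frame_slope i (frame j 0) - frame_slope j (frame i 0)) *\<^sub>R fder IT g p"
proof -
  define D where "D v p = frechet_derivative g (at p) v" for v p
  define e where "e = (0::real^'n, 0::real^'n, 1::real)"
  have sD: "smooth (D v)" for v
    unfolding D_def[abs_def] by (rule smooth_frechet_derivative[OF g])
  have l: "linear (\<lambda>v. D v p)" for p
    unfolding D_def using smooth_has_derivative[OF g] has_derivative_linear by blast
  have eq: "fder i g = (\<lambda>p. D (frame i 0) p + frame_slope i p *\<^sub>R D e p)" for i
    using fder_eq[OF g] by (auto simp: D_def e_def)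
  have fDe: "fder j (D v) p = D' (frame j 0) v + frame_slope j p *\<^sub>R D' e v"
    if "D' = (\<lambda>w v. frechet_derivative (D v) (at p) w)" for j v p D'
    using fder_eq[OF sD] that by (simp add: e_def)
  have 2: "fder j (fder i g) p = fder j (D (frame i 0)) p +
      (frame_slope i p *\<^sub>R fder j (D e) p + frame_slope i (frame j 0) *\<^sub>R D e p)" for i j
  proof -
    have "((\<lambda>p. D (frame i 0) p + frame_slope i p *\<^sub>R D e p) has_derivative
        (\<lambda>w. frechet_derivative (D (frame i 0)) (at p) w +
          (frame_slope i p *\<^sub>R frechet_derivative (D e) (at p) w + frame_slope i w *\<^sub>R D e p))) (at p)"
      by (intro has_derivative_add has_derivative_scaleR smooth_has_derivative sD
          bounded_linear_imp_has_derivative bounded_linear_frame_slope)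
    from fder_at[OF this, of j] show ?thesis
      unfolding eq[of i] by (simp only: fder_def frame_slope_frame[of i j p])
  qed
  define D' where "D' w v = frechet_derivative (D v) (at p) w" for w v
  have comm: "D' w v = D' v w" for v w
    unfolding D'_def D_def by (rule frechet_derivative_commute[OF g])
  have "D' = (\<lambda>w v. frechet_derivative (D v) (at p) w)"
    by (simp add: D'_def[abs_def])
  note f = fDe[OF this]
  have T: "fder IT g p = D e p"
    by (cases p) (simp add: fder_def D_def e_def)
  show ?thesis
    unfolding 2 f T comm[of e "frame j 0"] comm[of e "frame i 0"] comm[of "frame i 0" "frame j 0"]
    by (simp add: algebra_simps)
qed

lemma fder_commutator_XY:
  fixes g :: "'n::finite heis \<Rightarrow> 'b::euclidean_space"
  assumes "smooth g"
  shows "fder (IX a) (fder (IX b) g) p = fder (IX b) (fder (IX a) g) p"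
    and "fder (IY a) (fder (IY b) g) p = fder (IY b) (fder (IY a) g) p"
    and "fder (IX a) (fder (IY b) g) p = fder (IY b) (fder (IX a) g) p + (if a = b then fder IT g p else 0)"
  using scaleR_left_distrib[of "1 / 2" "1 / 2" "fder IT g p"]
    fder_commutator[OF assms, of "IX a" "IX b" p] fder_commutator[OF assms, of "IY a" "IY b" p]
    fder_commutator[OF assms, of "IX a" "IY b" p]
  by (simp_all add: zero_prod_def axis_def algebra_simps split: if_splits)

section \<open>Left translations and the dual coframe\<close>

definition dtrans :: "'n::finite heis \<Rightarrow> 'n heis \<Rightarrow> 'n heis" where
  "dtrans q v = (fst v, fst (snd v), snd (snd v) + (fst q \<bullet> fst (snd v)) / 2 - (fst v \<bullet> fst (snd q)) / 2)"

lemma bounded_linear_dtrans: "bounded_linear (dtrans q)"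
proof -
  have "linear (dtrans q)"
    by (rule linearI) (auto simp: dtrans_def inner_add_left inner_add_right algebra_simps add_divide_distrib diff_divide_distrib)
  then show ?thesis
    by (rule linear_conv_bounded_linear[THEN iffD1])
qed

text \<open>Left translations are affine in these coordinates, so \<open>dtrans q\<close> is their
  differential at every point.\<close>

lemma hmul_eq_dtrans: "hmul q p = q + dtrans q p"
  by (cases q) (simp add: hmul_eq dtrans_def)

lemma has_derivative_hmul: "((\<lambda>p. hmul q p) has_derivative dtrans q) (at p)"
proof -
  have "((\<lambda>p. q + dtrans q p) has_derivative (\<lambda>v. 0 + dtrans q v)) (at p)"
    by (intro has_derivative_add has_derivative_const bounded_linear_imp_has_derivative bounded_linear_dtrans)
  then show ?thesis
    by (simp add: hmul_eq_dtrans)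
qed

text \<open>This is the left invariance of the frame.\<close>

lemma dtrans_frame: "dtrans q (frame i p) = frame i (hmul q p)"
  by (cases q; cases p; cases i) (auto simp: dtrans_def inner_axis inner_axis' algebra_simps add_divide_distrib)

text \<open>The coframe \<open>dx\<^sub>j\<close>, \<open>dy\<^sub>j\<close>, \<theta> at
  \<open>p\<close>, evaluated on the coordinate vector \<open>v\<close>.\<close>

fun frame_coef :: "'n::finite hidx \<Rightarrow> 'n heis \<Rightarrow> 'n heis \<Rightarrow> real" where
  "frame_coef (IX j) p v = fst v $ j"
| "frame_coef (IY j) p v = fst (snd v) $ j"
| "frame_coef IT p v = snd (snd v) + (fst (snd p) \<bullet> fst v) / 2 - (fst p \<bullet> fst (snd v)) / 2"

lemma fst_snd_sum: "fst (\<Sum>i\<in>I. f i) = (\<Sum>i\<in>I. fst (f i))" "snd (\<Sum>i\<in>I. f i) = (\<Sum>i\<in>I. snd (f i))"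
  by (induction I rule: infinite_finite_induct) auto

lemma sum_axis: "(\<Sum>j\<in>UNIV. c j *\<^sub>R axis j (1::real)) = (\<chi> j. c j)"
  by (simp add: vec_eq_iff axis_def if_distrib cong: if_cong)

lemma frame_expansion: "v = (\<Sum>i\<in>UNIV. frame_coef i p v *\<^sub>R frame i p)"
proof -
  obtain x y t where p: "p = (x, y, t)" by (cases p)
  obtain a b c where v: "v = (a, b, c)" by (cases v)
  have "(\<Sum>j\<in>UNIV. a $ j * (y $ j)) = a \<bullet> y" "(\<Sum>j\<in>UNIV. b $ j * x $ j) = b \<bullet> x"
    by (simp_all add: inner_vec_def)
  then show ?thesis
    unfolding p v sum_hidx
    by (simp add: prod_eq_iff fst_snd_sum sum_axis sum_negf inner_commute flip: sum_divide_distrib)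
qed

lemma smooth_frame_coef: "smooth (\<lambda>p. frame_coef i p v)"
proof (cases i)
  case IT
  have "smooth (\<lambda>p :: 'a heis. fst (snd p) \<bullet> fst v)" "smooth (\<lambda>p :: 'a heis. fst p \<bullet> fst (snd v))"
    by (intro smooth_bounded_linear_compose[OF bounded_linear_inner_left] smooth_bounded_linear
        bounded_linear_fst bounded_linear_compose[OF bounded_linear_fst bounded_linear_snd])+
  then show ?thesis
    unfolding IT frame_coef.simps divide_inverse
    by (intro smooth_add smooth_diff smooth_mult smooth_const)
qed (simp_all add: smooth_const)

section \<open>Invariance of Lebesgue measure\<close>

lemma nn_integral_lborel_prod:
  fixes f :: "'a::euclidean_space \<times> 'b::euclidean_space \<Rightarrow> ennreal"
  assumes "f \<in> borel_measurable borel"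
  shows "(\<integral>\<^sup>+ p. f p \<partial>lborel) = (\<integral>\<^sup>+ x. \<integral>\<^sup>+ y. f (x, y) \<partial>lborel \<partial>lborel)"
  using assms unfolding lborel_prod[symmetric]
  by (subst lborel.nn_integral_fst) (auto simp: lborel_prod)

lemma nn_integral_lborel_shift:
  fixes f :: "real \<Rightarrow> ennreal"
  assumes "f \<in> borel_measurable borel"
  shows "(\<integral>\<^sup>+ t. f (t + c) \<partial>lborel) = (\<integral>\<^sup>+ t. f t \<partial>lborel)"
  using nn_integral_distr[of "(+) c" lborel borel f] assms by (simp add: lborel_distr_plus add.commute)

lemma borel_measurable_Pair_section:
  fixes g :: "'b::euclidean_space \<times> 'c::euclidean_space \<Rightarrow> ennreal"
  assumes "g \<in> borel_measurable borel"
  shows "(\<lambda>y. g (x, y)) \<in> borel_measurable borel"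
  using assms by (intro measurable_compose[OF _ assms] borel_measurable_continuous_onI continuous_intros)

lemma nn_integral_heis:
  fixes f :: "'n::finite heis \<Rightarrow> ennreal"
  assumes f: "f \<in> borel_measurable borel"
  shows "(\<integral>\<^sup>+ q. f q \<partial>lborel) = (\<integral>\<^sup>+ x. \<integral>\<^sup>+ y. \<integral>\<^sup>+ t. f (x, y, t) \<partial>lborel \<partial>lborel \<partial>lborel)"
  unfolding nn_integral_lborel_prod[OF f]
  by (intro nn_integral_cong nn_integral_lborel_prod borel_measurable_Pair_section f)

text \<open>The linear part of right translation by \<open>u\<close>. It shifts the vertical
  coordinate by an amount depending on the others only, so it preserves Lebesgue measure by Fubini's
  theorem.\<close>

definition hshear :: "'n::finite heis \<Rightarrow> 'n heis \<Rightarrow> 'n heis" where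
  "hshear u q = (fst q, fst (snd q), snd (snd q) + (fst q \<bullet> fst (snd u)) / 2 - (fst u \<bullet> fst (snd q)) / 2)"

lemma borel_measurable_hshear: "hshear u \<in> borel_measurable borel"
  unfolding hshear_def[abs_def] by (intro borel_measurable_continuous_onI continuous_intros) auto

lemma distr_hshear:
  fixes u :: "'n::finite heis"
  shows "distr lborel borel (hshear u) = lborel"
proof (rule measure_eqI)
  fix A assume "A \<in> sets (distr lborel borel (hshear u))"
  then have A: "A \<in> sets borel" by simp
  define f where "f = (\<lambda>q. indicator A q :: ennreal)"
  have f: "f \<in> borel_measurable borel"
    using A by (simp add: f_def)
  have fs: "(\<lambda>q. f (hshear u q)) \<in> borel_measurable borel"
    using measurable_compose[OF borel_measurable_hshear f] .
  have "emeasure (distr lborel borel (hshear u)) A = (\<integral>\<^sup>+ q. f (hshear u q) \<partial>lborel)"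
  proof -
    have "emeasure (distr lborel borel (hshear u)) A = (\<integral>\<^sup>+ q. f q \<partial>distr lborel borel (hshear u))"
      using A by (simp add: f_def)
    also have "\<dots> = (\<integral>\<^sup>+ q. f (hshear u q) \<partial>lborel)"
      using borel_measurable_hshear[of u] f by (intro nn_integral_distr) auto
    finally show ?thesis .
  qed
  also have "\<dots> = (\<integral>\<^sup>+ x. \<integral>\<^sup>+ y. \<integral>\<^sup>+ t. f (hshear u (x, y, t)) \<partial>lborel \<partial>lborel \<partial>lborel)"
    by (rule nn_integral_heis[OF fs])
  also have "\<dots> = (\<integral>\<^sup>+ x. \<integral>\<^sup>+ y. \<integral>\<^sup>+ t. f (x, y, t) \<partial>lborel \<partial>lborel \<partial>lborel)"
  proof (rule nn_integral_cong, rule nn_integral_cong)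
    fix x y :: "real^'n"
    have "(\<lambda>t. f (x, y, t)) \<in> borel_measurable borel"
      by (intro borel_measurable_Pair_section f)
    from nn_integral_lborel_shift[OF this, of "(x \<bullet> fst (snd u)) / 2 - (fst u \<bullet> y) / 2"]
    show "(\<integral>\<^sup>+ t. f (hshear u (x, y, t)) \<partial>lborel) = (\<integral>\<^sup>+ t. f (x, y, t) \<partial>lborel)"
      by (simp add: hshear_def add_diff_eq)
  qed
  also have "\<dots> = (\<integral>\<^sup>+ q. f q \<partial>lborel)"
    by (rule nn_integral_heis[OF f, symmetric])
  also have "\<dots> = emeasure lborel A"
    using A by (simp add: f_def)
  finally show "emeasure (distr lborel borel (hshear u)) A = emeasure lborel A" .
qed simp

lemma distr_compose_lborel:
  assumes "distr lborel borel f = lborel" "distr lborel borel g = lborel"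
    "f \<in> borel_measurable borel" "g \<in> borel_measurable borel"
  shows "distr lborel borel (\<lambda>x. g (f x)) = lborel"
proof -
  have "distr lborel borel (g \<circ> f) = distr (distr lborel borel f) borel g"
    using assms(3,4) by (subst distr_distr) auto
  with assms show ?thesis
    by (simp add: o_def)
qed

lemma distr_hmul_right: "distr lborel borel (\<lambda>q. hmul q u) = lborel"
proof -
  have "(\<lambda>q. hmul q u) = (\<lambda>q. u + hshear u q)"
    by (auto simp: fun_eq_iff hmul_eq hshear_def prod_eq_iff)
  moreover have "distr lborel borel (\<lambda>q. u + hshear u q) = lborel"
    using borel_measurable_hshear[of u]
    by (intro distr_compose_lborel[OF distr_hshear lborel_distr_plus]) auto
  ultimately show ?thesis by simp
qed

text \<open>The map is a shear followed by a reflection and a translation. As a change of variables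
  it exchanges the two forms of a convolution.\<close>

lemma distr_hmul_uminus: "distr lborel borel (\<lambda>q. hmul (- q) p) = lborel"
proof -
  have eq: "(\<lambda>q. hmul (- q) p) = (\<lambda>q. p + (- 1) *\<^sub>R hshear p q)"
    by (auto simp: fun_eq_iff hmul_eq hshear_def prod_eq_iff inner_commute)
  have "distr lborel borel (\<lambda>x. p + (- 1) *\<^sub>R x) = lborel"
    by (subst (2) lborel_affine[of "- 1" p]) (simp_all add: density_1)
  then have "distr lborel borel (\<lambda>q. p + (- 1) *\<^sub>R hshear p q) = lborel"
    using borel_measurable_hshear[of p]
    by (intro distr_compose_lborel[OF distr_hshear]) (auto intro!: borel_measurable_continuous_onI continuous_intros)
  then show ?thesis
    by (simp only: eq)
qed

lemma integral_hmul_right: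
  fixes f :: "'n::finite heis \<Rightarrow> real"
  assumes "f \<in> borel_measurable borel"
  shows "(LINT q|lborel. f (hmul q u)) = (LINT q|lborel. f q)"
proof -
  have "(\<lambda>q. hmul q u) \<in> borel_measurable borel"
    by (intro borel_measurable_continuous_onI continuous_intros)
  then show ?thesis
    using integral_distr[of "\<lambda>q. hmul q u" lborel borel f] assms by (simp add: distr_hmul_right)
qed

lemma integral_hmul_uminus:
  fixes f :: "'n::finite heis \<Rightarrow> real"
  assumes "f \<in> borel_measurable borel"
  shows "(LINT q|lborel. f (hmul (- q) p)) = (LINT q|lborel. f q)"
proof -
  have "(\<lambda>q. hmul (- q) p) \<in> borel_measurable borel"
    by (intro borel_measurable_continuous_onI continuous_intros)
  then show ?thesis
    using integral_distr[of "\<lambda>q. hmul (- q) p" lborel borel f] assms by (simp add: distr_hmul_uminus)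
qed

lemma hdil_eq: "hdil r p = (r *\<^sub>R fst p, r *\<^sub>R fst (snd p), r\<^sup>2 * snd (snd p))"
  by (cases p) simp

lemma continuous_on_hdil: "continuous_on A (hdil r)"
  unfolding hdil_eq[abs_def] by (intro continuous_intros)

lemma hdil_Basis: "hdil r p = 0 + (\<Sum>j\<in>Basis. ((if j = (0, 0, 1) then r\<^sup>2 else r) * (p \<bullet> j)) *\<^sub>R j)"
proof (rule euclidean_eqI)
  fix b :: "'a heis" assume b: "b \<in> Basis"
  have "(0 + (\<Sum>j\<in>Basis. ((if j = (0, 0, 1) then r\<^sup>2 else r) * (p \<bullet> j)) *\<^sub>R j)) \<bullet> b =
      (if b = (0, 0, 1) then r\<^sup>2 else r) * (p \<bullet> b)"
    using b by (simp add: inner_sum_left inner_Basis if_distrib cong: if_cong)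
  moreover have "hdil r p \<bullet> b = (if b = (0, 0, 1) then r\<^sup>2 else r) * (p \<bullet> b)"
    using b by (auto simp: Basis_prod_def hdil_eq inner_prod_def zero_prod_def)
  ultimately show "hdil r p \<bullet> b = (0 + (\<Sum>j\<in>Basis. ((if j = (0, 0, 1) then r\<^sup>2 else r) * (p \<bullet> j)) *\<^sub>R j)) \<bullet> b"
    by simp
qed

text \<open>\<open>J\<close> is the Jacobian \<open>r ^ (2 * CARD('n) + 2)\<close>, whose exponent
  is the homogeneous dimension; rescaled mollifiers are normalised by it.\<close>

lemma integral_hdil:
  assumes r: "0 < r"
  obtains J where "0 < J" "\<And>f :: 'n::finite heis \<Rightarrow> real. f \<in> borel_measurable borel \<Longrightarrow>
    (LINT q|lborel. f q) = J * (LINT q|lborel. f (hdil r q))"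
proof
  define c where "c j = (if j = (0, 0, 1) then r\<^sup>2 else r)" for j :: "'n heis"
  define J where "J = (\<Prod>j\<in>Basis. \<bar>c j :: real\<bar>)"
  show "0 < J"
    unfolding J_def c_def using r by (intro prod_pos) auto
  fix f :: "'n heis \<Rightarrow> real" assume f: "f \<in> borel_measurable borel"
  have h: "hdil r = (\<lambda>x. 0 + (\<Sum>j\<in>Basis. (c j * (x \<bullet> j)) *\<^sub>R j))"
    by (rule ext) (simp only: hdil_Basis c_def)
  have "lborel = density (distr lborel borel (hdil r :: 'n heis \<Rightarrow> _)) (\<lambda>_. (\<Prod>j\<in>Basis. \<bar>c j\<bar>))"
    unfolding h by (rule lborel_affine_euclidean) (use r in \<open>auto simp: c_def\<close>)
  then have lb: "lborel = density (distr lborel borel (hdil r :: 'n heis \<Rightarrow> _)) (\<lambda>_. ennreal J)"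
    by (simp add: J_def prod_ennreal)
  have m: "hdil r \<in> borel_measurable (borel :: 'n heis measure)"
    by (intro borel_measurable_continuous_onI continuous_on_hdil)
  have "(LINT q|lborel. f q) = (LINT q|density (distr lborel borel (hdil r)) (\<lambda>_. ennreal J). f q)"
    using lb by simp
  also have "\<dots> = (LINT q|distr lborel borel (hdil r). J * f q)"
    using f \<open>0 < J\<close> by (subst integral_density) auto
  also have "\<dots> = J * (LINT q|lborel. f (hdil r q))"
    using f m by (subst integral_distr) auto
  finally show "(LINT q|lborel. f q) = J * (LINT q|lborel. f (hdil r q))" .
qed

section \<open>Strict differentiability along horizontal directions\<close>

text \<open>Bridges the Lebesgue integral over the whole space and the gauge integral over a box,
  where differentiation under the integral sign takes place.\<close>

lemma compact_support_integral:
  fixes g :: "'a::euclidean_space \<Rightarrow> real"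
  assumes g: "continuous_on UNIV g" and z: "\<And>z. z \<notin> cbox a b \<Longrightarrow> g z = 0"
  shows "integrable lborel g" and "integral (cbox a b) g = (LINT z|lborel. g z)"
proof -
  have "integrable lborel (\<lambda>z. indicator (cbox a b) z *\<^sub>R g z)"
    by (intro borel_integrable_compact compact_cbox continuous_on_subset[OF g]) auto
  moreover have eq: "(\<lambda>z. indicator (cbox a b) z *\<^sub>R g z) = g"
    using z by (auto simp: indicator_def fun_eq_iff)
  ultimately show i: "integrable lborel g" by simp
  have "(\<lambda>z. if z \<in> cbox a b then g z else 0) = g"
    using z by auto
  then show "integral (cbox a b) g = (LINT z|lborel. g z)"
    using integral_lborel[OF i] integral_restrict_UNIV[of "cbox a b" g] by simp
qed

lemma integrable_compact_support:
  fixes g :: "'a::euclidean_space \<Rightarrow> real"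
  assumes "continuous_on UNIV g" "compact K" "\<And>z. z \<notin> K \<Longrightarrow> g z = 0"
  shows "integrable lborel g"
proof -
  obtain a where a: "K \<subseteq> cbox (- a) a"
    using bounded_subset_cbox_symmetric[OF compact_imp_bounded[OF assms(2)]] by blast
  show ?thesis
    by (rule compact_support_integral(1)[OF assms(1), of "- a" a]) (use a assms(3) in blast)
qed

lemma closure_support:
  fixes g :: "'a::euclidean_space \<Rightarrow> 'b::real_normed_vector"
  assumes "compact K" "\<And>z. z \<notin> K \<Longrightarrow> g z = 0"
  shows "closure {p. g p \<noteq> 0} \<subseteq> K" and "compact (closure {p. g p \<noteq> 0})"
proof -
  have "{p. g p \<noteq> 0} \<subseteq> K"
    using assms(2) by blast
  then show "closure {p. g p \<noteq> 0} \<subseteq> K" "compact (closure {p. g p \<noteq> 0})"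
    using closure_minimal[OF _ compact_imp_closed[OF assms(1)]]
      bounded_subset[OF compact_imp_bounded[OF assms(1)]] by auto
qed

lemma bump_integral_pos:
  assumes "box a b \<noteq> {}"
  shows "0 < (LINT z|lborel. bump a b z)"
proof -
  have cont: "continuous_on UNIV (bump a b)"
    by (rule smooth_continuous_on[OF smooth_bump])
  have i: "integrable lborel (bump a b)"
    by (rule integrable_compact_support[OF cont compact_cbox[of a b]])
       (metis bump_eq_0 box_subset_cbox subsetD)
  have "(LINT z|lborel. bump a b z) \<noteq> 0"
  proof
    assume "(LINT z|lborel. bump a b z) = 0"
    then have "AE z in lborel. bump a b z = 0"
      using integral_nonneg_eq_0_iff_AE[OF i AE_I2[OF bump_nonneg]] by simp
    then have "AE z in lborel. z \<notin> box a b"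
      by eventually_elim (metis bump_pos_iff less_irrefl)
    then have "emeasure lborel (box a b) = 0"
      by (subst (asm) AE_iff_measurable[where N = "box a b"]) auto
    moreover have ab: "\<And>i. i \<in> Basis \<Longrightarrow> a \<bullet> i < b \<bullet> i"
      using assms by (auto simp: box_eq_empty not_le)
    from ab have "0 < (\<Prod>i\<in>Basis. (b - a) \<bullet> i)"
      by (intro prod_pos) (auto simp: inner_diff_left)
    ultimately show False
      using ab by (auto simp: emeasure_lborel_box_eq less_imp_le ennreal_eq_0_iff simp del: prod_zero_iff)
  qed
  moreover have "0 \<le> (LINT z|lborel. bump a b z)"
    by (simp add: bump_nonneg)
  ultimately show ?thesis by simp
qed

lemma frechet_derivative_eq_0_outside:
  assumes "closed S" "\<And>z. z \<notin> S \<Longrightarrow> g z = 0" "w \<notin> S"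
  shows "frechet_derivative g (at w) v = 0"
proof -
  have "(g has_derivative (\<lambda>v. 0)) (at w)"
    by (rule has_derivative_transform_within_open[of "\<lambda>_. 0" _ _ UNIV "- S"]) (use assms in auto)
  from frechet_derivative_at[OF this] show ?thesis by metis
qed

lemma continuous_on_frechet_derivative:
  fixes g :: "'a::euclidean_space \<Rightarrow> 'b::real_normed_vector"
  assumes g: "smooth g" and "continuous_on S a" "continuous_on S b"
  shows "continuous_on S (\<lambda>x. frechet_derivative g (at (a x)) (b x))"
proof -
  have eq: "frechet_derivative g (at p) v = (\<Sum>i\<in>Basis. (v \<bullet> i) *\<^sub>R frechet_derivative g (at p) i)" for p v
  proof -
    have l: "linear (frechet_derivative g (at p))"
      using smooth_has_derivative[OF g] has_derivative_linear by blast
    show ?thesis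
      by (subst euclidean_representation[of v, symmetric]) (simp only: linear_sum[OF l] linear_cmul[OF l])
  qed
  have cont: "continuous_on S (\<lambda>x. frechet_derivative g (at (a x)) i)" for i
    by (rule continuous_on_compose2[OF smooth_continuous_on[OF smooth_frechet_derivative[OF g]] assms(2)]) auto
  have "(\<lambda>x. frechet_derivative g (at (a x)) (b x)) =
      (\<lambda>x. \<Sum>i\<in>Basis. (b x \<bullet> i) *\<^sub>R frechet_derivative g (at (a x)) i)"
    by (intro ext eq)
  then show ?thesis
    by (simp only:) (intro continuous_intros assms(3) cont)
qed

section \<open>Horizontal flows\<close>

abbreviation hexp :: "'n::finite hvec \<Rightarrow> 'n heis" where
  "hexp u \<equiv> (fst u, snd u, 0)"

text \<open>The value at \<open>z\<close> of the left-invariant horizontal field with coefficients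
  \<open>u\<close>. It is constant along its own integral curves, which are therefore straight
  lines, traced out by right multiplication with \<open>hexp\<close>.\<close>

definition hfield :: "'n::finite hvec \<Rightarrow> 'n heis \<Rightarrow> 'n heis" where
  "hfield u z = (fst u, snd u, (fst z \<bullet> snd u) / 2 - (fst u \<bullet> fst (snd z)) / 2)"

lemma hmul_hexp: "hmul z (hexp (s *\<^sub>R u)) = z + s *\<^sub>R hfield u z"
  by (simp add: hmul_eq hfield_def prod_eq_iff right_diff_distrib)

lemma hmul_hexp_1: "hmul z (hexp u) = z + hfield u z"
  using hmul_hexp[of z 1 u] by simp

lemma hfield_flow [simp]: "hfield u (z + s *\<^sub>R hfield u z) = hfield u z" "hfield u (z - s *\<^sub>R hfield u z) = hfield u z"
  by (simp_all add: hfield_def inner_add_left inner_add_right inner_diff_left inner_diff_right field_simps)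

lemma hfield_uminus: "hfield (- u) z = - hfield u z"
  by (simp add: hfield_def)

lemma continuous_on_hfield: "continuous_on S (hfield u)"
  unfolding hfield_def[abs_def] by (intro continuous_intros) auto

lemma frame_coef_hfield: "frame_coef i z (hfield u z) = hcoef u i"
  by (cases i) (simp_all add: hfield_def inner_commute)

lemma hfield_frame: "hfield u z = (\<Sum>i\<in>UNIV. hcoef u i *\<^sub>R frame i z)"
  using frame_expansion[of "hfield u z" z] by (simp add: frame_coef_hfield)

lemma bounded_linear_hshear: "bounded_linear (hshear u)"
proof -
  have "linear (hshear u)"
    by (rule linearI) (auto simp: hshear_def inner_add_left inner_add_right algebra_simps add_divide_distrib diff_divide_distrib)
  then show ?thesis
    by (rule linear_conv_bounded_linear[THEN iffD1])
qed

lemma hmul_eq_hshear: "hmul z w = w + hshear w z"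
  by (simp add: hmul_eq hshear_def prod_eq_iff)

lemma has_derivative_hmul_right: "((\<lambda>z. hmul z w) has_derivative hshear w) (at z)"
proof -
  have "((\<lambda>z. w + hshear w z) has_derivative (\<lambda>v. 0 + hshear w v)) (at z)"
    by (intro has_derivative_add has_derivative_const bounded_linear_imp_has_derivative bounded_linear_hshear)
  then show ?thesis
    by (simp add: hmul_eq_hshear)
qed

lemma smooth_hmul_right: "smooth (\<lambda>z. hmul z w)"
  unfolding hmul_eq_hshear
  by (intro smooth_add smooth_const smooth_bounded_linear bounded_linear_hshear)

lemma continuous_on_flow: "continuous_on S (\<lambda>(z, s). z + s *\<^sub>R hfield u z)"
  unfolding split_beta
  by (intro continuous_intros continuous_on_compose2[OF continuous_on_hfield[of UNIV]]) auto

lemma isCont_tendsto_nhds: "isCont g q \<Longrightarrow> (g \<longlongrightarrow> g q) (nhds q)"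
  by (simp add: isCont_def tendsto_at_iff_tendsto_nhds)

text \<open>The proof transports a bump function along the flow of the left-invariant field \<open>u\<close>, which preserves
  Lebesgue measure; the derivative of the transported integral is controlled by the distributional gradient.\<close>

lemma distr_hgrad_increment_le:
  fixes f :: "'n::finite heis \<Rightarrow> real"
  assumes U: "open U" and f: "continuous_on U f" and G: "continuous_on U G"
    and d: "distr_hgrad U f G" and V: "open V" "V \<subseteq> U"
    and seg: "\<And>s. 0 \<le> s \<Longrightarrow> s \<le> 1 \<Longrightarrow> q + s *\<^sub>R hfield u q \<in> V"
    and b: "\<And>z. z \<in> V \<Longrightarrow> G z \<bullet> u \<le> \<beta>"
  shows "f (q + hfield u q) - f q \<le> \<beta>"
proof (rule ccontr)
  assume contr: "\<not> f (q + hfield u q) - f q \<le> \<beta>"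
  \<comment> \<open>A value strictly between \<open>\<beta>\<close> and the increment at
    \<open>q\<close>: near \<open>q\<close> all increments exceed it, while the flow argument bounds
    their average by \<open>\<beta>\<close>.\<close>
  define \<gamma> where "\<gamma> = (f (q + hfield u q) - f q + \<beta>) / 2"
  have \<gamma>: "\<beta> < \<gamma>" "\<gamma> < f (q + hfield u q) - f q"
    using contr by (simp_all add: \<gamma>_def field_simps)
  define \<Phi> where "\<Phi> = (\<lambda>(z, s). z + s *\<^sub>R hfield u z)"
  have \<Phi>c: "continuous_on S \<Phi>" for S
    unfolding \<Phi>_def by (rule continuous_on_flow)
  have segK: "compact ((\<lambda>s. q + s *\<^sub>R hfield u q) ` {0..1})"
    by (intro compact_continuous_image continuous_intros compact_Icc)
  have "(\<lambda>s. q + s *\<^sub>R hfield u q) ` {0..1} \<subseteq> V"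
    using seg by auto
  then obtain \<epsilon> where \<epsilon>: "0 < \<epsilon>" "(\<Union>x\<in>(\<lambda>s. q + s *\<^sub>R hfield u q) ` {0..1}. ball x \<epsilon>) \<subseteq> V"
    using compact_subset_open_imp_ball_epsilon_subset[OF segK V(1)] by metis
  have q0: "q \<in> U" and q1: "q + hfield u q \<in> U"
    using seg[of 0] seg[of 1] V(2) by auto
  have h: "continuous (at q) (hfield u)"
    using continuous_on_hfield[of UNIV u] continuous_on_eq_continuous_at[OF open_UNIV] by blast
  have "((\<lambda>z. f (z + hfield u z) - f z) \<longlongrightarrow> f (q + hfield u q) - f q) (nhds q)"
  proof -
    have "isCont f q" "isCont f (q + hfield u q)"
      using f q0 q1 continuous_on_eq_continuous_at[OF U, of f] by blast+
    moreover from this(2) have "isCont (\<lambda>z. f (z + hfield u z)) q"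
      using h by (intro isCont_o2[of q "\<lambda>z. z + hfield u z" f] continuous_intros)
    ultimately have "isCont (\<lambda>z. f (z + hfield u z) - f z) q"
      by (intro continuous_diff)
    then show ?thesis
      by (rule isCont_tendsto_nhds)
  qed
  from order_tendstoD(1)[OF this \<gamma>(2)] have 1: "\<forall>\<^sub>F z in nhds q. \<gamma> < f (z + hfield u z) - f z" .
  have "((\<lambda>z. norm (z - q) + norm (hfield u z - hfield u q)) \<longlongrightarrow> norm (q - q) + norm (hfield u q - hfield u q)) (nhds q)"
  proof -
    have "isCont (\<lambda>z. norm (z - q) + norm (hfield u z - hfield u q)) q"
      using h by (intro continuous_intros)
    then show ?thesis
      by (rule isCont_tendsto_nhds)
  qed
  from order_tendstoD(2)[OF this, of \<epsilon>] \<epsilon>(1)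
  have 2: "\<forall>\<^sub>F z in nhds q. norm (z - q) + norm (hfield u z - hfield u q) < \<epsilon>"
    by simp
  obtain W where W: "open W" "q \<in> W"
    "\<And>z. z \<in> W \<Longrightarrow> \<gamma> < f (z + hfield u z) - f z"
    "\<And>z. z \<in> W \<Longrightarrow> norm (z - q) + norm (hfield u z - hfield u q) < \<epsilon>"
    using eventually_conj[OF 1 2] unfolding eventually_nhds by blast
  obtain a b where ab: "cbox a b \<subseteq> W" "q \<in> box a b"
    using open_contains_cbox[OF W(1,2)] by metis
  \<comment> \<open>The region swept out by the box under the flow up to time 1. It contains the
    supports of all transported bumps and stays in \<open>V\<close>, where the bound on
    \<open>G\<close> holds.\<close>
  define K where "K = \<Phi> ` (cbox a b \<times> {0..1})"
  have K: "compact K"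
    unfolding K_def by (intro compact_continuous_image \<Phi>c compact_Times compact_cbox compact_Icc)
  have KV: "K \<subseteq> V"
  proof
    fix x assume "x \<in> K"
    then obtain z s where zs: "z \<in> cbox a b" "0 \<le> s" "s \<le> 1" "x = z + s *\<^sub>R hfield u z"
      by (auto simp: K_def \<Phi>_def)
    have "dist (q + s *\<^sub>R hfield u q) x = norm ((z - q) + s *\<^sub>R (hfield u z - hfield u q))"
      by (subst dist_commute) (simp add: zs dist_norm algebra_simps)
    also have "\<dots> \<le> norm (z - q) + s * norm (hfield u z - hfield u q)"
      using zs(2) by (intro order_trans[OF norm_triangle_ineq]) simp
    also have "\<dots> \<le> norm (z - q) + norm (hfield u z - hfield u q)"
      using zs(2,3) by (simp add: mult_left_le_one_le)
    also have "\<dots> < \<epsilon>"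
      using W(4) ab(1) zs(1) by blast
    finally have "x \<in> ball (q + s *\<^sub>R hfield u q) \<epsilon>"
      by simp
    then show "x \<in> V"
      using zs(2,3) by (intro subsetD[OF \<epsilon>(2)] UN_I[of "q + s *\<^sub>R hfield u q"] imageI) auto
  qed
  have KU: "K \<subseteq> U" using KV V(2) by blast
  have cK: "closed K" by (rule compact_imp_closed[OF K])
  \<comment> \<open>\<open>f\<close> and \<open>G\<close> are continuous only on \<open>U\<close>;
    global continuous extensions agreeing with them on \<open>K\<close> make every integrand
    continuous.\<close>
  obtain f' where f': "continuous_on UNIV f'" "\<And>x. x \<in> K \<Longrightarrow> f' x = f x"
    using Tietze_unbounded[OF continuous_on_subset[OF f KU], of UNIV] cK by auto
  obtain G' where G': "continuous_on UNIV G'" "\<And>x. x \<in> K \<Longrightarrow> G' x = G x"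
    using Tietze_unbounded[OF continuous_on_subset[OF G KU], of UNIV] cK by auto
  define \<phi> where "\<phi> = bump a b"
  have \<phi>: "smooth \<phi>" "\<And>z. 0 \<le> \<phi> z" "\<And>z. z \<notin> cbox a b \<Longrightarrow> \<phi> z = 0"
    using bump_eq_0 box_subset_cbox[of a b] by (auto simp: \<phi>_def smooth_bump bump_nonneg)
  define \<psi> where "\<psi> s z = \<phi> (z - s *\<^sub>R hfield u z)" for s z
  have \<psi>_eq: "\<psi> s = (\<lambda>z. \<phi> (hmul z (hexp ((- s) *\<^sub>R u))))" for s
    by (simp only: hmul_hexp \<psi>_def[abs_def]) simp
  have \<psi>s: "smooth (\<psi> s)" for s
    unfolding \<psi>_eq by (rule smooth_compose[OF \<phi>(1) smooth_hmul_right])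
  have outK: "z - s *\<^sub>R hfield u z \<notin> cbox a b" if "z \<notin> K" "0 \<le> s" "s \<le> 1" for z s
  proof
    assume *: "z - s *\<^sub>R hfield u z \<in> cbox a b"
    have "\<Phi> (z - s *\<^sub>R hfield u z, s) \<in> K"
      unfolding K_def using * that by (intro imageI) auto
    with that(1) show False
      by (simp add: \<Phi>_def)
  qed
  have \<psi>0: "\<psi> s z = 0" if "z \<notin> K" "0 \<le> s" "s \<le> 1" for z s
    unfolding \<psi>_def by (rule \<phi>(3)[OF outK[OF that]])
  have D\<psi>: "frechet_derivative (\<psi> s) (at z) (hfield u z) =
      frechet_derivative \<phi> (at (z - s *\<^sub>R hfield u z)) (hfield u z)" for s z
  proof -
    have "(\<psi> s has_derivative (\<lambda>v. frechet_derivative \<phi> (at (hmul z (hexp ((- s) *\<^sub>R u))))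
        (hshear (hexp ((- s) *\<^sub>R u)) v))) (at z)"
      unfolding \<psi>_eq by (rule has_derivative_compose[OF has_derivative_hmul_right smooth_has_derivative[OF \<phi>(1)]])
    moreover have "hmul z (hexp ((- s) *\<^sub>R u)) = z - s *\<^sub>R hfield u z"
      unfolding hmul_hexp by simp
    moreover have "hshear (hexp ((- s) *\<^sub>R u)) (hfield u z) = hfield u z"
      by (simp add: hshear_def hfield_def inner_commute)
    ultimately show ?thesis
      using frechet_derivative_at by metis
  qed
  have D\<psi>0: "frechet_derivative (\<psi> s) (at z) v = 0" if "z \<notin> K" "0 \<le> s" "s \<le> 1" for z s v
    by (rule frechet_derivative_eq_0_outside[OF cK]) (use \<psi>0 that in auto)
  obtain c where c: "K \<subseteq> cbox (- c) c"
    using bounded_subset_cbox_symmetric[OF compact_imp_bounded[OF K]] by blast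
  have \<psi>0c: "\<psi> s z = 0" if "z \<notin> cbox (- c) c" "0 \<le> s" "s \<le> 1" for z s
    using \<psi>0 that c by blast
  have D\<psi>0c: "frechet_derivative (\<psi> s) (at z) v = 0" if "z \<notin> cbox (- c) c" "0 \<le> s" "s \<le> 1" for z s v
    using D\<psi>0 that c by blast
  \<comment> \<open>The average of \<open>f\<close> against the bump transported by time
    \<open>s\<close>; up to normalisation, \<open>A 1 - A 0\<close> averages the increments of
    \<open>f\<close> along the flow.\<close>
  define A where "A s = integral (cbox (- c) c) (\<lambda>z. f' z * \<psi> s z)" for s
  define A' where "A' s = integral (cbox (- c) c) (\<lambda>z. f' z * - frechet_derivative \<phi> (at (z - s *\<^sub>R hfield u z)) (hfield u z))" for s
  have hc: "continuous_on S (\<lambda>x. hfield u (g x))" if "continuous_on S g" for S :: "'x::topological_space set" and g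
    by (rule continuous_on_compose2[OF continuous_on_hfield[of UNIV] that]) auto
  have f'c: "continuous_on S (\<lambda>x. f' (g x))" if "continuous_on S g" for S :: "'x::topological_space set" and g
    by (rule continuous_on_compose2[OF f'(1) that]) auto
  have A: "(A has_vector_derivative A' s) (at s within {0..1})" if "s \<in> {0..1}" for s
    unfolding A_def A'_def
  proof (rule leibniz_rule_vector_derivative[OF _ _ _ that])
    fix s z
    have "((\<lambda>s. z - s *\<^sub>R hfield u z) has_derivative (\<lambda>h. - (h *\<^sub>R hfield u z))) (at s within {0..1})"
      by (auto intro!: derivative_eq_intros)
    from has_derivative_compose[OF this smooth_has_derivative[OF \<phi>(1)]]
    have "((\<lambda>s. \<psi> s z) has_derivative
        (\<lambda>h. frechet_derivative \<phi> (at (z - s *\<^sub>R hfield u z)) (- (h *\<^sub>R hfield u z)))) (at s within {0..1})"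
      by (simp add: \<psi>_def)
    moreover have "frechet_derivative \<phi> (at w) (- (h *\<^sub>R v)) = h *\<^sub>R (- frechet_derivative \<phi> (at w) v)" for w h v
    proof -
      have "linear (frechet_derivative \<phi> (at w))"
        using smooth_has_derivative[OF \<phi>(1)] has_derivative_linear by blast
      then show ?thesis
        by (simp add: linear_neg linear_cmul)
    qed
    ultimately have "((\<lambda>s. \<psi> s z) has_vector_derivative - frechet_derivative \<phi> (at (z - s *\<^sub>R hfield u z)) (hfield u z))
        (at s within {0..1})"
      by (simp add: has_vector_derivative_def)
    then show "((\<lambda>s. f' z * \<psi> s z) has_vector_derivative f' z * - frechet_derivative \<phi> (at (z - s *\<^sub>R hfield u z)) (hfield u z))
        (at s within {0..1})"
      by (intro has_vector_derivative_mult_right)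
  next
    fix s
    show "(\<lambda>z. f' z * \<psi> s z) integrable_on cbox (- c) c"
      by (intro integrable_continuous continuous_intros f'c smooth_continuous_on[OF \<psi>s])
  next
    show "continuous_on ({0..1} \<times> cbox (- c) c) (\<lambda>(s, z). f' z * - frechet_derivative \<phi> (at (z - s *\<^sub>R hfield u z)) (hfield u z))"
      unfolding split_beta
      by (intro continuous_intros f'c hc continuous_on_frechet_derivative[OF \<phi>(1)])
  qed auto
  have A_eq: "A s = (LINT z|lborel. f' z * \<psi> s z)" if "0 \<le> s" "s \<le> 1" for s
    unfolding A_def using \<psi>0c that
    by (intro compact_support_integral(2) continuous_intros f'c smooth_continuous_on[OF \<psi>s]) auto
  have \<psi>i: "(LINT z|lborel. \<psi> s z) = (LINT z|lborel. \<phi> z)" for s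
    unfolding \<psi>_eq
    by (rule integral_hmul_right) (intro borel_measurable_continuous_onI smooth_continuous_on \<phi>(1))
  have int\<psi>: "integrable lborel (\<lambda>z. g z * \<psi> s z)" if "continuous_on UNIV g" "0 \<le> s" "s \<le> 1" for g s
    using \<psi>0 that by (intro integrable_compact_support[OF _ K] continuous_intros smooth_continuous_on[OF \<psi>s]) auto
  have A'_le: "A' s \<le> \<beta> * (LINT z|lborel. \<phi> z)" if s: "0 \<le> s" "s \<le> 1" for s
  proof -
    have cDf: "continuous_on UNIV (\<lambda>z. frechet_derivative (\<psi> s) (at z) (frame i z))" for i
      using smooth_continuous_on[OF smooth_fder[OF \<psi>s]] by (simp add: fder_def[abs_def])
    have intD: "integrable lborel (\<lambda>z. f' z * frechet_derivative (\<psi> s) (at z) (frame i z))" for i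
      using D\<psi>0 s by (intro integrable_compact_support[OF _ K] continuous_intros f'c cDf) auto
    have test: "smooth (\<psi> s) \<and> compact (closure {p. \<psi> s p \<noteq> 0}) \<and> closure {p. \<psi> s p \<noteq> 0} \<subseteq> U"
      using closure_support[OF K, of "\<psi> s"] \<psi>0[OF _ s] \<psi>s KU by blast
    have d': "(LINT z|lborel. f' z * frechet_derivative (\<psi> s) (at z) (frame (IX j) z)) = - (LINT z|lborel. fst (G' z) $ j * \<psi> s z)"
      "(LINT z|lborel. f' z * frechet_derivative (\<psi> s) (at z) (frame (IY j) z)) = - (LINT z|lborel. snd (G' z) $ j * \<psi> s z)" for j
    proof -
      have e1: "(LINT z|lborel. f' z * frechet_derivative (\<psi> s) (at z) (frame i z)) =
          (LINT z|lborel. f z * frechet_derivative (\<psi> s) (at z) (frame i z))" for i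
        using f'(2) D\<psi>0 s by (intro Bochner_Integration.integral_cong refl) (metis mult_zero_right)
      have e2: "(LINT z|lborel. fst (G' z) $ j * \<psi> s z) = (LINT z|lborel. fst (G z) $ j * \<psi> s z)"
        "(LINT z|lborel. snd (G' z) $ j * \<psi> s z) = (LINT z|lborel. snd (G z) $ j * \<psi> s z)"
        using G'(2) \<psi>0 s by (intro Bochner_Integration.integral_cong refl, metis mult_zero_right)+
      show "(LINT z|lborel. f' z * frechet_derivative (\<psi> s) (at z) (frame (IX j) z)) = - (LINT z|lborel. fst (G' z) $ j * \<psi> s z)"
        "(LINT z|lborel. f' z * frechet_derivative (\<psi> s) (at z) (frame (IY j) z)) = - (LINT z|lborel. snd (G' z) $ j * \<psi> s z)"
        using d[unfolded distr_hgrad_def, rule_format, OF test, of j] by (auto simp: e1 e2)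
    qed
    have "A' s = (LINT z|lborel. f' z * - frechet_derivative (\<psi> s) (at z) (hfield u z))"
      unfolding A'_def D\<psi>[symmetric] using D\<psi>0c s
      by (intro compact_support_integral(2) continuous_intros f'c hc continuous_on_frechet_derivative[OF \<psi>s]) auto
    also have "\<dots> = (LINT z|lborel. - (\<Sum>i\<in>UNIV. hcoef u i * (f' z * frechet_derivative (\<psi> s) (at z) (frame i z))))"
    proof -
      have "frechet_derivative (\<psi> s) (at z) (hfield u z) = (\<Sum>i\<in>UNIV. hcoef u i * frechet_derivative (\<psi> s) (at z) (frame i z))" for z
      proof -
        have "linear (frechet_derivative (\<psi> s) (at z))"
          using smooth_has_derivative[OF \<psi>s] has_derivative_linear by blast
        then show ?thesis
          unfolding hfield_frame by (simp add: linear_sum linear_cmul)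
      qed
      then show ?thesis
        by (simp add: sum_distrib_left mult.left_commute)
    qed
    also have "\<dots> = - (\<Sum>i\<in>UNIV. hcoef u i * (LINT z|lborel. f' z * frechet_derivative (\<psi> s) (at z) (frame i z)))"
      using intD by (simp add: Bochner_Integration.integral_sum)
    also have "\<dots> = (\<Sum>j\<in>UNIV. fst u $ j * (LINT z|lborel. fst (G' z) $ j * \<psi> s z)) +
        (\<Sum>j\<in>UNIV. snd u $ j * (LINT z|lborel. snd (G' z) $ j * \<psi> s z))"
      by (simp add: sum_hidx d' sum_negf)
    also have "\<dots> = (LINT z|lborel. (\<Sum>j\<in>UNIV. fst u $ j * (fst (G' z) $ j * \<psi> s z)) +
        (\<Sum>j\<in>UNIV. snd u $ j * (snd (G' z) $ j * \<psi> s z)))"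
    proof -
      have "integrable lborel (\<lambda>z. fst (G' z) $ j * \<psi> s z)" "integrable lborel (\<lambda>z. snd (G' z) $ j * \<psi> s z)" for j
        by (intro int\<psi> s continuous_intros G'(1))+
      then show ?thesis
        by (simp add: Bochner_Integration.integral_add Bochner_Integration.integral_sum)
    qed
    also have "\<dots> = (LINT z|lborel. (G' z \<bullet> u) * \<psi> s z)"
      by (simp add: inner_prod_def inner_vec_def sum_distrib_left sum_distrib_right ac_simps distrib_left)
    also have "\<dots> \<le> (LINT z|lborel. \<beta> * \<psi> s z)"
    proof (intro integral_mono int\<psi> s continuous_intros G'(1))
      fix z
      show "G' z \<bullet> u * \<psi> s z \<le> \<beta> * \<psi> s z"
      proof (cases "z \<in> K")
        case True
        then have "G' z \<bullet> u \<le> \<beta>"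
          using b[of z] KV G'(2)[of z] by auto
        then show ?thesis
          using \<phi>(2)[of "z - s *\<^sub>R hfield u z"] by (intro mult_right_mono) (auto simp: \<psi>_def)
      qed (simp add: \<psi>0 s)
    qed
    also have "\<dots> = \<beta> * (LINT z|lborel. \<phi> z)"
      by (simp add: \<psi>i)
    finally show ?thesis .
  qed
  have "\<exists>s\<in>{0..1}. A 1 - A 0 = (1 - 0) *\<^sub>R A' s"
    using A by (intro mvt_very_simple) (auto simp: has_vector_derivative_def)
  then have "A 1 - A 0 \<le> \<beta> * (LINT z|lborel. \<phi> z)"
    using A'_le by auto
  moreover have "A 1 - A 0 \<ge> \<gamma> * (LINT z|lborel. \<phi> z)"
  proof -
    define g where "g z = f' z * \<psi> 1 z" for z
    have gc: "continuous_on UNIV g"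
      unfolding g_def by (intro continuous_intros f'c smooth_continuous_on[OF \<psi>s])
    \<comment> \<open>Right translation by \<open>hexp u\<close> undoes the transport of the bump
      and evaluates \<open>f\<close> at the end of the flow line instead.\<close>
    have "A 1 = (LINT z|lborel. g (hmul z (hexp u)))"
      unfolding A_eq[of 1, simplified] g_def[symmetric]
      by (rule integral_hmul_right[symmetric]) (intro borel_measurable_continuous_onI gc)
    also have "\<dots> = (LINT z|lborel. f' (z + hfield u z) * \<phi> z)"
      using hfield_flow(1)[of u _ 1] by (simp add: g_def \<psi>_def hmul_hexp_1)
    finally have A1: "A 1 = (LINT z|lborel. f' (z + hfield u z) * \<phi> z)" .
    have A0: "A 0 = (LINT z|lborel. f' z * \<phi> z)"
      unfolding A_eq[of 0, simplified] by (simp add: \<psi>_def)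
    have int: "integrable lborel (\<lambda>z. g z * \<phi> z)" if "continuous_on UNIV g" for g
      using \<phi>(3) that by (intro integrable_compact_support[OF _ compact_cbox[of a b]] continuous_intros smooth_continuous_on[OF \<phi>(1)]) auto
    have c1: "continuous_on UNIV (\<lambda>z. f' (z + hfield u z))"
      by (intro f'c continuous_intros hc)
    have "\<gamma> * (LINT z|lborel. \<phi> z) = (LINT z|lborel. \<gamma> * \<phi> z)"
      by simp
    also have "\<dots> \<le> (LINT z|lborel. (f' (z + hfield u z) - f' z) * \<phi> z)"
    proof (intro integral_mono int continuous_intros c1 f'(1))
      fix z
      show "\<gamma> * \<phi> z \<le> (f' (z + hfield u z) - f' z) * \<phi> z"
      proof (cases "z \<in> cbox a b")
        case True
        then have "\<Phi> (z, 0) \<in> K" "\<Phi> (z, 1) \<in> K"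
          unfolding K_def by auto
        then have "f' (z + hfield u z) - f' z = f (z + hfield u z) - f z"
          using f'(2)[of "\<Phi> (z, 0)"] f'(2)[of "\<Phi> (z, 1)"] by (simp add: \<Phi>_def)
        moreover have "\<gamma> < f (z + hfield u z) - f z"
          using W(3) ab(1) True by blast
        ultimately show ?thesis
          using \<phi>(2)[of z] by (intro mult_right_mono) auto
      qed (simp add: \<phi>(3))
    qed
    also have "\<dots> = A 1 - A 0"
      unfolding A0 A1 left_diff_distrib by (intro Bochner_Integration.integral_diff int c1 f'(1))
    finally show ?thesis .
  qed
  moreover have "\<beta> * (LINT z|lborel. \<phi> z) < \<gamma> * (LINT z|lborel. \<phi> z)"
    using \<gamma>(1) bump_integral_pos[of a b] ab(2) unfolding \<phi>_def by (intro mult_strict_right_mono) auto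
  ultimately show False by linarith
qed

text \<open>Strict differentiability: the estimate is uniform in the base point \<open>q\<close>
  near \<open>p\<close>, as chains of horizontal steps and the fixed point argument require.\<close>

definition hdiff :: "'n::finite heis set \<Rightarrow> ('n heis \<Rightarrow> real) \<Rightarrow> ('n heis \<Rightarrow> 'n hvec) \<Rightarrow> bool" where
  "hdiff U f G \<longleftrightarrow> open U \<and> continuous_on U f \<and> continuous_on U G \<and>
     (\<forall>p\<in>U. \<forall>e>0. \<exists>r>0. \<forall>q u. dist q p < r \<longrightarrow> norm u < r \<longrightarrow>
        q \<in> U \<and> q + hfield u q \<in> U \<and> \<bar>f (q + hfield u q) - f q - G p \<bullet> u\<bar> \<le> e * norm u)"

lemma norm_hfield_le: "norm (hfield u q) \<le> norm u * (1 + norm q)"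
proof -
  have le: "norm (fst v) \<le> norm v" "norm (snd v) \<le> norm v" for v :: "'x::real_normed_vector \<times> 'y::real_normed_vector"
    using norm_fst_le[of "fst v" "snd v"] norm_snd_le[of "snd v" "fst v"] by auto
  have q: "norm (fst q) \<le> norm q" "norm (fst (snd q)) \<le> norm q"
    using le(1)[of q] order_trans[OF le(1)[of "snd q"] le(2)[of q]] by auto
  have "\<bar>fst q \<bullet> snd u\<bar> \<le> norm q * norm u" "\<bar>fst u \<bullet> fst (snd q)\<bar> \<le> norm q * norm u"
    using order_trans[OF Cauchy_Schwarz_ineq2 mult_mono[OF q(1) le(2)[of u]]]
      order_trans[OF Cauchy_Schwarz_ineq2 mult_mono[OF le(1)[of u] q(2)]] by (auto simp: mult.commute)
  then have t: "\<bar>(fst q \<bullet> snd u) / 2 - (fst u \<bullet> fst (snd q)) / 2\<bar> \<le> norm q * norm u"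
    by (auto simp: abs_le_iff)
  have "hfield u q = (fst u, snd u, 0) + (0, 0, (fst q \<bullet> snd u) / 2 - (fst u \<bullet> fst (snd q)) / 2)"
    by (simp add: hfield_def)
  then have "norm (hfield u q) \<le> norm (fst u, snd u, 0::real) +
      norm (0::real^'a, 0::real^'a, (fst q \<bullet> snd u) / 2 - (fst u \<bullet> fst (snd q)) / 2)"
    by (metis norm_triangle_ineq)
  also have "\<dots> = norm u + \<bar>(fst q \<bullet> snd u) / 2 - (fst u \<bullet> fst (snd q)) / 2\<bar>"
    by (simp add: norm_prod_def)
  finally show ?thesis
    using t by (simp add: algebra_simps)
qed

text \<open>On a ball where \<open>G\<close> varies by at most \<open>e\<close>, the one-sided
  increment bound is applied twice: to \<open>u\<close> starting at \<open>q\<close>, and to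
  \<open>- u\<close> starting at the end point.\<close>

lemma distr_hgrad_imp_hdiff:
  fixes f :: "'n::finite heis \<Rightarrow> real"
  assumes U: "open U" and f: "continuous_on U f" and G: "continuous_on U G" and d: "distr_hgrad U f G"
  shows "hdiff U f G"
  unfolding hdiff_def
proof (intro conjI ballI allI impI U f G)
  fix p and e :: real assume p: "p \<in> U" and e: "0 < e"
  have "isCont G p"
    using G p continuous_on_eq_continuous_at[OF U, of G] by blast
  then obtain r1 where r1: "0 < r1" "\<And>z. dist z p < r1 \<Longrightarrow> dist (G z) (G p) < e"
    unfolding continuous_at_eps_delta using e by blast
  obtain r2 where r2: "0 < r2" "ball p r2 \<subseteq> U"
    using openE[OF U p] by metis
  define r0 where "r0 = min r1 r2"
  have r0: "0 < r0" "ball p r0 \<subseteq> U"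
    using r1(1) r2 by (auto simp: r0_def)
  have r0G: "\<bar>G z \<bullet> u - G p \<bullet> u\<bar> \<le> e * norm u" if "z \<in> ball p r0" for z u
  proof -
    have "\<bar>(G z - G p) \<bullet> u\<bar> \<le> norm (G z - G p) * norm u"
      by (rule Cauchy_Schwarz_ineq2)
    also have "\<dots> \<le> e * norm u"
      using r1(2)[of z] that by (intro mult_right_mono) (auto simp: r0_def dist_commute dist_norm[symmetric])
    finally show ?thesis
      by (simp add: inner_diff_left)
  qed
  \<comment> \<open>The 3 adds 1 for the distance of \<open>q\<close> from \<open>p\<close> to the
    factor \<open>2 + norm p\<close> bounding the growth of the field at \<open>q\<close>; so the
    whole segment stays in the ball of radius \<open>r0\<close>.\<close>
  define r where "r = min 1 (r0 / (3 + norm p))"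
  have r: "0 < r" "r \<le> 1" "r * (3 + norm p) \<le> r0"
  proof -
    have c: "0 < 3 + norm p" by (intro add_pos_nonneg) auto
    then show "0 < r" "r \<le> 1"
      using r0(1) by (auto simp: r_def)
    have "r \<le> r0 / (3 + norm p)" by (simp add: r_def)
    then show "r * (3 + norm p) \<le> r0"
      by (simp only: pos_le_divide_eq[OF c])
  qed
  show "\<exists>r>0. \<forall>q u. dist q p < r \<longrightarrow> norm u < r \<longrightarrow>
        q \<in> U \<and> q + hfield u q \<in> U \<and> \<bar>f (q + hfield u q) - f q - G p \<bullet> u\<bar> \<le> e * norm u"
  proof (intro exI[of _ r] conjI[OF r(1)] allI impI)
    fix q and u :: "'n hvec" assume q: "dist q p < r" and u: "norm u < r"
    have seg: "q + s *\<^sub>R hfield u q \<in> ball p r0" if s: "0 \<le> s" "s \<le> 1" for s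
    proof -
      have "norm q \<le> norm p + norm (q - p)"
        using norm_triangle_ineq[of p "q - p"] by simp
      then have nq: "norm q \<le> norm p + 1"
        using q r(2) by (simp add: dist_norm)
      have "dist (q + s *\<^sub>R hfield u q) p \<le> dist q p + s * norm (hfield u q)"
        using norm_triangle_ineq[of "q - p" "s *\<^sub>R hfield u q"] s by (simp add: dist_norm algebra_simps)
      also have "\<dots> \<le> dist q p + norm u * (1 + norm q)"
        using s norm_hfield_le[of u q] by (intro add_left_mono order_trans[OF mult_left_le_one_le]) auto
      also have "\<dots> \<le> dist q p + r * (2 + norm p)"
        using u nq r(1) by (intro add_left_mono mult_mono) auto
      also have "\<dots> < r * (3 + norm p)"
        using q by (simp add: algebra_simps)
      finally show ?thesis
        using r(3) by (simp add: dist_commute)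
    qed
    have 1: "f (q + hfield u q) - f q \<le> G p \<bullet> u + e * norm u"
    proof (rule distr_hgrad_increment_le[OF U f G d _ r0(2) seg])
      fix z assume "z \<in> ball p r0"
      from r0G[OF this, of u] show "G z \<bullet> u \<le> G p \<bullet> u + e * norm u"
        by linarith
    qed auto
    define q' where "q' = q + hfield u q"
    have h: "hfield (- u) q' = - hfield u q"
      using hfield_flow(1)[of u q 1] by (simp add: q'_def hfield_uminus)
    have "f (q' + hfield (- u) q') - f q' \<le> - (G p \<bullet> u) + e * norm u"
    proof (rule distr_hgrad_increment_le[OF U f G d _ r0(2)])
      fix s :: real assume s: "0 \<le> s" "s \<le> 1"
      have "q' + s *\<^sub>R hfield (- u) q' = q + (1 - s) *\<^sub>R hfield u q"
        by (simp add: h) (simp add: q'_def algebra_simps)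
      then show "q' + s *\<^sub>R hfield (- u) q' \<in> ball p r0"
        using seg[of "1 - s"] s by simp
    next
      fix z assume "z \<in> ball p r0"
      from r0G[OF this, of u] show "G z \<bullet> - u \<le> - (G p \<bullet> u) + e * norm u"
        by (simp add: abs_le_iff)
    qed simp
    then have 2: "f q - f (q + hfield u q) \<le> - (G p \<bullet> u) + e * norm u"
      by (simp add: h) (simp add: q'_def)
    have "q \<in> U" "q + hfield u q \<in> U"
      using seg[of 0] seg[of 1] r0(2) by auto
    with 1 2 show "q \<in> U \<and> q + hfield u q \<in> U \<and> \<bar>f (q + hfield u q) - f q - G p \<bullet> u\<bar> \<le> e * norm u"
      by (auto simp: abs_le_iff)
  qed
qed

text \<open>Serves to polarise the condition obtained in the middle degree, which is quadratic in
  the gradient.\<close>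

lemma hdiff_add:
  fixes f g :: "'n::finite heis \<Rightarrow> real"
  assumes "hdiff U f G" "hdiff U g H"
  shows "hdiff U (\<lambda>p. f p + g p) (\<lambda>p. G p + H p)"
  unfolding hdiff_def
proof (intro conjI ballI allI impI)
  show "open U" "continuous_on U (\<lambda>p. f p + g p)" "continuous_on U (\<lambda>p. G p + H p)"
    using assms by (auto simp: hdiff_def intro!: continuous_intros)
  fix p and e :: real assume p: "p \<in> U" and e: "0 < e"
  then have e2: "0 < e / 2" by simp
  obtain r1 where r1: "0 < r1" "\<And>q u. dist q p < r1 \<Longrightarrow> norm u < r1 \<Longrightarrow>
      q \<in> U \<and> q + hfield u q \<in> U \<and> \<bar>f (q + hfield u q) - f q - G p \<bullet> u\<bar> \<le> e / 2 * norm u"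
    using assms(1) p e2 unfolding hdiff_def by metis
  obtain r2 where r2: "0 < r2" "\<And>q u. dist q p < r2 \<Longrightarrow> norm u < r2 \<Longrightarrow>
      \<bar>g (q + hfield u q) - g q - H p \<bullet> u\<bar> \<le> e / 2 * norm u"
    using assms(2) p e2 unfolding hdiff_def by metis
  show "\<exists>r>0. \<forall>q u. dist q p < r \<longrightarrow> norm u < r \<longrightarrow> q \<in> U \<and> q + hfield u q \<in> U \<and>
      \<bar>f (q + hfield u q) + g (q + hfield u q) - (f q + g q) - (G p + H p) \<bullet> u\<bar> \<le> e * norm u"
  proof (intro exI[of _ "min r1 r2"] conjI allI impI)
    fix q and u :: "'n hvec" assume *: "dist q p < min r1 r2" "norm u < min r1 r2"
    then show "q \<in> U" "q + hfield u q \<in> U"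
      using r1(2)[of q u] by auto
    have "\<bar>f (q + hfield u q) - f q - G p \<bullet> u\<bar> \<le> e / 2 * norm u" "\<bar>g (q + hfield u q) - g q - H p \<bullet> u\<bar> \<le> e / 2 * norm u"
      using r1(2)[of q u] r2(2)[of q u] * by auto
    then show "\<bar>f (q + hfield u q) + g (q + hfield u q) - (f q + g q) - (G p + H p) \<bullet> u\<bar> \<le> e * norm u"
      using field_sum_of_halves[of "e * norm u"] unfolding inner_add_left by (simp only: times_divide_eq_left)
  qed (use r1 r2 in auto)
qed

text \<open>The radius is a Lebesgue number for a cover of \<open>C\<close> by balls on which the
  increment error and the oscillation of \<open>G\<close> each account for half of
  \<open>e\<close>.\<close>

lemma hdiff_uniform:
  assumes h: "hdiff U f G" and C: "compact C" "C \<subseteq> U" and e: "0 < e"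
  obtains r where "0 < r" "\<And>p q u. p \<in> C \<Longrightarrow> dist q p < r \<Longrightarrow> norm u < r \<Longrightarrow>
    q \<in> U \<and> q + hfield u q \<in> U \<and> \<bar>f (q + hfield u q) - f q - G p \<bullet> u\<bar> \<le> e * norm u"
proof -
  have "\<exists>r>0. (\<forall>q u. dist q p < r \<longrightarrow> norm u < r \<longrightarrow>
        q \<in> U \<and> q + hfield u q \<in> U \<and> \<bar>f (q + hfield u q) - f q - G p \<bullet> u\<bar> \<le> e / 2 * norm u) \<and>
        (\<forall>q. dist q p < r \<longrightarrow> norm (G q - G p) \<le> e / 2)" if p: "p \<in> C" for p
  proof -
    have pU: "p \<in> U" using p C(2) by blast
    have e2: "0 < e / 2" using e by simp
    obtain r1 where r1: "0 < r1" "\<And>q u. dist q p < r1 \<Longrightarrow> norm u < r1 \<Longrightarrow>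
        q \<in> U \<and> q + hfield u q \<in> U \<and> \<bar>f (q + hfield u q) - f q - G p \<bullet> u\<bar> \<le> e / 2 * norm u"
      using h pU e2 unfolding hdiff_def by metis
    have "isCont G p"
      using h pU continuous_on_eq_continuous_at[of U G] unfolding hdiff_def by blast
    then obtain r2 where r2: "0 < r2" "\<And>z. dist z p < r2 \<Longrightarrow> dist (G z) (G p) < e / 2"
      unfolding continuous_at_eps_delta using e2 by blast
    show ?thesis
      using r1 r2 by (intro exI[of _ "min r1 r2"]) (auto simp: dist_norm less_imp_le)
  qed
  then obtain R where R: "\<And>p. p \<in> C \<Longrightarrow> 0 < R p"
    "\<And>p q u. p \<in> C \<Longrightarrow> dist q p < R p \<Longrightarrow> norm u < R p \<Longrightarrow>
        q \<in> U \<and> q + hfield u q \<in> U \<and> \<bar>f (q + hfield u q) - f q - G p \<bullet> u\<bar> \<le> e / 2 * norm u"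
    "\<And>p q. p \<in> C \<Longrightarrow> dist q p < R p \<Longrightarrow> norm (G q - G p) \<le> e / 2"
    by metis
  have "C \<subseteq> \<Union>((\<lambda>p. ball p (R p)) ` C)"
    using R(1) by force
  then obtain r where r: "0 < r" "\<And>p. p \<in> C \<Longrightarrow> \<exists>B\<in>(\<lambda>p. ball p (R p)) ` C. ball p r \<subseteq> B"
    using Heine_Borel_lemma[OF C(1), of "(\<lambda>p. ball p (R p)) ` C"] by (metis (mono_tags, lifting) imageE open_ball)
  show ?thesis
  proof (rule that[OF r(1)])
    fix p q :: "'a heis" and u :: "'a hvec"
    assume p: "p \<in> C" and q: "dist q p < r" and u: "norm u < r"
    obtain p' where p': "p' \<in> C" "ball p r \<subseteq> ball p' (R p')"
      using r(2)[OF p] by auto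
    have rR: "r \<le> R p'"
      using p'(2) r(1) zero_le_dist[of p p'] unfolding ball_subset_ball_iff by linarith
    have "dist q p' < R p'" "dist p p' < R p'"
      using subsetD[OF p'(2), of q] subsetD[OF p'(2), of p] q r(1) by (auto simp: dist_commute)
    then have *: "q \<in> U \<and> q + hfield u q \<in> U \<and> \<bar>f (q + hfield u q) - f q - G p' \<bullet> u\<bar> \<le> e / 2 * norm u"
      "norm (G p - G p') \<le> e / 2"
      using R(2)[OF p'(1), of q u] R(3)[OF p'(1), of p] u rR by auto
    have "\<bar>(G p - G p') \<bullet> u\<bar> \<le> e / 2 * norm u"
      using *(2) by (intro order_trans[OF Cauchy_Schwarz_ineq2] mult_right_mono) auto
    moreover have "e * norm u = e / 2 * norm u + e / 2 * norm u" by simp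
    ultimately show "q \<in> U \<and> q + hfield u q \<in> U \<and> \<bar>f (q + hfield u q) - f q - G p \<bullet> u\<bar> \<le> e * norm u"
      using *(1) unfolding inner_diff_left by linarith
  qed
qed

text \<open>Increments and errors add up along a chain of horizontal steps. Staying within
  \<open>min r 1\<close> of \<open>p\<close> keeps the estimate valid and bounds
  \<open>norm q\<close> by \<open>B + 1\<close>, so a single step moves the point by at most
  \<open>\<eta> * (2 + B)\<close>.\<close>

lemma hdiff_chain:
  fixes us :: "'n::finite hvec list"
  assumes unif: "\<And>q u. dist q p < r \<Longrightarrow> norm u < r \<Longrightarrow>
      q \<in> U \<and> q + hfield u q \<in> U \<and> \<bar>f (q + hfield u q) - f q - G \<bullet> u\<bar> \<le> e * norm u"
    and B: "norm p \<le> B" and r: "0 < r" and e: "0 \<le> e" and \<eta>: "\<eta> < r"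
    and us: "\<And>u. u \<in> set us \<Longrightarrow> norm u \<le> \<eta>"
    and len: "real (length us) * (\<eta> * (2 + B)) < min r 1" and \<eta>0: "0 \<le> \<eta>"
  shows "dist (foldl (\<lambda>q u. q + hfield u q) p us) p \<le> real (length us) * (\<eta> * (2 + B)) \<and>
    foldl (\<lambda>q u. q + hfield u q) p us \<in> U \<and>
    \<bar>f (foldl (\<lambda>q u. q + hfield u q) p us) - f p - G \<bullet> sum_list us\<bar> \<le> real (length us) * (e * \<eta>)"
  using us len
proof (induction us rule: rev_induct)
  case Nil
  then show ?case using unif[of p 0] r by simp
next
  case (snoc u us)
  define q where "q = foldl (\<lambda>q u. q + hfield u q) p us"
  have B0: "0 \<le> B" using B norm_ge_zero order_trans by blast
  have c: "0 \<le> \<eta> * (2 + B)" using \<eta>0 B0 by simp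
  have lt: "real (length us) * (\<eta> * (2 + B)) < min r 1"
    using snoc.prems(2) c by (simp add: distrib_right)
  have IH: "dist q p \<le> real (length us) * (\<eta> * (2 + B))" "\<bar>f q - f p - G \<bullet> sum_list us\<bar> \<le> real (length us) * (e * \<eta>)"
    using snoc.IH[OF _ lt] snoc.prems(1) by (auto simp: q_def)
  have u: "norm u \<le> \<eta>" using snoc.prems(1) by simp
  have qp: "dist q p < r" "dist q p < 1"
    using IH(1) lt by auto
  have *: "q + hfield u q \<in> U" "\<bar>f (q + hfield u q) - f q - G \<bullet> u\<bar> \<le> e * norm u"
    using unif[OF qp(1), of u] u \<eta> by auto
  have "norm q \<le> norm p + norm (q - p)"
    using norm_triangle_ineq[of p "q - p"] by simp
  then have nq: "norm q \<le> B + 1"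
    using qp(2) B by (simp add: dist_norm)
  have "dist (q + hfield u q) p \<le> dist q p + norm (hfield u q)"
    using norm_triangle_ineq[of "q - p" "hfield u q"] by (simp add: dist_norm algebra_simps)
  also have "norm (hfield u q) \<le> norm u * (1 + norm q)"
    by (rule norm_hfield_le)
  also have "\<dots> \<le> \<eta> * (2 + B)"
    using u nq \<eta>0 by (intro mult_mono) auto
  finally have d: "dist (q + hfield u q) p \<le> real (length (us @ [u])) * (\<eta> * (2 + B))"
    using IH(1) by (simp add: distrib_right)
  have "e * norm u \<le> e * \<eta>"
    using u e by (intro mult_left_mono)
  then have "\<bar>f (q + hfield u q) - f p - G \<bullet> sum_list (us @ [u])\<bar> \<le> real (length (us @ [u])) * (e * \<eta>)"
    using *(2) IH(2) by (simp add: inner_add_right distrib_right abs_le_iff)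
  with d *(1) show ?case
    by (simp add: q_def)
qed

text \<open>Group commutators of steps of length \<open>s\<close> along \<open>X\<^sub>j\<close> and
  \<open>Y\<^sub>j\<close> are vertical; exchanging the two fields reverses the direction.\<close>

lemma vertical_commutator:
  "hmul (hmul (hmul (hmul p (hexp (s *\<^sub>R axis j 1, 0))) (hexp (0, s *\<^sub>R axis j 1))) (hexp (- s *\<^sub>R axis j 1, 0)))
    (hexp (0, - s *\<^sub>R axis j 1)) = hmul p (0, 0, s\<^sup>2)"
  "hmul (hmul (hmul (hmul p (hexp (0, s *\<^sub>R axis j 1))) (hexp (s *\<^sub>R axis j 1, 0))) (hexp (0, - s *\<^sub>R axis j 1)))
    (hexp (- s *\<^sub>R axis j 1, 0)) = hmul p (0, 0, - s\<^sup>2)"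
  unfolding hmul_assoc
  by (rule arg_cong[where f = "hmul p"]; simp add: hmul_eq inner_add_left inner_add_right inner_axis_axis power2_eq_square)+

lemma norm_cbox_One: "w \<in> cbox (- One) One \<Longrightarrow> norm w \<le> norm (One :: 'a)" for w :: "'a::euclidean_space"
  by (rule norm_le_componentwise) (force simp: mem_box)

text \<open>Vertical displacements of order \<open>\<delta>\<^sup>2\<close> are commutators of horizontal ones of order \<open>\<delta>\<close>.\<close>

lemma hdiff_taylor:
  fixes f :: "'n::finite heis \<Rightarrow> real"
  assumes h: "hdiff U f G" and C: "compact C" "C \<subseteq> U" and e: "0 < e"
  obtains d where "0 < d" "\<And>p \<delta> w. p \<in> C \<Longrightarrow> 0 < \<delta> \<Longrightarrow> \<delta> < d \<Longrightarrow> w \<in> cbox (- One) One \<Longrightarrow>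
    hmul p (hdil \<delta> w) \<in> U \<and>
    \<bar>f (hmul p (hdil \<delta> w)) - f p - \<delta> * (G p \<bullet> (fst w, fst (snd w)))\<bar> \<le> e * \<delta>"
proof -
  define M where "M = max 1 (norm (One :: 'n heis))"
  have M: "1 \<le> M" "0 < M" by (simp_all add: M_def)
  obtain B where B: "\<And>p. p \<in> C \<Longrightarrow> norm p \<le> B" "0 \<le> B"
    using compact_imp_bounded[OF C(1)] unfolding bounded_iff by (metis abs_ge_self abs_ge_zero order_trans)
  \<comment> \<open>Five horizontal steps will be used, each of length at most
    \<open>M * \<delta>\<close>, so their errors add up to \<open>e * \<delta>\<close>.\<close>
  have "0 < e / (5 * M)" using e M by simp
  then obtain r where r: "0 < r" "\<And>p q u. p \<in> C \<Longrightarrow> dist q p < r \<Longrightarrow> norm u < r \<Longrightarrow>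
    q \<in> U \<and> q + hfield u q \<in> U \<and> \<bar>f (q + hfield u q) - f q - G p \<bullet> u\<bar> \<le> e / (5 * M) * norm u"
    using hdiff_uniform[OF h C] by metis
  define d where "d = min r 1 / (5 * (M * (2 + B)))"
  have MB: "0 < 5 * (M * (2 + B))" using M B(2) by simp
  have d: "0 < d" using r(1) MB by (simp add: d_def)
  show ?thesis
  proof (rule that[OF d])
    fix p :: "'n heis" and \<delta> :: real and w
    assume p: "p \<in> C" and \<delta>: "0 < \<delta>" "\<delta> < d" and w: "w \<in> cbox (- One) (One :: 'n heis)"
    obtain x y t where w': "w = (x, y, t)" by (cases w)
    have t: "\<bar>t\<bar> \<le> 1"
    proof -
      have "(0, 0, 1) \<in> (Basis :: 'n heis set)"
        by (simp add: Basis_prod_def)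
      with w have "w \<bullet> (0, 0, 1) \<le> 1" "- 1 \<le> w \<bullet> (0, 0, 1)"
        unfolding mem_box by force+
      then show ?thesis by (simp add: w' abs_le_iff)
    qed
    have nw: "norm (x, y) \<le> M"
    proof -
      have "norm (x, y) \<le> norm w"
        by (simp add: w' norm_prod_def)
      then show ?thesis
        using norm_cbox_One[OF w] by (simp add: M_def)
    qed
    obtain j :: 'n where True by blast
    \<comment> \<open>A commutator of steps of length \<open>s\<close> moves vertically by
      \<open>s\<^sup>2\<close>, which has to equal \<open>\<delta>\<^sup>2 * \<bar>t\<bar>\<close>;
      the order of the steps takes care of the sign of \<open>t\<close>.\<close>
    define s where "s = \<delta> * sqrt \<bar>t\<bar>"
    have s: "0 \<le> s" "s \<le> \<delta>" "s\<^sup>2 = \<delta>\<^sup>2 * \<bar>t\<bar>"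
      using \<delta> t by (auto simp: s_def power_mult_distrib intro: mult_left_le)
    define E where "E = (axis j 1 :: real^'n)"
    define us where "us = (if 0 \<le> t then [(s *\<^sub>R E, 0), (0, s *\<^sub>R E), (- s *\<^sub>R E, 0), (0, - s *\<^sub>R E), (\<delta> *\<^sub>R x, \<delta> *\<^sub>R y)]
      else [(0, s *\<^sub>R E), (s *\<^sub>R E, 0), (0, - s *\<^sub>R E), (- s *\<^sub>R E, 0), (\<delta> *\<^sub>R x, \<delta> *\<^sub>R y)])"
    have "foldl (\<lambda>q u. q + hfield u q) p us = hmul (hmul p (0, 0, \<delta>\<^sup>2 * t)) (hexp (\<delta> *\<^sub>R x, \<delta> *\<^sub>R y))"
      unfolding us_def hmul_hexp_1[symmetric] E_def using vertical_commutator[of p s j] s(3)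
      by (auto split: if_splits)
    also have "\<dots> = hmul p (hdil \<delta> w)"
      unfolding hmul_assoc by (simp add: hmul_eq w' hdil_eq)
    finally have fold: "foldl (\<lambda>q u. q + hfield u q) p us = hmul p (hdil \<delta> w)" .
    have len: "length us = 5" by (simp add: us_def)
    have sum: "sum_list us = \<delta> *\<^sub>R (x, y)" by (simp add: us_def zero_prod_def[symmetric])
    have E: "norm E = 1" by (simp add: E_def)
    have \<eta>: "norm u \<le> M * \<delta>" if "u \<in> set us" for u
    proof -
      have "s \<le> M * \<delta>"
        using s(2) mult_right_mono[OF M(1), of \<delta>] \<delta>(1) by linarith
      moreover have "norm (\<delta> *\<^sub>R x, \<delta> *\<^sub>R y) \<le> M * \<delta>"
      proof -
        have "(\<delta> *\<^sub>R x, \<delta> *\<^sub>R y) = \<delta> *\<^sub>R (x, y)" by simp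
        then show ?thesis
          using nw \<delta>(1) by (simp only: norm_scaleR) (simp add: mult.commute)
      qed
      moreover have "u = (s *\<^sub>R E, 0) \<or> u = (0, s *\<^sub>R E) \<or> u = (- s *\<^sub>R E, 0) \<or> u = (0, - s *\<^sub>R E) \<or> u = (\<delta> *\<^sub>R x, \<delta> *\<^sub>R y)"
        using that by (auto simp: us_def split: if_splits)
      ultimately show ?thesis
        using s(1) E by (elim disjE) (simp_all add: norm_prod_def)
    qed
    have "5 * (M * \<delta> * (2 + B)) < min r 1"
    proof -
      have "\<delta> * (5 * (M * (2 + B))) < min r 1"
        using \<delta>(2) MB unfolding d_def by (simp add: pos_less_divide_eq)
      then show ?thesis by (simp add: ac_simps)
    qed
    then have lt: "real (length us) * (M * \<delta> * (2 + B)) < min r 1" by (simp add: len)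
    have "M * \<delta> * 1 \<le> 5 * (M * \<delta> * (2 + B))"
      using M \<delta>(1) B(2) by (simp add: mult_le_cancel_left_pos)
    then have lt2: "M * \<delta> < r" using lt len by simp
    have "hmul p (hdil \<delta> w) \<in> U \<and> \<bar>f (hmul p (hdil \<delta> w)) - f p - G p \<bullet> \<delta> *\<^sub>R (x, y)\<bar> \<le> real 5 * (e / (5 * M) * (M * \<delta>))"
      using hdiff_chain[OF r(2)[OF p] B(1)[OF p] r(1) _ lt2 \<eta> lt] e M \<delta>(1) unfolding fold sum len by auto
    moreover have "real 5 * (e / (5 * M) * (M * \<delta>)) = e * \<delta>"
      using M by simp
    ultimately show "hmul p (hdil \<delta> w) \<in> U \<and>
        \<bar>f (hmul p (hdil \<delta> w)) - f p - \<delta> * (G p \<bullet> (fst w, fst (snd w)))\<bar> \<le> e * \<delta>"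
      by (simp only: w' fst_conv snd_conv inner_scaleR_right)
  qed
qed

text \<open>The dual vector of \<open>g j\<close> is its component orthogonal to the other vectors,
  rescaled. The reconstruction formula holds because a vector of the span that is orthogonal to all
  \<open>g i\<close> is orthogonal to itself.\<close>

lemma dual_basis:
  fixes g :: "nat \<Rightarrow> 'a::euclidean_space"
  assumes dim: "dim (g ` {..<k}) = k"
  obtains w where "\<And>i. i < k \<Longrightarrow> w i \<in> span (g ` {..<k})"
    "\<And>i j. i < k \<Longrightarrow> j < k \<Longrightarrow> g i \<bullet> w j = (if i = j then 1 else 0)"
    "\<And>u. u \<in> span (g ` {..<k}) \<Longrightarrow> (\<Sum>i<k. (g i \<bullet> u) *\<^sub>R w i) = u"
proof -
  let ?B = "g ` {..<k}"
  have "dim ?B \<le> card ?B" "card ?B \<le> k"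
    using dim_le_card[of ?B ?B] card_image_le[of "{..<k}" g] by (auto simp: span_superset)
  then have card: "card ?B = k" using dim by simp
  then have inj: "inj_on g {..<k}"
    by (simp add: eq_card_imp_inj_on)
  have ind: "independent ?B"
    using card_eq_dim[of ?B ?B] card dim by (simp add: span_superset)
  have "\<exists>w. w \<in> span ?B \<and> (\<forall>i<k. g i \<bullet> w = (if i = j then 1 else 0))" if j: "j < k" for j
  proof -
    let ?O = "?B - {g j}"
    obtain y z where y: "y \<in> span ?O" and z: "\<And>x. x \<in> span ?O \<Longrightarrow> orthogonal z x" and yz: "g j = y + z"
      using orthogonal_subspace_decomp_exists[of ?O "g j"] by metis
    have "g j \<notin> span ?O"
      using ind j unfolding dependent_def by blast
    then have z0: "z \<noteq> 0" using y yz by auto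
    have "y \<in> span ?B" using y span_mono[of ?O ?B] by blast
    moreover have "g j \<in> span ?B" using j by (intro span_base) auto
    moreover have "z = g j - y" using yz by simp
    ultimately have zB: "z \<in> span ?B" by (simp only: span_diff)
    show ?thesis
    proof (intro exI[of _ "inverse (z \<bullet> z) *\<^sub>R z"] conjI allI impI)
      show "inverse (z \<bullet> z) *\<^sub>R z \<in> span ?B" using zB by (rule span_scale)
      fix i assume i: "i < k"
      show "g i \<bullet> inverse (z \<bullet> z) *\<^sub>R z = (if i = j then 1 else 0)"
      proof (cases "i = j")
        case True
        have "g j \<bullet> z = z \<bullet> z"
          using z[OF y] by (simp add: yz inner_add_left inner_add_right orthogonal_def inner_commute)
        with z0 True show ?thesis by simp
      next
        case False
        then have gi: "g i \<in> ?O" using inj i j by (auto simp: inj_on_def)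
        have "g i \<bullet> z = 0"
          using z[OF span_base[OF gi]] by (simp add: orthogonal_def inner_commute)
        with False show ?thesis by simp
      qed
    qed
  qed
  then obtain w where w: "\<And>j. j < k \<Longrightarrow> w j \<in> span ?B"
    "\<And>i j. j < k \<Longrightarrow> i < k \<Longrightarrow> g i \<bullet> w j = (if i = j then 1 else 0)"
    by metis
  show ?thesis
  proof (rule that[of w])
    fix u assume u: "u \<in> span ?B"
    define d where "d = (\<Sum>i<k. (g i \<bullet> u) *\<^sub>R w i) - u"
    have dB: "d \<in> span ?B"
      unfolding d_def using w(1) u by (intro span_diff span_sum span_scale) auto
    have "g j \<bullet> d = 0" if "j < k" for j
    proof -
      have "g j \<bullet> (\<Sum>i<k. (g i \<bullet> u) *\<^sub>R w i) = (\<Sum>i<k. if i = j then g i \<bullet> u else 0)"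
        unfolding inner_sum_right using w(2)[OF _ that] by (intro sum.cong) auto
      also have "\<dots> = g j \<bullet> u" using that by simp
      finally show ?thesis by (simp add: d_def inner_diff_right)
    qed
    then have "?B \<subseteq> {x. d \<bullet> x = 0}" by (auto simp: inner_commute[of d])
    then have "span ?B \<subseteq> {x. d \<bullet> x = 0}"
      by (intro span_minimal subspace_hyperplane)
    with dB have "d \<bullet> d = 0" by blast
    then show "(\<Sum>i<k. (g i \<bullet> u) *\<^sub>R w i) = u"
      by (simp add: d_def)
  qed (use w in auto)
qed

lemma continuous_on_hfield_vec: "continuous_on S (\<lambda>u. hfield u q)"
  unfolding hfield_def by (intro continuous_intros) auto

text \<open>Brouwer's theorem corrects the horizontal step \<open>s v\<close> to a point of \<open>S\<close> at distance \<open>o(s)\<close>.\<close>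

lemma hdiff_tangent:
  fixes f :: "nat \<Rightarrow> 'n::finite heis \<Rightarrow> real"
  assumes k: "0 < k" and h: "\<And>i. i < k \<Longrightarrow> hdiff U (f i) (G i)" and S: "S \<inter> U = {p \<in> U. \<forall>i<k. f i p = 0}"
    and dim: "dim ((\<lambda>i. G i p) ` {..<k}) = k" and p: "p \<in> S" "p \<in> U" "p \<in> U'"
    and h': "hdiff U' f' G'" and z': "\<And>q. q \<in> S \<Longrightarrow> q \<in> U' \<Longrightarrow> f' q = 0"
    and v: "\<And>i. i < k \<Longrightarrow> G i p \<bullet> v = 0"
  shows "G' p \<bullet> v = 0"
proof (rule ccontr)
  assume neq: "G' p \<bullet> v \<noteq> 0"
  define c where "c = \<bar>G' p \<bullet> v\<bar>"
  have c: "0 < c" using neq by (simp add: c_def)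
  have v0: "0 < norm v" using neq by auto
  let ?A = "span ((\<lambda>i. G i p) ` {..<k})"
  obtain w where w: "\<And>i. i < k \<Longrightarrow> w i \<in> ?A"
    "\<And>i j. i < k \<Longrightarrow> j < k \<Longrightarrow> G i p \<bullet> w j = (if i = j then 1 else 0)"
    "\<And>u. u \<in> ?A \<Longrightarrow> (\<Sum>i<k. (G i p \<bullet> u) *\<^sub>R w i) = u"
    using dual_basis[OF dim] by blast
  define C where "C = (\<Sum>i<k. norm (w i)) + 1"
  have C: "1 \<le> C" by (simp add: C_def sum_nonneg)
  \<comment> \<open>Collects the constants of the final estimate, in which the errors add up to
    \<open>s * (e * (D - 1))\<close>.\<close>
  define D where "D = norm v * (1 + 2 * C * (norm (G' p) + 1)) + 1"
  have D: "1 \<le> D" using C by (simp add: D_def)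
  define e where "e = min (min 1 (1 / (2 * C))) (c / (2 * D))"
  have e: "0 < e" "e \<le> 1" "2 * C * e \<le> 1" "2 * D * e \<le> c"
  proof -
    have c1: "0 < 2 * C" and c2: "0 < 2 * D" using C D by simp_all
    then show "0 < e" "e \<le> 1" using c by (simp_all add: e_def)
    have "e \<le> 1 / (2 * C)" "e \<le> c / (2 * D)" by (simp_all add: e_def)
    then have "e * (2 * C) \<le> 1" "e * (2 * D) \<le> c"
      by (simp_all only: pos_le_divide_eq[OF c1] pos_le_divide_eq[OF c2])
    then show "2 * C * e \<le> 1" "2 * D * e \<le> c"
      by (simp_all only: mult.commute)
  qed
  have "\<exists>r>0. \<forall>q u. dist q p < r \<longrightarrow> norm u < r \<longrightarrow>
      q + hfield u q \<in> U \<and> \<bar>f i (q + hfield u q) - f i q - G i p \<bullet> u\<bar> \<le> e * norm u" if i: "i < k" for i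
  proof -
    obtain r where "0 < r" "\<And>q u. dist q p < r \<Longrightarrow> norm u < r \<Longrightarrow>
        q \<in> U \<and> q + hfield u q \<in> U \<and> \<bar>f i (q + hfield u q) - f i q - G i p \<bullet> u\<bar> \<le> e * norm u"
      using h[OF i] p(2) e(1) unfolding hdiff_def by metis
    then show ?thesis by (intro exI[of _ r]) simp
  qed
  then obtain R where R: "\<And>i. i < k \<Longrightarrow> 0 < R i" "\<And>i q u. i < k \<Longrightarrow> dist q p < R i \<Longrightarrow> norm u < R i \<Longrightarrow>
      q + hfield u q \<in> U \<and> \<bar>f i (q + hfield u q) - f i q - G i p \<bullet> u\<bar> \<le> e * norm u"
    by metis
  obtain r' where r': "0 < r'" "\<And>q u. dist q p < r' \<Longrightarrow> norm u < r' \<Longrightarrow>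
      q \<in> U' \<and> q + hfield u q \<in> U' \<and> \<bar>f' (q + hfield u q) - f' q - G' p \<bullet> u\<bar> \<le> e * norm u"
    using h' p(3) e(1) unfolding hdiff_def by metis
  define r where "r = Min (insert r' (R ` {..<k}))"
  have r: "0 < r" "r \<le> r'" "\<And>i. i < k \<Longrightarrow> r \<le> R i"
    using R(1) r'(1) by (auto simp: r_def Min_gr_iff)
  \<comment> \<open>Small enough that the step from \<open>p\<close> to \<open>q\<close>, and
    corrections of length up to \<open>s * norm v\<close> at \<open>q\<close>, stay within the
    radius \<open>r\<close>.\<close>
  define s where "s = r / (2 * norm v * (1 + norm p) + 2 * norm v)"
  have den: "0 < 2 * norm v * (1 + norm p) + 2 * norm v"
    using v0 by (intro add_nonneg_pos) auto
  have s: "0 < s" "s * norm v < r" "s * norm v * (1 + norm p) < r"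
  proof -
    show s0: "0 < s" using r(1) den by (simp add: s_def)
    have "s * (2 * norm v * (1 + norm p) + 2 * norm v) = r" using den by (simp add: s_def)
    moreover have "0 < s * norm v" "0 \<le> s * norm v * (1 + norm p)" using s0 v0 by simp_all
    ultimately show "s * norm v < r" "s * norm v * (1 + norm p) < r"
      by (simp_all add: algebra_simps)
  qed
  define q where "q = p + hfield (s *\<^sub>R v) p"
  have ns: "norm (s *\<^sub>R v) = s * norm v" using s(1) by simp
  have qp: "dist q p < r"
  proof -
    have "dist q p = norm (hfield (s *\<^sub>R v) p)" by (simp add: q_def dist_norm)
    also have "\<dots> \<le> s * norm v * (1 + norm p)" using norm_hfield_le[of "s *\<^sub>R v" p] unfolding ns .
    finally show ?thesis using s(3) by linarith
  qed
  have fp: "f i p = 0" if "i < k" for i using S p that by auto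
  have fq: "\<bar>f i q\<bar> \<le> e * (s * norm v)" if "i < k" for i
  proof -
    have "norm (s *\<^sub>R v) < R i" using s(2) r(3)[OF that] unfolding ns by linarith
    then have "\<bar>f i q - f i p - G i p \<bullet> s *\<^sub>R v\<bar> \<le> e * (s * norm v)"
      using R(2)[OF that, of p "s *\<^sub>R v"] R(1)[OF that] unfolding ns q_def by simp
    then show ?thesis
      unfolding inner_scaleR_right v[OF that] fp[OF that] by simp
  qed
  define X where "X = ?A \<inter> cball 0 (s * norm v)"
  \<comment> \<open>On the conormal space
    \<open>(\<Sum>i<k. (G i p \<bullet> u) *\<^sub>R w i) = u\<close>, so the linear parts cancel
    and \<open>\<Phi>\<close> is small there. At a fixed point the sum is zero, and duality makes
    every \<open>f i (q + hfield u q)\<close> vanish.\<close>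
  define \<Phi> where "\<Phi> u = u - (\<Sum>i<k. f i (q + hfield u q) *\<^sub>R w i)" for u
  have est: "norm (\<Phi> u) \<le> 2 * C * e * (s * norm v)" if u: "u \<in> X" for u
  proof -
    have nu: "norm u \<le> s * norm v" and uA: "u \<in> ?A" using u by (auto simp: X_def)
    have fi: "\<bar>f i (q + hfield u q) - G i p \<bullet> u\<bar> \<le> 2 * e * (s * norm v)" if i: "i < k" for i
    proof -
      have "\<bar>f i (q + hfield u q) - f i q - G i p \<bullet> u\<bar> \<le> e * norm u"
        using R(2)[OF i, of q u] qp r(3)[OF i] nu s(2) by simp
      moreover have "e * norm u \<le> e * (s * norm v)" using nu e(1) by (intro mult_left_mono) auto
      ultimately show ?thesis using fq[OF i] by linarith
    qed
    have "\<Phi> u = (\<Sum>i<k. (G i p \<bullet> u) *\<^sub>R w i) - (\<Sum>i<k. f i (q + hfield u q) *\<^sub>R w i)"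
      using w(3)[OF uA] by (simp add: \<Phi>_def)
    also have "\<dots> = - (\<Sum>i<k. (f i (q + hfield u q) - G i p \<bullet> u) *\<^sub>R w i)"
      by (simp add: scaleR_left_diff_distrib sum_subtractf)
    finally have "norm (\<Phi> u) \<le> (\<Sum>i<k. norm ((f i (q + hfield u q) - G i p \<bullet> u) *\<^sub>R w i))"
      by (simp only: norm_minus_cancel norm_sum)
    also have "\<dots> \<le> (\<Sum>i<k. 2 * e * (s * norm v) * norm (w i))"
      using fi by (intro sum_mono) (auto intro!: mult_right_mono)
    also have "\<dots> = 2 * e * (s * norm v) * (C - 1)"
      by (simp add: C_def sum_distrib_left)
    also have "\<dots> \<le> 2 * e * (s * norm v) * C"
      using e(1) s(1) v0 by (intro mult_left_mono) auto
    finally show ?thesis by (simp add: ac_simps)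
  qed
  have X: "compact X" "convex X" "X \<noteq> {}" "continuous_on X \<Phi>" "\<Phi> \<in> X \<rightarrow> X"
  proof -
    show "compact X" unfolding X_def by (intro closed_Int_compact closed_span compact_cball)
    show "convex X" unfolding X_def by (intro convex_Int convex_cball subspace_imp_convex subspace_span)
    have "0 \<in> X" using s(1) v0 by (simp add: X_def span_zero)
    then show "X \<noteq> {}" by blast
    show "continuous_on X \<Phi>"
      unfolding \<Phi>_def
    proof (intro continuous_intros)
      fix i assume "i \<in> {..<k}"
      then have i: "i < k" by simp
      have "continuous_on U (f i)" using h[OF i] by (simp add: hdiff_def)
      moreover have "(\<lambda>u. q + hfield u q) ` X \<subseteq> U"
      proof (rule image_subsetI)
        fix u assume "u \<in> X"
        then show "q + hfield u q \<in> U"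
          using R(2)[OF i, of q u] qp r(3)[OF i] s(2) by (simp add: X_def)
      qed
      ultimately show "continuous_on X (\<lambda>u. f i (q + hfield u q))"
        by (rule continuous_on_compose2[OF _ continuous_on_add[OF continuous_on_const continuous_on_hfield_vec]])
    qed
    show "\<Phi> \<in> X \<rightarrow> X"
    proof
      fix u assume u: "u \<in> X"
      have "\<Phi> u \<in> ?A"
        unfolding \<Phi>_def using u w(1) by (intro span_diff span_sum span_scale) (auto simp: X_def)
      moreover have "2 * C * e * (s * norm v) \<le> 1 * (s * norm v)"
        using e(3) s(1) by (intro mult_right_mono) auto
      then have "norm (\<Phi> u) \<le> s * norm v" using est[OF u] by simp
      ultimately show "\<Phi> u \<in> X" by (simp add: X_def)
    qed
  qed
  obtain u where u: "u \<in> X" "\<Phi> u = u"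
    using brouwer[OF X] by metis
  have nu: "norm u \<le> 2 * C * e * (s * norm v)" "norm u \<le> s * norm v"
    using est[OF u(1)] u(1) unfolding u(2) by (simp_all add: X_def)
  have sum0: "(\<Sum>i<k. f i (q + hfield u q) *\<^sub>R w i) = 0"
    using u(2) by (simp add: \<Phi>_def)
  have f0: "f j (q + hfield u q) = 0" if j: "j < k" for j
  proof -
    have "0 = G j p \<bullet> (\<Sum>i<k. f i (q + hfield u q) *\<^sub>R w i)" by (simp add: sum0)
    also have "\<dots> = (\<Sum>i<k. if i = j then f i (q + hfield u q) else 0)"
      unfolding inner_sum_right using w(2)[OF j] by (intro sum.cong) auto
    also have "\<dots> = f j (q + hfield u q)" using j by simp
    finally show ?thesis by simp
  qed
  have qU: "q + hfield u q \<in> U"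
    using R(2)[OF k, of q u] qp r(3)[OF k] nu(2) s(2) by simp
  have "q + hfield u q \<in> S" using S qU f0 by auto
  moreover have *: "q + hfield u q \<in> U'" "\<bar>f' (q + hfield u q) - f' q - G' p \<bullet> u\<bar> \<le> e * norm u"
    using r'(2)[of q u] qp r(2) nu(2) s(2) by auto
  ultimately have fz: "f' (q + hfield u q) = 0" using z' by blast
  have "f' p = 0" using z' p by blast
  then have fq': "\<bar>f' q - s * (G' p \<bullet> v)\<bar> \<le> e * (s * norm v)"
  proof -
    have "norm (s *\<^sub>R v) < r'" using s(2) r(2) unfolding ns by linarith
    then have "\<bar>f' q - f' p - G' p \<bullet> s *\<^sub>R v\<bar> \<le> e * (s * norm v)"
      using r'(2)[of p "s *\<^sub>R v"] r'(1) unfolding ns q_def by simp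
    then show ?thesis
      unfolding inner_scaleR_right \<open>f' p = 0\<close> by simp
  qed
  \<comment> \<open>Both \<open>p\<close> and the corrected point lie in \<open>S\<close>, so
    \<open>f'\<close> vanishes at both; yet its increment would be
    \<open>s * (G' p \<bullet> v)\<close> up to errors smaller than \<open>s * c\<close>.\<close>
  have "s * c = \<bar>s * (G' p \<bullet> v)\<bar>" using s(1) by (simp add: c_def abs_mult)
  also have "\<dots> \<le> e * (s * norm v) + e * norm u + \<bar>G' p \<bullet> u\<bar>"
    using fq' *(2) fz by linarith
  also have "\<bar>G' p \<bullet> u\<bar> \<le> norm (G' p) * norm u" by (rule Cauchy_Schwarz_ineq2)
  also have "e * (s * norm v) + e * norm u + norm (G' p) * norm u \<le> e * (s * norm v) + (norm (G' p) + 1) * norm u"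
    using e(2) mult_right_mono[OF e(2) norm_ge_zero[of u]] by (simp add: distrib_right)
  also have "\<dots> \<le> e * (s * norm v) + (norm (G' p) + 1) * (2 * C * e * (s * norm v))"
    using nu(1) by (intro add_left_mono mult_left_mono) auto
  also have "\<dots> = s * (e * (D - 1))" by (simp add: D_def algebra_simps)
  also have "\<dots> < s * c"
  proof -
    have "e * (D - 1) < e * D" using e(1) by (intro mult_strict_left_mono) auto
    moreover have "0 < e * D" using e(1) D by simp
    moreover have "2 * D * e = e * D + e * D" by simp
    ultimately have "e * (D - 1) < c" using e(4) by linarith
    then show ?thesis using s(1) by (rule mult_strict_left_mono)
  qed
  finally show False by simp
qed

section \<open>Mollification by right convolution\<close>

text \<open>The kernel enters through the left translate \<open>hmul (- q) p\<close>, where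
  \<open>- q\<close> is the group inverse, so left-invariant derivatives in \<open>p\<close> fall on
  \<open>h\<close>.\<close>

definition conv :: "('n::finite heis \<Rightarrow> real) \<Rightarrow> ('n heis \<Rightarrow> real) \<Rightarrow> 'n heis \<Rightarrow> real" where
  "conv c h p = (LINT q|lborel. c q * h (hmul (- q) p))"

text \<open>The substitution \<open>z = hmul (- q) p\<close> exhibits the convolution as an average
  of \<open>c\<close> over the points \<open>hmul p (- z)\<close>.\<close>

lemma conv_eq:
  assumes c: "continuous_on UNIV c" and h: "continuous_on UNIV h"
  shows "conv c h p = (LINT z|lborel. c (hmul p (- z)) * h z)"
proof -
  have cm: "continuous_on UNIV (\<lambda>z. c (hmul p (- z)))"
    by (rule continuous_on_compose2[OF c]) (auto intro!: continuous_intros)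
  have "conv c h p = (LINT q|lborel. c (hmul p (- hmul (- q) p)) * h (hmul (- q) p))"
    by (simp add: conv_def uminus_hmul)
  also have "\<dots> = (LINT z|lborel. c (hmul p (- z)) * h z)"
    by (rule integral_hmul_uminus) (intro borel_measurable_continuous_onI continuous_intros cm h)
  finally show ?thesis .
qed

lemma conv_diff:
  assumes "continuous_on UNIV c" "continuous_on UNIV c'" "continuous_on UNIV h"
    and h0: "\<And>z. z \<notin> cbox a b \<Longrightarrow> h z = 0"
  shows "conv (\<lambda>q. c q - c' q) h p = conv c h p - conv c' h p"
proof -
  have *: "integrable lborel (\<lambda>z. c (hmul p (- z)) * h z)" if c: "continuous_on UNIV c" for c
  proof -
    have "continuous_on UNIV (\<lambda>z. c (hmul p (- z)))"
      by (rule continuous_on_compose2[OF c]) (auto intro!: continuous_intros)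
    then show ?thesis
      using h0 by (intro integrable_compact_support[OF _ compact_cbox[of a b]] continuous_intros assms(3)) auto
  qed
  show ?thesis
    using assms(1-3) by (simp add: conv_eq continuous_on_diff left_diff_distrib
        Bochner_Integration.integral_diff[OF *[OF assms(1)] *[OF assms(2)]])
qed

lemma bounded_linear_frame_coef: "bounded_linear (frame_coef i p)"
proof -
  have "linear (frame_coef i p)"
    by (rule linearI; cases i) (auto simp: inner_add_right algebra_simps add_divide_distrib diff_divide_distrib)
  then show ?thesis
    by (rule linear_conv_bounded_linear[THEN iffD1])
qed

lemma frame_coef_frame: "frame_coef j p (frame i p) = (if i = j then 1 else 0)"
  by (cases p; cases i; cases j) (simp_all add: inner_axis inner_axis', auto simp: axis_def)

lemma has_derivative_left_translate:
  fixes h :: "'n::finite heis \<Rightarrow> real"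
  assumes h: "smooth h"
  shows "((\<lambda>p. h (hmul q p)) has_derivative (\<lambda>v. \<Sum>i\<in>UNIV. frame_coef i p v * fder i h (hmul q p))) (at p)"
proof -
  have l: "linear (frechet_derivative h (at (hmul q p)))"
    using smooth_has_derivative[OF h] has_derivative_linear by blast
  have eq: "frechet_derivative h (at (hmul q p)) (dtrans q v) = (\<Sum>i\<in>UNIV. frame_coef i p v * fder i h (hmul q p))" for v
  proof -
    have "linear (dtrans q)" using bounded_linear_dtrans bounded_linear.linear by blast
    then have "dtrans q v = (\<Sum>i\<in>UNIV. frame_coef i p v *\<^sub>R frame i (hmul q p))"
      by (subst frame_expansion[of v p]) (simp only: linear_sum linear_cmul dtrans_frame)
    then show ?thesis
      by (simp add: linear_sum[OF l] linear_cmul[OF l] fder_def)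
  qed
  show ?thesis
    using has_derivative_compose[OF has_derivative_hmul smooth_has_derivative[OF h], of q p]
    by (simp only: eq)
qed

lemma fder_outside:
  fixes h :: "'n::finite heis \<Rightarrow> 'b::real_normed_vector"
  shows "(\<And>z. z \<notin> cbox a b \<Longrightarrow> h z = 0) \<Longrightarrow> z \<notin> cbox a b \<Longrightarrow> fder i h z = 0"
  unfolding fder_def by (rule frechet_derivative_eq_0_outside[OF closed_cbox])

lemma conv_has_derivative:
  fixes c h :: "'n::finite heis \<Rightarrow> real"
  assumes c: "continuous_on UNIV c" and h: "smooth h" and h0: "\<And>z. z \<notin> cbox a b \<Longrightarrow> h z = 0"
  shows "(conv c h has_derivative (\<lambda>v. \<Sum>i\<in>UNIV. frame_coef i p v * conv c (fder i h) p)) (at p)"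
proof -
  \<comment> \<open>All \<open>q\<close> for which \<open>hmul (- q) p'\<close> meets the support of
    \<open>h\<close>, with \<open>p'\<close> near \<open>p\<close>, lie in this compact set; hence
    one box serves for all \<open>p'\<close>.\<close>
  define K where "K = (\<lambda>(p', z). hmul p' (- z)) ` (cball p 1 \<times> cbox a b)"
  have "compact K"
    unfolding K_def split_beta by (intro compact_continuous_image continuous_intros compact_Times compact_cball compact_cbox)
  then obtain B where B: "K \<subseteq> cbox (- B) B"
    using bounded_subset_cbox_symmetric[OF compact_imp_bounded] by blast
  have out: "hmul (- q) p' \<notin> cbox a b" if "q \<notin> cbox (- B) B" "p' \<in> ball p 1" for q p'
  proof
    assume *: "hmul (- q) p' \<in> cbox a b"
    have "(\<lambda>(p', z). hmul p' (- z)) (p', hmul (- q) p') \<in> K"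
      unfolding K_def using * that(2) by (intro imageI) auto
    then have "q \<in> K" by (simp add: uminus_hmul)
    with B that(1) show False by blast
  qed
  have ht: "continuous_on S (\<lambda>x. g (hmul (- f1 x) (f2 x)))"
    if "smooth g" "continuous_on S f1" "continuous_on S f2" for S :: "'x::topological_space set" and g f1 f2
    by (rule continuous_on_compose2[OF smooth_continuous_on[OF that(1), of UNIV]]) (auto intro!: continuous_intros that)
  have ct: "continuous_on S (\<lambda>x. c (f1 x))" if "continuous_on S f1" for S :: "'x::topological_space set" and f1
    by (rule continuous_on_compose2[OF c that]) auto
  have conv_box: "conv c g p' = integral (cbox (- B) B) (\<lambda>q. c q * g (hmul (- q) p'))"
    if "smooth g" "\<And>z. z \<notin> cbox a b \<Longrightarrow> g z = 0" "p' \<in> ball p 1" for g p'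
    unfolding conv_def using that(2)[OF out[OF _ that(3)]]
    by (intro compact_support_integral(2)[symmetric] continuous_intros ht that c) auto
  \<comment> \<open>Differentiation under the integral asks for a derivative depending continuously
    on the point as a bounded linear map, hence the passage to \<open>Blinfun\<close>.\<close>
  define L where "L i p' = Blinfun (frame_coef i p')" for i and p' :: "'n heis"
  have L: "blinfun_apply (L i p') = frame_coef i p'" for i p'
    unfolding L_def by (rule bounded_linear_Blinfun_apply[OF bounded_linear_frame_coef])
  have Lc: "continuous_on S (\<lambda>x. L i (f1 x))" if "continuous_on S f1" for S :: "'x::t2_space set" and f1 i
  proof (rule continuous_on_blinfun_componentwise)
    fix v :: "'n heis"
    show "continuous_on S (\<lambda>x. blinfun_apply (L i (f1 x)) v)"
      unfolding L by (rule continuous_on_compose2[OF smooth_continuous_on[OF smooth_frame_coef, of UNIV] that]) auto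
  qed
  define fx where "fx p' q = (\<Sum>i\<in>UNIV. (c q * fder i h (hmul (- q) p')) *\<^sub>R L i p')" for p' q
  have fx_apply: "blinfun_apply (fx p' q) = (\<lambda>v. c q * (\<Sum>i\<in>UNIV. frame_coef i p' v * fder i h (hmul (- q) p')))" for p' q
    by (auto simp: fx_def blinfun.sum_left blinfun.scaleR_left L sum_distrib_left ac_simps)
  have fxc: "continuous_on (ball p 1 \<times> cbox (- B) B) (\<lambda>(p', q). fx p' q)"
    unfolding fx_def split_beta by (intro continuous_intros ct ht Lc smooth_fder h)
  have "((\<lambda>p'. integral (cbox (- B) B) (\<lambda>q. c q * h (hmul (- q) p'))) has_derivative
      blinfun_apply (integral (cbox (- B) B) (fx p))) (at p within ball p 1)"
  proof (rule leibniz_rule[OF _ _ fxc])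
    fix p' q
    show "((\<lambda>p'. c q * h (hmul (- q) p')) has_derivative blinfun_apply (fx p' q)) (at p' within ball p 1)"
      unfolding fx_apply
      by (intro has_derivative_mult_right has_derivative_at_withinI[OF has_derivative_left_translate[OF h]])
  next
    fix p' assume "p' \<in> ball p 1"
    show "(\<lambda>q. c q * h (hmul (- q) p')) integrable_on cbox (- B) B"
      by (intro integrable_continuous continuous_intros ct ht h)
  qed auto
  then have D: "((\<lambda>p'. integral (cbox (- B) B) (\<lambda>q. c q * h (hmul (- q) p'))) has_derivative
      blinfun_apply (integral (cbox (- B) B) (fx p))) (at p)"
    by (simp add: at_within_open[OF centre_in_ball[THEN iffD2, of 1] open_ball])
  have D': "(conv c h has_derivative blinfun_apply (integral (cbox (- B) B) (fx p))) (at p)"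
    by (rule has_derivative_transform_within_open[OF D open_ball[of p 1]]) (auto simp: conv_box[OF h h0])
  have "blinfun_apply (integral (cbox (- B) B) (fx p)) v = (\<Sum>i\<in>UNIV. frame_coef i p v * conv c (fder i h) p)" for v
  proof -
    have "fx p integrable_on cbox (- B) B"
      unfolding fx_def by (intro integrable_continuous continuous_intros ct ht smooth_fder h)
    then have "blinfun_apply (integral (cbox (- B) B) (fx p)) v = integral (cbox (- B) B) (\<lambda>q. blinfun_apply (fx p q) v)"
      by (rule blinfun_apply_integral)
    also have "\<dots> = integral (cbox (- B) B) (\<lambda>q. \<Sum>i\<in>UNIV. frame_coef i p v * (c q * fder i h (hmul (- q) p)))"
      by (simp add: fx_apply sum_distrib_left ac_simps)
    also have "\<dots> = (\<Sum>i\<in>UNIV. integral (cbox (- B) B) (\<lambda>q. frame_coef i p v * (c q * fder i h (hmul (- q) p))))"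
      by (intro Henstock_Kurzweil_Integration.integral_sum integrable_continuous continuous_intros ct ht smooth_fder h) auto
    also have "\<dots> = (\<Sum>i\<in>UNIV. frame_coef i p v * conv c (fder i h) p)"
      by (simp add: conv_box[OF smooth_fder[OF h] fder_outside[OF h0]])
    finally show ?thesis .
  qed
  then have "blinfun_apply (integral (cbox (- B) B) (fx p)) = (\<lambda>v. \<Sum>i\<in>UNIV. frame_coef i p v * conv c (fder i h) p)"
    by (rule ext)
  with D' show ?thesis by simp
qed

text \<open>The derivative of a convolution is a combination, with smooth coefficients, of
  convolutions with \<open>fder i h\<close>. So the induction runs over all kernels at once, with
  \<open>c\<close> fixed and merely continuous.\<close>

lemma Ck_conv:
  fixes c h :: "'n::finite heis \<Rightarrow> real"
  assumes c: "continuous_on UNIV c"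
  shows "smooth h \<Longrightarrow> (\<And>z. z \<notin> cbox a b \<Longrightarrow> h z = 0) \<Longrightarrow> Ck k (conv c h)"
proof (induction k arbitrary: h)
  case 0
  have "isCont (conv c h) x" for x
    using conv_has_derivative[OF c 0] has_derivative_continuous by blast
  then show ?case by (simp add: continuous_at_imp_continuous_on)
next
  case (Suc k)
  show ?case
  proof (rule Ck_SucI[OF conv_has_derivative[OF c Suc.prems]])
    fix v :: "'n heis"
    have "Ck k (\<lambda>p. frame_coef i p v)" for i
      using smooth_frame_coef[of i v] by (simp add: smooth_def)
    then show "Ck k (\<lambda>x. \<Sum>i\<in>UNIV. frame_coef i x v * conv c (fder i h) x)"
      using Suc.prems by (intro Ck_sum Ck_bilinear[OF bounded_bilinear_mult] Suc.IH smooth_fder fder_outside) auto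
  qed
qed

lemma smooth_conv:
  fixes c h :: "'n::finite heis \<Rightarrow> real"
  assumes "continuous_on UNIV c" "smooth h" "\<And>z. z \<notin> cbox a b \<Longrightarrow> h z = 0"
  shows "smooth (conv c h)"
  using Ck_conv[OF assms] by (simp add: smooth_def[of "conv c h"])

lemma fder_conv:
  fixes c h :: "'n::finite heis \<Rightarrow> real"
  assumes "continuous_on UNIV c" "smooth h" "\<And>z. z \<notin> cbox a b \<Longrightarrow> h z = 0"
  shows "fder i (conv c h) p = conv c (fder i h) p"
proof -
  have "fder i (conv c h) p = (\<Sum>j\<in>UNIV. frame_coef j p (frame i p) * conv c (fder j h) p)"
    by (rule fder_at[OF conv_has_derivative[OF assms]])
  also have "\<dots> = (\<Sum>j\<in>UNIV. if i = j then conv c (fder j h) p else 0)"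
    by (intro sum.cong refl) (simp add: frame_coef_frame)
  finally show ?thesis by simp
qed

section \<open>Affine functions and dilations under convolution\<close>

definition haff :: "real \<Rightarrow> 'n::finite hvec \<Rightarrow> 'n heis \<Rightarrow> real" where
  "haff \<alpha> g q = \<alpha> + g \<bullet> (fst q, fst (snd q))"

lemma bounded_linear_hproj: "bounded_linear (\<lambda>q :: 'n::finite heis. g \<bullet> (fst q, fst (snd q)))"
  by (intro bounded_linear_compose[OF bounded_linear_inner_right] bounded_linear_Pair bounded_linear_fst
      bounded_linear_compose[OF bounded_linear_fst bounded_linear_snd])

lemma smooth_haff: "smooth (haff \<alpha> g)"
  unfolding haff_def[abs_def] by (intro smooth_add smooth_const smooth_bounded_linear bounded_linear_hproj)

lemma fder_haff: "fder i (haff \<alpha> g) = (\<lambda>p. hcoef g i)"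
proof
  fix p
  have "(haff \<alpha> g has_derivative (\<lambda>v. 0 + g \<bullet> (fst v, fst (snd v)))) (at p)"
    unfolding haff_def[abs_def]
    by (intro has_derivative_add has_derivative_const bounded_linear_imp_has_derivative bounded_linear_hproj)
  from fder_at[OF this, of i] show "fder i (haff \<alpha> g) p = hcoef g i"
    by (cases p; cases i) (auto simp: inner_prod_def inner_axis)
qed

lemma fder_const: "fder i (\<lambda>p. c) p = 0"
  by (simp add: fder_at[OF has_derivative_const])

text \<open>The horizontal linear part is a group homomorphism and integrates to zero against an
  even kernel, so averaging does not change the affine function.\<close>

lemma conv_haff:
  fixes K :: "'n::finite heis \<Rightarrow> real"
  assumes K: "continuous_on UNIV K" "\<And>z. z \<notin> cbox a b \<Longrightarrow> K z = 0" and even: "\<And>z. K (- z) = K z"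
    and int: "(LINT z|lborel. K z) = 1"
  shows "conv (haff \<alpha> g) K = haff \<alpha> g"
proof
  fix p
  have i1: "integrable lborel (\<lambda>z. (g \<bullet> (fst z, fst (snd z))) * K z)"
    by (intro integrable_compact_support[OF _ compact_cbox[of a b]] continuous_intros K(1)) (simp add: K(2))
  have i2: "integrable lborel K"
    by (rule integrable_compact_support[OF K(1) compact_cbox[of a b] K(2)])
  have "(LINT z|lborel. (g \<bullet> (fst z, fst (snd z))) * K z) = (LINT z|lborel. (g \<bullet> (fst (hmul (- z) 0), fst (snd (hmul (- z) 0)))) * K (hmul (- z) 0))"
    by (rule integral_hmul_uminus[symmetric]) (intro borel_measurable_continuous_onI continuous_intros K(1))
  also have "\<dots> = - (LINT z|lborel. (g \<bullet> (fst z, fst (snd z))) * K z)"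
    by (simp add: even inner_prod_def flip: Bochner_Integration.integral_minus)
       (simp add: algebra_simps)
  finally have odd: "(LINT z|lborel. (g \<bullet> (fst z, fst (snd z))) * K z) = 0" by simp
  have "conv (haff \<alpha> g) K p = (LINT z|lborel. haff \<alpha> g (hmul p (- z)) * K z)"
    by (rule conv_eq[OF smooth_continuous_on[OF smooth_haff] K(1)])
  also have "\<dots> = (LINT z|lborel. haff \<alpha> g p * K z - (g \<bullet> (fst z, fst (snd z))) * K z)"
  proof (rule Bochner_Integration.integral_cong[OF refl])
    fix z
    have "haff \<alpha> g (hmul p (- z)) = haff \<alpha> g p - g \<bullet> (fst z, fst (snd z))"
      by (simp add: haff_def hmul_eq inner_prod_def inner_diff_right)
    then show "haff \<alpha> g (hmul p (- z)) * K z = haff \<alpha> g p * K z - (g \<bullet> (fst z, fst (snd z))) * K z"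
      by (simp only: left_diff_distrib)
  qed
  also have "\<dots> = haff \<alpha> g p"
    using i1 i2 by (simp add: odd int)
  finally show "conv (haff \<alpha> g) K p = haff \<alpha> g p" .
qed

fun weight :: "'n hidx \<Rightarrow> nat" where
  "weight IT = 2" | "weight i = 1"

lemma hdil_frame: "hdil r (frame i z) = r ^ weight i *\<^sub>R frame i (hdil r z)"
  by (cases z; cases i) (auto simp: power2_eq_square)

lemma bounded_linear_hdil: "bounded_linear (hdil r)"
proof -
  have "linear (hdil r)"
    by (rule linearI) (auto simp: hdil_eq algebra_simps)
  then show ?thesis
    by (rule linear_conv_bounded_linear[THEN iffD1])
qed

lemma smooth_hdil: "smooth h \<Longrightarrow> smooth (\<lambda>z. h (hdil r z))"
  by (rule smooth_compose[OF _ smooth_bounded_linear[OF bounded_linear_hdil]])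

lemma fder_hdil:
  fixes h :: "'n::finite heis \<Rightarrow> real"
  assumes h: "smooth h"
  shows "fder i (\<lambda>z. h (hdil r z)) z = r ^ weight i * fder i h (hdil r z)"
proof -
  have "linear (frechet_derivative h (at (hdil r z)))"
    using smooth_has_derivative[OF h] has_derivative_linear by blast
  then show ?thesis
    by (subst fder_at[OF has_derivative_compose[OF bounded_linear_imp_has_derivative[OF bounded_linear_hdil] smooth_has_derivative[OF h]]])
       (simp add: hdil_frame linear_cmul fder_def)
qed

lemma hdil_hdil: "hdil r (hdil s z) = hdil (r * s) z"
  by (simp add: hdil_eq power_mult_distrib)

lemma hdil_1 [simp]: "hdil 1 z = z"
  by (simp add: hdil_eq)

lemma hdil_uminus: "- hdil r z = hdil r (- z)"
  by (simp add: hdil_eq)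

text \<open>The change of variables \<open>w = hdil r z\<close> moves the dilation from the kernel
  to the argument of \<open>g\<close>. The factor \<open>s\<close> stands for the powers of
  \<open>r\<close> produced by differentiating the kernel.\<close>

lemma conv_hdil:
  fixes g H :: "'n::finite heis \<Rightarrow> real"
  assumes g: "continuous_on UNIV g" and H: "continuous_on UNIV H" and r: "0 < r"
    and J: "\<And>f :: 'n heis \<Rightarrow> real. f \<in> borel_measurable borel \<Longrightarrow> (LINT q|lborel. f q) = J * (LINT q|lborel. f (hdil r q))"
  shows "conv g (\<lambda>z. s * (J * H (hdil r z))) p = s * (LINT w|lborel. g (hmul p (hdil (1 / r) (- w))) * H w)"
proof -
  have cd: "continuous_on S (\<lambda>x. hdil a (f x))" if "continuous_on S f" for S :: "'x::topological_space set" and f a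
    by (rule continuous_on_compose2[OF continuous_on_hdil[of UNIV] that]) auto
  have gc: "continuous_on UNIV (\<lambda>w. g (hmul p (hdil (1 / r) (- w))))"
    by (rule continuous_on_compose2[OF g]) (auto intro!: continuous_intros cd)
  have Hc: "continuous_on UNIV (\<lambda>z. s * (J * H (hdil r z)))"
    by (intro continuous_intros continuous_on_compose2[OF H continuous_on_hdil]) auto
  have "conv g (\<lambda>z. s * (J * H (hdil r z))) p = (LINT z|lborel. g (hmul p (- z)) * (s * (J * H (hdil r z))))"
    by (rule conv_eq[OF g Hc])
  also have "\<dots> = (LINT z|lborel. s * J * (g (hmul p (hdil (1 / r) (- hdil r z))) * H (hdil r z)))"
    using r by (simp add: hdil_uminus hdil_hdil ac_simps)
  also have "\<dots> = s * (J * (LINT z|lborel. g (hmul p (hdil (1 / r) (- hdil r z))) * H (hdil r z)))"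
    by simp
  also have "J * (LINT z|lborel. g (hmul p (hdil (1 / r) (- hdil r z))) * H (hdil r z)) =
      (LINT w|lborel. g (hmul p (hdil (1 / r) (- w))) * H w)"
    by (rule J[symmetric]) (intro borel_measurable_continuous_onI continuous_intros gc H)
  finally show ?thesis .
qed

lemma hdil_inner: "b \<in> Basis \<Longrightarrow> hdil r p \<bullet> b = (if b = (0, 0, 1) then r\<^sup>2 else r) * (p \<bullet> b)"
  by (auto simp: Basis_prod_def hdil_eq inner_prod_def zero_prod_def)

lemma hdil_cbox_shrink:
  fixes z :: "'n::finite heis"
  assumes r: "1 \<le> r" and z: "hdil r z \<in> cbox (- One) One"
  shows "z \<in> cbox (- One) One"
  unfolding mem_box
proof
  fix b :: "'n heis" assume b: "b \<in> Basis"
  define c where "c = (if b = (0, 0, 1) then r\<^sup>2 else r)"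
  have c: "1 \<le> c" using r by (auto simp: c_def one_le_power)
  have "\<bar>c * (z \<bullet> b)\<bar> \<le> 1"
    using z b unfolding mem_box c_def by (auto simp: hdil_inner abs_le_iff)
  then have "\<bar>z \<bullet> b\<bar> \<le> 1"
    using c mult_right_mono[OF c, of "\<bar>z \<bullet> b\<bar>"] by (simp add: abs_mult)
  then show "- One \<bullet> b \<le> z \<bullet> b \<and> z \<bullet> b \<le> One \<bullet> b"
    using b by (auto simp: abs_le_iff)
qed

lemma fder_cmult: "smooth h \<Longrightarrow> fder i (\<lambda>z. c * h z) z = c * fder i h z" for h :: "'n::finite heis \<Rightarrow> real"
  by (rule fder_bounded_linear[OF bounded_linear_mult_right])

lemma bump_One_even: "bump (- One) One (- z) = bump (- One) One z"
  by (simp add: bump_def mult.commute add.commute)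

text \<open>Replacing \<open>f\<close> by \<open>f\<close> minus its affine Taylor polynomial costs nothing under the mollifier,
  so each derivative of the mollified function only loses a factor \<open>1 / \<delta>\<close> against an error \<open>o(\<delta>)\<close>.\<close>

lemma hdiff_approximation:
  fixes f :: "'n::finite heis \<Rightarrow> real"
  assumes h: "hdiff U f G" and C: "compact C" "C \<subseteq> U"
  obtains F :: "nat \<Rightarrow> 'n heis \<Rightarrow> real" and \<delta> :: "nat \<Rightarrow> real"
  where "\<And>\<nu>. 0 < \<delta> \<nu>" "\<And>\<nu>. \<delta> \<nu> \<le> 1" "\<delta> \<longlonglongrightarrow> 0" "\<And>\<nu>. smooth (F \<nu>)"
    "\<And>e. 0 < e \<Longrightarrow> \<forall>\<^sub>F \<nu> in sequentially. \<forall>p\<in>C. \<bar>F \<nu> p - f p\<bar> \<le> e * \<delta> \<nu> \<and>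
      (\<forall>i. i \<noteq> IT \<longrightarrow> \<bar>fder i (F \<nu>) p - hcoef (G p) i\<bar> \<le> e) \<and>
      (\<forall>i j. i \<noteq> IT \<longrightarrow> j \<noteq> IT \<longrightarrow> \<bar>\<delta> \<nu> * fder j (fder i (F \<nu>)) p\<bar> \<le> e)"
proof -
  let ?Q = "cbox (- One) One :: 'n heis set"
  define I where "I = (LINT z|lborel. bump (- One) (One :: 'n heis) z)"
  have "0 \<in> box (- One) (One :: 'n heis)" by (simp add: mem_box)
  then have I: "0 < I"
    unfolding I_def by (intro bump_integral_pos) auto
  define K where "K z = inverse I * bump (- One) (One :: 'n heis) z" for z
  have K: "smooth K" "\<And>z. z \<notin> ?Q \<Longrightarrow> K z = 0" "\<And>z. K (- z) = K z" "(LINT z|lborel. K z) = 1"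
  proof -
    show "smooth K" unfolding K_def by (intro smooth_cmult smooth_bump)
    show "K z = 0" if "z \<notin> ?Q" for z
      using that box_subset_cbox[of "- One" "One :: 'n heis"] bump_eq_0[of z "- One" One] by (auto simp: K_def)
    show "K (- z) = K z" for z by (simp only: K_def bump_One_even)
    show "(LINT z|lborel. K z) = 1" using I by (simp add: K_def I_def[symmetric])
  qed
  define r where "r \<nu> = real (Suc \<nu>)" for \<nu>
  have r: "0 < r \<nu>" "1 \<le> r \<nu>" for \<nu> by (simp_all add: r_def)
  define \<delta> where "\<delta> \<nu> = 1 / r \<nu>" for \<nu>
  have \<delta>: "0 < \<delta> \<nu>" "\<delta> \<nu> \<le> 1" "r \<nu> * \<delta> \<nu> = 1" for \<nu> using r[of \<nu>] by (simp_all add: \<delta>_def)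
  have \<delta>lim: "\<delta> \<longlonglongrightarrow> 0"
    unfolding \<delta>_def[abs_def] r_def using LIMSEQ_inverse_real_of_nat by (simp add: inverse_eq_divide)
  have "\<exists>J>0. \<forall>f :: 'n heis \<Rightarrow> real. f \<in> borel_measurable borel \<longrightarrow>
      (LINT q|lborel. f q) = J * (LINT q|lborel. f (hdil (r \<nu>) q))" for \<nu>
    using integral_hdil[OF r(1)[of \<nu>], where 'n = 'n] by metis
  then obtain J where J: "\<And>\<nu>. 0 < J \<nu>" "\<And>\<nu> (f :: 'n heis \<Rightarrow> real). f \<in> borel_measurable borel \<Longrightarrow>
      (LINT q|lborel. f q) = J \<nu> * (LINT q|lborel. f (hdil (r \<nu>) q))"
    by metis
  define Kd where "Kd \<nu> z = J \<nu> * K (hdil (r \<nu>) z)" for \<nu> z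
  have Kd: "smooth (Kd \<nu>)" "\<And>z. z \<notin> ?Q \<Longrightarrow> Kd \<nu> z = 0" "\<And>z. Kd \<nu> (- z) = Kd \<nu> z" "(LINT z|lborel. Kd \<nu> z) = 1" for \<nu>
  proof -
    show "smooth (Kd \<nu>)" unfolding Kd_def by (intro smooth_cmult smooth_hdil K(1))
    show "Kd \<nu> z = 0" if "z \<notin> ?Q" for z
      using that hdil_cbox_shrink[OF r(2)[of \<nu>], of z] K(2)[of "hdil (r \<nu>) z"] by (auto simp: Kd_def)
    show "Kd \<nu> (- z) = Kd \<nu> z" for z by (simp only: Kd_def hdil_uminus[symmetric] K(3))
    show "(LINT z|lborel. Kd \<nu> z) = 1"
      using J(2)[of K \<nu>] K(4) smooth_continuous_on[OF K(1), of UNIV]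
      by (simp add: Kd_def borel_measurable_continuous_onI)
  qed
  have Kdc: "continuous_on UNIV (Kd \<nu>)" for \<nu> by (rule smooth_continuous_on[OF Kd(1)])
  have w1: "weight i = 1" if "i \<noteq> IT" for i :: "'n hidx" using that by (cases i) auto
  have fKd: "fder i (Kd \<nu>) = (\<lambda>z. r \<nu> * (J \<nu> * fder i K (hdil (r \<nu>) z)))" if "i \<noteq> IT" for i \<nu>
    unfolding Kd_def[abs_def] using w1[OF that]
    by (simp add: fun_eq_iff fder_cmult[OF smooth_hdil[OF K(1)]] fder_hdil[OF K(1)])
  have ffKd: "fder j (fder i (Kd \<nu>)) = (\<lambda>z. (r \<nu> * r \<nu>) * (J \<nu> * fder j (fder i K) (hdil (r \<nu>) z)))"
    if "i \<noteq> IT" "j \<noteq> IT" for i j \<nu>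
    unfolding fKd[OF that(1)] using w1[OF that(2)]
    by (simp add: fun_eq_iff fder_cmult smooth_cmult smooth_hdil smooth_fder K(1) fder_hdil)
  obtain d0 where d0: "0 < d0" "\<And>p \<delta> w. p \<in> C \<Longrightarrow> 0 < \<delta> \<Longrightarrow> \<delta> < d0 \<Longrightarrow> w \<in> ?Q \<Longrightarrow> hmul p (hdil \<delta> w) \<in> U"
    using hdiff_taylor[OF h C zero_less_one] by metis
  \<comment> \<open>A compact subset of \<open>U\<close> containing all points over which
    \<open>f\<close> is averaged at small scales; \<open>c\<close> will extend \<open>f\<close>
    continuously beyond it.\<close>
  define C' where "C' = (\<lambda>(p, s, w). hmul p (hdil s w)) ` (C \<times> {0..d0/2} \<times> ?Q)"
  have C'c: "compact C'"
    unfolding C'_def split_beta hdil_eq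
    by (intro compact_continuous_image continuous_intros compact_Times C(1) compact_cbox compact_Icc)
  have C'U: "C' \<subseteq> U"
  proof
    fix x assume "x \<in> C'"
    then obtain p s w where x: "p \<in> C" "0 \<le> s" "s \<le> d0 / 2" "w \<in> ?Q" "x = hmul p (hdil s w)"
      by (auto simp: C'_def)
    show "x \<in> U"
    proof (cases "s = 0")
      case True
      then have "hdil s w = 0" by (simp add: hdil_eq zero_prod_def)
      then show ?thesis using x C(2) by auto
    next
      case False
      then show ?thesis using x d0 by auto
    qed
  qed
  have "continuous_on C' f"
    using h C'U unfolding hdiff_def by (blast intro: continuous_on_subset)
  then obtain c where c: "continuous_on UNIV c" "\<And>x. x \<in> C' \<Longrightarrow> c x = f x"
    using Tietze_unbounded[of C' f UNIV] compact_imp_closed[OF C'c] by auto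
  define F where "F \<nu> = conv c (Kd \<nu>)" for \<nu>
  have F: "smooth (F \<nu>)" for \<nu>
    unfolding F_def by (rule smooth_conv[OF c(1) Kd(1,2)])
  \<comment> \<open>Bounds the \<open>L\<^sup>1\<close> norms of the kernel and of its first and
    second frame derivatives; the 1 makes it positive.\<close>
  define M where "M = 1 + (LINT z|lborel. \<bar>K z\<bar>) + (\<Sum>i\<in>UNIV. LINT z|lborel. \<bar>fder i K z\<bar>) +
    (\<Sum>i\<in>UNIV. \<Sum>j\<in>UNIV. LINT z|lborel. \<bar>fder j (fder i K) z\<bar>)"
  have M: "0 < M" "(LINT z|lborel. \<bar>K z\<bar>) \<le> M" "\<And>i. (LINT z|lborel. \<bar>fder i K z\<bar>) \<le> M"
    "\<And>i j. (LINT z|lborel. \<bar>fder j (fder i K) z\<bar>) \<le> M"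
  proof -
    have p1: "0 \<le> (LINT z|lborel. \<bar>K z\<bar>)" by simp
    have p2: "0 \<le> (\<Sum>i\<in>UNIV. LINT z|lborel. \<bar>fder i K z\<bar>)" by (intro sum_nonneg) simp
    have p3: "0 \<le> (\<Sum>i\<in>UNIV. \<Sum>j\<in>UNIV. LINT z|lborel. \<bar>fder j (fder i K) z\<bar>)" by (intro sum_nonneg) simp
    show "0 < M" "(LINT z|lborel. \<bar>K z\<bar>) \<le> M" using p1 p2 p3 unfolding M_def by linarith+
    fix i j
    have "(LINT z|lborel. \<bar>fder i K z\<bar>) \<le> (\<Sum>i\<in>UNIV. LINT z|lborel. \<bar>fder i K z\<bar>)"
      by (rule member_le_sum) auto
    then show "(LINT z|lborel. \<bar>fder i K z\<bar>) \<le> M" using p1 p3 unfolding M_def by linarith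
    have "(LINT z|lborel. \<bar>fder j (fder i K) z\<bar>) \<le> (\<Sum>j\<in>UNIV. LINT z|lborel. \<bar>fder j (fder i K) z\<bar>)"
      by (rule member_le_sum) auto
    also have "\<dots> \<le> (\<Sum>i\<in>UNIV. \<Sum>j\<in>UNIV. LINT z|lborel. \<bar>fder j (fder i K) z\<bar>)"
      by (rule member_le_sum[where f = "\<lambda>i. \<Sum>j\<in>UNIV. LINT z|lborel. \<bar>fder j (fder i K) z\<bar>"]) (auto intro: sum_nonneg)
    finally show "(LINT z|lborel. \<bar>fder j (fder i K) z\<bar>) \<le> M" using p1 p2 unfolding M_def by linarith
  qed
  show ?thesis
  proof (rule that[OF \<delta>(1,2) \<delta>lim F])
    fix e :: real assume e: "0 < e"
    then have eM: "0 < e / M" using M(1) by simp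
    obtain d where d: "0 < d" "\<And>p \<delta> w. p \<in> C \<Longrightarrow> 0 < \<delta> \<Longrightarrow> \<delta> < d \<Longrightarrow> w \<in> ?Q \<Longrightarrow>
        \<bar>f (hmul p (hdil \<delta> w)) - f p - \<delta> * (G p \<bullet> (fst w, fst (snd w)))\<bar> \<le> e / M * \<delta>"
      using hdiff_taylor[OF h C eM] by metis
    have "\<forall>\<^sub>F \<nu> in sequentially. \<delta> \<nu> < min d (d0 / 2)"
      using order_tendstoD(2)[OF \<delta>lim, of "min d (d0 / 2)"] d(1) d0(1) by simp
    then show "\<forall>\<^sub>F \<nu> in sequentially. \<forall>p\<in>C. \<bar>F \<nu> p - f p\<bar> \<le> e * \<delta> \<nu> \<and>
      (\<forall>i. i \<noteq> IT \<longrightarrow> \<bar>fder i (F \<nu>) p - hcoef (G p) i\<bar> \<le> e) \<and>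
      (\<forall>i j. i \<noteq> IT \<longrightarrow> j \<noteq> IT \<longrightarrow> \<bar>\<delta> \<nu> * fder j (fder i (F \<nu>)) p\<bar> \<le> e)"
    proof eventually_elim
      case (elim \<nu>)
      show ?case
      proof
        fix p assume p: "p \<in> C"
        \<comment> \<open>The horizontal Taylor polynomial of \<open>f\<close> at \<open>p\<close>.
          Since convolution leaves it unchanged, it contributes exactly \<open>f p\<close>,
          \<open>G p\<close> and 0 to the value and to the first and second derivatives at
          \<open>p\<close>.\<close>
        define a where "a = haff (f p - G p \<bullet> (fst p, fst (snd p))) (G p)"
        have ac: "continuous_on UNIV a" unfolding a_def by (rule smooth_continuous_on[OF smooth_haff])
        have ap: "a p = f p" by (simp add: a_def haff_def)
        have ca: "continuous_on UNIV (\<lambda>q. c q - a q)" by (intro continuous_intros c(1) ac)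
        have aK: "conv a (Kd \<nu>) = a"
          unfolding a_def by (rule conv_haff[OF Kdc Kd(2-4)])
        have ptw: "\<bar>c (hmul p (hdil (1 / r \<nu>) (- w))) - a (hmul p (hdil (1 / r \<nu>) (- w)))\<bar> \<le> e / M * \<delta> \<nu>"
          if w: "w \<in> ?Q" for w
        proof -
          have w': "- w \<in> ?Q" using w by (auto simp: mem_box)
          have "hmul p (hdil (\<delta> \<nu>) (- w)) \<in> C'"
            unfolding C'_def using p elim w' \<delta>(1)[of \<nu>] by (intro image_eqI[of _ _ "(p, \<delta> \<nu>, - w)"]) auto
          then have "c (hmul p (hdil (\<delta> \<nu>) (- w))) = f (hmul p (hdil (\<delta> \<nu>) (- w)))" by (rule c(2))
          moreover have "a (hmul p (hdil (\<delta> \<nu>) (- w))) = f p + \<delta> \<nu> * (G p \<bullet> (fst (- w), fst (snd (- w))))"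
            by (simp add: a_def haff_def hmul_eq hdil_eq inner_prod_def inner_diff_right inner_add_right algebra_simps)
          ultimately show ?thesis
            using d(2)[OF p \<delta>(1)[of \<nu>] _ w'] elim by (simp add: \<delta>_def[symmetric] diff_diff_eq)
        qed
        \<comment> \<open>One estimate for the value and for both orders of derivatives, used with
          \<open>s\<close> equal to 1, \<open>r \<nu>\<close> and
          \<open>r \<nu> * r \<nu>\<close>.\<close>
        have est: "\<bar>conv c (\<lambda>z. s * (J \<nu> * H (hdil (r \<nu>) z))) p - conv a (\<lambda>z. s * (J \<nu> * H (hdil (r \<nu>) z))) p\<bar> \<le> \<bar>s\<bar> * (e * \<delta> \<nu>)"
          if H: "continuous_on UNIV H" "\<And>z. z \<notin> ?Q \<Longrightarrow> H z = 0" "(LINT z|lborel. \<bar>H z\<bar>) \<le> M" for s H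
        proof -
          have Hc: "continuous_on UNIV (\<lambda>z. s * (J \<nu> * H (hdil (r \<nu>) z)))"
            by (intro continuous_intros continuous_on_compose2[OF H(1) continuous_on_hdil]) auto
          have H0: "s * (J \<nu> * H (hdil (r \<nu>) z)) = 0" if "z \<notin> ?Q" for z
            using that hdil_cbox_shrink[OF r(2)[of \<nu>], of z] H(2)[of "hdil (r \<nu>) z"] by auto
          define g where "g w = (c (hmul p (hdil (1 / r \<nu>) (- w))) - a (hmul p (hdil (1 / r \<nu>) (- w)))) * H w" for w
          have gc: "continuous_on UNIV g"
            unfolding g_def
            by (intro continuous_intros H(1) continuous_on_compose2[OF c(1)] continuous_on_compose2[OF ac]
                continuous_on_compose2[OF continuous_on_hdil[of UNIV]]) auto
          have gi: "integrable lborel g"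
            by (rule integrable_compact_support[OF gc compact_cbox[of "- One" One]]) (simp add: g_def H(2))
          have Hi: "integrable lborel (\<lambda>w. \<bar>H w\<bar>)"
            by (rule integrable_compact_support[OF continuous_on_rabs[OF H(1)] compact_cbox[of "- One" One]]) (simp add: H(2))
          have "conv c (\<lambda>z. s * (J \<nu> * H (hdil (r \<nu>) z))) p - conv a (\<lambda>z. s * (J \<nu> * H (hdil (r \<nu>) z))) p =
              conv (\<lambda>q. c q - a q) (\<lambda>z. s * (J \<nu> * H (hdil (r \<nu>) z))) p"
            by (rule conv_diff[OF c(1) ac Hc H0, symmetric])
          also have "\<dots> = s * (LINT w|lborel. g w)"
            unfolding g_def by (rule conv_hdil[OF ca H(1) r(1) J(2)])
          finally have "\<bar>conv c (\<lambda>z. s * (J \<nu> * H (hdil (r \<nu>) z))) p - conv a (\<lambda>z. s * (J \<nu> * H (hdil (r \<nu>) z))) p\<bar> =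
              \<bar>s\<bar> * \<bar>LINT w|lborel. g w\<bar>"
            by (simp only: abs_mult)
          also have "\<bar>LINT w|lborel. g w\<bar> \<le> (LINT w|lborel. \<bar>g w\<bar>)"
            by (rule integral_abs_bound)
          also have "\<dots> \<le> (LINT w|lborel. e / M * \<delta> \<nu> * \<bar>H w\<bar>)"
          proof (rule integral_mono[OF integrable_abs[OF gi] integrable_mult_right[OF Hi]])
            fix w
            show "\<bar>g w\<bar> \<le> e / M * \<delta> \<nu> * \<bar>H w\<bar>"
            proof (cases "w \<in> ?Q")
              case True
              then show ?thesis
                unfolding g_def abs_mult by (intro mult_right_mono ptw) auto
            qed (simp add: g_def H(2))
          qed
          also have "\<dots> = e / M * \<delta> \<nu> * (LINT w|lborel. \<bar>H w\<bar>)" by simp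
          also have "\<dots> \<le> e / M * \<delta> \<nu> * M"
            by (rule mult_left_mono[OF H(3) less_imp_le[OF mult_pos_pos[OF eM \<delta>(1)]]])
          also have "\<dots> = e * \<delta> \<nu>" using M(1) by simp
          finally show ?thesis by (simp add: mult_left_mono)
        qed
        have "\<bar>F \<nu> p - f p\<bar> \<le> \<bar>1\<bar> * (e * \<delta> \<nu>)"
        proof -
          have eq: "Kd \<nu> = (\<lambda>z. 1 * (J \<nu> * K (hdil (r \<nu>) z)))" by (simp add: Kd_def[abs_def])
          have "F \<nu> p - f p = conv c (Kd \<nu>) p - conv a (Kd \<nu>) p" by (simp add: F_def aK ap)
          also have "\<bar>\<dots>\<bar> \<le> \<bar>1\<bar> * (e * \<delta> \<nu>)"
            unfolding eq by (rule est[OF smooth_continuous_on[OF K(1)] K(2) M(2)])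
          finally show ?thesis .
        qed
        moreover have "\<bar>fder i (F \<nu>) p - hcoef (G p) i\<bar> \<le> e" if i: "i \<noteq> IT" for i
        proof -
          have "hcoef (G p) i = fder i (conv a (Kd \<nu>)) p" by (simp only: aK) (simp add: a_def fder_haff)
          also have "\<dots> = conv a (fder i (Kd \<nu>)) p" by (rule fder_conv[OF ac Kd(1,2)])
          finally have "fder i (F \<nu>) p - hcoef (G p) i = conv c (fder i (Kd \<nu>)) p - conv a (fder i (Kd \<nu>)) p"
            unfolding F_def by (simp only: fder_conv[OF c(1) Kd(1,2)])
          also have "\<bar>\<dots>\<bar> \<le> \<bar>r \<nu>\<bar> * (e * \<delta> \<nu>)"
            unfolding fKd[OF i]
            by (rule est[OF smooth_continuous_on[OF smooth_fder[OF K(1)]] fder_outside[OF K(2)] M(3)])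
          also have "\<dots> = e * (r \<nu> * \<delta> \<nu>)" using r(1)[of \<nu>] by simp
          finally show ?thesis by (simp add: \<delta>(3))
        qed
        moreover have "\<bar>\<delta> \<nu> * fder j (fder i (F \<nu>)) p\<bar> \<le> e" if ij: "i \<noteq> IT" "j \<noteq> IT" for i j
        proof -
          have ff: "fder j (fder i (conv b (Kd \<nu>))) p = conv b (fder j (fder i (Kd \<nu>))) p" if b: "continuous_on UNIV b" for b
          proof -
            have "fder i (conv b (Kd \<nu>)) = conv b (fder i (Kd \<nu>))" using fder_conv[OF b Kd(1,2)] by (intro ext)
            then show ?thesis using fder_conv[OF b smooth_fder[OF Kd(1)] fder_outside[OF Kd(2)]] by simp
          qed
          have "conv a (fder j (fder i (Kd \<nu>))) p = 0"
            unfolding ff[OF ac, symmetric] aK by (simp add: a_def fder_haff fder_const)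
          then have "fder j (fder i (F \<nu>)) p = conv c (fder j (fder i (Kd \<nu>))) p - conv a (fder j (fder i (Kd \<nu>))) p"
            by (simp add: F_def ff[OF c(1)])
          also have "\<bar>\<dots>\<bar> \<le> \<bar>r \<nu> * r \<nu>\<bar> * (e * \<delta> \<nu>)"
            unfolding ffKd[OF ij]
            by (rule est[OF smooth_continuous_on[OF smooth_fder[OF smooth_fder[OF K(1)]]] fder_outside[OF fder_outside[OF K(2)]] M(4)])
          finally have "\<delta> \<nu> * \<bar>fder j (fder i (F \<nu>)) p\<bar> \<le> \<delta> \<nu> * (\<bar>r \<nu> * r \<nu>\<bar> * (e * \<delta> \<nu>))"
            using \<delta>(1)[of \<nu>] by (intro mult_left_mono) auto
          also have "\<dots> = e * (r \<nu> * \<delta> \<nu>) * (r \<nu> * \<delta> \<nu>)" using r(1)[of \<nu>] by simp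
          finally show ?thesis using \<delta>(1)[of \<nu>] by (simp add: \<delta>(3) abs_mult)
        qed
        ultimately show "\<bar>F \<nu> p - f p\<bar> \<le> e * \<delta> \<nu> \<and>
          (\<forall>i. i \<noteq> IT \<longrightarrow> \<bar>fder i (F \<nu>) p - hcoef (G p) i\<bar> \<le> e) \<and>
          (\<forall>i j. i \<noteq> IT \<longrightarrow> j \<noteq> IT \<longrightarrow> \<bar>\<delta> \<nu> * fder j (fder i (F \<nu>)) p\<bar> \<le> e)"
          by simp
      qed
    qed
  qed
qed

section \<open>Test functions concentrating on a level set\<close>

lemma continuous_bounded_on_compact:
  fixes g :: "'a::metric_space \<Rightarrow> real"
  assumes "compact C" "continuous_on C g"
  obtains B where "0 \<le> B" "\<And>x. x \<in> C \<Longrightarrow> \<bar>g x\<bar> \<le> B"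
proof -
  have "bounded (g ` C)"
    by (intro compact_imp_bounded compact_continuous_image assms)
  then obtain B where "0 < B" "\<forall>x\<in>C. \<bar>g x\<bar> \<le> B"
    unfolding bounded_pos by auto
  with that[of B] show ?thesis by auto
qed

lemma continuous_bounded_on_compact_family:
  fixes g :: "'i::finite \<Rightarrow> 'a::metric_space \<Rightarrow> real"
  assumes "compact C" "\<And>i. continuous_on C (g i)"
  obtains B where "0 \<le> B" "\<And>i x. x \<in> C \<Longrightarrow> \<bar>g i x\<bar> \<le> B"
proof -
  have "\<exists>B. 0 \<le> B \<and> (\<forall>x\<in>C. \<bar>g i x\<bar> \<le> B)" for i
    using continuous_bounded_on_compact[OF assms(1) assms(2)[of i]] by metis
  then obtain B where B: "\<And>i. 0 \<le> B i" "\<And>i x. x \<in> C \<Longrightarrow> \<bar>g i x\<bar> \<le> B i"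
    by metis
  show ?thesis
  proof (rule that[of "\<Sum>i\<in>UNIV. B i"])
    show "0 \<le> (\<Sum>i\<in>UNIV. B i)" by (intro sum_nonneg B(1))
    fix i x assume "x \<in> C"
    then have "\<bar>g i x\<bar> \<le> B i" by (rule B(2))
    also have "\<dots> \<le> (\<Sum>i\<in>UNIV. B i)" by (rule member_le_sum) (auto intro: B(1))
    finally show "\<bar>g i x\<bar> \<le> (\<Sum>i\<in>UNIV. B i)" .
  qed
qed

lemma isCont_Psi2: "isCont Psi2 s"
  using smooth_continuous_on[OF smooth_Psi2, of UNIV] by (simp add: continuous_on_eq_continuous_at)

text \<open>On the level set the quotient tends to 0, because the mollification error is
  o(\<delta>). Off it the numerator stays away from 0, the quotient blows up, and the decay of
  \<open>Psi2\<close> takes over.\<close>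

lemma Psi2_limit:
  assumes \<delta>: "\<And>\<nu>. 0 < \<delta> \<nu>" "\<delta> \<longlonglongrightarrow> 0" and F: "\<And>e. 0 < e \<Longrightarrow> \<forall>\<^sub>F \<nu> in sequentially. \<bar>F \<nu> - x\<bar> \<le> e * \<delta> \<nu>"
  shows "(\<lambda>\<nu>. Psi2 (F \<nu> / \<delta> \<nu>)) \<longlonglongrightarrow> (if x = 0 then 1 else 0)"
proof (cases "x = 0")
  case True
  have "(\<lambda>\<nu>. F \<nu> / \<delta> \<nu>) \<longlonglongrightarrow> 0"
  proof (rule tendstoI)
    fix e :: real assume e: "0 < e"
    then have "0 < e / 2" by simp
    from F[OF this] show "\<forall>\<^sub>F \<nu> in sequentially. dist (F \<nu> / \<delta> \<nu>) 0 < e"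
    proof eventually_elim
      case (elim \<nu>)
      have "\<bar>F \<nu> / \<delta> \<nu>\<bar> \<le> e / 2"
        using elim True \<delta>(1)[of \<nu>] by (simp add: abs_divide pos_divide_le_eq)
      with e show ?case unfolding dist_real_def by linarith
    qed
  qed
  from isCont_tendsto_compose[OF isCont_Psi2 this] show ?thesis
    using True by (simp add: Psi2_0)
next
  case False
  have 1: "\<forall>\<^sub>F \<nu> in sequentially. \<bar>F \<nu> - x\<bar> \<le> 1 * \<delta> \<nu>" by (rule F) simp
  have 2: "\<forall>\<^sub>F \<nu> in sequentially. \<delta> \<nu> < \<bar>x\<bar> / 2"
    using order_tendstoD(2)[OF \<delta>(2), of "\<bar>x\<bar> / 2"] False by simp
  have "\<forall>\<^sub>F \<nu> in sequentially. norm (Psi2 (F \<nu> / \<delta> \<nu>)) \<le> (2 * \<delta> \<nu> / \<bar>x\<bar>)\<^sup>2"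
    using 1 2
  proof eventually_elim
    case (elim \<nu>)
    have x: "0 < \<bar>x\<bar> / 2" using False by simp
    have "\<bar>x\<bar> / 2 \<le> \<bar>F \<nu>\<bar>" using elim by linarith
    then have "(\<bar>x\<bar> / 2)\<^sup>2 \<le> (F \<nu>)\<^sup>2"
      using x by (metis abs_le_square_iff abs_of_pos)
    then have "(\<bar>x\<bar> / 2 / \<delta> \<nu>)\<^sup>2 \<le> (F \<nu> / \<delta> \<nu>)\<^sup>2"
      unfolding power_divide[of "\<bar>x\<bar> / 2" "\<delta> \<nu>" 2] power_divide[of "F \<nu>" "\<delta> \<nu>" 2]
      by (rule divide_right_mono) simp
    then have "(\<bar>x\<bar> / 2 / \<delta> \<nu>)\<^sup>2 \<le> 1 + (F \<nu> / \<delta> \<nu>)\<^sup>2" by simp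
    moreover have "0 < (\<bar>x\<bar> / 2 / \<delta> \<nu>)\<^sup>2" using x \<delta>(1)[of \<nu>] by (intro zero_less_power divide_pos_pos) auto
    ultimately have "inverse (1 + (F \<nu> / \<delta> \<nu>)\<^sup>2) \<le> inverse ((\<bar>x\<bar> / 2 / \<delta> \<nu>)\<^sup>2)"
      by (rule le_imp_inverse_le)
    also have "\<dots> = (2 * \<delta> \<nu> / \<bar>x\<bar>)\<^sup>2" by (simp add: power_divide power_mult_distrib)
    finally show ?case using Psi2_bound[of "F \<nu> / \<delta> \<nu>"] by simp
  qed
  moreover have "(\<lambda>\<nu>. (2 * \<delta> \<nu> / \<bar>x\<bar>)\<^sup>2) \<longlonglongrightarrow> (2 * 0 / \<bar>x\<bar>)\<^sup>2"
    using False by (intro tendsto_intros \<delta>(2)) simp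
  then have "(\<lambda>\<nu>. (2 * \<delta> \<nu> / \<bar>x\<bar>)\<^sup>2) \<longlonglongrightarrow> 0" by simp
  ultimately have "(\<lambda>\<nu>. Psi2 (F \<nu> / \<delta> \<nu>)) \<longlonglongrightarrow> 0"
    by (rule Lim_null_comparison)
  with False show ?thesis by simp
qed

text \<open>The witnesses are \<open>\<delta>\<^sup>2 \<Psi> (f\<^sub>\<delta> / \<delta>) \<zeta>\<close>.\<close>

lemma level_set_test_functions:
  fixes f :: "'n::finite heis \<Rightarrow> real"
  assumes h: "hdiff U f G" and abU: "cbox a b \<subseteq> U"
    and \<zeta>: "smooth \<zeta>" "\<And>p. p \<notin> cbox a b \<Longrightarrow> \<zeta> p = 0"
  obtains g :: "nat \<Rightarrow> 'n heis \<Rightarrow> real" and B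
  where "\<And>\<nu>. smooth (g \<nu>)" "\<And>\<nu> p. p \<notin> cbox a b \<Longrightarrow> g \<nu> p = 0"
    "\<And>e. 0 < e \<Longrightarrow> \<forall>\<^sub>F \<nu> in sequentially. \<forall>p. \<bar>g \<nu> p\<bar> \<le> e \<and> (\<forall>i. i \<noteq> IT \<longrightarrow> \<bar>fder i (g \<nu>) p\<bar> \<le> e)"
    "\<forall>\<^sub>F \<nu> in sequentially. \<forall>p i j. i \<noteq> IT \<longrightarrow> j \<noteq> IT \<longrightarrow> \<bar>fder j (fder i (g \<nu>)) p\<bar> \<le> B"
    "\<And>p i j. i \<noteq> IT \<Longrightarrow> j \<noteq> IT \<Longrightarrow>
      (\<lambda>\<nu>. fder j (fder i (g \<nu>)) p) \<longlonglongrightarrow> (if p \<in> cbox a b \<and> f p = 0 then \<zeta> p * hcoef (G p) j * hcoef (G p) i else 0)"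
proof -
  let ?C = "cbox a b"
  have "continuous_on U f" "continuous_on U G"
    using h by (simp_all add: hdiff_def)
  then have fc: "continuous_on ?C f" and Gc: "continuous_on ?C G"
    by (auto intro: continuous_on_subset[OF _ abU])
  obtain F \<delta> where \<delta>: "\<And>\<nu>. 0 < \<delta> \<nu>" "\<And>\<nu>. \<delta> \<nu> \<le> 1" "\<delta> \<longlonglongrightarrow> 0" and F: "\<And>\<nu>. smooth (F \<nu>)" and
    ap: "\<And>e. 0 < e \<Longrightarrow> \<forall>\<^sub>F \<nu> in sequentially. \<forall>p\<in>?C. \<bar>F \<nu> p - f p\<bar> \<le> e * \<delta> \<nu> \<and>
      (\<forall>i. i \<noteq> IT \<longrightarrow> \<bar>fder i (F \<nu>) p - hcoef (G p) i\<bar> \<le> e) \<and>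
      (\<forall>i j. i \<noteq> IT \<longrightarrow> j \<noteq> IT \<longrightarrow> \<bar>\<delta> \<nu> * fder j (fder i (F \<nu>)) p\<bar> \<le> e)"
    by (rule hdiff_approximation[OF h compact_cbox abU]) (rule that)
  have hc: "continuous_on ?C (\<lambda>p. hcoef (G p) i)" for i
    using Gc by (cases i) (auto intro!: continuous_intros)
  obtain B0 where B0: "0 \<le> B0" "\<And>p. p \<in> ?C \<Longrightarrow> \<bar>f p\<bar> \<le> B0"
    by (rule continuous_bounded_on_compact[OF compact_cbox fc]) (rule that)
  obtain B1 where B1: "0 \<le> B1" "\<And>i p. p \<in> ?C \<Longrightarrow> \<bar>hcoef (G p) i\<bar> \<le> B1"
    by (rule continuous_bounded_on_compact_family[OF compact_cbox hc]) (rule that)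
  obtain X0 where X0: "0 \<le> X0" "\<And>p. p \<in> ?C \<Longrightarrow> \<bar>\<zeta> p\<bar> \<le> X0"
    by (rule continuous_bounded_on_compact[OF compact_cbox smooth_continuous_on[OF \<zeta>(1)]]) (rule that)
  obtain X1 where X1: "0 \<le> X1" "\<And>i p. p \<in> ?C \<Longrightarrow> \<bar>fder i \<zeta> p\<bar> \<le> X1"
    by (rule continuous_bounded_on_compact_family[OF compact_cbox smooth_continuous_on[OF smooth_fder[OF \<zeta>(1)]]]) (rule that)
  obtain X2 where X2: "0 \<le> X2" "\<And>ij p. p \<in> ?C \<Longrightarrow> \<bar>fder (fst ij) (fder (snd ij) \<zeta>) p\<bar> \<le> X2"
    by (rule continuous_bounded_on_compact_family[OF compact_cbox,
        where g = "\<lambda>ij :: 'n hidx \<times> 'n hidx. fder (fst ij) (fder (snd ij) \<zeta>)"])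
       (rule smooth_continuous_on[OF smooth_fder[OF smooth_fder[OF \<zeta>(1)]]], rule that)
  define Y where "Y = max 1 (max (B0 + 1) (B1 + 1))"
  define X where "X = max X0 (max X1 X2)"
  have Y: "1 \<le> Y" by (simp add: Y_def)
  have X: "0 \<le> X" "\<And>p. p \<in> ?C \<Longrightarrow> \<bar>\<zeta> p\<bar> \<le> X" "\<And>i p. p \<in> ?C \<Longrightarrow> \<bar>fder i \<zeta> p\<bar> \<le> X"
    "\<And>i j p. p \<in> ?C \<Longrightarrow> \<bar>fder j (fder i \<zeta>) p\<bar> \<le> X"
  proof -
    show "0 \<le> X" using X0(1) by (simp add: X_def)
    show "\<bar>\<zeta> p\<bar> \<le> X" if "p \<in> ?C" for p using X0(2)[OF that] by (simp add: X_def)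
    show "\<bar>fder i \<zeta> p\<bar> \<le> X" if "p \<in> ?C" for p i using X1(2)[OF that, of i] by (simp add: X_def)
    show "\<bar>fder j (fder i \<zeta>) p\<bar> \<le> X" if "p \<in> ?C" for p i j using X2(2)[OF that, of "(j, i)"] by (simp add: X_def)
  qed
  define g where "g \<nu> p = (\<delta> \<nu>)\<^sup>2 * Psi (F \<nu> p / \<delta> \<nu>) * \<zeta> p" for \<nu> p
  have Fd: "smooth (\<lambda>p. F \<nu> p / \<delta> \<nu>)" for \<nu>
    unfolding divide_inverse by (intro smooth_mult F smooth_const)
  have s0: "smooth (\<lambda>p. Psi (F \<nu> p / \<delta> \<nu>))" and s1: "smooth (\<lambda>p. Psi1 (F \<nu> p / \<delta> \<nu>))" for \<nu>
    by (intro smooth_compose[OF smooth_Psi Fd] smooth_compose[OF smooth_Psi1 Fd])+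
  have gs: "smooth (g \<nu>)" for \<nu>
    unfolding g_def[abs_def] by (intro smooth_mult smooth_const s0 \<zeta>(1))
  have g0: "g \<nu> p = 0" if "p \<notin> ?C" for \<nu> p using \<zeta>(2)[OF that] by (simp add: g_def)
  have dg0: "fder i (g \<nu>) p = 0" if "p \<notin> ?C" for i \<nu> p
    using that by (rule fder_outside[where a = a and b = b, rotated]) (rule g0)
  have ddg0: "fder j (fder i (g \<nu>)) p = 0" if "p \<notin> ?C" for i j \<nu> p
    using that by (rule fder_outside[where a = a and b = b, rotated]) (rule dg0)
  have dF: "fder i (\<lambda>p. F \<nu> p / \<delta> \<nu>) p = fder i (F \<nu>) p / \<delta> \<nu>" for i \<nu> p
    using fder_bounded_linear[OF bounded_linear_divide F] .
  have d0: "fder i (\<lambda>p. Psi (F \<nu> p / \<delta> \<nu>)) p = Psi1 (F \<nu> p / \<delta> \<nu>) * (fder i (F \<nu>) p / \<delta> \<nu>)" for i \<nu> p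
    by (subst fder_compose[OF Fd DERIV_Psi]) (simp only: dF)
  have d1: "fder i (\<lambda>p. Psi1 (F \<nu> p / \<delta> \<nu>)) p = Psi2 (F \<nu> p / \<delta> \<nu>) * (fder i (F \<nu>) p / \<delta> \<nu>)" for i \<nu> p
    by (subst fder_compose[OF Fd DERIV_Psi1]) (simp only: dF)
  have dg: "fder i (g \<nu>) = (\<lambda>p. \<delta> \<nu> * (Psi1 (F \<nu> p / \<delta> \<nu>) * fder i (F \<nu>) p * \<zeta> p) +
      (\<delta> \<nu>)\<^sup>2 * (Psi (F \<nu> p / \<delta> \<nu>) * fder i \<zeta> p))" for i \<nu>
  proof
    fix p
    have "fder i (g \<nu>) p = (\<delta> \<nu>)\<^sup>2 * (Psi (F \<nu> p / \<delta> \<nu>) * fder i \<zeta> p + Psi1 (F \<nu> p / \<delta> \<nu>) * (fder i (F \<nu>) p / \<delta> \<nu>) * \<zeta> p)"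
    proof -
      have "g \<nu> = (\<lambda>p. (\<delta> \<nu>)\<^sup>2 * (Psi (F \<nu> p / \<delta> \<nu>) * \<zeta> p))"
        by (simp add: g_def fun_eq_iff)
      then show ?thesis
        by (simp only: fder_cmult[OF smooth_mult[OF s0 \<zeta>(1)]] fder_mult[OF s0 \<zeta>(1)] d0)
    qed
    then show "fder i (g \<nu>) p = \<delta> \<nu> * (Psi1 (F \<nu> p / \<delta> \<nu>) * fder i (F \<nu>) p * \<zeta> p) +
        (\<delta> \<nu>)\<^sup>2 * (Psi (F \<nu> p / \<delta> \<nu>) * fder i \<zeta> p)"
      using \<delta>(1)[of \<nu>] by (simp add: distrib_left power2_eq_square)
  qed
  \<comment> \<open>Only the first of the five terms survives in the limit: the second contains
    \<open>\<delta> \<nu>\<close> times a second derivative of \<open>F \<nu>\<close>, which tends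
    to 0, and the others carry a power of \<open>\<delta> \<nu>\<close> with bounded factors or with
    \<open>Psi\<close>.\<close>
  have ddg: "fder j (fder i (g \<nu>)) p =
      Psi2 (F \<nu> p / \<delta> \<nu>) * fder j (F \<nu>) p * fder i (F \<nu>) p * \<zeta> p +
      Psi1 (F \<nu> p / \<delta> \<nu>) * (\<delta> \<nu> * fder j (fder i (F \<nu>)) p) * \<zeta> p +
      \<delta> \<nu> * (Psi1 (F \<nu> p / \<delta> \<nu>) * fder i (F \<nu>) p * fder j \<zeta> p) +
      \<delta> \<nu> * (Psi1 (F \<nu> p / \<delta> \<nu>) * fder j (F \<nu>) p * fder i \<zeta> p) +
      (\<delta> \<nu>)\<^sup>2 * (Psi (F \<nu> p / \<delta> \<nu>) * fder j (fder i \<zeta>) p)" for i j \<nu> p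
  proof -
    have A: "fder j (\<lambda>p. Psi1 (F \<nu> p / \<delta> \<nu>) * fder i (F \<nu>) p * \<zeta> p) p =
        Psi1 (F \<nu> p / \<delta> \<nu>) * fder i (F \<nu>) p * fder j \<zeta> p +
        (Psi1 (F \<nu> p / \<delta> \<nu>) * fder j (fder i (F \<nu>)) p + Psi2 (F \<nu> p / \<delta> \<nu>) * (fder j (F \<nu>) p / \<delta> \<nu>) * fder i (F \<nu>) p) * \<zeta> p"
      by (simp only: fder_mult[OF smooth_mult[OF s1 smooth_fder[OF F]] \<zeta>(1)] fder_mult[OF s1 smooth_fder[OF F]] d1)
    have B: "fder j (\<lambda>p. Psi (F \<nu> p / \<delta> \<nu>) * fder i \<zeta> p) p =
        Psi (F \<nu> p / \<delta> \<nu>) * fder j (fder i \<zeta>) p + Psi1 (F \<nu> p / \<delta> \<nu>) * (fder j (F \<nu>) p / \<delta> \<nu>) * fder i \<zeta> p"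
      by (simp only: fder_mult[OF s0 smooth_fder[OF \<zeta>(1)]] d0)
    have sA: "smooth (\<lambda>p. Psi1 (F \<nu> p / \<delta> \<nu>) * fder i (F \<nu>) p * \<zeta> p)"
      by (intro smooth_mult s1 smooth_fder F \<zeta>(1))
    have sB: "smooth (\<lambda>p. Psi (F \<nu> p / \<delta> \<nu>) * fder i \<zeta> p)"
      by (intro smooth_mult s0 smooth_fder \<zeta>(1))
    have "fder j (fder i (g \<nu>)) p = \<delta> \<nu> * fder j (\<lambda>p. Psi1 (F \<nu> p / \<delta> \<nu>) * fder i (F \<nu>) p * \<zeta> p) p +
        (\<delta> \<nu>)\<^sup>2 * fder j (\<lambda>p. Psi (F \<nu> p / \<delta> \<nu>) * fder i \<zeta> p) p"
      unfolding dg by (simp only: fder_add[OF smooth_cmult[OF sA] smooth_cmult[OF sB]] fder_cmult[OF sA] fder_cmult[OF sB])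
    then show ?thesis
      unfolding A B using \<delta>(1)[of \<nu>] by (simp add: power2_eq_square algebra_simps)
  qed
  have bd: "\<forall>\<^sub>F \<nu> in sequentially. \<forall>p\<in>?C. \<bar>F \<nu> p\<bar> \<le> Y \<and> (\<forall>i. i \<noteq> IT \<longrightarrow> \<bar>fder i (F \<nu>) p\<bar> \<le> Y) \<and>
      (\<forall>i j. i \<noteq> IT \<longrightarrow> j \<noteq> IT \<longrightarrow> \<bar>\<delta> \<nu> * fder j (fder i (F \<nu>)) p\<bar> \<le> 1)"
    using ap[OF zero_less_one]
  proof eventually_elim
    case (elim \<nu>)
    show ?case
    proof (intro ballI conjI allI impI)
      fix p assume p: "p \<in> ?C"
      have "\<bar>F \<nu> p - f p\<bar> \<le> 1" using elim p \<delta>(2)[of \<nu>] by force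
      with B0(2)[OF p] show "\<bar>F \<nu> p\<bar> \<le> Y" unfolding Y_def by linarith
      show "\<bar>fder i (F \<nu>) p\<bar> \<le> Y" if i: "i \<noteq> IT" for i
      proof -
        have "\<bar>fder i (F \<nu>) p - hcoef (G p) i\<bar> \<le> 1" using elim p i by blast
        with B1(2)[OF p, of i] show ?thesis unfolding Y_def by linarith
      qed
      show "\<bar>\<delta> \<nu> * fder j (fder i (F \<nu>)) p\<bar> \<le> 1" if "i \<noteq> IT" "j \<noteq> IT" for i j using elim p that by blast
    qed
  qed
  \<comment> \<open>The linear growth of \<open>Psi\<close> consumes one of the two factors
    \<open>\<delta> \<nu>\<close> and leaves the other.\<close>
  have PsiB: "\<bar>(\<delta> \<nu>)\<^sup>2 * (Psi (F \<nu> p / \<delta> \<nu>) * x)\<bar> \<le> \<delta> \<nu> * (Y * X)" if "\<bar>F \<nu> p\<bar> \<le> Y" "\<bar>x\<bar> \<le> X" for \<nu> p x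
  proof -
    have "\<bar>Psi (F \<nu> p / \<delta> \<nu>)\<bar> \<le> Y / \<delta> \<nu>"
      using order_trans[OF Psi_bound[of "F \<nu> p / \<delta> \<nu>"], of "Y / \<delta> \<nu>"] that(1) \<delta>(1)[of \<nu>]
      by (simp add: abs_divide divide_right_mono)
    then have "\<bar>Psi (F \<nu> p / \<delta> \<nu>)\<bar> * \<bar>x\<bar> \<le> Y / \<delta> \<nu> * X"
      using that(2) Y \<delta>(1)[of \<nu>] by (intro mult_mono) auto
    then have "(\<delta> \<nu>)\<^sup>2 * (\<bar>Psi (F \<nu> p / \<delta> \<nu>)\<bar> * \<bar>x\<bar>) \<le> (\<delta> \<nu>)\<^sup>2 * (Y / \<delta> \<nu> * X)"
      by (intro mult_left_mono) auto
    also have "\<dots> = \<delta> \<nu> * (Y * X)" using \<delta>(1)[of \<nu>] by (simp add: power2_eq_square)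
    finally show ?thesis by (simp add: abs_mult)
  qed
  have Psi1B: "\<bar>\<delta> \<nu> * (Psi1 s * y * x)\<bar> \<le> \<delta> \<nu> * (Y * X)" if "\<bar>y\<bar> \<le> Y" "\<bar>x\<bar> \<le> X" for \<nu> s y x
  proof -
    have "\<bar>Psi1 s\<bar> * \<bar>y\<bar> * \<bar>x\<bar> \<le> 1 * Y * X"
      using Psi1_bound[of s] that Y by (intro mult_mono) auto
    then show ?thesis
      using \<delta>(1)[of \<nu>] by (simp add: abs_mult mult_left_mono)
  qed
  show ?thesis
  proof (rule that[OF gs g0])
    fix e :: real assume e: "0 < e"
    have "0 < e / (2 * (Y * X) + 1)" using e Y X(1) by (intro divide_pos_pos add_nonneg_pos) auto
    then have "\<forall>\<^sub>F \<nu> in sequentially. \<delta> \<nu> < e / (2 * (Y * X) + 1)"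
      by (rule order_tendstoD(2)[OF \<delta>(3)])
    with bd show "\<forall>\<^sub>F \<nu> in sequentially. \<forall>p. \<bar>g \<nu> p\<bar> \<le> e \<and> (\<forall>i. i \<noteq> IT \<longrightarrow> \<bar>fder i (g \<nu>) p\<bar> \<le> e)"
    proof eventually_elim
      case (elim \<nu>)
      have YX: "0 \<le> Y * X" using Y X(1) by simp
      then have "\<delta> \<nu> * (2 * (Y * X) + 1) < e"
        using elim(2) by (subst (asm) pos_less_divide_eq) auto
      then have small: "2 * (\<delta> \<nu> * (Y * X)) \<le> e" using \<delta>(1)[of \<nu>] by (simp add: algebra_simps)
      have small1: "0 \<le> \<delta> \<nu> * (Y * X)" using YX \<delta>(1)[of \<nu>] by simp
      show ?case
      proof (intro allI conjI impI)
        fix p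
        show "\<bar>g \<nu> p\<bar> \<le> e"
        proof (cases "p \<in> ?C")
          case True
          then have "\<bar>g \<nu> p\<bar> \<le> \<delta> \<nu> * (Y * X)"
            unfolding g_def mult.assoc using elim(1) X(2) by (intro PsiB) auto
          with small small1 show ?thesis by linarith
        qed (use e g0 in simp)
        fix i :: "'n hidx" assume i: "i \<noteq> IT"
        show "\<bar>fder i (g \<nu>) p\<bar> \<le> e"
        proof (cases "p \<in> ?C")
          case True
          have "\<bar>\<delta> \<nu> * (Psi1 (F \<nu> p / \<delta> \<nu>) * fder i (F \<nu>) p * \<zeta> p)\<bar> \<le> \<delta> \<nu> * (Y * X)"
            using elim(1) True i X(2) by (intro Psi1B) auto
          moreover have "\<bar>(\<delta> \<nu>)\<^sup>2 * (Psi (F \<nu> p / \<delta> \<nu>) * fder i \<zeta> p)\<bar> \<le> \<delta> \<nu> * (Y * X)"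
            using elim(1) True X(3) by (intro PsiB) auto
          ultimately show ?thesis unfolding dg using small by linarith
        next
          case False
          then have "fder i (g \<nu>) p = 0" by (rule dg0)
          with e show ?thesis by simp
        qed
      qed
    qed
  next
    \<comment> \<open>One summand for each of the first two terms of \<open>ddg\<close>, and
      \<open>Y * X\<close> for each of the remaining three.\<close>
    show "\<forall>\<^sub>F \<nu> in sequentially. \<forall>p i j. i \<noteq> IT \<longrightarrow> j \<noteq> IT \<longrightarrow> \<bar>fder j (fder i (g \<nu>)) p\<bar> \<le> Y * Y * X + X + 3 * (Y * X)"
      using bd
    proof eventually_elim
      case (elim \<nu>)
      have YX: "0 \<le> Y * X" using Y X(1) by simp
      have le: "\<delta> \<nu> * (Y * X) \<le> Y * X"
        using mult_right_mono[OF \<delta>(2)[of \<nu>] YX] by simp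
      show ?case
      proof (intro allI impI)
        fix p and i j :: "'n hidx" assume ij: "i \<noteq> IT" "j \<noteq> IT"
        show "\<bar>fder j (fder i (g \<nu>)) p\<bar> \<le> Y * Y * X + X + 3 * (Y * X)"
        proof (cases "p \<in> ?C")
          case True
          note bds = elim[rule_format, OF True]
          have "\<bar>Psi2 (F \<nu> p / \<delta> \<nu>) * fder j (F \<nu>) p * fder i (F \<nu>) p * \<zeta> p\<bar> \<le> 1 * Y * Y * X"
            unfolding abs_mult using bds ij X(2)[OF True] Psi2_bound_1 Y by (intro mult_mono) auto
          moreover have "\<bar>Psi1 (F \<nu> p / \<delta> \<nu>) * (\<delta> \<nu> * fder j (fder i (F \<nu>)) p) * \<zeta> p\<bar> \<le> 1 * 1 * X"
            unfolding abs_mult[of "_ * _" "\<zeta> p"] abs_mult[of "Psi1 _"]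
            using bds ij X(2)[OF True] Psi1_bound by (intro mult_mono) auto
          moreover have "\<bar>\<delta> \<nu> * (Psi1 (F \<nu> p / \<delta> \<nu>) * fder i (F \<nu>) p * fder j \<zeta> p)\<bar> \<le> \<delta> \<nu> * (Y * X)"
            using bds ij X(3)[OF True] by (intro Psi1B) auto
          moreover have "\<bar>\<delta> \<nu> * (Psi1 (F \<nu> p / \<delta> \<nu>) * fder j (F \<nu>) p * fder i \<zeta> p)\<bar> \<le> \<delta> \<nu> * (Y * X)"
            using bds ij X(3)[OF True] by (intro Psi1B) auto
          moreover have "\<bar>(\<delta> \<nu>)\<^sup>2 * (Psi (F \<nu> p / \<delta> \<nu>) * fder j (fder i \<zeta>) p)\<bar> \<le> \<delta> \<nu> * (Y * X)"
            using bds X(4)[OF True] by (intro PsiB) auto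
          ultimately show ?thesis unfolding ddg using le by linarith
        next
          case False
          then have "fder j (fder i (g \<nu>)) p = 0" by (rule ddg0)
          then show ?thesis using Y X(1) by simp
        qed
      qed
    qed
  next
    fix p and i j :: "'n hidx" assume ij: "i \<noteq> IT" "j \<noteq> IT"
    show "(\<lambda>\<nu>. fder j (fder i (g \<nu>)) p) \<longlonglongrightarrow> (if p \<in> ?C \<and> f p = 0 then \<zeta> p * hcoef (G p) j * hcoef (G p) i else 0)"
    proof (cases "p \<in> ?C")
      case False
      then have "fder j (fder i (g \<nu>)) p = 0" for \<nu> by (rule ddg0)
      with False show ?thesis by simp
    next
      case True
      have "(\<lambda>\<nu>. Psi2 (F \<nu> p / \<delta> \<nu>)) \<longlonglongrightarrow> (if f p = 0 then 1 else 0)"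
      proof (rule Psi2_limit[OF \<delta>(1,3)])
        fix e :: real assume "0 < e"
        from ap[OF this] show "\<forall>\<^sub>F \<nu> in sequentially. \<bar>F \<nu> p - f p\<bar> \<le> e * \<delta> \<nu>"
          by eventually_elim (use True in blast)
      qed
      moreover have d: "(\<lambda>\<nu>. fder l (F \<nu>) p) \<longlonglongrightarrow> hcoef (G p) l" if l: "l \<noteq> IT" for l
      proof (rule tendstoI)
        fix e :: real assume e: "0 < e"
        then have "0 < e / 2" by simp
        from ap[OF this] show "\<forall>\<^sub>F \<nu> in sequentially. dist (fder l (F \<nu>) p) (hcoef (G p) l) < e"
        proof eventually_elim
          case (elim \<nu>)
          then have "\<bar>fder l (F \<nu>) p - hcoef (G p) l\<bar> \<le> e / 2" using True l by blast
          with e show ?case by (simp add: dist_real_def)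
        qed
      qed
      ultimately have 1: "(\<lambda>\<nu>. Psi2 (F \<nu> p / \<delta> \<nu>) * fder j (F \<nu>) p * fder i (F \<nu>) p * \<zeta> p) \<longlonglongrightarrow>
          (if f p = 0 then 1 else 0) * hcoef (G p) j * hcoef (G p) i * \<zeta> p"
        using ij by (intro tendsto_intros) auto
      have 2: "(\<lambda>\<nu>. Psi1 (F \<nu> p / \<delta> \<nu>) * (\<delta> \<nu> * fder j (fder i (F \<nu>)) p) * \<zeta> p) \<longlonglongrightarrow> 0"
      proof (rule Lim_null_comparison)
        show "\<forall>\<^sub>F \<nu> in sequentially. norm (Psi1 (F \<nu> p / \<delta> \<nu>) * (\<delta> \<nu> * fder j (fder i (F \<nu>)) p) * \<zeta> p) \<le>
            1 * \<bar>\<delta> \<nu> * fder j (fder i (F \<nu>)) p\<bar> * X"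
          unfolding real_norm_def abs_mult[of "_ * _" "\<zeta> p"] abs_mult[of "Psi1 _"]
          using X(1,2) True Psi1_bound by (intro always_eventually allI mult_mono) auto
        have "(\<lambda>\<nu>. \<delta> \<nu> * fder j (fder i (F \<nu>)) p) \<longlonglongrightarrow> 0"
        proof (rule tendstoI)
          fix e :: real assume e: "0 < e"
          then have "0 < e / 2" by simp
          from ap[OF this] show "\<forall>\<^sub>F \<nu> in sequentially. dist (\<delta> \<nu> * fder j (fder i (F \<nu>)) p) 0 < e"
          proof eventually_elim
            case (elim \<nu>)
            then have "\<bar>\<delta> \<nu> * fder j (fder i (F \<nu>)) p\<bar> \<le> e / 2" using True ij by blast
            with e show ?case unfolding dist_real_def by linarith
          qed
        qed
        then have "(\<lambda>\<nu>. 1 * \<bar>\<delta> \<nu> * fder j (fder i (F \<nu>)) p\<bar> * X) \<longlonglongrightarrow> 1 * \<bar>0\<bar> * X"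
          by (intro tendsto_intros)
        then show "(\<lambda>\<nu>. 1 * \<bar>\<delta> \<nu> * fder j (fder i (F \<nu>)) p\<bar> * X) \<longlonglongrightarrow> 0" by simp
      qed
      have \<delta>YX: "(\<lambda>\<nu>. \<delta> \<nu> * (Y * X)) \<longlonglongrightarrow> 0"
        using tendsto_mult_left_zero[OF \<delta>(3)] by simp
      have 3: "(\<lambda>\<nu>. \<delta> \<nu> * (Psi1 (F \<nu> p / \<delta> \<nu>) * fder k (F \<nu>) p * fder l \<zeta> p)) \<longlonglongrightarrow> 0" if "k \<noteq> IT" for k l
      proof (rule Lim_null_comparison[OF _ \<delta>YX])
        show "\<forall>\<^sub>F \<nu> in sequentially. norm (\<delta> \<nu> * (Psi1 (F \<nu> p / \<delta> \<nu>) * fder k (F \<nu>) p * fder l \<zeta> p)) \<le> \<delta> \<nu> * (Y * X)"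
          using bd by eventually_elim (use True that X(3)[OF True] in \<open>auto intro!: Psi1B simp del: abs_mult\<close>)
      qed
      have 4: "(\<lambda>\<nu>. (\<delta> \<nu>)\<^sup>2 * (Psi (F \<nu> p / \<delta> \<nu>) * fder j (fder i \<zeta>) p)) \<longlonglongrightarrow> 0"
      proof (rule Lim_null_comparison[OF _ \<delta>YX])
        show "\<forall>\<^sub>F \<nu> in sequentially. norm ((\<delta> \<nu>)\<^sup>2 * (Psi (F \<nu> p / \<delta> \<nu>) * fder j (fder i \<zeta>) p)) \<le> \<delta> \<nu> * (Y * X)"
          using bd by eventually_elim (use True X(4)[OF True] in \<open>auto intro!: PsiB simp del: abs_mult\<close>)
      qed
      have "(\<lambda>\<nu>. fder j (fder i (g \<nu>)) p) \<longlonglongrightarrow>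
          (if f p = 0 then 1 else 0) * hcoef (G p) j * hcoef (G p) i * \<zeta> p + 0 + 0 + 0 + 0"
        unfolding ddg by (intro tendsto_add 1 2 3 4 ij)
      with True show ?thesis by (simp add: ac_simps split: if_splits)
    qed
  qed
qed

section \<open>The Rumin differential\<close>

lemma isgn_IT: "IT \<notin> K \<Longrightarrow> isgn IT K = (- 1) ^ card K"
proof -
  assume "IT \<notin> K"
  have "hidx_less j IT" if "j \<in> K" for j
    using that \<open>IT \<notin> K\<close> by (cases j) auto
  then have "{j\<in>K. hidx_less j IT} = K" by auto
  then show ?thesis by (simp add: isgn_eq)
qed

lemma ann_IT_expansion:
  "ann IT a = (\<Sum>I | IT \<in> I. (a $ I) *\<^sub>R ((- 1) ^ card (I - {IT}) *\<^sub>R ext_basis (I - {IT})))"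
proof -
  have "ann IT a $ K = (\<Sum>I | IT \<in> I. (a $ I) *\<^sub>R ((- 1) ^ card (I - {IT}) *\<^sub>R ext_basis (I - {IT}))) $ K" for K
  proof (cases "IT \<in> K")
    case True
    then have "(ext_basis (I - {IT}) :: 'a ext) $ K = 0" for I
      by (auto simp: ext_basis_def axis_def)
    with True show ?thesis by (simp add: ann_nth)
  next
    case False
    have "(\<Sum>I | IT \<in> I. (a $ I) *\<^sub>R ((- 1) ^ card (I - {IT}) *\<^sub>R ext_basis (I - {IT}))) $ K =
        (\<Sum>I | IT \<in> I. if I = insert IT K then a $ I * (- 1) ^ card K else 0)"
      unfolding sum_component using False by (intro sum.cong) (auto simp: ext_basis_def axis_def)
    also have "\<dots> = isgn IT K * a $ insert IT K"
      using False by (simp add: isgn_IT)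
    finally show ?thesis
      using False by (simp add: ann_nth)
  qed
  then show ?thesis by (simp add: vec_eq_iff)
qed

text \<open>The zeroth-order term of the exterior derivative is contraction with \<open>T\<close>
  followed by multiplication by \<open>d\<theta>\<close>; in this form it is accessible to the
  operator relations.\<close>

lemma ext_deriv_eq: "ext_deriv \<alpha> p = (\<Sum>i\<in>UNIV. cre i (fder i \<alpha> p)) + lefschetz (ann IT (\<alpha> p))"
proof -
  have "lefschetz (ann IT (\<alpha> p)) = (\<Sum>I | IT \<in> I. (\<alpha> p $ I) *\<^sub>R ((- 1) ^ card (I - {IT}) *\<^sub>R (ext_basis (I - {IT}) \<and>\<^sub>e dtheta)))"
    unfolding ann_IT_expansion by (simp only: lefschetz_simps lefschetz_def[symmetric])
  then show ?thesis
    by (simp only: ext_deriv_def cre_def fder_def)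
qed

lemma rumin_J_iff: "a \<in> rumin_J m \<longleftrightarrow> a \<in> ext_power (int m) \<and> cre IT a = 0 \<and> lefschetz a = 0"
  by (auto simp: rumin_J_def wedge_theta_eq_0_iff lefschetz_def)

lemma subspace_rumin_J: "subspace (rumin_J m)"
proof (rule subspaceI)
  show "0 \<in> rumin_J m"
    by (simp add: rumin_J_iff cre_simps lefschetz_simps subspace_0[OF subspace_ext_power])
  show "x + y \<in> rumin_J m" if "x \<in> rumin_J m" "y \<in> rumin_J m" for x y :: "'a ext"
    using that by (simp add: rumin_J_iff cre_simps lefschetz_simps subspace_add[OF subspace_ext_power])
  show "c *\<^sub>R x \<in> rumin_J m" if "x \<in> rumin_J m" for c and x :: "'a ext"
    using that by (simp add: rumin_J_iff cre_simps lefschetz_simps subspace_scale[OF subspace_ext_power])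
qed

lemma hor_part_cre: "i \<noteq> IT \<Longrightarrow> hor_part (cre i a) = cre i (hor_part a)"
  by (auto simp: vec_eq_iff hor_part_def cre_nth)

lemma hor_part_cre_IT: "hor_part (cre IT a) = 0"
  by (auto simp: vec_eq_iff hor_part_def cre_nth)

lemma linear_hor_part: "linear hor_part"
  by (rule linearI) (auto simp: vec_eq_iff hor_part_def)

lemma hor_part_hor: "a \<in> ext_power_hor j \<Longrightarrow> hor_part a = a"
  by (auto simp: vec_eq_iff hor_part_def ext_power_hor_def)

lemma hor_part_ext_power: "a \<in> ext_power j \<Longrightarrow> hor_part a \<in> ext_power_hor j"
  by (auto simp: ext_power_def ext_power_hor_def hor_part_def)

lemma hor_part_lefschetz: "hor_part (lefschetz a) = lefschetz (hor_part a)"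
  by (simp add: lefschetz_eq linear_neg[OF linear_hor_part] linear_sum[OF linear_hor_part] hor_part_cre)

lemma hor_part_wedge_theta: "hor_part (a \<and>\<^sub>e theta) = 0"
  by (auto simp: vec_eq_iff hor_part_def wedge_theta)

lemma bounded_linear_ext: "linear l \<Longrightarrow> bounded_linear (l :: 'n::finite ext \<Rightarrow> 'b::real_normed_vector)"
  by (rule linear_conv_bounded_linear[THEN iffD1])

lemma fder_hor:
  fixes \<alpha> :: "'n::{finite,linorder} heis \<Rightarrow> 'n ext"
  assumes s: "smooth \<alpha>" and h: "\<And>p. \<alpha> p \<in> ext_power_hor j"
  shows "fder i \<alpha> p \<in> ext_power_hor j"
  unfolding ext_power_hor_iff
proof (intro allI impI)
  fix K assume K: "fder i \<alpha> p $ K \<noteq> 0"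
  show "IT \<notin> K \<and> int (card K) = j"
  proof (rule ccontr)
    assume "\<not> (IT \<notin> K \<and> int (card K) = j)"
    then have "\<alpha> q $ K = 0" for q
      using h[of q] unfolding ext_power_hor_iff by blast
    then have "(\<lambda>q. \<alpha> q $ K) = (\<lambda>q. 0)" by auto
    then have "fder i (\<lambda>q. \<alpha> q $ K) p = 0" by (simp add: fder_at[OF has_derivative_const])
    moreover have "fder i (\<lambda>q. \<alpha> q $ K) p = fder i \<alpha> p $ K"
      by (rule fder_bounded_linear[OF bounded_linear_vec_nth s])
    ultimately show False using K by simp
  qed
qed

abbreviation hors :: "'n::finite hidx set" where "hors \<equiv> - {IT}"

lemma sum_hors: "(\<Sum>i\<in>hors. f i) = (\<Sum>j\<in>UNIV. f (IX j)) + (\<Sum>j\<in>UNIV. f (IY j))"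
  for f :: "'n::finite hidx \<Rightarrow> 'a::ab_group_add"
proof -
  have "(\<Sum>i\<in>UNIV. f i) = f IT + (\<Sum>i\<in>hors. f i)"
    by (subst sum.remove[of UNIV IT]) (auto simp: Compl_eq_Diff_UNIV)
  then show ?thesis by (simp add: sum_hidx algebra_simps)
qed

lemma sum_UNIV_hors: "(\<Sum>i\<in>UNIV. f i) = (\<Sum>i\<in>hors. f i) + f IT"
  for f :: "'n::finite hidx \<Rightarrow> 'a::ab_group_add"
  by (simp add: sum_hidx sum_hors)

text \<open>The commutation relations \<open>[X\<^sub>j, Y\<^sub>j] = T\<close>, in the form in which they enter \<open>d \<circ> d = 0\<close>.\<close>

lemma second_fder_antisymmetrized:
  fixes \<nu> :: "'n::{finite,linorder} heis \<Rightarrow> 'n ext"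
  assumes s: "smooth \<nu>"
  shows "(\<Sum>i\<in>hors. \<Sum>j\<in>hors. cre j (cre i (fder j (fder i \<nu>) p))) = - lefschetz (fder IT \<nu> p)"
proof -
  note C = fder_commutator_XY[OF s]
  let ?t = "\<lambda>i j. cre j (cre i (fder j (fder i \<nu>) p))"
  \<comment> \<open>Fields of the same kind commute while the operators \<open>cre\<close>
    anticommute, so these double sums are their own negatives.\<close>
  have anti: "(\<Sum>a\<in>UNIV. \<Sum>b\<in>UNIV. ?t (k a) (k b)) = 0"
    if "\<And>a b. fder (k b) (fder (k a) \<nu>) p = fder (k a) (fder (k b) \<nu>) p" for k :: "'n \<Rightarrow> 'n hidx"
  proof -
    have "(\<Sum>a\<in>UNIV. \<Sum>b\<in>UNIV. ?t (k a) (k b)) = (\<Sum>a\<in>UNIV. \<Sum>b\<in>UNIV. - ?t (k b) (k a))"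
      using that by (intro sum.cong refl) (metis cre_anticommute)
    also have "\<dots> = - (\<Sum>a\<in>UNIV. \<Sum>b\<in>UNIV. ?t (k a) (k b))"
      by (subst sum.swap) (simp add: sum_negf)
    finally show ?thesis by (simp add: eq_neg_iff_add_eq_0 flip: scaleR_2)
  qed
  have XX: "(\<Sum>a\<in>UNIV. \<Sum>b\<in>UNIV. ?t (IX a) (IX b)) = 0" by (rule anti) (rule C)
  have YY: "(\<Sum>a\<in>UNIV. \<Sum>b\<in>UNIV. ?t (IY a) (IY b)) = 0" by (rule anti) (rule C)
  have "(\<Sum>b\<in>UNIV. \<Sum>a\<in>UNIV. ?t (IY b) (IX a)) =
      (\<Sum>b\<in>UNIV. \<Sum>a\<in>UNIV. (if a = b then cre (IX a) (cre (IY b) (fder IT \<nu> p)) else 0) - ?t (IX a) (IY b))"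
    by (intro sum.cong refl) (simp add: C(3) cre_simps cre_anticommute[of "IY _" "IX _"])
  also have "\<dots> = - lefschetz (fder IT \<nu> p) - (\<Sum>a\<in>UNIV. \<Sum>b\<in>UNIV. ?t (IX a) (IY b))"
  proof -
    have "(\<Sum>b\<in>UNIV. \<Sum>a\<in>UNIV. ?t (IX a) (IY b)) = (\<Sum>a\<in>UNIV. \<Sum>b\<in>UNIV. ?t (IX a) (IY b))"
      by (rule sum.swap)
    then show ?thesis by (simp add: sum_subtractf lefschetz_eq)
  qed
  finally have XY: "(\<Sum>b\<in>UNIV. \<Sum>a\<in>UNIV. ?t (IY b) (IX a)) + (\<Sum>a\<in>UNIV. \<Sum>b\<in>UNIV. ?t (IX a) (IY b)) = - lefschetz (fder IT \<nu> p)"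
    by simp
  have "(\<Sum>i\<in>hors. \<Sum>j\<in>hors. ?t i j) = (\<Sum>a\<in>UNIV. \<Sum>b\<in>UNIV. ?t (IX a) (IX b)) + (\<Sum>a\<in>UNIV. \<Sum>b\<in>UNIV. ?t (IX a) (IY b)) +
      ((\<Sum>b\<in>UNIV. \<Sum>a\<in>UNIV. ?t (IY b) (IX a)) + (\<Sum>a\<in>UNIV. \<Sum>b\<in>UNIV. ?t (IY a) (IY b)))"
    by (simp only: sum_hors sum.distrib add.assoc add.left_commute add.commute)
  then show ?thesis using XX YY XY by (simp add: add.commute)
qed

lemma smooth_linear_ext: "linear l \<Longrightarrow> smooth \<alpha> \<Longrightarrow> smooth (\<lambda>p. l (\<alpha> p))"
  for l :: "'n::finite ext \<Rightarrow> 'b::real_normed_vector"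
  by (rule smooth_bounded_linear_compose[OF bounded_linear_ext])

lemma fder_linear_ext: "linear l \<Longrightarrow> smooth \<alpha> \<Longrightarrow> fder i (\<lambda>p. l (\<alpha> p)) p = l (fder i \<alpha> p)"
  for l :: "'n::finite ext \<Rightarrow> 'b::real_normed_vector"
  by (rule fder_bounded_linear[OF bounded_linear_ext])

lemma fder_sum:
  "(\<And>i. i \<in> I \<Longrightarrow> smooth (f i)) \<Longrightarrow> fder j (\<lambda>p. \<Sum>i\<in>I. f i p) p = (\<Sum>i\<in>I. fder j (f i) p)"
proof (induction I rule: infinite_finite_induct)
  case (insert i I)
  then have "fder j (\<lambda>p. f i p + (\<Sum>l\<in>I. f l p)) p = fder j (f i) p + fder j (\<lambda>p. \<Sum>l\<in>I. f l p) p"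
    by (intro fder_add smooth_sum) auto
  with insert show ?case by simp
qed (simp_all add: fder_at[OF has_derivative_const])

text \<open>Rumin's operator in the middle degree is \<theta> times this expression
  (\<open>rumin_D_eq\<close>). The total linear map \<open>lefs_pinv\<close> makes it visibly linear
  in the derivatives of \<open>\<alpha>\<close>.\<close>

definition rumin_second :: "('n::{finite,linorder} heis \<Rightarrow> 'n ext) \<Rightarrow> 'n heis \<Rightarrow> 'n ext" where
  "rumin_second \<alpha> p = fder IT \<alpha> p + (\<Sum>i\<in>hors. \<Sum>j\<in>hors. cre j (lefs_pinv (cre i (fder j (fder i \<alpha>) p))))"

text \<open>The correction \<open>\<beta>\<close> is such that its product with
  \<open>d\<theta>\<close> cancels the horizontal part of \<open>d\<alpha>\<close>; what is left is
  divisible by \<theta>.\<close>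

lemma rumin_D_eq:
  fixes \<alpha> :: "'n::{finite,linorder} heis \<Rightarrow> 'n ext"
  assumes s: "smooth \<alpha>" and h: "\<And>p. \<alpha> p \<in> ext_power_hor (int CARD('n))"
  shows "rumin_D \<alpha> p = cre IT (rumin_second \<alpha> p)"
proof -
  have fh: "fder i \<alpha> p \<in> ext_power_hor (int CARD('n))" for i p
    by (rule fder_hor[OF s h])
  define \<eta> where "\<eta> p = (\<Sum>i\<in>hors. cre i (fder i \<alpha> p))" for p
  have \<eta>h: "\<eta> p \<in> ext_power_hor (int CARD('n) + 1)" for p
    unfolding \<eta>_def by (intro subspace_sum subspace_ext_power_hor cre_ext_power_hor fh) auto
  have ed: "ext_deriv \<alpha> p = \<eta> p + cre IT (fder IT \<alpha> p)" for p
    using ann_IT_eq_0[OF h] by (simp add: ext_deriv_eq sum_UNIV_hors \<eta>_def lefschetz_simps)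
  have hp: "hor_part (ext_deriv \<alpha> p) = \<eta> p" for p
    by (simp add: ed linear_add[OF linear_hor_part] hor_part_cre_IT hor_part_hor[OF \<eta>h])
  define \<beta> where "\<beta> p = (\<Sum>i\<in>hors. lefs_pinv (cre i (fder i \<alpha> p)))" for p
  have \<beta>: "lefschetz_inv (hor_part (ext_deriv \<alpha> p)) = \<beta> p" for p
    unfolding hp lefs_pinv_eq[OF \<eta>h, symmetric] by (simp add: \<eta>_def \<beta>_def linear_sum[OF linear_lefs_pinv])
  have L\<beta>: "lefschetz (\<beta> p) = \<eta> p" and \<beta>h: "\<beta> p \<in> ext_power_hor (int CARD('n) - 1)" for p
    using lefschetz_inv[OF \<eta>h, of p] unfolding \<beta>[of p, unfolded hp] by auto
  have s1: "smooth (\<lambda>p. lefs_pinv (cre i (fder i \<alpha> p)))" for i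
    by (intro smooth_linear_ext[OF linear_lefs_pinv] smooth_linear_ext[OF linear_cre] smooth_fder s)
  have s\<beta>: "smooth \<beta>"
    unfolding \<beta>_def[abs_def] by (intro smooth_sum s1)
  have f\<beta>: "fder j \<beta> p = (\<Sum>i\<in>hors. lefs_pinv (cre i (fder j (fder i \<alpha>) p)))" for j
    unfolding \<beta>_def[abs_def]
    by (simp add: fder_sum[OF s1] fder_linear_ext[OF linear_lefs_pinv smooth_linear_ext[OF linear_cre smooth_fder[OF s]]]
        fder_linear_ext[OF linear_cre smooth_fder[OF s]])
  have D: "rumin_D \<alpha> = ext_deriv (\<lambda>p. \<alpha> p - cre IT (\<beta> p))"
    by (simp add: rumin_D_def \<beta> theta_def cre_def)
  have sT: "smooth (\<lambda>p. cre IT (\<beta> p))" by (rule smooth_linear_ext[OF linear_cre s\<beta>])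
  have f\<gamma>: "fder j (\<lambda>p. \<alpha> p - cre IT (\<beta> p)) p = fder j \<alpha> p - cre IT (fder j \<beta> p)" for j
    by (simp only: fder_diff[OF s sT] fder_linear_ext[OF linear_cre s\<beta>])
  have "rumin_D \<alpha> p = (\<Sum>j\<in>UNIV. cre j (fder j \<alpha> p)) - (\<Sum>j\<in>UNIV. cre j (cre IT (fder j \<beta> p))) +
      lefschetz (ann IT (\<alpha> p - cre IT (\<beta> p)))"
    unfolding D ext_deriv_eq f\<gamma> by (simp add: cre_simps sum_subtractf)
  also have "(\<Sum>j\<in>UNIV. cre j (fder j \<alpha> p)) = \<eta> p + cre IT (fder IT \<alpha> p)"
    by (simp add: sum_UNIV_hors \<eta>_def)
  also have "(\<Sum>j\<in>UNIV. cre j (cre IT (fder j \<beta> p))) = - cre IT (\<Sum>j\<in>hors. cre j (fder j \<beta> p))"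
  proof -
    have "(\<Sum>j\<in>UNIV. cre j (cre IT (fder j \<beta> p))) = (\<Sum>j\<in>hors. - cre IT (cre j (fder j \<beta> p)))"
      unfolding sum_UNIV_hors cre_cre add_0_right by (intro sum.cong refl) (rule cre_anticommute)
    then show ?thesis by (simp add: sum_negf cre_simps)
  qed
  also have "ann IT (\<alpha> p - cre IT (\<beta> p)) = - \<beta> p"
    using ann_IT_eq_0[OF h] ann_IT_eq_0[OF \<beta>h] by (simp add: ann_simps ann_cre cre_simps)
  also have "(\<Sum>j\<in>hors. cre j (fder j \<beta> p)) = (\<Sum>i\<in>hors. \<Sum>j\<in>hors. cre j (lefs_pinv (cre i (fder j (fder i \<alpha>) p))))"
    unfolding f\<beta> cre_simps by (rule sum.swap)
  finally show ?thesis
    by (simp add: rumin_second_def lefschetz_simps L\<beta> cre_simps)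
qed

text \<open>\<open>lefschetz\<close> undoes \<open>lefs_pinv\<close>, and the antisymmetrised second
  derivatives that remain cancel the \<open>T\<close>-derivative.\<close>

lemma rumin_second_J:
  fixes \<alpha> :: "'n::{finite,linorder} heis \<Rightarrow> 'n ext"
  assumes s: "smooth \<alpha>" and h: "\<And>p. \<alpha> p \<in> ext_power_hor (int CARD('n))"
  shows "cre IT (rumin_second \<alpha> p) \<in> rumin_J (CARD('n) + 1)"
proof -
  have f1: "fder i \<alpha> p \<in> ext_power_hor (int CARD('n))" for i p
    by (rule fder_hor[OF s h])
  have f2: "fder j (fder i \<alpha>) p \<in> ext_power_hor (int CARD('n))" for i j
    by (rule fder_hor[OF smooth_fder[OF s] f1])
  have c: "cre i (fder j (fder i \<alpha>) p) \<in> ext_power_hor (int CARD('n) + 1)" if "i \<in> hors" for i j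
    using that by (intro cre_ext_power_hor f2) auto
  have inv: "lefschetz (lefs_pinv (cre i (fder j (fder i \<alpha>) p))) = cre i (fder j (fder i \<alpha>) p)"
    "lefs_pinv (cre i (fder j (fder i \<alpha>) p)) \<in> ext_power_hor (int CARD('n) - 1)" if "i \<in> hors" for i j
    using lefschetz_inv[OF c[OF that]] by (simp_all add: lefs_pinv_eq[OF c[OF that]])
  have "lefschetz (rumin_second \<alpha> p) = lefschetz (fder IT \<alpha> p) + (\<Sum>i\<in>hors. \<Sum>j\<in>hors. cre j (cre i (fder j (fder i \<alpha>) p)))"
    by (simp add: rumin_second_def lefschetz_simps cre_lefschetz[symmetric] inv(1))
  also have "\<dots> = 0" by (simp add: second_fder_antisymmetrized[OF s])
  finally have L: "lefschetz (cre IT (rumin_second \<alpha> p)) = 0" by (simp add: cre_lefschetz[symmetric] cre_simps)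
  have "cre j (lefs_pinv (cre i (fder j (fder i \<alpha>) p))) \<in> ext_power_hor (int CARD('n) - 1 + 1)" if "i \<in> hors" "j \<in> hors" for i j
    using inv(2)[OF that(1)] that(2) by (intro cre_ext_power_hor) auto
  then have "rumin_second \<alpha> p \<in> ext_power_hor (int CARD('n))"
    unfolding rumin_second_def by (intro subspace_add subspace_sum subspace_ext_power_hor f1) simp
  then have "cre IT (rumin_second \<alpha> p) \<in> ext_power (int CARD('n) + 1)"
    using ext_power_hor_subset by (intro cre_ext_power) blast
  with L show ?thesis by (simp add: rumin_J_iff add.commute)
qed

lemma smooth_rumin_second: "smooth \<alpha> \<Longrightarrow> smooth (rumin_second \<alpha>)"
  unfolding rumin_second_def[abs_def]
  by (intro smooth_add smooth_sum smooth_linear_ext[OF linear_cre] smooth_linear_ext[OF linear_lefs_pinv] smooth_fder)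

lemma rumin_second_diff:
  assumes "smooth \<alpha>" "smooth \<beta>"
  shows "rumin_second (\<lambda>p. \<alpha> p - \<beta> p) p = rumin_second \<alpha> p - rumin_second \<beta> p"
proof -
  have "fder i (\<lambda>p. \<alpha> p - \<beta> p) = (\<lambda>p. fder i \<alpha> p - fder i \<beta> p)" for i
    using fder_diff[OF assms] by (intro ext)
  then show ?thesis
    by (simp add: rumin_second_def fder_diff smooth_fder assms cre_simps linear_diff[OF linear_lefs_pinv] sum_subtractf)
qed

text \<open>This is why the operator descends to the quotient: on multiples of
  \<open>d\<theta>\<close> the map \<open>lefs_pinv\<close> cancels, and the second derivatives
  again compensate the \<open>T\<close>-derivative.\<close>

lemma rumin_second_lefschetz:
  fixes \<nu> :: "'n::{finite,linorder} heis \<Rightarrow> 'n ext"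
  assumes s: "smooth \<nu>" and h: "\<And>p. \<nu> p \<in> ext_power_hor (int CARD('n) - 2)"
  shows "rumin_second (\<lambda>p. lefschetz (\<nu> p)) p = 0"
proof -
  have f1: "fder i (\<lambda>p. lefschetz (\<nu> p)) = (\<lambda>p. lefschetz (fder i \<nu> p))" for i
    using fder_linear_ext[OF linear_lefschetz s] by (intro ext)
  have f2: "fder j (\<lambda>p. lefschetz (fder i \<nu> p)) p = lefschetz (fder j (fder i \<nu>) p)" for i j
    by (rule fder_linear_ext[OF linear_lefschetz smooth_fder[OF s]])
  have "lefs_pinv (cre i (lefschetz (fder j (fder i \<nu>) p))) = cre i (fder j (fder i \<nu>) p)" if "i \<in> hors" for i j
  proof -
    have "fder j (fder i \<nu>) p \<in> ext_power_hor (int CARD('n) - 2)"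
      by (intro fder_hor smooth_fder s h)
    then have "cre i (fder j (fder i \<nu>) p) \<in> ext_power_hor (int CARD('n) - 2 + 1)"
      using that by (intro cre_ext_power_hor) auto
    then have c: "cre i (fder j (fder i \<nu>) p) \<in> ext_power_hor (int CARD('n) - 1)" by simp
    have "lefschetz (cre i (fder j (fder i \<nu>) p)) \<in> ext_power_hor (int CARD('n) + 1)"
      using lefschetz_ext_power_hor[OF c] by (simp add: add.commute)
    then show ?thesis
      by (simp add: cre_lefschetz lefs_pinv_eq lefschetz_inv_eq[OF c])
  qed
  then show ?thesis
    by (simp add: rumin_second_def f1 f2 second_fder_antisymmetrized[OF s])
qed

section \<open>The boundary of a current on test forms\<close>

lemma rumin_class_high:
  fixes a :: "'n::{finite,linorder} ext"
  shows "CARD('n) < m \<Longrightarrow> rumin_class m a = {a}"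
  by (simp add: rumin_class_def rumin_den_def)

lemma zero_in_rumin_den: "0 \<in> (rumin_den m :: 'n::{finite,linorder} ext set)"
proof -
  have "(0 :: 'n ext) = (0 \<and>\<^sub>e theta) + (0 \<and>\<^sub>e dtheta)"
    by (simp add: linear_0[OF linear_wedge_left])
  then have "(0 :: 'n ext) \<in> rumin_I m"
    unfolding rumin_I_def using subspace_0[OF subspace_ext_power] by blast
  then show ?thesis by (simp add: rumin_den_def)
qed

lemma in_rumin_class: "a \<in> rumin_class m a"
  using zero_in_rumin_den[of m] by (force simp: rumin_class_def)

lemma rumin_norm_class_le: "rumin_norm (rumin_class m a) \<le> norm a"
  using infdist_le[OF in_rumin_class, of 0 m a] by (simp add: rumin_norm_def)

lemma rumin_norm_nonneg: "0 \<le> rumin_norm c"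
  by (simp add: rumin_norm_def infdist_nonneg)

text \<open>Above the middle degree the cosets are singletons, so the lift in the definite
  description is unique.\<close>

lemma d_C_high:
  fixes \<alpha> :: "'n::{finite,linorder} heis \<Rightarrow> 'n ext"
  assumes m: "CARD('n) < m" and \<alpha>: "\<alpha> \<in> test_lifts m"
  shows "d_C m (\<lambda>p. rumin_class m (\<alpha> p)) = (\<lambda>p. rumin_class (Suc m) (ext_deriv \<alpha> p))"
  unfolding d_C_def
proof (rule the_equality)
  show "\<exists>\<beta>\<in>test_lifts m. (\<lambda>p. rumin_class m (\<alpha> p)) = (\<lambda>p. rumin_class m (\<beta> p)) \<and>
      (if m = CARD('n) then (\<forall>p. \<beta> p \<in> ext_power_hor (int m)) \<and>
        (\<lambda>p. rumin_class (Suc m) (ext_deriv \<alpha> p)) = (\<lambda>p. rumin_class (Suc m) (rumin_D \<beta> p))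
      else (\<lambda>p. rumin_class (Suc m) (ext_deriv \<alpha> p)) = (\<lambda>p. rumin_class (Suc m) (ext_deriv \<beta> p)))"
    using m \<alpha> by (intro bexI[of _ \<alpha>]) simp_all
next
  fix \<eta>
  assume "\<exists>\<beta>\<in>test_lifts m. (\<lambda>p. rumin_class m (\<alpha> p)) = (\<lambda>p. rumin_class m (\<beta> p)) \<and>
      (if m = CARD('n) then (\<forall>p. \<beta> p \<in> ext_power_hor (int m)) \<and> \<eta> = (\<lambda>p. rumin_class (Suc m) (rumin_D \<beta> p))
      else \<eta> = (\<lambda>p. rumin_class (Suc m) (ext_deriv \<beta> p)))"
  then obtain \<beta> where \<beta>: "(\<lambda>p. rumin_class m (\<alpha> p)) = (\<lambda>p. rumin_class m (\<beta> p))"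
    and \<eta>: "\<eta> = (\<lambda>p. rumin_class (Suc m) (ext_deriv \<beta> p))"
    using m by (auto split: if_splits)
  have "\<alpha> = \<beta>"
  proof
    fix p show "\<alpha> p = \<beta> p" using fun_cong[OF \<beta>, of p] m by (simp add: rumin_class_high)
  qed
  then show "\<eta> = (\<lambda>p. rumin_class (Suc m) (ext_deriv \<alpha> p))" using \<eta> by simp
qed

lemma horizontal_rumin_I:
  assumes "x \<in> rumin_I m" "x \<in> ext_power_hor (int m)"
  shows "x \<in> lefschetz ` ext_power_hor (int m - 2)"
proof -
  from assms(1) obtain l u where x: "x = (l \<and>\<^sub>e theta) + (u \<and>\<^sub>e dtheta)" and u: "u \<in> ext_power (int m - 2)"
    unfolding rumin_I_def by blast
  have "x = hor_part x" by (simp add: hor_part_hor[OF assms(2)])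
  also have "\<dots> = lefschetz (hor_part u)"
    by (simp add: x linear_add[OF linear_hor_part] hor_part_wedge_theta hor_part_lefschetz flip: lefschetz_def)
  finally show ?thesis using hor_part_ext_power[OF u] by blast
qed

text \<open>The two lifts differ by a multiple of \<open>d\<theta>\<close>. A linear right inverse
  \<open>r\<close> of \<open>lefschetz\<close> supplies a smooth quotient \<open>\<nu>\<close>, and
  the operator annihilates \<open>lefschetz (\<nu> p)\<close>.\<close>

lemma rumin_D_cong:
  fixes \<alpha> \<beta> :: "'n::{finite,linorder} heis \<Rightarrow> 'n ext"
  assumes s: "smooth \<alpha>" "smooth \<beta>"
    and h: "\<And>p. \<alpha> p \<in> ext_power_hor (int CARD('n))" "\<And>p. \<beta> p \<in> ext_power_hor (int CARD('n))"
    and eq: "\<And>p. rumin_class (CARD('n)) (\<alpha> p) = rumin_class (CARD('n)) (\<beta> p)"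
  shows "rumin_D \<alpha> = rumin_D \<beta>"
proof
  fix p
  obtain r :: "'n ext \<Rightarrow> 'n ext" where r: "range r \<subseteq> ext_power_hor (int CARD('n) - 2)" "linear r"
    "\<And>v. v \<in> lefschetz ` ext_power_hor (int CARD('n) - 2) \<Longrightarrow> lefschetz (r v) = v"
    using linear_exists_right_inverse_on[OF linear_lefschetz subspace_ext_power_hor[of "int CARD('n) - 2"]] by blast
  define \<nu> where "\<nu> p = r (\<alpha> p - \<beta> p)" for p
  have L: "(\<lambda>p. \<alpha> p - \<beta> p) = (\<lambda>p. lefschetz (\<nu> p))"
  proof
    fix q
    have "\<alpha> q \<in> rumin_class (CARD('n)) (\<beta> q)" using in_rumin_class[of "\<alpha> q" "CARD('n)"] by (simp only: eq)
    then have "\<alpha> q - \<beta> q \<in> rumin_I (CARD('n))" by (auto simp: rumin_class_def rumin_den_def)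
    moreover have "\<alpha> q - \<beta> q \<in> ext_power_hor (int CARD('n))"
      by (intro subspace_diff subspace_ext_power_hor h)
    ultimately show "\<alpha> q - \<beta> q = lefschetz (\<nu> q)"
      unfolding \<nu>_def by (intro r(3)[symmetric] horizontal_rumin_I)
  qed
  have "smooth \<nu>" unfolding \<nu>_def[abs_def] by (intro smooth_linear_ext[OF r(2)] smooth_diff s)
  moreover have "\<nu> q \<in> ext_power_hor (int CARD('n) - 2)" for q using r(1) by (auto simp: \<nu>_def)
  ultimately have "rumin_second (\<lambda>p. lefschetz (\<nu> p)) p = 0" by (rule rumin_second_lefschetz)
  then have "rumin_second \<alpha> p = rumin_second \<beta> p"
    using rumin_second_diff[OF s, of p] by (simp add: L)
  then show "rumin_D \<alpha> p = rumin_D \<beta> p"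
    by (simp add: rumin_D_eq[OF s(1) h(1)] rumin_D_eq[OF s(2) h(2)])
qed

lemma d_C_middle:
  fixes \<alpha> :: "'n::{finite,linorder} heis \<Rightarrow> 'n ext"
  assumes m: "m = CARD('n)" and \<alpha>: "\<alpha> \<in> test_lifts m" and h: "\<And>p. \<alpha> p \<in> ext_power_hor (int m)"
  shows "d_C m (\<lambda>p. rumin_class m (\<alpha> p)) = (\<lambda>p. rumin_class (Suc m) (rumin_D \<alpha> p))"
  unfolding d_C_def
proof (rule the_equality)
  show "\<exists>\<beta>\<in>test_lifts m. (\<lambda>p. rumin_class m (\<alpha> p)) = (\<lambda>p. rumin_class m (\<beta> p)) \<and>
      (if m = CARD('n) then (\<forall>p. \<beta> p \<in> ext_power_hor (int m)) \<and>
        (\<lambda>p. rumin_class (Suc m) (rumin_D \<alpha> p)) = (\<lambda>p. rumin_class (Suc m) (rumin_D \<beta> p))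
      else (\<lambda>p. rumin_class (Suc m) (rumin_D \<alpha> p)) = (\<lambda>p. rumin_class (Suc m) (ext_deriv \<beta> p)))"
    using m \<alpha> h by (intro bexI[of _ \<alpha>]) simp_all
next
  fix \<eta>
  assume "\<exists>\<beta>\<in>test_lifts m. (\<lambda>p. rumin_class m (\<alpha> p)) = (\<lambda>p. rumin_class m (\<beta> p)) \<and>
      (if m = CARD('n) then (\<forall>p. \<beta> p \<in> ext_power_hor (int m)) \<and> \<eta> = (\<lambda>p. rumin_class (Suc m) (rumin_D \<beta> p))
      else \<eta> = (\<lambda>p. rumin_class (Suc m) (ext_deriv \<beta> p)))"
  then obtain \<beta> where \<beta>: "\<beta> \<in> test_lifts m" "(\<lambda>p. rumin_class m (\<alpha> p)) = (\<lambda>p. rumin_class m (\<beta> p))"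
    "\<forall>p. \<beta> p \<in> ext_power_hor (int m)" and \<eta>: "\<eta> = (\<lambda>p. rumin_class (Suc m) (rumin_D \<beta> p))"
    using m by (auto split: if_splits)
  have "rumin_D \<alpha> = rumin_D \<beta>"
  proof (rule rumin_D_cong)
    show "smooth \<alpha>" "smooth \<beta>" using \<alpha> \<beta>(1) by (simp_all add: test_lifts_def)
    show "\<alpha> p \<in> ext_power_hor (int CARD('n))" "\<beta> p \<in> ext_power_hor (int CARD('n))" for p
      using h[of p] \<beta>(3)[rule_format, of p] by (simp_all only: m)
    show "rumin_class (CARD('n)) (\<alpha> p) = rumin_class (CARD('n)) (\<beta> p)" for p
      using fun_cong[OF \<beta>(2), of p] by (simp only: m)
  qed
  then show "\<eta> = (\<lambda>p. rumin_class (Suc m) (rumin_D \<alpha> p))" using \<eta> by simp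
qed

lemma test_liftsI:
  assumes "smooth \<alpha>" "compact K" "\<And>p. p \<notin> K \<Longrightarrow> \<alpha> p = 0" "\<And>p. \<alpha> p \<in> rumin_num m"
  shows "\<alpha> \<in> test_lifts m"
  using closure_support[OF assms(2,3)] assms(1,4) by (auto simp: test_lifts_def)

text \<open>The quotient norm is dominated by the norm of a lift, so the mass bound may be used for
  lifts. \<open>M\<close> could be negative, whence \<open>\<bar>M\<bar>\<close> as the
  constant.\<close>

lemma boundary_mass_bound:
  fixes T :: "('n::{finite,linorder} heis \<Rightarrow> 'n ext set) \<Rightarrow> real"
  assumes "locally_finite_mass m (boundary (Suc m) T)" "compact K"
  shows "\<exists>C\<ge>0. \<forall>\<alpha>\<in>test_lifts m. \<forall>s. (\<forall>p. p \<notin> K \<longrightarrow> \<alpha> p = 0) \<longrightarrow> (\<forall>p. norm (\<alpha> p) \<le> s) \<longrightarrow>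
    \<bar>T (d_C m (\<lambda>p. rumin_class m (\<alpha> p)))\<bar> \<le> C * s"
proof -
  obtain M where M: "\<forall>\<omega>\<in>rumin_forms m.
        (\<forall>p. p \<notin> K \<longrightarrow> \<omega> p = rumin_class m 0) \<longrightarrow> \<bar>boundary (Suc m) T \<omega>\<bar> \<le> M * (SUP p. rumin_norm (\<omega> p))"
    using assms unfolding locally_finite_mass_def by meson
  show ?thesis
  proof (rule exI[of _ "\<bar>M\<bar>"], intro conjI ballI allI impI)
    fix \<alpha> :: "'n heis \<Rightarrow> 'n ext" and s
    assume \<alpha>: "\<alpha> \<in> test_lifts m" "\<forall>p. p \<notin> K \<longrightarrow> \<alpha> p = 0" and s: "\<forall>p. norm (\<alpha> p) \<le> s"
    define \<omega> where "\<omega> p = rumin_class m (\<alpha> p)" for p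
    have \<omega>: "\<omega> \<in> rumin_forms m" using \<alpha>(1) unfolding rumin_forms_def \<omega>_def[abs_def] by blast
    have "\<bar>boundary (Suc m) T \<omega>\<bar> \<le> M * (SUP p. rumin_norm (\<omega> p))"
      using M[THEN bspec, OF \<omega>] \<alpha>(2) by (simp add: \<omega>_def)
    also have "\<dots> \<le> \<bar>M\<bar> * s"
    proof -
      have le: "rumin_norm (\<omega> p) \<le> s" for p
        using rumin_norm_class_le[of m "\<alpha> p"] s[rule_format, of p] by (simp add: \<omega>_def)
      have 1: "(SUP p. rumin_norm (\<omega> p)) \<le> s" by (intro cSUP_least le) auto
      have "rumin_norm (\<omega> 0) \<le> (SUP p. rumin_norm (\<omega> p))"
        by (rule cSUP_upper) (auto intro!: bdd_aboveI2 le)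
      then have 2: "0 \<le> (SUP p. rumin_norm (\<omega> p))" using rumin_norm_nonneg[of "\<omega> 0"] by linarith
      have "M * (SUP p. rumin_norm (\<omega> p)) \<le> \<bar>M\<bar> * (SUP p. rumin_norm (\<omega> p))"
        by (intro mult_right_mono 2) simp
      also have "\<dots> \<le> \<bar>M\<bar> * s" by (intro mult_left_mono 1) simp
      finally show ?thesis .
    qed
    finally show "\<bar>T (d_C m (\<lambda>p. rumin_class m (\<alpha> p)))\<bar> \<le> \<bar>M\<bar> * s"
      by (simp add: boundary_def \<omega>_def[abs_def])
  qed simp
qed

lemma fder_scaleR_const: "smooth g \<Longrightarrow> fder i (\<lambda>p. g p *\<^sub>R c) = (\<lambda>p. fder i g p *\<^sub>R c)"
  by (rule ext) (rule fder_bounded_linear[OF bounded_linear_scaleR_left])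

lemma smooth_scaleR_const: "smooth g \<Longrightarrow> smooth (\<lambda>p. g p *\<^sub>R c)"
  by (intro smooth_scaleR smooth_const)

lemma cre_rumin_J:
  assumes l: "l \<in> rumin_J m" shows "cre i l \<in> rumin_J (Suc m)"
proof -
  have l0: "l \<in> ext_power (int m)" "cre IT l = 0" "lefschetz l = 0" using l by (simp_all add: rumin_J_iff)
  then show ?thesis
    using cre_ext_power[OF l0(1), of i] cre_anticommute[of IT i l]
    by (simp add: rumin_J_iff cre_simps flip: cre_lefschetz) (simp add: add.commute)
qed

text \<open>For \<open>l\<close> in \<open>rumin_J m\<close> the products with \<theta> and
  \<open>d\<theta>\<close> vanish, so \<open>d (g l)\<close> contains only horizontal derivatives of
  \<open>g\<close>, while the bound involves only the size of \<open>g\<close> itself.\<close>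

lemma first_order_bound:
  fixes T :: "('n::{finite,linorder} heis \<Rightarrow> 'n ext set) \<Rightarrow> real"
  assumes m: "CARD('n) < m" and fm: "locally_finite_mass m (boundary (Suc m) T)"
    and rep: "mass_representation (Suc m) N T \<mu> Tvec" and l: "l \<in> rumin_J m"
  shows "\<exists>C\<ge>0. \<forall>g s. smooth g \<longrightarrow> (\<forall>p. p \<notin> cbox a b \<longrightarrow> g p = 0) \<longrightarrow> (\<forall>p. \<bar>g p\<bar> \<le> s) \<longrightarrow>
    \<bar>LINT p|completion \<mu>. Tvec p (\<Sum>i\<in>hors. fder i g p *\<^sub>R cre i l)\<bar> \<le> C * s"
proof -
  obtain C where C: "0 \<le> C" "\<forall>\<alpha>\<in>test_lifts m. \<forall>s. (\<forall>p. p \<notin> cbox a b \<longrightarrow> \<alpha> p = 0) \<longrightarrow> (\<forall>p. norm (\<alpha> p) \<le> s) \<longrightarrow>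
    \<bar>T (d_C m (\<lambda>p. rumin_class m (\<alpha> p)))\<bar> \<le> C * s"
    using boundary_mass_bound[OF fm compact_cbox[of a b]] by meson
  have l0: "cre IT l = 0" "lefschetz l = 0" using l by (simp_all add: rumin_J_iff)
  show ?thesis
  proof (rule exI[of _ "C * norm l"], intro conjI allI impI)
    show "0 \<le> C * norm l" using C(1) by simp
    fix g :: "'n heis \<Rightarrow> real" and s
    assume "smooth g" "\<forall>p. p \<notin> cbox a b \<longrightarrow> g p = 0" "\<forall>p. \<bar>g p\<bar> \<le> s"
    then have g: "smooth g" "\<And>p. p \<notin> cbox a b \<Longrightarrow> g p = 0" "\<And>p. \<bar>g p\<bar> \<le> s" by blast+
    define \<alpha> where "\<alpha> p = g p *\<^sub>R l" for p
    have \<alpha>: "\<alpha> \<in> test_lifts m"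
      by (rule test_liftsI[of _ "cbox a b"])
        (use g m l in \<open>auto simp: \<alpha>_def[abs_def] rumin_num_def smooth_scaleR_const subspace_scale[OF subspace_rumin_J]\<close>)
    define \<beta> where "\<beta> p = (\<Sum>i\<in>hors. fder i g p *\<^sub>R cre i l)" for p
    have "ext_deriv \<alpha> = \<beta>"
    proof
      fix p
      have "lefschetz (ann IT l) = 0" by (simp add: l0 ann_simps flip: ann_IT_lefschetz)
      then show "ext_deriv \<alpha> p = \<beta> p"
        unfolding ext_deriv_eq \<beta>_def \<alpha>_def[abs_def] fder_scaleR_const[OF g(1)]
        by (simp add: cre_simps ann_simps lefschetz_simps sum_UNIV_hors l0)
    qed
    have J: "\<beta> p \<in> rumin_J (Suc m)" for p
      unfolding \<beta>_def by (intro subspace_sum subspace_scale subspace_rumin_J cre_rumin_J l)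
    have \<beta>: "\<beta> \<in> test_lifts (Suc m)"
    proof (rule test_liftsI[of _ "cbox a b"])
      show "smooth \<beta>" unfolding \<beta>_def[abs_def] by (intro smooth_sum smooth_scaleR_const smooth_fder g)
      show "\<beta> p \<in> rumin_num (Suc m)" for p using J[of p] m by (simp add: rumin_num_def)
      show "\<beta> p = 0" if "p \<notin> cbox a b" for p
        using fder_outside[OF g(2) that] by (simp add: \<beta>_def)
    qed simp
    have "(LINT p|completion \<mu>. Tvec p (\<beta> p)) = T (\<lambda>p. rumin_class (Suc m) (\<beta> p))"
      using rep \<beta> by (simp add: mass_representation_def)
    also have "\<dots> = T (d_C m (\<lambda>p. rumin_class m (\<alpha> p)))"
      by (simp add: d_C_high[OF m \<alpha>] \<open>ext_deriv \<alpha> = \<beta>\<close>)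
    finally have "\<bar>LINT p|completion \<mu>. Tvec p (\<beta> p)\<bar> = \<bar>T (d_C m (\<lambda>p. rumin_class m (\<alpha> p)))\<bar>" by simp
    also have "\<dots> \<le> C * (s * norm l)"
      by (rule C(2)[rule_format, OF \<alpha>]) (use g in \<open>auto simp: \<alpha>_def intro!: mult_right_mono\<close>)
    finally show "\<bar>LINT p|completion \<mu>. Tvec p (\<Sum>i\<in>hors. fder i g p *\<^sub>R cre i l)\<bar> \<le> C * norm l * s"
      by (simp add: \<beta>_def mult_ac)
  qed
qed

text \<open>In the middle degree \<open>d\<^sub>C\<close> is of second order, so boundary mass
  controls an integral of second derivatives of \<open>g\<close> by the size of \<open>g\<close>
  alone.\<close>

lemma second_order_bound:
  fixes T :: "('n::{finite,linorder} heis \<Rightarrow> 'n ext set) \<Rightarrow> real"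
  assumes m: "m = CARD('n)" and fm: "locally_finite_mass m (boundary (Suc m) T)"
    and rep: "mass_representation (Suc m) N T \<mu> Tvec" and l: "l \<in> ext_power_hor (int m)"
  shows "\<exists>C\<ge>0. \<forall>g s. smooth g \<longrightarrow> (\<forall>p. p \<notin> cbox a b \<longrightarrow> g p = 0) \<longrightarrow> (\<forall>p. \<bar>g p\<bar> \<le> s) \<longrightarrow>
    \<bar>LINT p|completion \<mu>. Tvec p (cre IT (rumin_second (\<lambda>p. g p *\<^sub>R l) p))\<bar> \<le> C * s"
proof -
  obtain C where C: "0 \<le> C" "\<forall>\<alpha>\<in>test_lifts m. \<forall>s. (\<forall>p. p \<notin> cbox a b \<longrightarrow> \<alpha> p = 0) \<longrightarrow> (\<forall>p. norm (\<alpha> p) \<le> s) \<longrightarrow>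
    \<bar>T (d_C m (\<lambda>p. rumin_class m (\<alpha> p)))\<bar> \<le> C * s"
    using boundary_mass_bound[OF fm compact_cbox[of a b]] by meson
  show ?thesis
  proof (rule exI[of _ "C * norm l"], intro conjI allI impI)
    show "0 \<le> C * norm l" using C(1) by simp
    fix g :: "'n heis \<Rightarrow> real" and s
    assume "smooth g" "\<forall>p. p \<notin> cbox a b \<longrightarrow> g p = 0" "\<forall>p. \<bar>g p\<bar> \<le> s"
    then have g: "smooth g" "\<And>p. p \<notin> cbox a b \<Longrightarrow> g p = 0" "\<And>p. \<bar>g p\<bar> \<le> s" by blast+
    define \<alpha> where "\<alpha> p = g p *\<^sub>R l" for p
    have s\<alpha>: "smooth \<alpha>" unfolding \<alpha>_def[abs_def] by (rule smooth_scaleR_const[OF g(1)])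
    have h: "\<alpha> p \<in> ext_power_hor (int m)" for p
      unfolding \<alpha>_def by (intro subspace_scale subspace_ext_power_hor l)
    have \<alpha>: "\<alpha> \<in> test_lifts m"
    proof (rule test_liftsI[of _ "cbox a b"])
      show "\<alpha> p \<in> rumin_num m" for p
        using h[of p] ext_power_hor_subset[of "int m"] by (auto simp: rumin_num_def m)
    qed (use s\<alpha> g(2) in \<open>auto simp: \<alpha>_def\<close>)
    have J: "cre IT (rumin_second \<alpha> p) \<in> rumin_J (Suc m)" for p
      using rumin_second_J[OF s\<alpha> h[unfolded m], of p] by (simp add: m)
    have fo: "fder i \<alpha> p = 0" if "p \<notin> cbox a b" for i p
      by (rule fder_outside[OF _ that]) (simp add: \<alpha>_def g(2))
    have fo2: "fder j (fder i \<alpha>) p = 0" if "p \<notin> cbox a b" for i j p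
      by (rule fder_outside[OF fo that])
    have \<beta>: "(\<lambda>p. cre IT (rumin_second \<alpha> p)) \<in> test_lifts (Suc m)"
    proof (rule test_liftsI[of _ "cbox a b"])
      show "smooth (\<lambda>p. cre IT (rumin_second \<alpha> p))" by (intro smooth_linear_ext[OF linear_cre] smooth_rumin_second s\<alpha>)
      show "cre IT (rumin_second \<alpha> p) \<in> rumin_num (Suc m)" for p using J[of p] m by (simp add: rumin_num_def)
      show "cre IT (rumin_second \<alpha> p) = 0" if "p \<notin> cbox a b" for p
        using fo[OF that] fo2[OF that] by (simp add: rumin_second_def cre_simps linear_0[OF linear_lefs_pinv])
    qed simp
    have "(LINT p|completion \<mu>. Tvec p (cre IT (rumin_second \<alpha> p))) = T (\<lambda>p. rumin_class (Suc m) (cre IT (rumin_second \<alpha> p)))"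
      using rep \<beta> by (simp add: mass_representation_def)
    also have "\<dots> = T (d_C m (\<lambda>p. rumin_class m (\<alpha> p)))"
      by (simp add: d_C_middle[OF m \<alpha> h] rumin_D_eq[OF s\<alpha> h[unfolded m]])
    finally have "\<bar>LINT p|completion \<mu>. Tvec p (cre IT (rumin_second \<alpha> p))\<bar> = \<bar>T (d_C m (\<lambda>p. rumin_class m (\<alpha> p)))\<bar>" by simp
    also have "\<dots> \<le> C * (s * norm l)"
      by (rule C(2)[rule_format, OF \<alpha>]) (use g in \<open>auto simp: \<alpha>_def intro!: mult_right_mono\<close>)
    finally show "\<bar>LINT p|completion \<mu>. Tvec p (cre IT (rumin_second (\<lambda>p. g p *\<^sub>R l) p))\<bar> \<le> C * norm l * s"
      by (simp add: \<alpha>_def[abs_def] mult_ac)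
  qed
qed

section \<open>The density of the current as a vector field\<close>

lemma J_class_in_dual: "J_class m v \<in> rumin_J_dual m"
  by (auto simp: J_class_def rumin_J_dual_def inner_add_right subspace_add[OF subspace_rumin_J] subspace_scale[OF subspace_rumin_J])

text \<open>Compactness of the unit sphere in \<open>rumin_J m\<close>: the norm pulled back along
  \<open>J_class\<close> is convex, hence continuous, and positive there, so it has a positive
  minimum.\<close>

lemma norm_J_class_lower:
  fixes N :: "('n::{finite,linorder} ext \<Rightarrow> real) \<Rightarrow> real"
  assumes N: "norm_on_J_dual m N"
  obtains c where "0 < c" "\<And>v. v \<in> rumin_J m \<Longrightarrow> norm v \<le> c * N (J_class m v)"
proof -
  let ?J = "rumin_J m :: 'n ext set"
  define \<psi> where "\<psi> v = N (J_class m v)" for v :: "'n ext"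
  have tri: "\<psi> (v + w) \<le> \<psi> v + \<psi> w" for v w
  proof -
    have "J_class m (v + w) = (\<lambda>a. J_class m v a + J_class m w a)"
      by (auto simp: J_class_def inner_add_left)
    then show ?thesis using N J_class_in_dual[of m v] J_class_in_dual[of m w]
      by (simp add: \<psi>_def norm_on_J_dual_def)
  qed
  have hom: "\<psi> (c *\<^sub>R v) = \<bar>c\<bar> * \<psi> v" for c v
  proof -
    have "J_class m (c *\<^sub>R v) = (\<lambda>a. c * J_class m v a)"
      by (auto simp: J_class_def)
    then show ?thesis using N J_class_in_dual[of m v]
      by (simp add: \<psi>_def norm_on_J_dual_def)
  qed
  have pos: "0 < \<psi> v" if "v \<in> ?J" "v \<noteq> 0" for v
  proof -
    have "J_class m v v \<noteq> 0" using that by (simp add: J_class_def)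
    then have "J_class m v \<noteq> (\<lambda>a. 0)" by metis
    then have "N (J_class m v) \<noteq> 0" "0 \<le> N (J_class m v)"
      using N J_class_in_dual[of m v] by (auto simp: norm_on_J_dual_def)
    then show ?thesis by (simp add: \<psi>_def)
  qed
  have "convex_on UNIV \<psi>"
  proof (rule convex_onI)
    fix t :: real and x y :: "'n ext" assume "0 < t" "t < 1"
    then show "\<psi> ((1 - t) *\<^sub>R x + t *\<^sub>R y) \<le> (1 - t) * \<psi> x + t * \<psi> y"
      using tri[of "(1 - t) *\<^sub>R x" "t *\<^sub>R y"] by (simp add: hom)
  qed simp
  then have cont: "continuous_on UNIV \<psi>" by (intro convex_on_continuous) auto
  define K where "K = ?J \<inter> sphere 0 1"
  have "compact K" unfolding K_def
    by (intro closed_Int_compact closed_subspace subspace_rumin_J compact_sphere)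
  show thesis
  proof (cases "K = {}")
    case True
    have "v = 0" if "v \<in> ?J" for v
    proof (rule ccontr)
      assume "v \<noteq> 0"
      then have "(1 / norm v) *\<^sub>R v \<in> K" using that by (simp add: K_def subspace_scale[OF subspace_rumin_J])
      with True show False by simp
    qed
    moreover have "\<psi> 0 = 0" using hom[of 0 0] by simp
    ultimately have "norm v \<le> 1 * N (J_class m v)" if "v \<in> ?J" for v
      using that unfolding \<psi>_def by (metis mult_1 norm_zero order_refl)
    then show thesis by (intro that[of 1]) auto
  next
    case False
    obtain u where u: "u \<in> K" "\<And>v. v \<in> K \<Longrightarrow> \<psi> u \<le> \<psi> v"
      using continuous_attains_inf[OF \<open>compact K\<close> False continuous_on_subset[OF cont subset_UNIV]] by blast
    have u0: "0 < \<psi> u" using u(1) by (intro pos) (auto simp: K_def)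
    show thesis
    proof (rule that[of "1 / \<psi> u"])
      show "0 < 1 / \<psi> u" using u0 by simp
      fix v assume v: "v \<in> ?J"
      show "norm v \<le> 1 / \<psi> u * N (J_class m v)"
      proof (cases "v = 0")
        case True
        then show ?thesis using hom[of 0 0] by (simp add: \<psi>_def)
      next
        case False
        then have "(1 / norm v) *\<^sub>R v \<in> K" using v by (simp add: K_def subspace_scale[OF subspace_rumin_J])
        from u(2)[OF this] have "\<psi> u \<le> \<psi> v / norm v" by (simp add: hom)
        with False u0 show ?thesis by (simp add: \<psi>_def field_simps)
      qed
    qed
  qed
qed

text \<open>Riesz representation in an orthonormal basis of \<open>rumin_J m\<close> turns the
  functionals into a measurable vector field; comparing \<open>N\<close> with the Euclidean norm
  makes it bounded.\<close>

lemma mass_representation_vector: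
  fixes \<mu> :: "'n::{finite,linorder} heis measure"
  assumes N: "norm_on_J_dual m N" and rep: "mass_representation m N T \<mu> Tvec"
  obtains \<tau> c where "\<And>p. \<tau> p \<in> rumin_J m" "\<And>p a. a \<in> rumin_J m \<Longrightarrow> Tvec p a = \<tau> p \<bullet> a"
    "\<tau> \<in> borel_measurable (completion \<mu>)" "AE p in \<mu>. norm (\<tau> p) \<le> c"
proof -
  let ?J = "rumin_J m :: 'n ext set"
  obtain B where B: "B \<subseteq> ?J" "pairwise orthogonal B" "\<And>x. x \<in> B \<Longrightarrow> norm x = 1" "independent B" "span B = ?J"
    using orthonormal_basis_subspace[OF subspace_rumin_J[of m]] by metis
  have fin: "finite B" by (rule independent_imp_finite[OF B(4)])
  have dual: "Tvec p \<in> rumin_J_dual m" for p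
    using rep unfolding mass_representation_def by blast
  define \<tau> where "\<tau> p = (\<Sum>e\<in>B. Tvec p e *\<^sub>R e)" for p
  have \<tau>J: "\<tau> p \<in> ?J" for p
    unfolding \<tau>_def using B(1) by (intro subspace_sum subspace_scale subspace_rumin_J) auto
  have eqB: "Tvec p e = \<tau> p \<bullet> e" if e: "e \<in> B" for p e
  proof -
    have "\<tau> p \<bullet> e = (\<Sum>e'\<in>B. if e' = e then Tvec p e else 0)"
      unfolding \<tau>_def inner_sum_left
    proof (intro sum.cong refl)
      fix e' assume "e' \<in> B"
      then have "e' \<noteq> e \<Longrightarrow> e' \<bullet> e = 0" using B(2) e by (auto simp: pairwise_def orthogonal_def)
      moreover have "e \<bullet> e = 1" using B(3)[OF e] by (simp add: dot_square_norm)
      ultimately show "Tvec p e' *\<^sub>R e' \<bullet> e = (if e' = e then Tvec p e else 0)" by auto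
    qed
    then show ?thesis using e fin by simp
  qed
  have eq: "Tvec p a = \<tau> p \<bullet> a" if a: "a \<in> ?J" for p a
  proof -
    have lin: "Tvec p (x + y) = Tvec p x + Tvec p y" "Tvec p (c *\<^sub>R x) = c * Tvec p x" if "x \<in> ?J" "y \<in> ?J" for x y c
      using dual[of p] that by (simp_all add: rumin_J_dual_def)
    have 0: "Tvec p 0 = 0" using lin(2)[of 0 0 0] subspace_0[OF subspace_rumin_J[of m]] by simp
    have "subspace {x \<in> ?J. Tvec p x = \<tau> p \<bullet> x}"
      by (rule subspaceI)
        (auto simp: 0 lin inner_add_right subspace_0[OF subspace_rumin_J] subspace_add[OF subspace_rumin_J] subspace_scale[OF subspace_rumin_J])
    moreover have "B \<subseteq> {x \<in> ?J. Tvec p x = \<tau> p \<bullet> x}" using B(1) eqB[of _ p] by auto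
    ultimately have "span B \<subseteq> {x \<in> ?J. Tvec p x = \<tau> p \<bullet> x}" by (rule span_minimal[rotated])
    then show ?thesis using a B(5) by auto
  qed
  have JT: "J_class m (\<tau> p) = Tvec p" for p
  proof
    fix a show "J_class m (\<tau> p) a = Tvec p a"
      using eq[of a p] dual[of p] by (simp add: J_class_def rumin_J_dual_def)
  qed
  obtain c where c: "0 < c" "\<And>v. v \<in> ?J \<Longrightarrow> norm v \<le> c * N (J_class m v)"
    by (rule norm_J_class_lower[OF N]) (rule that)
  have "AE p in \<mu>. N (Tvec p) = 1" using rep by (simp add: mass_representation_def)
  then have ae: "AE p in \<mu>. norm (\<tau> p) \<le> c"
  proof eventually_elim
    case (elim p)
    then show ?case using c(2)[OF \<tau>J, of p] by (simp add: JT)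
  qed
  have meas: "\<tau> \<in> borel_measurable (completion \<mu>)"
  proof -
    have "(\<lambda>p. Tvec p e) \<in> borel_measurable (completion \<mu>)" if "e \<in> B" for e
      using rep B(1) that by (auto simp: mass_representation_def)
    then show ?thesis unfolding \<tau>_def[abs_def] by (intro borel_measurable_sum borel_measurable_scaleR) auto
  qed
  show thesis by (rule that[OF \<tau>J eq meas ae])
qed

section \<open>Level sets of horizontally differentiable functions\<close>

text \<open>The positive and the negative part of a Borel version of \<open>h\<close> are densities
  of two measures that agree on boxes, a generating system stable under intersection. Uniqueness of
  densities then identifies them.\<close>

lemma AE_zero_of_box_integrals:
  fixes \<mu> :: "'a::euclidean_space measure" and h :: "'a \<Rightarrow> real"
  assumes s: "sets \<mu> = sets borel" and h: "integrable (completion \<mu>) h"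
    and z: "\<And>a b. (LINT p|completion \<mu>. indicator (box a b) p * h p) = 0"
  shows "AE p in \<mu>. h p = 0"
proof -
  \<comment> \<open>\<open>h\<close> is measurable only for the completion, so it is replaced by a
    Borel function that equals it almost everywhere.\<close>
  obtain h' where h': "h' \<in> borel_measurable \<mu>" and ae: "AE p in \<mu>. h p = h' p"
    using completion_ex_borel_measurable_real[OF borel_measurable_integrable[OF h]] by blast
  have ae': "AE p in completion \<mu>. h p = h' p" using ae by (simp add: AE_completion_iff)
  have h'c: "h' \<in> borel_measurable (completion \<mu>)" using h' by (rule measurable_completion)
  have box[measurable]: "box a b \<in> sets \<mu>" for a b by (simp add: s)
  have int: "integrable \<mu> h'"
  proof -
    have "integrable (completion \<mu>) h'"
      using h integrable_cong_AE[OF borel_measurable_integrable[OF h] h'c ae'] by simp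
    then show ?thesis by (simp add: integrable_completion h')
  qed
  define f where "f p = max 0 (h' p)" for p
  define g where "g p = max 0 (- h' p)" for p
  have fg: "integrable \<mu> f" "integrable \<mu> g"
    unfolding f_def[abs_def] g_def[abs_def] using int by (auto intro!: integrable_max)
  have nn: "(\<integral>\<^sup>+p. ennreal (k p) * indicator (box a b) p \<partial>\<mu>) = ennreal (LINT p|\<mu>. indicator (box a b) p * k p)"
    and ii: "integrable \<mu> (\<lambda>p. indicator (box a b) p * k p)"
    if k: "integrable \<mu> k" "\<And>p. 0 \<le> k p" for k :: "'a \<Rightarrow> real" and a b
  proof -
    show i: "integrable \<mu> (\<lambda>p. indicator (box a b) p * k p)"
      using integrable_mult_indicator[OF box k(1), of a b] by simp
    have "(\<integral>\<^sup>+p. ennreal (k p) * indicator (box a b) p \<partial>\<mu>) = (\<integral>\<^sup>+p. ennreal (indicator (box a b) p * k p) \<partial>\<mu>)"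
      by (intro nn_integral_cong) (auto simp: indicator_def)
    then show "(\<integral>\<^sup>+p. ennreal (k p) * indicator (box a b) p \<partial>\<mu>) = ennreal (LINT p|\<mu>. indicator (box a b) p * k p)"
      using k(2) by (simp add: nn_integral_eq_integral[OF i])
  qed
  have f0: "0 \<le> f p" and g0: "0 \<le> g p" for p by (simp_all add: f_def g_def)
  have eq: "emeasure (density \<mu> f) (box a b) = emeasure (density \<mu> g) (box a b)" for a b
  proof -
    have "(LINT p|completion \<mu>. indicator (box a b) p * h' p) = (LINT p|completion \<mu>. indicator (box a b) p * h p)"
    proof (rule integral_cong_AE)
      have [measurable]: "h \<in> borel_measurable (completion \<mu>)" "h' \<in> borel_measurable (completion \<mu>)"
        using borel_measurable_integrable[OF h] h'c by auto
      have [measurable]: "box a b \<in> sets (completion \<mu>)" using box by (rule sets_completionI_sets)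
      show "(\<lambda>p. indicator (box a b) p * h' p) \<in> borel_measurable (completion \<mu>)" by measurable
      show "(\<lambda>p. indicator (box a b) p * h p) \<in> borel_measurable (completion \<mu>)" by measurable
      show "AE p in completion \<mu>. indicator (box a b) p * h' p = indicator (box a b) p * h p"
        using ae' by eventually_elim simp
    qed
    then have "0 = (LINT p|completion \<mu>. indicator (box a b) p * h' p)" by (simp add: z)
    also have "\<dots> = (LINT p|\<mu>. indicator (box a b) p * h' p)"
      by (rule integral_completion) (use h' in measurable)
    also have "\<dots> = (LINT p|\<mu>. indicator (box a b) p * f p - indicator (box a b) p * g p)"
      by (intro Bochner_Integration.integral_cong refl) (auto simp: f_def g_def max_def)
    also have "\<dots> = (LINT p|\<mu>. indicator (box a b) p * f p) - (LINT p|\<mu>. indicator (box a b) p * g p)"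
      by (intro Bochner_Integration.integral_diff ii fg f0 g0)
    finally show ?thesis
      using fg by (simp add: emeasure_density nn[OF fg(1) f0] nn[OF fg(2) g0])
  qed
  have dens: "density \<mu> f = density \<mu> g"
  proof (rule measure_eqI_generator_eq)
    let ?E = "range (\<lambda>(a, b). box a b) :: 'a set set"
    show "Int_stable ?E"
    proof (rule Int_stableI)
      fix X Y assume "X \<in> ?E" "Y \<in> ?E"
      then obtain a b c d where "X = box a b" "Y = box c d" by auto
      then show "X \<inter> Y \<in> ?E" unfolding \<open>X = _\<close> \<open>Y = _\<close> box_Int_box by auto
    qed
    show "?E \<subseteq> Pow UNIV" by simp
    show "emeasure (density \<mu> f) X = emeasure (density \<mu> g) X" if "X \<in> ?E" for X
      using that eq by auto
    have sb: "sets (borel :: 'a measure) = sigma_sets UNIV ?E" by (subst borel_eq_box) simp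
    show "sets (density \<mu> f) = sigma_sets UNIV ?E" "sets (density \<mu> g) = sigma_sets UNIV ?E"
      by (simp_all add: s sb)
    let ?A = "\<lambda>i::nat. box (- (real i *\<^sub>R One)) (real i *\<^sub>R One) :: 'a set"
    show "range ?A \<subseteq> ?E" by auto
    show "(\<Union>i. ?A i) = UNIV" by (rule UN_box_eq_UNIV)
    show "emeasure (density \<mu> f) (?A i) \<noteq> \<infinity>" for i
      using fg by (simp add: emeasure_density nn[OF fg(1) f0])
  qed
  have "AE p in \<mu>. ennreal (f p) = ennreal (g p)"
  proof (rule finite_density_unique[THEN iffD1, OF _ _ _ _ _ dens])
    show "(\<integral>\<^sup>+p. ennreal (f p) \<partial>\<mu>) \<noteq> \<infinity>" by (simp add: nn_integral_eq_integral[OF fg(1)] f0)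
  qed (use fg in auto)
  with ae show ?thesis
  proof eventually_elim
    case (elim p)
    then have "f p = g p" using f0[of p] g0[of p] by simp
    then show ?case using elim(1) by (auto simp: f_def g_def max_def split: if_splits)
  qed
qed

text \<open>Inserting the test functions for the level set into \<open>C\<close> makes its
  right-hand side tend to 0, while its left-hand side converges by dominated convergence to the
  integral of the wanted pairing over the level set against \<open>\<zeta>\<close>. As
  \<open>\<zeta>\<close> is arbitrary, the pairing vanishes almost everywhere. The coefficients
  \<open>q\<close> allow first-order and second-order operators to be treated alike.\<close>

lemma ae_level_set:
  fixes f :: "'n::{finite,linorder} heis \<Rightarrow> real" and \<mu> :: "'n heis measure" and q :: "'n hidx \<Rightarrow> 'n hidx \<Rightarrow> 'n ext"
  assumes s: "sets \<mu> = sets borel" and fin: "emeasure \<mu> (cbox a b) < \<infinity>"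
    and \<tau>: "\<tau> \<in> borel_measurable (completion \<mu>)" "AE p in \<mu>. norm (\<tau> p) \<le> c"
    and C: "\<And>g s. smooth g \<Longrightarrow> (\<And>p. p \<notin> cbox a b \<Longrightarrow> g p = 0) \<Longrightarrow> (\<And>p. \<bar>g p\<bar> \<le> s) \<Longrightarrow> (\<And>i p. i \<noteq> IT \<Longrightarrow> \<bar>fder i g p\<bar> \<le> s) \<Longrightarrow>
      \<bar>LINT p|completion \<mu>. \<tau> p \<bullet> (\<Sum>i\<in>hors. \<Sum>j\<in>hors. fder j (fder i g) p *\<^sub>R q i j)\<bar> \<le> C * s"
    and h: "hdiff U f G" "cbox a b \<subseteq> U"
  shows "AE p in \<mu>. p \<in> box a b \<and> f p = 0 \<longrightarrow>
    \<tau> p \<bullet> (\<Sum>i\<in>hors. \<Sum>j\<in>hors. (hcoef (G p) j * hcoef (G p) i) *\<^sub>R q i j) = 0"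
proof -
  let ?M = "completion \<mu>" and ?C = "cbox a b"
  define Q where "Q p = \<tau> p \<bullet> (\<Sum>i\<in>hors. \<Sum>j\<in>hors. (hcoef (G p) j * hcoef (G p) i) *\<^sub>R q i j)" for p
  define k where "k p = (if p \<in> box a b \<and> f p = 0 then Q p else 0)" for p
  have \<tau>ae: "AE p in ?M. norm (\<tau> p) \<le> c" using \<tau>(2) by (simp add: AE_completion_iff)
  have cs: "?C \<in> sets \<mu>" by (simp add: s)
  have fin': "emeasure ?M ?C < \<infinity>" using fin cs by simp
  have csM: "?C \<in> sets ?M" using cs by (rule sets_completionI_sets)
  have icst: "integrable ?M (\<lambda>p. indicator ?C p * r)" for r :: real
    using csM fin' by (intro integrable_mult_left integrable_real_indicator)
  have contM: "g \<in> borel_measurable ?M" if "continuous_on UNIV g" for g :: "'n heis \<Rightarrow> real"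
    by (intro measurable_completion) (use borel_measurable_continuous_onI[OF that] measurable_cong_sets[OF s refl] in blast)
  have bound: "norm (v \<bullet> (\<Sum>i\<in>hors. \<Sum>j\<in>hors. x i j *\<^sub>R q i j)) \<le> c * (\<Sum>i\<in>hors. \<Sum>j\<in>hors. r * norm (q i j))"
    if "norm v \<le> c" "\<And>i j. i \<noteq> IT \<Longrightarrow> j \<noteq> IT \<Longrightarrow> \<bar>x i j\<bar> \<le> r" for v and x :: "'n hidx \<Rightarrow> 'n hidx \<Rightarrow> real" and r
  proof -
    have "norm (\<Sum>i\<in>hors. \<Sum>j\<in>hors. x i j *\<^sub>R q i j) \<le> (\<Sum>i\<in>hors. \<Sum>j\<in>hors. r * norm (q i j))"
      by (intro sum_norm_le) (auto intro!: mult_right_mono that(2))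
    moreover have "0 \<le> c" using that(1) norm_ge_zero[of v] by linarith
    ultimately have "norm v * norm (\<Sum>i\<in>hors. \<Sum>j\<in>hors. x i j *\<^sub>R q i j) \<le> c * (\<Sum>i\<in>hors. \<Sum>j\<in>hors. r * norm (q i j))"
      using that(1) by (intro mult_mono) auto
    then show ?thesis using Cauchy_Schwarz_ineq2[of v "\<Sum>i\<in>hors. \<Sum>j\<in>hors. x i j *\<^sub>R q i j"] by simp
  qed
  have step: "(\<lambda>p. \<zeta> p * k p) \<in> borel_measurable ?M \<and> (LINT p|?M. \<zeta> p * k p) = 0"
    if \<zeta>: "smooth \<zeta>" "\<And>p. p \<notin> box a b \<Longrightarrow> \<zeta> p = 0" for \<zeta> :: "'n heis \<Rightarrow> real"
  proof -
    have \<zeta>0: "\<zeta> p = 0" if "p \<notin> cbox a b" for p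
      using that box_subset_cbox[of a b] by (intro \<zeta>(2)) blast
    obtain g :: "nat \<Rightarrow> 'n heis \<Rightarrow> real" and B where
      g: "\<And>\<nu>. smooth (g \<nu>)" "\<And>\<nu> p. p \<notin> cbox a b \<Longrightarrow> g \<nu> p = 0"
      and small: "\<And>e. 0 < e \<Longrightarrow> \<forall>\<^sub>F \<nu> in sequentially. \<forall>p. \<bar>g \<nu> p\<bar> \<le> e \<and> (\<forall>i. i \<noteq> IT \<longrightarrow> \<bar>fder i (g \<nu>) p\<bar> \<le> e)"
      and bd: "\<forall>\<^sub>F \<nu> in sequentially. \<forall>p i j. i \<noteq> IT \<longrightarrow> j \<noteq> IT \<longrightarrow> \<bar>fder j (fder i (g \<nu>)) p\<bar> \<le> B"
      and lim: "\<And>p i j. i \<noteq> IT \<Longrightarrow> j \<noteq> IT \<Longrightarrow>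
        (\<lambda>\<nu>. fder j (fder i (g \<nu>)) p) \<longlonglongrightarrow> (if p \<in> cbox a b \<and> f p = 0 then \<zeta> p * hcoef (G p) j * hcoef (G p) i else 0)"
      by (rule level_set_test_functions[OF h \<zeta>(1) \<zeta>0], assumption) (rule that)
    \<comment> \<open>The bound on second derivatives holds only eventually, so the sequence is
      shifted to have a dominating function from the start.\<close>
    obtain N0 where N0: "\<And>\<nu>. N0 \<le> \<nu> \<Longrightarrow> \<forall>p i j. i \<noteq> IT \<longrightarrow> j \<noteq> IT \<longrightarrow> \<bar>fder j (fder i (g \<nu>)) p\<bar> \<le> B"
      using bd unfolding eventually_sequentially by blast
    define S where "S \<nu> p = \<tau> p \<bullet> (\<Sum>i\<in>hors. \<Sum>j\<in>hors. fder j (fder i (g \<nu>)) p *\<^sub>R q i j)" for \<nu> p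
    have Sm: "S \<nu> \<in> borel_measurable ?M" for \<nu>
      unfolding S_def[abs_def]
      by (intro borel_measurable_inner borel_measurable_sum borel_measurable_scaleR borel_measurable_const \<tau>(1)
          contM smooth_continuous_on smooth_fder g)
    have Sl: "(\<lambda>\<nu>. S (\<nu> + N0) p) \<longlonglongrightarrow> \<zeta> p * k p" for p
    proof -
      let ?L = "\<lambda>i j. if p \<in> cbox a b \<and> f p = 0 then \<zeta> p * hcoef (G p) j * hcoef (G p) i else 0"
      have "(\<lambda>\<nu>. S \<nu> p) \<longlonglongrightarrow> \<tau> p \<bullet> (\<Sum>i\<in>hors. \<Sum>j\<in>hors. ?L i j *\<^sub>R q i j)"
        unfolding S_def by (intro tendsto_inner tendsto_sum tendsto_scaleR tendsto_const lim) auto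
      moreover have "\<tau> p \<bullet> (\<Sum>i\<in>hors. \<Sum>j\<in>hors. ?L i j *\<^sub>R q i j) = \<zeta> p * k p"
      proof (cases "p \<in> box a b \<and> f p = 0")
        case True
        then have "p \<in> cbox a b" using box_subset_cbox[of a b] by blast
        with True show ?thesis
          by (simp add: k_def Q_def inner_sum_right sum_distrib_left mult.assoc)
      next
        case False
        then have "\<zeta> p = 0 \<or> f p \<noteq> 0" and k0: "k p = 0" using \<zeta>(2)[of p] by (cases "p \<in> box a b"; simp only: k_def simp_thms if_False if_True)+
        then have "?L i j = 0" for i j by auto
        with k0 show ?thesis by simp
      qed
      ultimately show ?thesis by (intro LIMSEQ_ignore_initial_segment) simp
    qed
    have m: "(\<lambda>p. \<zeta> p * k p) \<in> borel_measurable ?M"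
      by (rule borel_measurable_LIMSEQ_real[OF Sl Sm])
    define w where "w p = indicator ?C p * (c * (\<Sum>i\<in>hors. \<Sum>j\<in>hors. B * norm (q i j)))" for p
    have "(\<lambda>\<nu>. LINT p|?M. S (\<nu> + N0) p) \<longlonglongrightarrow> (LINT p|?M. \<zeta> p * k p)"
    proof (rule integral_dominated_convergence[OF m Sm, of w])
      show "integrable ?M w" unfolding w_def by (rule icst)
      show "AE p in ?M. (\<lambda>\<nu>. S (\<nu> + N0) p) \<longlonglongrightarrow> \<zeta> p * k p" by (rule AE_I2) (rule Sl)
      show "AE p in ?M. norm (S (\<nu> + N0) p) \<le> w p" for \<nu>
        using \<tau>ae
      proof eventually_elim
        case (elim p)
        show ?case
        proof (cases "p \<in> ?C")
          case True
          have "norm (S (\<nu> + N0) p) \<le> c * (\<Sum>i\<in>hors. \<Sum>j\<in>hors. B * norm (q i j))"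
            unfolding S_def by (rule bound[OF elim]) (use N0[of "\<nu> + N0", THEN spec, of p] in simp)
          then show ?thesis using True by (simp add: w_def)
        next
          case False
          have "fder j (fder i (g (\<nu> + N0))) p = 0" for i j
            by (rule fder_outside[OF fder_outside False]) (rule g(2))
          then show ?thesis using False by (simp add: S_def w_def)
        qed
      qed
    qed
    moreover have "(\<lambda>\<nu>. LINT p|?M. S (\<nu> + N0) p) \<longlonglongrightarrow> 0"
    proof (rule LIMSEQ_ignore_initial_segment, rule tendstoI)
      fix r :: real assume r: "0 < r"
      \<comment> \<open>The sign of \<open>C\<close> is not prescribed, hence the denominator
        \<open>\<bar>C\<bar> + 1\<close>.\<close>
      define e where "e = r / (\<bar>C\<bar> + 1)"
      have e: "0 < e" using r by (simp add: e_def add_nonneg_pos)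
      have "C * e \<le> \<bar>C\<bar> * e" using e by (intro mult_right_mono) auto
      also have "\<dots> < r" using r by (simp add: e_def field_simps add_nonneg_pos)
      finally have Ce: "C * e < r" .
      show "\<forall>\<^sub>F \<nu> in sequentially. dist (LINT p|?M. S \<nu> p) 0 < r"
        using small[OF e]
      proof eventually_elim
        case (elim \<nu>)
        have "\<bar>g \<nu> p\<bar> \<le> e" "i \<noteq> IT \<Longrightarrow> \<bar>fder i (g \<nu>) p\<bar> \<le> e" for p i
          using elim[rule_format, of p] by blast+
        then have "\<bar>LINT p|?M. S \<nu> p\<bar> \<le> C * e"
          unfolding S_def by (intro C g)
        with Ce show ?case by simp
      qed
    qed
    ultimately have "(LINT p|?M. \<zeta> p * k p) = 0" by (rule LIMSEQ_unique)
    with m show ?thesis by blast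
  qed
  have kl: "(\<lambda>\<nu>. bump_step a' b' \<nu> p * k p) \<longlonglongrightarrow> indicator (box a' b') p * k p" for a' b' p
    by (intro tendsto_mult bump_step_tendsto tendsto_const)
  \<comment> \<open>Measurability comes out of the limits: each product of \<open>k\<close> with a
    smooth cut-off is a pointwise limit of measurable functions, and \<open>k\<close> is a limit of
    such products.\<close>
  have km: "k \<in> borel_measurable ?M"
  proof (rule borel_measurable_LIMSEQ_real)
    have ind: "indicator (box a b) p * k p = k p" for p by (simp add: k_def indicator_def)
    show "(\<lambda>\<nu>. bump_step a b \<nu> p * k p) \<longlonglongrightarrow> k p" for p
      using kl[of a b p] by (simp only: ind)
    show "(\<lambda>p. bump_step a b \<nu> p * k p) \<in> borel_measurable ?M" for \<nu>
      using step[OF smooth_bump_step bump_step_eq_0, of a b \<nu>] by blast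
  qed
  have "continuous_on U G" using h(1) by (simp add: hdiff_def)
  then have Gc: "continuous_on ?C G" by (rule continuous_on_subset[OF _ h(2)])
  have hc: "continuous_on ?C (\<lambda>p. hcoef (G p) i)" for i
    using Gc by (cases i) (auto intro!: continuous_intros)
  obtain B1 where B1: "0 \<le> B1" "\<And>i p. p \<in> ?C \<Longrightarrow> \<bar>hcoef (G p) i\<bar> \<le> B1"
    by (rule continuous_bounded_on_compact_family[OF compact_cbox hc]) (rule that)
  have ki: "integrable ?M k"
  proof (rule Bochner_Integration.integrable_bound[OF icst[of "c * (\<Sum>i\<in>hors. \<Sum>j\<in>hors. (B1 * B1) * norm (q i j))"] km])
    show "AE p in ?M. norm (k p) \<le> norm (indicator ?C p * (c * (\<Sum>i\<in>hors. \<Sum>j\<in>hors. (B1 * B1) * norm (q i j))))"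
      using \<tau>ae
    proof eventually_elim
      case (elim p)
      show ?case
      proof (cases "p \<in> box a b \<and> f p = 0")
        case True
        then have p: "p \<in> ?C" using box_subset_cbox[of a b] by blast
        have "norm (Q p) \<le> c * (\<Sum>i\<in>hors. \<Sum>j\<in>hors. (B1 * B1) * norm (q i j))"
          unfolding Q_def
          by (rule bound[OF elim]) (use B1(2)[OF p] B1(1) in \<open>auto simp: abs_mult intro!: mult_mono\<close>)
        with True p show ?thesis by (simp add: k_def)
      next
        case False
        then have "k p = 0" by (simp only: k_def if_False)
        then show ?thesis using bound[OF elim, of "\<lambda>_ _. 0" "B1 * B1"] B1(1) by simp
      qed
    qed
  qed
  have "AE p in \<mu>. k p = 0"
  proof (rule AE_zero_of_box_integrals[OF s ki])
    fix a' b' :: "'n heis"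
    obtain a'' b'' where ab: "box a' b' \<inter> box a b = box a'' b''" using box_Int_box by blast
    have eq: "indicator (box a' b') p * k p = indicator (box a'' b'') p * k p" for p
      by (simp add: k_def indicator_def flip: ab)
    have sub: "box a'' b'' \<subseteq> box a b" using ab by blast
    have st: "(\<lambda>p. bump_step a'' b'' \<nu> p * k p) \<in> borel_measurable ?M" "(LINT p|?M. bump_step a'' b'' \<nu> p * k p) = 0" for \<nu>
      using step[OF smooth_bump_step bump_step_eq_0, of a'' b'' \<nu>] sub by blast+
    have m: "(\<lambda>p. indicator (box a'' b'') p * k p) \<in> borel_measurable ?M"
      by (rule borel_measurable_LIMSEQ_real[OF kl st(1)])
    have "(\<lambda>\<nu>. LINT p|?M. bump_step a'' b'' \<nu> p * k p) \<longlonglongrightarrow> (LINT p|?M. indicator (box a'' b'') p * k p)"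
    proof (rule integral_dominated_convergence[OF m st(1), of "\<lambda>p. \<bar>k p\<bar>"])
      show "AE p in ?M. norm (bump_step a'' b'' \<nu> p * k p) \<le> \<bar>k p\<bar>" for \<nu>
        using bump_step_bounds[of a'' b'' \<nu>] by (intro AE_I2) (simp add: abs_mult mult_left_le_one_le)
      show "AE p in ?M. (\<lambda>\<nu>. bump_step a'' b'' \<nu> p * k p) \<longlonglongrightarrow> indicator (box a'' b'') p * k p"
        by (rule AE_I2) (rule kl)
    qed (use ki in auto)
    then have "(LINT p|?M. indicator (box a'' b'') p * k p) = 0"
      unfolding st(2) by (rule LIMSEQ_unique[OF _ tendsto_const])
    then show "(LINT p|?M. indicator (box a' b') p * k p) = 0" by (simp only: eq)
  qed
  then show ?thesis
  proof eventually_elim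
    case (elim p)
    show ?case
    proof
      assume "p \<in> box a b \<and> f p = 0"
      then show "\<tau> p \<bullet> (\<Sum>i\<in>hors. \<Sum>j\<in>hors. (hcoef (G p) j * hcoef (G p) i) *\<^sub>R q i j) = 0"
        using elim by (simp only: k_def Q_def if_True simp_thms)
    qed
  qed
qed

lemma hcre_eq: "hcre v a = (\<Sum>i\<in>hors. hcoef v i *\<^sub>R cre i a)"
  by (simp add: hcre_def sum_UNIV_hors)

text \<open>The first-order bound is used with \<open>fder i0 g\<close> in place of
  \<open>g\<close>, so that second derivatives appear. The limit is \<open>hcoef (G p) i0\<close>
  times the wanted pairing; if all these coefficients vanish, so does exterior multiplication by
  \<open>G p\<close>.\<close>

lemma level_set_high:
  fixes T :: "('n::{finite,linorder} heis \<Rightarrow> 'n ext set) \<Rightarrow> real" and f :: "'n heis \<Rightarrow> real"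
  assumes m: "CARD('n) < m" and fm: "locally_finite_mass m (boundary (Suc m) T)"
    and rep: "mass_representation (Suc m) N T \<mu> Tvec"
    and eq: "\<And>p a. a \<in> rumin_J (Suc m) \<Longrightarrow> Tvec p a = \<tau> p \<bullet> a"
    and \<tau>: "\<tau> \<in> borel_measurable (completion \<mu>)" "AE p in \<mu>. norm (\<tau> p) \<le> c"
    and h: "hdiff U f G" "cbox a b \<subseteq> U" and l: "l \<in> rumin_J m"
  shows "AE p in \<mu>. p \<in> box a b \<and> f p = 0 \<longrightarrow> \<tau> p \<bullet> hcre (G p) l = 0"
proof -
  have s: "sets \<mu> = sets borel" and fin: "emeasure \<mu> (cbox a b) < \<infinity>"
    using rep by (simp_all add: mass_representation_def radon_measure_def)
  obtain C where C: "0 \<le> C" "\<forall>g s. smooth g \<longrightarrow> (\<forall>p. p \<notin> cbox a b \<longrightarrow> g p = 0) \<longrightarrow> (\<forall>p. \<bar>g p\<bar> \<le> s) \<longrightarrow>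
    \<bar>LINT p|completion \<mu>. Tvec p (\<Sum>i\<in>hors. fder i g p *\<^sub>R cre i l)\<bar> \<le> C * s"
    using first_order_bound[OF m fm rep l, of a b] by meson
  have "AE p in \<mu>. p \<in> box a b \<and> f p = 0 \<longrightarrow> hcoef (G p) i0 * (\<tau> p \<bullet> hcre (G p) l) = 0" if i0: "i0 \<in> hors" for i0
  proof -
    define q where "q i j = (if i = i0 then cre j l else 0)" for i j
    have one: "(\<Sum>i\<in>hors. \<Sum>j\<in>hors. x i j *\<^sub>R q i j) = (\<Sum>j\<in>hors. x i0 j *\<^sub>R cre j l)" for x :: "'n hidx \<Rightarrow> 'n hidx \<Rightarrow> real"
    proof -
      have "(\<Sum>i\<in>hors. \<Sum>j\<in>hors. x i j *\<^sub>R q i j) = (\<Sum>i\<in>hors. if i = i0 then \<Sum>j\<in>hors. x i0 j *\<^sub>R cre j l else 0)"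
        by (intro sum.cong refl) (simp add: q_def)
      then show ?thesis using i0 by simp
    qed
    have "AE p in \<mu>. p \<in> box a b \<and> f p = 0 \<longrightarrow>
      \<tau> p \<bullet> (\<Sum>i\<in>hors. \<Sum>j\<in>hors. (hcoef (G p) j * hcoef (G p) i) *\<^sub>R q i j) = 0"
    proof (rule ae_level_set[OF s fin \<tau> _ h])
      fix g :: "'n heis \<Rightarrow> real" and s
      assume g: "smooth g" "\<And>p. p \<notin> cbox a b \<Longrightarrow> g p = 0" "\<And>i p. i \<noteq> IT \<Longrightarrow> \<bar>fder i g p\<bar> \<le> s"
      have J: "(\<Sum>j\<in>hors. fder j (fder i0 g) p *\<^sub>R cre j l) \<in> rumin_J (Suc m)" for p
        by (intro subspace_sum subspace_scale subspace_rumin_J cre_rumin_J l)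
      have 0: "fder i0 g p = 0" if "p \<notin> cbox a b" for p by (rule fder_outside[OF g(2) that])
      have "\<bar>LINT p|completion \<mu>. Tvec p (\<Sum>j\<in>hors. fder j (fder i0 g) p *\<^sub>R cre j l)\<bar> \<le> C * s"
        by (rule C(2)[THEN spec, THEN spec, THEN mp, THEN mp, THEN mp]) (use smooth_fder[OF g(1)] 0 g(3) i0 in auto)
      then show "\<bar>LINT p|completion \<mu>. \<tau> p \<bullet> (\<Sum>i\<in>hors. \<Sum>j\<in>hors. fder j (fder i g) p *\<^sub>R q i j)\<bar> \<le> C * s"
        unfolding one eq[OF J] .
    qed
    then show ?thesis
    proof eventually_elim
      case (elim p)
      have "(\<Sum>i\<in>hors. \<Sum>j\<in>hors. (hcoef (G p) j * hcoef (G p) i) *\<^sub>R q i j) = hcoef (G p) i0 *\<^sub>R hcre (G p) l"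
        unfolding one hcre_eq by (simp add: scaleR_sum_right mult.commute)
      with elim show ?case by simp
    qed
  qed
  then have "AE p in \<mu>. \<forall>i0\<in>hors. p \<in> box a b \<and> f p = 0 \<longrightarrow> hcoef (G p) i0 * (\<tau> p \<bullet> hcre (G p) l) = 0"
    by (intro AE_finite_allI) auto
  then show ?thesis
  proof eventually_elim
    case (elim p)
    show ?case
    proof (intro impI, rule ccontr)
      assume "p \<in> box a b \<and> f p = 0" and ne: "\<tau> p \<bullet> hcre (G p) l \<noteq> 0"
      with elim have "\<forall>i\<in>hors. hcoef (G p) i = 0" by fastforce
      then have "hcre (G p) l = 0" unfolding hcre_eq by (intro sum.neutral) simp
      with ne show False by simp
    qed
  qed
qed

text \<open>The second-order operator already produces second derivatives, so it is applied to
  \<open>g l\<close> directly. The coefficients of its limit are products of two components of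
  \<open>G p\<close>, whence two exterior multiplications by \<open>G p\<close>.\<close>

lemma level_set_middle:
  fixes T :: "('n::{finite,linorder} heis \<Rightarrow> 'n ext set) \<Rightarrow> real" and f :: "'n heis \<Rightarrow> real"
  assumes m: "m = CARD('n)" and fm: "locally_finite_mass m (boundary (Suc m) T)"
    and rep: "mass_representation (Suc m) N T \<mu> Tvec"
    and eq: "\<And>p a. a \<in> rumin_J (Suc m) \<Longrightarrow> Tvec p a = \<tau> p \<bullet> a"
    and \<tau>: "\<tau> \<in> borel_measurable (completion \<mu>)" "AE p in \<mu>. norm (\<tau> p) \<le> c"
    and h: "hdiff U f G" "cbox a b \<subseteq> U" and l: "l \<in> ext_power_hor (int m)"
  shows "AE p in \<mu>. p \<in> box a b \<and> f p = 0 \<longrightarrow> \<tau> p \<bullet> cre IT (hcre (G p) (lefs_pinv (hcre (G p) l))) = 0"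
proof -
  have s: "sets \<mu> = sets borel" and fin: "emeasure \<mu> (cbox a b) < \<infinity>"
    using rep by (simp_all add: mass_representation_def radon_measure_def)
  obtain C where C: "0 \<le> C" "\<forall>g s. smooth g \<longrightarrow> (\<forall>p. p \<notin> cbox a b \<longrightarrow> g p = 0) \<longrightarrow> (\<forall>p. \<bar>g p\<bar> \<le> s) \<longrightarrow>
    \<bar>LINT p|completion \<mu>. Tvec p (cre IT (rumin_second (\<lambda>p. g p *\<^sub>R l) p))\<bar> \<le> C * s"
    using second_order_bound[OF m fm rep l, of a b] by meson
  \<comment> \<open>An arbitrary index, used to write the \<open>T\<close>-derivative as a
    commutator of horizontal ones. Its contribution to \<open>q\<close> is antisymmetric and
    disappears in the limit, where the coefficients are symmetric.\<close>
  define e :: 'n where "e = undefined"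
  define q where "q i j = cre IT (cre j (lefs_pinv (cre i l))) +
    (if i = IY e then if j = IX e then cre IT l else 0 else 0) - (if i = IX e then if j = IY e then cre IT l else 0 else 0)" for i j
  have expand: "(\<Sum>i\<in>hors. \<Sum>j\<in>hors. x i j *\<^sub>R q i j) =
      cre IT ((x (IY e) (IX e) - x (IX e) (IY e)) *\<^sub>R l + (\<Sum>i\<in>hors. \<Sum>j\<in>hors. x i j *\<^sub>R cre j (lefs_pinv (cre i l))))"
    for x :: "'n hidx \<Rightarrow> 'n hidx \<Rightarrow> real"
  proof -
    have "(\<Sum>i\<in>hors. \<Sum>j\<in>hors. x i j *\<^sub>R q i j) = (\<Sum>i\<in>hors. \<Sum>j\<in>hors. x i j *\<^sub>R cre IT (cre j (lefs_pinv (cre i l)))) +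
      (\<Sum>i\<in>hors. if i = IY e then \<Sum>j\<in>hors. if j = IX e then x i j *\<^sub>R cre IT l else 0 else 0) -
      (\<Sum>i\<in>hors. if i = IX e then \<Sum>j\<in>hors. if j = IY e then x i j *\<^sub>R cre IT l else 0 else 0)"
      unfolding sum.distrib[symmetric] sum_subtractf[symmetric]
    proof (intro sum.cong refl)
      fix i :: "'n hidx"
      show "(\<Sum>j\<in>hors. x i j *\<^sub>R q i j) = (\<Sum>j\<in>hors. x i j *\<^sub>R cre IT (cre j (lefs_pinv (cre i l)))) +
         (if i = IY e then \<Sum>j\<in>hors. if j = IX e then x i j *\<^sub>R cre IT l else 0 else 0) -
         (if i = IX e then \<Sum>j\<in>hors. if j = IY e then x i j *\<^sub>R cre IT l else 0 else 0)"
        by (cases "i = IY e"; cases "i = IX e")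
          (simp_all add: q_def scaleR_add_right scaleR_diff_right sum.distrib sum_subtractf if_distrib[of "\<lambda>t. _ *\<^sub>R t"] cong: if_cong)
    qed
    then show ?thesis by (simp add: cre_simps scaleR_diff_left)
  qed
  have "AE p in \<mu>. p \<in> box a b \<and> f p = 0 \<longrightarrow>
    \<tau> p \<bullet> (\<Sum>i\<in>hors. \<Sum>j\<in>hors. (hcoef (G p) j * hcoef (G p) i) *\<^sub>R q i j) = 0"
  proof (rule ae_level_set[OF s fin \<tau> _ h])
    fix g :: "'n heis \<Rightarrow> real" and s
    assume g: "smooth g" "\<And>p. p \<notin> cbox a b \<Longrightarrow> g p = 0" "\<And>p. \<bar>g p\<bar> \<le> s"
    have hl: "g p *\<^sub>R l \<in> ext_power_hor (int CARD('n))" for p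
      using l by (auto simp: m intro!: subspace_scale subspace_ext_power_hor)
    have J: "cre IT (rumin_second (\<lambda>p. g p *\<^sub>R l) p) \<in> rumin_J (Suc m)" for p
      using rumin_second_J[OF smooth_scaleR_const[OF g(1)] hl, of p] by (simp add: m)
    have "fder (IX e) (fder (IY e) g) p - fder (IY e) (fder (IX e) g) p = fder IT g p" for p
      using fder_commutator_XY(3)[OF g(1), of e e p] by simp
    then have sec: "(\<Sum>i\<in>hors. \<Sum>j\<in>hors. fder j (fder i g) p *\<^sub>R q i j) = cre IT (rumin_second (\<lambda>p. g p *\<^sub>R l) p)" for p
      unfolding expand rumin_second_def
      by (simp add: fder_scaleR_const smooth_fder g(1) cre_simps linear_cmul[OF linear_lefs_pinv])
    have "\<bar>LINT p|completion \<mu>. Tvec p (cre IT (rumin_second (\<lambda>p. g p *\<^sub>R l) p))\<bar> \<le> C * s"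
      by (rule C(2)[THEN spec, THEN spec, THEN mp, THEN mp, THEN mp]) (use g in auto)
    then show "\<bar>LINT p|completion \<mu>. \<tau> p \<bullet> (\<Sum>i\<in>hors. \<Sum>j\<in>hors. fder j (fder i g) p *\<^sub>R q i j)\<bar> \<le> C * s"
      unfolding sec eq[OF J] .
  qed
  then show ?thesis
  proof eventually_elim
    case (elim p)
    have "(\<Sum>i\<in>hors. \<Sum>j\<in>hors. (hcoef (G p) j * hcoef (G p) i) *\<^sub>R q i j) = cre IT (hcre (G p) (lefs_pinv (hcre (G p) l)))"
      unfolding expand
      by (subst sum.swap)
        (simp add: hcre_eq cre_simps linear_sum[OF linear_lefs_pinv] linear_cmul[OF linear_lefs_pinv] scaleR_sum_right mult.commute)
    with elim show ?case by simp
  qed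
qed

section \<open>From annihilated symbols to divisibility\<close>

lemma contraction_divisible:
  fixes b :: "'n::{finite,linorder} ext"
  assumes r: "r \<in> ext_power_hor (j + 1)" and eq: "hann w b = lefs_adj r" and z: "hann w r = 0"
  shows "\<exists>\<sigma>\<in>ext_power_hor (j + 2). hann w b = lefs_adj (hann w \<sigma>)"
proof (cases "w = 0")
  case True
  have "hann w b = 0" for b :: "'n ext" using True hann_add_vec[of 0 0 b] by simp
  then show ?thesis using subspace_0[OF subspace_ext_power_hor[of "j + 2"]] by (intro bexI[of _ 0]) (auto simp: lefs_adj_simps)
next
  case False
  \<comment> \<open>By the Koszul homotopy, \<open>r\<close> is the contraction of
    \<open>hcre w r\<close> divided by \<open>w \<bullet> w\<close>.\<close>
  have "hcre w r \<in> ext_power_hor (j + 1 + 1)" by (rule hcre_ext_power_hor[OF r])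
  then have "(1 / (w \<bullet> w)) *\<^sub>R hcre w r \<in> ext_power_hor (j + 2)"
    by (intro subspace_scale subspace_ext_power_hor) (simp add: add.assoc)
  moreover have "hann w ((1 / (w \<bullet> w)) *\<^sub>R hcre w r) = r"
    using False by (simp add: hann_simps hann_hcre z hcre_simps)
  ultimately show ?thesis using eq by (intro bexI[of _ "(1 / (w \<bullet> w)) *\<^sub>R hcre w r"]) auto
qed

text \<open>The contraction splits into a primitive part \<open>z\<close> and
  \<open>lefs_adj r\<close>. Testing with \<theta> times \<open>z\<close> gives
  \<open>z = 0\<close>; contracting once more gives \<open>lefs_adj (hann w r) = 0\<close>, and
  \<open>hann w r\<close> has degree above the middle, where \<open>lefs_adj\<close> is
  injective.\<close>

lemma contraction_divisible_high:
  fixes t :: "'n::{finite,linorder} ext"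
  assumes j: "CARD('n) < j" and t: "t \<in> rumin_J (Suc j)" and c: "\<And>l. l \<in> rumin_J j \<Longrightarrow> t \<bullet> hcre w l = 0"
  shows "\<exists>\<sigma>\<in>ext_power_hor (int j + 2). hann w (ann IT t) = lefs_adj (hann w \<sigma>)"
proof -
  have "ann IT t \<in> ext_power_hor (int (Suc j) - 1)" using t by (intro ann_IT_hor) (simp add: rumin_J_iff)
  then have b: "ann IT t \<in> ext_power_hor (int j)" by simp
  obtain z r where zr: "hann w (ann IT t) = z + lefs_adj r" "z \<in> ext_power_hor (int j - 1)"
    "r \<in> ext_power_hor (int j - 1 + 2)" "lefschetz z = 0"
    by (rule primitive_decomposition[OF hann_ext_power_hor[OF b, of w]])
  have "cre IT z \<in> ext_power (int j - 1 + 1)"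
    using zr(2) ext_power_hor_subset by (intro cre_ext_power) blast
  then have "cre IT z \<in> rumin_J j"
    by (simp add: rumin_J_iff zr(4) cre_simps flip: cre_lefschetz)
  from c[OF this] have "hann w (ann IT t) \<bullet> z = 0"
    unfolding hann_adjoint ann_adjoint cre_hcre by (simp add: hcre_simps)
  moreover have "lefs_adj r \<bullet> z = 0" by (simp add: lefs_adjoint zr(4))
  ultimately have "z = 0" by (simp add: zr(1) inner_add_left)
  then have eq: "hann w (ann IT t) = lefs_adj r" using zr(1) by simp
  have r: "r \<in> ext_power_hor (int j + 1)" using zr(3) by (simp add: add.commute)
  have "lefs_adj (hann w r) = 0" by (simp add: hann_lefs_adj[symmetric] eq[symmetric])
  moreover have hr: "hann w r \<in> ext_power_hor (int j)" using hann_ext_power_hor[OF r, of w] by simp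
  ultimately have "hann w r = 0" using j by (intro lefs_adj_eq_0D[OF hr]) auto
  then show ?thesis by (rule contraction_divisible[OF r eq])
qed

text \<open>Below the middle degree there is no nonzero kernel of \<open>lefschetz\<close>, so
  \<open>z = 0\<close> is automatic. Now \<open>hann w r\<close> has exactly the middle degree,
  where \<open>lefs_adj\<close> may fail to be injective; the quadratic condition with
  \<open>l = hann w r\<close> yields its squared norm instead.\<close>

lemma contraction_divisible_middle:
  fixes t :: "'n::{finite,linorder} ext"
  assumes j: "j = CARD('n)" and t: "t \<in> rumin_J (Suc j)"
    and c: "\<And>l. l \<in> ext_power_hor (int j) \<Longrightarrow> t \<bullet> cre IT (hcre w (lefs_pinv (hcre w l))) = 0"
  shows "\<exists>\<sigma>\<in>ext_power_hor (int j + 2). hann w (ann IT t) = lefs_adj (hann w \<sigma>)"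
proof -
  have "ann IT t \<in> ext_power_hor (int (Suc j) - 1)" using t by (intro ann_IT_hor) (simp add: rumin_J_iff)
  then have b: "ann IT t \<in> ext_power_hor (int j)" by simp
  obtain z r where zr: "hann w (ann IT t) = z + lefs_adj r" "z \<in> ext_power_hor (int j - 1)"
    "r \<in> ext_power_hor (int j - 1 + 2)" "lefschetz z = 0"
    by (rule primitive_decomposition[OF hann_ext_power_hor[OF b, of w]])
  have "z = 0" using zr(2,4) j by (intro lefschetz_eq_0D[OF zr(2)]) auto
  then have eq: "hann w (ann IT t) = lefs_adj r" using zr(1) by simp
  have r: "r \<in> ext_power_hor (int j + 1)" using zr(3) by (simp add: add.commute)
  have hr: "hann w r \<in> ext_power_hor (int j)" using hann_ext_power_hor[OF r, of w] by simp
  have h2: "hcre w (hann w r) \<in> ext_power_hor (int CARD('n) + 1)"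
    using hcre_ext_power_hor[OF hr, of w] unfolding j .
  have inv: "lefschetz (lefs_pinv (hcre w (hann w r))) = hcre w (hann w r)"
    unfolding lefs_pinv_eq[OF h2] by (rule lefschetz_inv(2)[OF h2])
  have "lefs_adj r \<bullet> lefs_pinv (hcre w (hann w r)) = 0"
    using c[OF hr] unfolding eq[symmetric] hann_adjoint ann_adjoint .
  then have "hann w r \<bullet> hann w r = 0" by (simp add: lefs_adjoint inv hann_adjoint)
  then have "hann w r = 0" by simp
  then show ?thesis by (rule contraction_divisible[OF r eq])
qed

lemma linear_hcre_vec: "linear (\<lambda>v. hcre v a)"
  by (rule linearI) (simp_all add: hcre_def hcoef_add hcoef_scale scaleR_add_left sum.distrib scaleR_sum_right)

text \<open>Polarisation: vanishing at all sums of two members of \<open>B\<close>, including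
  doubled members, kills the symmetric part on \<open>B\<close> and hence on its span.\<close>

lemma quadratic_zero_on_span:
  fixes b :: "'a::real_vector \<Rightarrow> 'a \<Rightarrow> real"
  assumes l: "\<And>x. linear (b x)" "\<And>y. linear (\<lambda>x. b x y)"
    and z: "\<And>x y. x \<in> B \<Longrightarrow> y \<in> B \<Longrightarrow> b (x + y) (x + y) = 0" and w: "w \<in> span B"
  shows "b w w = 0"
proof -
  have add: "b (x + y) (x + y) = b x x + (b x y + b y x) + b y y" for x y
    by (simp add: linear_add[OF l(1)] linear_add[OF l(2)])
  have x0: "b x x = 0" if "x \<in> B" for x using z[OF that that] by (simp add: add)
  have 1: "b x y + b y x = 0" if "x \<in> B" "y \<in> B" for x y
    using z[OF that] x0[OF that(1)] x0[OF that(2)] by (simp add: add)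
  have ls: "linear (\<lambda>y. b x y + b y x)" for x by (intro linear_compose_add l)
  have 2: "b x w + b w x = 0" if "x \<in> B" for x
    by (rule linear_eq_0_on_span[OF ls _ w]) (rule 1[OF that])
  have "b w w + b w w = 0"
    by (rule linear_eq_0_on_span[OF ls _ w]) (use 2 in \<open>simp add: add.commute\<close>)
  then show ?thesis by simp
qed

text \<open>To stay with finitely many null sets, the conditions are imposed for the given gradients
  and a basis of test covectors only, and extended to all conormals by linear algebra. In the middle
  degree the sums \<open>f i + f j\<close>, which also vanish on the common zero set, supply the
  polarisation.\<close>

lemma level_set_divisible:
  fixes T :: "('n::{finite,linorder} heis \<Rightarrow> 'n ext set) \<Rightarrow> real" and f :: "nat \<Rightarrow> 'n heis \<Rightarrow> real"
  assumes m: "CARD('n) \<le> m" and fm: "locally_finite_mass m (boundary (Suc m) T)"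
    and rep: "mass_representation (Suc m) N T \<mu> Tvec"
    and J: "\<And>p. \<tau> p \<in> rumin_J (Suc m)" and eq: "\<And>p a. a \<in> rumin_J (Suc m) \<Longrightarrow> Tvec p a = \<tau> p \<bullet> a"
    and \<tau>: "\<tau> \<in> borel_measurable (completion \<mu>)" "AE p in \<mu>. norm (\<tau> p) \<le> c"
    and h: "\<And>i. i < k \<Longrightarrow> hdiff U (f i) (G i)" and ab: "cbox a b \<subseteq> U"
  shows "AE p in \<mu>. p \<in> box a b \<and> (\<forall>i<k. f i p = 0) \<longrightarrow>
    (\<forall>w\<in>span ((\<lambda>i. G i p) ` {..<k}). \<exists>\<sigma>\<in>ext_power_hor (int m + 2). hann w (ann IT (\<tau> p)) = lefs_adj (hann w \<sigma>))"
proof (cases "m = CARD('n)")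
  case False
  with m have m': "CARD('n) < m" by simp
  obtain B :: "'n ext set" where B: "B \<subseteq> rumin_J m" "independent B" "rumin_J m \<subseteq> span B"
      "card B = dim (rumin_J m :: 'n ext set)"
    by (rule basis_exists[of "rumin_J m :: 'n ext set"])
  have fin: "finite B" by (rule independent_imp_finite[OF B(2)])
  have "AE p in \<mu>. \<forall>i\<in>{..<k}. \<forall>l\<in>B. p \<in> box a b \<and> f i p = 0 \<longrightarrow> \<tau> p \<bullet> hcre (G i p) l = 0"
    using B(1) by (intro AE_finite_allI fin level_set_high[OF m' fm rep eq \<tau> h ab]) auto
  then show ?thesis
  proof eventually_elim
    case (elim p)
    show ?case
    proof (intro impI ballI)
      fix w assume p: "p \<in> box a b \<and> (\<forall>i<k. f i p = 0)" and w: "w \<in> span ((\<lambda>i. G i p) ` {..<k})"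
      have z: "\<tau> p \<bullet> hcre w l = 0" if l: "l \<in> B" for l
      proof (rule linear_eq_0_on_span[OF _ _ w])
        show "linear (\<lambda>w. \<tau> p \<bullet> hcre w l)"
          using linear_compose[OF linear_hcre_vec[of l] bounded_linear.linear[OF bounded_linear_inner_right[of "\<tau> p"]]]
          by (simp add: o_def)
        show "\<tau> p \<bullet> hcre x l = 0" if "x \<in> (\<lambda>i. G i p) ` {..<k}" for x
          using that elim p l by blast
      qed
      have lin: "linear (\<lambda>l. \<tau> p \<bullet> hcre w l)"
        using linear_compose[OF linear_hcre[of w] bounded_linear.linear[OF bounded_linear_inner_right[of "\<tau> p"]]]
        by (simp add: o_def)
      have "\<tau> p \<bullet> hcre w l = 0" if "l \<in> rumin_J m" for l
        by (rule linear_eq_0_on_span[OF lin z]) (use that B(3) in blast)+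
      then show "\<exists>\<sigma>\<in>ext_power_hor (int m + 2). hann w (ann IT (\<tau> p)) = lefs_adj (hann w \<sigma>)"
        by (rule contraction_divisible_high[OF m' J])
    qed
  qed
next
  case True
  obtain B :: "'n ext set" where B: "B \<subseteq> ext_power_hor (int m)" "independent B" "ext_power_hor (int m) \<subseteq> span B"
      "card B = dim (ext_power_hor (int m) :: 'n ext set)"
    by (rule basis_exists[of "ext_power_hor (int m) :: 'n ext set"])
  have fin: "finite B" by (rule independent_imp_finite[OF B(2)])
  define q where "q t v w l = t \<bullet> cre IT (hcre v (lefs_pinv (hcre w l)))" for t :: "'n ext" and v w l
  have lin: "linear (\<lambda>v. q t v w l)" "linear (\<lambda>w. q t v w l)" "linear (\<lambda>l. q t v w l)" for t v w l
    by (rule linearI, simp_all add: q_def hcre_simps cre_simps linear_add[OF linear_lefs_pinv] linear_cmul[OF linear_lefs_pinv]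
        linear_add[OF linear_hcre_vec] linear_cmul[OF linear_hcre_vec] inner_add_right)+
  have "AE p in \<mu>. \<forall>i\<in>{..<k}. \<forall>j\<in>{..<k}. \<forall>l\<in>B. p \<in> box a b \<and> f i p + f j p = 0 \<longrightarrow>
      q (\<tau> p) (G i p + G j p) (G i p + G j p) l = 0"
    unfolding q_def
    using B(1) by (intro AE_finite_allI fin level_set_middle[OF True fm rep eq \<tau> hdiff_add[OF h h] ab]) auto
  then show ?thesis
  proof eventually_elim
    case (elim p)
    show ?case
    proof (intro impI ballI)
      fix w assume p: "p \<in> box a b \<and> (\<forall>i<k. f i p = 0)" and w: "w \<in> span ((\<lambda>i. G i p) ` {..<k})"
      have qB: "q (\<tau> p) w w l = 0" if l: "l \<in> B" for l
      proof (rule quadratic_zero_on_span[OF lin(2) lin(1) _ w])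
        fix x y assume "x \<in> (\<lambda>i. G i p) ` {..<k}" "y \<in> (\<lambda>i. G i p) ` {..<k}"
        then obtain i j where "i < k" "x = G i p" "j < k" "y = G j p" by blast
        then show "q (\<tau> p) (x + y) (x + y) l = 0" using elim p l by simp
      qed
      have "q (\<tau> p) w w l = 0" if "l \<in> ext_power_hor (int m)" for l
        by (rule linear_eq_0_on_span[OF lin(3) qB]) (use that B(3) in blast)+
      then show "\<exists>\<sigma>\<in>ext_power_hor (int m + 2). hann w (ann IT (\<tau> p)) = lefs_adj (hann w \<sigma>)"
        unfolding q_def by (rule contraction_divisible_middle[OF True J])
    qed
  qed
qed

lemma local_defining_hdiff: "local_defining k S U f G \<Longrightarrow> i < k \<Longrightarrow> hdiff U (f i) (G i)"
  unfolding local_defining_def by (blast intro: distr_hgrad_imp_hdiff)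

text \<open>Lindelof's theorem reduces the matter to countably many boxes, each inside the domain of
  one defining map. The defining map depends on the point, since \<open>S\<close> is only locally a
  zero set.\<close>

lemma H_regular_divisible:
  fixes T :: "('n::{finite,linorder} heis \<Rightarrow> 'n ext set) \<Rightarrow> real"
  assumes m: "CARD('n) \<le> m" and fm: "locally_finite_mass m (boundary (Suc m) T)"
    and rep: "mass_representation (Suc m) N T \<mu> Tvec"
    and J: "\<And>p. \<tau> p \<in> rumin_J (Suc m)" and eq: "\<And>p a. a \<in> rumin_J (Suc m) \<Longrightarrow> Tvec p a = \<tau> p \<bullet> a"
    and \<tau>: "\<tau> \<in> borel_measurable (completion \<mu>)" "AE p in \<mu>. norm (\<tau> p) \<le> c"
    and S: "H_regular k S"
  shows "AE p in \<mu>. p \<in> S \<longrightarrow> (\<exists>U f G. p \<in> U \<and> local_defining k S U f G \<and>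
    (\<forall>w\<in>span ((\<lambda>i. G i p) ` {..<k}). \<exists>\<sigma>\<in>ext_power_hor (int m + 2). hann w (ann IT (\<tau> p)) = lefs_adj (hann w \<sigma>)))"
proof -
  define D where "D G p \<longleftrightarrow> (\<forall>w\<in>span ((\<lambda>i. G i p) ` {..<k}). \<exists>\<sigma>\<in>ext_power_hor (int m + 2). hann w (ann IT (\<tau> p)) = lefs_adj (hann w \<sigma>))"
    for G :: "nat \<Rightarrow> 'n heis \<Rightarrow> 'n hvec" and p
  have "\<exists>X. open X \<and> p \<in> X \<and> (AE q in \<mu>. q \<in> S \<and> q \<in> X \<longrightarrow> (\<exists>U f G. q \<in> U \<and> local_defining k S U f G \<and> D G q))"
    if "p \<in> S" for p
  proof -
    obtain U f G where U: "p \<in> U" and ld: "local_defining k S U f G"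
      using S \<open>p \<in> S\<close> unfolding H_regular_def by blast
    then have "open U" by (simp add: local_defining_def)
    from open_contains_cbox[OF this U] obtain a b where ab: "cbox a b \<subseteq> U" "p \<in> box a b" by metis
    have bU: "box a b \<subseteq> U" using ab(1) box_subset_cbox[of a b] by blast
    have SU: "S \<inter> U = {p \<in> U. \<forall>i<k. f i p = 0}" using ld by (simp add: local_defining_def)
    have "AE q in \<mu>. q \<in> box a b \<and> (\<forall>i<k. f i q = 0) \<longrightarrow> D G q"
      unfolding D_def by (rule level_set_divisible[OF m fm rep J eq \<tau> local_defining_hdiff[OF ld] ab(1)])
    then have "AE q in \<mu>. q \<in> S \<and> q \<in> box a b \<longrightarrow> (\<exists>U f G. q \<in> U \<and> local_defining k S U f G \<and> D G q)"
    proof eventually_elim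
      case (elim q)
      show ?case
      proof
        assume q: "q \<in> S \<and> q \<in> box a b"
        then have "q \<in> S \<inter> U" using bU by blast
        then have "\<forall>i<k. f i q = 0" unfolding SU by blast
        with elim q have "D G q" by blast
        with q bU ld show "\<exists>U f G. q \<in> U \<and> local_defining k S U f G \<and> D G q" by blast
      qed
    qed
    then show ?thesis using ab(2) open_box by blast
  qed
  then have "\<exists>X. \<forall>p\<in>S. open (X p) \<and> p \<in> X p \<and>
      (AE q in \<mu>. q \<in> S \<and> q \<in> X p \<longrightarrow> (\<exists>U f G. q \<in> U \<and> local_defining k S U f G \<and> D G q))"
    by (intro bchoice ballI)
  then obtain X where X0: "\<forall>p\<in>S. open (X p) \<and> p \<in> X p \<and>
      (AE q in \<mu>. q \<in> S \<and> q \<in> X p \<longrightarrow> (\<exists>U f G. q \<in> U \<and> local_defining k S U f G \<and> D G q))" ..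
  have X: "open (X p)" "p \<in> X p"
    and ae: "AE q in \<mu>. q \<in> S \<and> q \<in> X p \<longrightarrow> (\<exists>U f G. q \<in> U \<and> local_defining k S U f G \<and> D G q)"
    if "p \<in> S" for p
    using bspec[OF X0 that] by simp_all
  obtain F where F: "F \<subseteq> X ` S" "countable F" "\<Union>F = \<Union>(X ` S)"
    using Lindelof[of "X ` S"] X(1) by blast
  have "AE q in \<mu>. \<forall>Y\<in>F. q \<in> S \<and> q \<in> Y \<longrightarrow> (\<exists>U f G. q \<in> U \<and> local_defining k S U f G \<and> D G q)"
    unfolding AE_ball_countable[OF F(2)]
  proof
    fix Y assume "Y \<in> F"
    then obtain p where "p \<in> S" "Y = X p" using F(1) by blast
    then show "AE q in \<mu>. q \<in> S \<and> q \<in> Y \<longrightarrow> (\<exists>U f G. q \<in> U \<and> local_defining k S U f G \<and> D G q)"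
      using ae[of p] by simp
  qed
  then have "AE q in \<mu>. q \<in> S \<longrightarrow> (\<exists>U f G. q \<in> U \<and> local_defining k S U f G \<and> D G q)"
  proof eventually_elim
    case (elim q)
    show ?case
    proof
      assume q: "q \<in> S"
      then have "q \<in> \<Union>F" unfolding F(3) using X(2)[OF q] by blast
      then obtain Y where "Y \<in> F" "q \<in> Y" by blast
      with elim q show "\<exists>U f G. q \<in> U \<and> local_defining k S U f G \<and> D G q" by blast
    qed
  qed
  then show ?thesis unfolding D_def .
qed

section \<open>The tangent multivector\<close>

lemma ext_basis_IT: "ext_basis {IT} = cre IT (ext_basis {})"
proof -
  have "isgn IT ({IT :: 'a hidx} - {IT}) = 1" by (simp only: Diff_cancel isgn_IT empty_iff card.empty power_0 simp_thms not_False_eq_True)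
  then have "isgn IT {IT :: 'a hidx} = 1" by (simp only: isgn_Diff_self)
  then show ?thesis by (auto simp: vec_eq_iff cre_nth ext_basis_def axis_def)
qed

lemma hcres_cre_IT: "hcres vs (cre IT a) = (- 1) ^ length vs *\<^sub>R cre IT (hcres vs a)"
  by (induction vs) (simp_all add: hcre_simps cre_hcre)

text \<open>The tangent and the divisibility may come from different defining maps at the same
  point. Each component of \<open>f\<close> vanishes on \<open>S\<close> near \<open>p\<close>, so
  \<open>hdiff_tangent\<close> makes its gradient orthogonal to the vectors \<open>vs\<close>, and
  \<open>primitive_pairing_multiple\<close> applies.\<close>

lemma tangent_multiple:
  fixes t :: "'n::{finite,linorder} ext"
  assumes k: "1 \<le> k" "k \<le> CARD('n)" and t: "t \<in> rumin_J (2 * CARD('n) + 1 - k)"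
    and tan: "H_tangent k S p s" and U: "p \<in> U" "local_defining k S U f G"
    and dv: "\<And>w. w \<in> span ((\<lambda>i. G i p) ` {..<k}) \<Longrightarrow>
      \<exists>\<sigma>\<in>ext_power_hor (2 * int CARD('n) - int k + 2). hann w (ann IT t) = lefs_adj (hann w \<sigma>)"
  obtains c where "\<And>a. a \<in> rumin_J (2 * CARD('n) + 1 - k) \<Longrightarrow> t \<bullet> a = c * (s \<bullet> a)"
proof -
  from tan obtain V g H vs where V: "p \<in> V" "local_defining k S V g H" and len: "length vs = 2 * CARD('n) - k"
    and on: "\<forall>i<length vs. \<forall>j<length vs. vs ! i \<bullet> vs ! j = (if i = j then 1 else 0)"
    and sp: "span (set vs) = {v. \<forall>i<k. H i p \<bullet> v = 0}"
    and s: "s = foldr (\<lambda>v a. hor_vec v \<and>\<^sub>e a) vs (ext_basis {IT})" and pS: "p \<in> S"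
    unfolding H_tangent_def by blast
  have dist: "distinct vs"
    unfolding distinct_conv_nth using on by (metis zero_neq_one)
  have ol: "orthonormal_list vs"
    unfolding orthonormal_list_def pairwise_def orthogonal_def
    using dist on by (metis in_set_conv_nth)
  have perp: "v \<bullet> w = 0" if v: "v \<in> set vs" and w: "w \<in> span ((\<lambda>i. G i p) ` {..<k})" for v w
  proof (rule linear_eq_0_on_span[OF _ _ w])
    show "linear (\<lambda>w. v \<bullet> w)" by (rule bounded_linear.linear[OF bounded_linear_inner_right])
    fix x assume "x \<in> (\<lambda>i. G i p) ` {..<k}"
    then obtain l where l: "l < k" "x = G l p" by blast
    have "v \<in> span (set vs)" using v by (rule span_base)
    then have Hv: "H i p \<bullet> v = 0" if "i < k" for i using sp that by blast
    have "G l p \<bullet> v = 0"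
    proof (rule hdiff_tangent[where f = g and U = V and G = H and k = k and S = S and p = p and U' = U and f' = "f l"])
      show "0 < k" using k by simp
      show "hdiff V (g i) (H i)" if "i < k" for i by (rule local_defining_hdiff[OF V(2) that])
      show "S \<inter> V = {p \<in> V. \<forall>i<k. g i p = 0}" "dim ((\<lambda>i. H i p) ` {..<k}) = k"
        using V unfolding local_defining_def by blast+
      show "hdiff U (f l) (G l)" by (rule local_defining_hdiff[OF U(2) l(1)])
      show "f l q = 0" if "q \<in> S" "q \<in> U" for q
      proof -
        have "S \<inter> U = {p \<in> U. \<forall>i<k. f i p = 0}" using U(2) unfolding local_defining_def by blast
        then show ?thesis using that l(1) by blast
      qed
    qed (use pS V U Hv in auto)
    then show "v \<bullet> x = 0" by (simp add: l inner_commute)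
  qed
  have dim: "dim (span ((\<lambda>i. G i p) ` {..<k})) = k"
    using U unfolding local_defining_def by simp
  have deg: "int (2 * CARD('n) + 1 - k) - 1 = 2 * int CARD('n) - int k" using k by (simp add: of_nat_diff)
  have b: "ann IT t \<in> ext_power_hor (2 * int CARD('n) - int k)"
    using t unfolding deg[symmetric] by (intro ann_IT_hor) (simp add: rumin_J_iff)
  obtain c where c: "\<And>\<mu>. lefschetz \<mu> = 0 \<Longrightarrow> ann IT t \<bullet> \<mu> = c * (hcres vs (ext_basis {}) \<bullet> \<mu>)"
    by (rule primitive_pairing_multiple[OF k(2) subspace_span dim b dv ol len perp]) (assumption | rule that)+
  have s': "s = (- 1) ^ length vs *\<^sub>R cre IT (hcres vs (ext_basis {}))"
    unfolding s hor_vec_wedge ext_basis_IT by (rule hcres_cre_IT)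
  show thesis
  proof (rule that[of "c * (- 1) ^ length vs"])
    fix a :: "'n ext" assume a: "a \<in> rumin_J (2 * CARD('n) + 1 - k)"
    \<comment> \<open>A covector annihilated by multiplication with \<theta> is \<theta> times its
      contraction with \<open>T\<close>; so only the horizontal factors have to be paired.\<close>
    have a': "a = cre IT (ann IT a)" using a ann_cre[of IT IT a] by (simp add: rumin_J_iff ann_simps)
    have L: "lefschetz (ann IT a) = 0" using a by (simp add: rumin_J_iff ann_simps flip: ann_IT_lefschetz)
    have "t \<bullet> a = ann IT t \<bullet> ann IT a" by (subst a') (simp add: ann_adjoint)
    also have "\<dots> = c * (hcres vs (ext_basis {}) \<bullet> ann IT a)" by (rule c[OF L])
    also have "hcres vs (ext_basis {}) \<bullet> ann IT a = (- 1) ^ length vs * (s \<bullet> a)"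
      by (simp add: s' cre_adjoint flip: power_mult_distrib mult.assoc)
    finally show "t \<bullet> a = c * (- 1) ^ length vs * (s \<bullet> a)" by simp
  qed
qed

theorem theorem1p8:
  fixes d :: "'n::{finite,linorder} heis \<Rightarrow> 'n heis \<Rightarrow> real"
    and k m :: nat
    and T :: "('n heis \<Rightarrow> 'n ext set) \<Rightarrow> real"
    and N :: "('n ext \<Rightarrow> real) \<Rightarrow> real"
    and \<mu> \<mu>a \<mu>s :: "'n heis measure"
    and Tvec :: "'n heis \<Rightarrow> 'n ext \<Rightarrow> real"
    and R :: "'n heis set"
    and tR :: "'n heis \<Rightarrow> 'n ext"
  assumes "heis_distance d"
    and "1 \<le> k" and "k \<le> CARD('n)" and "m = 2 * CARD('n) + 1 - k"
    and "locally_normal m T"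
    and "norm_on_J_dual m N" and "mass_representation m N T \<mu> Tvec"
    and "locally_H_rectifiable d k R"
    and "H_tangent_field d k R tR"
    and "lebesgue_decomposition (spherical_restr d (hom_dim TYPE('n) - k) R) \<mu> \<mu>a \<mu>s"
  shows "AE p in \<mu>a. \<exists>c::real. Tvec p = (\<lambda>a. c * J_class m (tR p) a)"
proof -
  let ?\<nu> = "spherical_restr d (hom_dim TYPE('n) - k) R"
  \<comment> \<open>The degree of the boundary, which is also the degree of the horizontal factor of
    \<open>\<tau>\<close>; it is at least \<open>n\<close> because \<open>k \<le> n\<close>.\<close>
  define j where "j = m - 1"
  have m: "m = Suc j" and j: "CARD('n) \<le> j" and ij: "int j = 2 * int CARD('n) - int k"
    using assms(2,3,4) by (auto simp: j_def)
  have fm: "locally_finite_mass j (boundary (Suc j) T)"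
    using assms(5) by (simp add: locally_normal_def m)
  have rep: "mass_representation (Suc j) N T \<mu> Tvec" using assms(7) by (simp only: m)
  obtain \<tau> c where J: "\<And>p. \<tau> p \<in> rumin_J (Suc j)" and eq: "\<And>p a. a \<in> rumin_J (Suc j) \<Longrightarrow> Tvec p a = \<tau> p \<bullet> a"
    and \<tau>: "\<tau> \<in> borel_measurable (completion \<mu>)" "AE p in \<mu>. norm (\<tau> p) \<le> c"
    by (rule mass_representation_vector[OF assms(6)[unfolded m] rep]) (assumption | rule that)+
  obtain S :: "nat \<Rightarrow> 'n heis set" where S: "\<And>i. H_regular k (S i)"
    and tan: "AE p in ?\<nu>. \<exists>i. H_tangent k (S i) p (tR p)"
    using assms(9) unfolding H_tangent_field_def by blast
  define D where "D i p \<longleftrightarrow> (\<exists>U f G. p \<in> U \<and> local_defining k (S i) U f G \<and>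
    (\<forall>w\<in>span ((\<lambda>i. G i p) ` {..<k}). \<exists>\<sigma>\<in>ext_power_hor (int j + 2). hann w (ann IT (\<tau> p)) = lefs_adj (hann w \<sigma>)))" for i p
  have "AE p in \<mu>. p \<in> S i \<longrightarrow> D i p" for i
    unfolding D_def by (rule H_regular_divisible[OF j fm rep J eq \<tau> S])
  then have D: "AE p in \<mu>. \<forall>i. p \<in> S i \<longrightarrow> D i p" by (simp add: AE_all_countable)
  have sets: "sets \<mu>a = sets \<mu>" and ac: "absolutely_continuous ?\<nu> \<mu>a"
    using assms(10) by (simp_all add: lebesgue_decomposition_def)
  have le: "emeasure \<mu>a A \<le> emeasure \<mu> A" if "A \<in> sets \<mu>" for A
    using assms(10) that by (simp add: lebesgue_decomposition_def)
  have s\<mu>: "sets \<mu> = sets borel" using rep by (simp add: mass_representation_def radon_measure_def)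
  \<comment> \<open>The part \<open>\<mu>a\<close> is dominated by \<open>\<mu>\<close>, so
    divisibility, which holds \<open>\<mu>\<close>-almost everywhere on each \<open>S i\<close>,
    passes to it.\<close>
  have "absolutely_continuous \<mu> \<mu>a"
    unfolding absolutely_continuous_def
  proof
    fix A assume "A \<in> null_sets \<mu>"
    then show "A \<in> null_sets \<mu>a" using le[of A] by (auto simp: null_sets_def sets)
  qed
  then have D': "AE p in \<mu>a. \<forall>i. p \<in> S i \<longrightarrow> D i p"
    by (rule absolutely_continuous_AE[OF sets _ D])
  have s\<nu>: "sets ?\<nu> = sets borel"
    using sets.sigma_sets_eq[of "borel :: 'n heis measure"] by (simp add: spherical_restr_def sets_measure_of_conv)
  \<comment> \<open>Absolute continuity with respect to the measure on \<open>R\<close> transfers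
    the choice of tangent to \<open>\<mu>a\<close>.\<close>
  have tan': "AE p in \<mu>a. \<exists>i. H_tangent k (S i) p (tR p)"
    by (rule absolutely_continuous_AE[OF _ ac tan]) (simp only: sets s\<mu> s\<nu>)
  have dual: "Tvec p \<in> rumin_J_dual (Suc j)" for p
    using rep unfolding mass_representation_def by blast
  show ?thesis
    using tan' D'
  proof eventually_elim
    case (elim p)
    from elim(1) obtain i where i: "H_tangent k (S i) p (tR p)" ..
    then have "p \<in> S i" by (simp add: H_tangent_def)
    with elim(2) have "D i p" by blast
    then obtain U f G where U: "p \<in> U" "local_defining k (S i) U f G" and
      dv: "\<And>w. w \<in> span ((\<lambda>i. G i p) ` {..<k}) \<Longrightarrow>
        \<exists>\<sigma>\<in>ext_power_hor (2 * int CARD('n) - int k + 2). hann w (ann IT (\<tau> p)) = lefs_adj (hann w \<sigma>)"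
      unfolding D_def ij by blast
    have t: "\<tau> p \<in> rumin_J (2 * CARD('n) + 1 - k)" using J[of p] by (simp only: m[symmetric] assms(4))
    obtain c where c: "\<And>a. a \<in> rumin_J (2 * CARD('n) + 1 - k) \<Longrightarrow> \<tau> p \<bullet> a = c * (tR p \<bullet> a)"
      by (rule tangent_multiple[OF assms(2,3) t i U dv]) (assumption | rule that)+
    have "Tvec p a = c * J_class m (tR p) a" for a
    proof (cases "a \<in> rumin_J m")
      case True
      have "Tvec p a = \<tau> p \<bullet> a" using True by (intro eq) (simp only: m)
      also have "\<dots> = c * (tR p \<bullet> a)" using True by (intro c) (simp only: assms(4))
      finally show ?thesis using True by (simp add: J_class_def)
    next
      case False
      \<comment> \<open>Outside \<open>rumin_J m\<close> both functionals are extended by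
        zero.\<close>
      then show ?thesis using dual[of p] by (simp add: J_class_def rumin_J_dual_def m)
    qed
    then show "\<exists>c. Tvec p = (\<lambda>a. c * J_class m (tR p) a)" by blast
  qed
qed

end
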